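(* Let $k$ be a field of odd characteristic $p$ and let $G$ be a finite $p$-group with cyclic commutator subgroup $G'$. Let $H$ be a group such that $kG$ and $kH$ are isomorphic as $k$-algebras. Then: (a) for every $k$-algebra isomorphism $\phi:kG\to kH$ preserving augmentation one has $\phi(I({\rm C}_G(G'))kG)=I({\rm C}_H(H'))kH$; (b) ${\mathrm D}_i({\rm C}_G(G'))/{\mathrm D}_{i+1}({\rm C}_G(G'))\cong {\mathrm D}_i({\rm C}_H(H'))/{\mathrm D}_{i+1}({\rm C}_H(H'))$ for every $i\ge1$; (c) $\exp({\rm C}_G(G'))=\exp({\rm C}_H(H'))$; (d) ${\rm C}_G(G')/G'\cong {\rm C}_H(H')/H'$; (e) ${\rm C}_G(G')/{\rm C}_G(G')'\cong {\rm C}_H(H')/{\rm C}_H(H')'$.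
   Context: For a group $\Gamma$ and a subgroup $N$, $I(N)$ denotes the augmentation ideal of $kN$ (the kernel of the $k$-linear map $kN\to k$ sending each group element to $1$), and $I(N)k\Gamma$ is the relative augmentation ideal. An isomorphism preserves augmentation if it is compatible with the augmentation maps $kG\to k$, $kH\to k$. For a finite $p$-group $N$, the Jennings series is ${\mathrm D}_n(N)=\prod_{ip^j\ge n}\mho_j(\gamma_i(N))$, where $\gamma_i$ is the lower central series and $\mho_j(X)=\langle x^{p^j}:x\in X\rangle$. *)

theory Defs
  imports "HOL-Algebra.Algebra" "HOL-Computational_Algebra.Primes"
begin

definition conv :: "('a, 'b) monoid_scheme \<Rightarrow> ('a \<Rightarrow> 'k::field) \<Rightarrow> ('a \<Rightarrow> 'k) \<Rightarrow> 'a \<Rightarrow> 'k" where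
  "conv G f g x = (if x \<in> carrier G
     then (\<Sum>y\<in>{y. f y \<noteq> 0}. f y * g (inv\<^bsub>G\<^esub> y \<otimes>\<^bsub>G\<^esub> x)) else 0)"

definition group_alg :: "('a, 'b) monoid_scheme \<Rightarrow> ('a \<Rightarrow> 'k::field) ring" where
  "group_alg G =
    \<lparr> carrier = {f. (\<forall>x. x \<notin> carrier G \<longrightarrow> f x = 0) \<and> finite {x. f x \<noteq> 0}},
      Group.monoid.mult = conv G,
      Group.monoid.one = (\<lambda>x. if x = \<one>\<^bsub>G\<^esub> then 1 else 0),
      Ring.ring.zero = (\<lambda>x. 0),
      Ring.ring.add = (\<lambda>f g x. f x + g x) \<rparr>"

definition aug :: "('a \<Rightarrow> 'k::field) \<Rightarrow> 'k" where
  "aug f = (\<Sum>x\<in>{x. f x \<noteq> 0}. f x)"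

definition kalg_iso :: "('a, 'c) monoid_scheme \<Rightarrow> ('b, 'd) monoid_scheme
    \<Rightarrow> (('a \<Rightarrow> 'k::field) \<Rightarrow> ('b \<Rightarrow> 'k)) \<Rightarrow> bool" where
  "kalg_iso G H \<phi> \<longleftrightarrow>
     \<phi> \<in> ring_iso (group_alg G) (group_alg H) \<and>
     (\<forall>c. \<forall>f\<in>carrier (group_alg G). \<phi> (\<lambda>x. c * f x) = (\<lambda>x. c * \<phi> f x))"

definition aug_preserving :: "('a, 'c) monoid_scheme \<Rightarrow> (('a \<Rightarrow> 'k::field) \<Rightarrow> ('b \<Rightarrow> 'k)) \<Rightarrow> bool" where
  "aug_preserving G \<phi> \<longleftrightarrow> (\<forall>f\<in>carrier (group_alg G). aug (\<phi> f) = aug f)"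

definition aug_ideal_in :: "('a, 'c) monoid_scheme \<Rightarrow> 'a set \<Rightarrow> ('a \<Rightarrow> 'k::field) set" where
  "aug_ideal_in G N = {f \<in> carrier (group_alg G). {x. f x \<noteq> 0} \<subseteq> N \<and> aug f = 0}"

inductive_set rel_aug_ideal :: "('a, 'c) monoid_scheme \<Rightarrow> 'a set \<Rightarrow> ('a \<Rightarrow> 'k::field) set"
  for G :: "('a, 'c) monoid_scheme" and N :: "'a set" where
  zero: "(\<lambda>x. 0) \<in> rel_aug_ideal G N"
| prod: "a \<in> (aug_ideal_in G N :: ('a \<Rightarrow> 'k) set) \<Longrightarrow> b \<in> carrier (group_alg G)
          \<Longrightarrow> a \<otimes>\<^bsub>(group_alg G :: ('a \<Rightarrow> 'k) ring)\<^esub> b \<in> rel_aug_ideal G N"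
| add: "u \<in> rel_aug_ideal G N \<Longrightarrow> v \<in> rel_aug_ideal G N
          \<Longrightarrow> u \<oplus>\<^bsub>(group_alg G :: ('a \<Rightarrow> 'k) ring)\<^esub> v \<in> rel_aug_ideal G N"

definition centralizer :: "('a, 'b) monoid_scheme \<Rightarrow> 'a set \<Rightarrow> 'a set" where
  "centralizer G S = {g \<in> carrier G. \<forall>s\<in>S. g \<otimes>\<^bsub>G\<^esub> s = s \<otimes>\<^bsub>G\<^esub> g}"

definition p_group :: "nat \<Rightarrow> ('a, 'b) monoid_scheme \<Rightarrow> bool" where
  "p_group p G \<longleftrightarrow> group G \<and> finite (carrier G) \<and> (\<exists>n. card (carrier G) = p ^ n)"

definition comm_subgroup :: "('a, 'b) monoid_scheme \<Rightarrow> 'a set \<Rightarrow> 'a set \<Rightarrow> 'a set" where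
  "comm_subgroup G A B = generate G
     (\<Union>x\<in>A. \<Union>y\<in>B. {x \<otimes>\<^bsub>G\<^esub> y \<otimes>\<^bsub>G\<^esub> inv\<^bsub>G\<^esub> x \<otimes>\<^bsub>G\<^esub> inv\<^bsub>G\<^esub> y})"

text \<open>Lower central series: gamma G 1 = G, gamma G (i+1) = [gamma G i, G]
  (gamma G 0 is also set to G; it is never used).\<close>
fun lower_central :: "('a, 'b) monoid_scheme \<Rightarrow> nat \<Rightarrow> 'a set" where
  "lower_central G 0 = carrier G"
| "lower_central G (Suc 0) = carrier G"
| "lower_central G (Suc (Suc n)) = comm_subgroup G (lower_central G (Suc n)) (carrier G)"

definition gpow :: "('a, 'b) monoid_scheme \<Rightarrow> nat \<Rightarrow> 'a \<Rightarrow> 'a" where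
  "gpow G n y = y [^]\<^bsub>G\<^esub> n"

definition agemo :: "('a, 'b) monoid_scheme \<Rightarrow> nat \<Rightarrow> nat \<Rightarrow> 'a set \<Rightarrow> 'a set" where
  "agemo G p j S = generate G (gpow G (p ^ j) ` S)"

text \<open>Jennings series D_n = prod over i p^j >= n (i >= 1) of mho_j(gamma_i); the product of these
  (normal) subgroups is the subgroup generated by their union.\<close>
definition jennings :: "('a, 'b) monoid_scheme \<Rightarrow> nat \<Rightarrow> nat \<Rightarrow> 'a set" where
  "jennings G p n = generate G
     (\<Union>{agemo G p j (lower_central G i) | i j. 1 \<le> i \<and> n \<le> i * p ^ j})"

definition group_exponent :: "('a, 'b) monoid_scheme \<Rightarrow> nat" where
  "group_exponent G = Lcm (group.ord G ` carrier G)"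

definition CGG :: "('a, 'b) monoid_scheme \<Rightarrow> ('a, 'b) monoid_scheme" where
  "CGG G = G\<lparr>carrier := centralizer G (derived G (carrier G))\<rparr>"

end

theory Submission
  imports Defs "HOL-Library.Function_Algebras" "HOL-Number_Theory.Cong" "HOL-Computational_Algebra.Polynomial"
begin

text \<open>For a subgroup \<open>N\<close> of \<open>G\<close> the relative augmentation ideal consists of the elements of \<open>kG\<close> whose sum over
  every right coset of \<open>N\<close> vanishes; write \<open>RI N\<close> for it. Commutativity of \<open>k[G/G']\<close> makes \<open>RI G'\<close> invariant under
  isomorphisms, and because \<open>RI G'\<close> is generated by the single element \<open>c - 1\<close> with \<open>G' = \<langle>c\<rangle>\<close>, a nilpotency
  argument shows that \<open>H'\<close> is cyclic as well. A central element of augmentation zero is constant on conjugacy classes,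
  so modulo \<open>p\<close> only sums over central elements survive; hence \<open>RI (Z(G) G')\<close> and \<open>RI (Z(G) \<inter> G')\<close> are invariant too.

  If \<open>p\<^sup>s\<close> is the order of \<open>Z(G) \<inter> G'\<close>, which turns out to be the derived subgroup of the centralizer \<open>C\<close> of \<open>G'\<close>, then
  \<open>g\<close> lies in \<open>C\<close> exactly if its \<open>p\<^sup>s\<close>-th power lies in \<open>Z(G) G'\<close>. Since \<open>G/G'\<close> is abelian, the Frobenius map
  translates this into a description of \<open>RI C\<close> in terms of \<open>RI (Z(G) G')\<close>, which gives (a).

  The \<open>p\<^sup>j\<close>-th powers of elements of \<open>C\<close> form a subgroup \<open>P j\<close>. The Frobenius map shows that the order of \<open>P j G'\<close> is an
  invariant. So is the order of \<open>P j \<inter> G'\<close>, because the lower bound in Jennings' theorem says that \<open>z \<in> C\<close> is a \<open>p\<^sup>j\<close>-th power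
  when \<open>z - 1\<close> lies in the \<open>p\<^sup>j\<close>-th power of \<open>RI C\<close>. Hence the order of \<open>P j\<close> is an invariant. As the subgroups of \<open>G'\<close>
  form a chain, these orders give the orders of all Jennings factors, which are elementary abelian, and of the power
  subgroups of the abelian groups \<open>C/G'\<close> and \<open>C/C'\<close>, which determine these groups up to isomorphism.\<close>

section \<open>The group algebra\<close>

text \<open>Two obstacles shape the proof. The Frobenius map is additive only modulo
  \<open>RI D\<close>, since kG is not commutative, so it sees \<open>P j\<close> only up to G'. The
  missing part of \<open>P j\<close> inside G' has to be reached through powers of the ideal
  \<open>RI C\<close>; it is measurable because G' has only the subgroups generated by c^(p^t), and
  (c - 1)^(p^t) = c^(p^t) - 1 can be followed through an isomorphism. The oddness of p is used above
  all through one fact: for r = 1 modulo p the sum 1 + r + ... + r^(p^l - 1) equals p^l times a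
  number congruent to 1 modulo p. If h acts on G' by d -> d^r and a lies in C, this sum is the
  exponent in [h^(p^l), a] = [h, a]^(...), so commutators with p-power powers are known exactly. The
  same fact makes G/C cyclic. Oddness also gives commutators of C square roots, which turn C, of
  class at most two, into an abelian group with the same powers; its characters detect p^j-th
  powers.\<close>

definition sc :: "'k::field \<Rightarrow> ('a \<Rightarrow> 'k) \<Rightarrow> 'a \<Rightarrow> 'k" where
  "sc c f = (\<lambda>x. c * f x)"

text \<open>The point mass is the group element \<open>x\<close> seen inside kG; the point masses
  form the standard basis.\<close>

definition dl :: "'a \<Rightarrow> 'a \<Rightarrow> 'k::field" where
  "dl x = (\<lambda>y. if y = x then 1 else 0)"

text \<open>Powers are taken on bare functions with the convolution product, so that no ring
  structure on \<open>group_alg G\<close> has to be established first.\<close>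

primrec kpow :: "('a, 'b) monoid_scheme \<Rightarrow> ('a \<Rightarrow> 'k::field) \<Rightarrow> nat \<Rightarrow> 'a \<Rightarrow> 'k" where
  "kpow G f 0 = dl \<one>\<^bsub>G\<^esub>"
| "kpow G f (Suc n) = conv G f (kpow G f n)"

lemma sc_apply [simp]: "sc c f x = c * f x"
  by (simp add: sc_def)

lemma dl_apply: "dl x y = (if y = x then 1 else 0)"
  by (simp add: dl_def)

lemma sum_fun_apply: "(\<Sum>i\<in>I. F i) x = (\<Sum>i\<in>I. (F i x :: 'k::comm_monoid_add))"
  by (induction I rule: infinite_finite_induct) auto

lemma sc_one [simp]: "sc 1 f = f" by (auto simp: sc_def)
lemma sc_zero [simp]: "sc 0 f = 0" "sc c 0 = 0" by (auto simp: sc_def)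
lemma sc_sc [simp]: "sc c (sc d f) = sc (c * d) f" by (auto simp: sc_def mult.assoc)
lemma sc_add: "sc c (f + g) = sc c f + sc c g" by (auto simp: sc_def algebra_simps)
lemma sc_sum: "sc c (\<Sum>i\<in>I. F i) = (\<Sum>i\<in>I. sc c (F i))"
  by (rule ext) (simp add: sum_fun_apply sum_distrib_left)

lemma vector_space_sc: "vector_space sc"
  by unfold_locales (auto simp: sc_def algebra_simps)

locale fgroup = group G for G :: "('a, 'b) monoid_scheme" (structure) +
  assumes fin: "finite (carrier G)"
begin

text \<open>The carrier of \<open>group_alg G\<close>: over a finite group finite support is
  automatic.\<close>

definition KG :: "('a \<Rightarrow> 'k::field) set" where
  "KG = {f. \<forall>x. x \<notin> carrier G \<longrightarrow> f x = 0}"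

abbreviation cv (infixl \<open>\<star>\<close> 70) where "f \<star> g \<equiv> conv G f g"

lemma carrier_group_alg: "carrier (group_alg G) = KG"
proof -
  have "finite {x. f x \<noteq> 0}" if "\<forall>x. x \<notin> carrier G \<longrightarrow> f x = 0" for f :: "'a \<Rightarrow> 'k::field"
    by (rule finite_subset[OF _ fin]) (use that in auto)
  then show ?thesis by (auto simp: group_alg_def KG_def)
qed

lemma KG_out: "f \<in> KG \<Longrightarrow> x \<notin> carrier G \<Longrightarrow> f x = 0"
  by (auto simp: KG_def)

lemma conv_eq:
  assumes "f \<in> KG" "x \<in> carrier G"
  shows "(f \<star> g) x = (\<Sum>y\<in>carrier G. f y * g (inv y \<otimes> x))"
proof -
  have "(\<Sum>y\<in>{y. f y \<noteq> 0}. f y * g (inv y \<otimes> x)) = (\<Sum>y\<in>carrier G. f y * g (inv y \<otimes> x))"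
    by (rule sum.mono_neutral_left[OF fin]) (use assms in \<open>auto simp: KG_def\<close>)
  then show ?thesis using assms by (simp add: conv_def)
qed

lemma aug_eq: "f \<in> KG \<Longrightarrow> aug f = (\<Sum>x\<in>carrier G. f x)"
  unfolding aug_def by (rule sum.mono_neutral_left[OF fin]) (auto simp: KG_def)

lemma conv_closed [simp, intro]: "f \<star> g \<in> KG"
  by (auto simp: KG_def conv_def)
lemma KG_zero [simp, intro]: "0 \<in> KG" by (auto simp: KG_def)
lemma KG_add [simp, intro]: "f \<in> KG \<Longrightarrow> g \<in> KG \<Longrightarrow> f + g \<in> KG" by (auto simp: KG_def)
lemma KG_minus [simp, intro]: "f \<in> KG \<Longrightarrow> g \<in> KG \<Longrightarrow> f - g \<in> KG" by (auto simp: KG_def)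
lemma KG_sc [simp, intro]: "f \<in> KG \<Longrightarrow> sc c f \<in> KG" by (auto simp: KG_def)
lemma KG_dl [simp, intro]: "x \<in> carrier G \<Longrightarrow> dl x \<in> KG" by (auto simp: KG_def dl_def)
lemma KG_sum [simp, intro]: "(\<And>i. i \<in> I \<Longrightarrow> F i \<in> KG) \<Longrightarrow> (\<Sum>i\<in>I. F i) \<in> KG"
  by (induction I rule: infinite_finite_induct) auto

lemma KG_eqI:
  assumes "f \<in> KG" "g \<in> KG" "\<And>x. x \<in> carrier G \<Longrightarrow> f x = g x"
  shows "f = g"
  using assms by (intro ext) (metis KG_out)

lemma conv_add_left: "f \<in> KG \<Longrightarrow> f' \<in> KG \<Longrightarrow> (f + f') \<star> g = f \<star> g + f' \<star> g"
  by (rule KG_eqI) (auto simp: conv_eq algebra_simps sum.distrib)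
lemma conv_add_right: "f \<in> KG \<Longrightarrow> f \<star> (g + g') = f \<star> g + f \<star> g'"
  by (rule KG_eqI) (auto simp: conv_eq algebra_simps sum.distrib)
lemma conv_minus_left: "f \<in> KG \<Longrightarrow> f' \<in> KG \<Longrightarrow> (f - f') \<star> g = f \<star> g - f' \<star> g"
  by (rule KG_eqI) (auto simp: conv_eq algebra_simps sum_subtractf)
lemma conv_minus_right: "f \<in> KG \<Longrightarrow> f \<star> (g - g') = f \<star> g - f \<star> g'"
  by (rule KG_eqI) (auto simp: conv_eq algebra_simps sum_subtractf)
lemma conv_sc_left: "f \<in> KG \<Longrightarrow> sc c f \<star> g = sc c (f \<star> g)"
  by (rule KG_eqI) (auto simp: conv_eq algebra_simps sum_distrib_left)
lemma conv_sc_right: "f \<in> KG \<Longrightarrow> f \<star> sc c g = sc c (f \<star> g)"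
  by (rule KG_eqI) (auto simp: conv_eq algebra_simps sum_distrib_left)
lemma conv_zero_left [simp]: "0 \<star> g = 0"
  by (rule KG_eqI) (auto simp: conv_eq)
lemma conv_zero_right [simp]: "f \<in> KG \<Longrightarrow> f \<star> 0 = 0"
  by (rule KG_eqI) (auto simp: conv_eq)
lemma conv_sum_left: "(\<And>i. i \<in> I \<Longrightarrow> F i \<in> KG) \<Longrightarrow> (\<Sum>i\<in>I. F i) \<star> g = (\<Sum>i\<in>I. F i \<star> g)"
  by (induction I rule: infinite_finite_induct) (auto simp: conv_add_left)
lemma conv_sum_right: "f \<in> KG \<Longrightarrow> f \<star> (\<Sum>i\<in>I. F i) = (\<Sum>i\<in>I. f \<star> F i)"
  by (induction I rule: infinite_finite_induct) (auto simp: conv_add_right)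

lemma conv_dl_left: "x \<in> carrier G \<Longrightarrow> y \<in> carrier G \<Longrightarrow> (dl x \<star> f) y = f (inv x \<otimes> y)"
  by (simp add: conv_eq dl_apply fin if_distrib[of "\<lambda>c. c * _"] cong: if_cong)

lemma inv_mult_eq_iff:
  assumes "x \<in> carrier G" "y \<in> carrier G" "z \<in> carrier G"
  shows "inv x \<otimes> y = z \<longleftrightarrow> y = x \<otimes> z"
  using assms by (metis inv_solve_left)

lemma conv_dl_dl: "x \<in> carrier G \<Longrightarrow> y \<in> carrier G \<Longrightarrow> dl x \<star> dl y = dl (x \<otimes> y)"
  by (rule KG_eqI) (auto simp: conv_dl_left dl_apply inv_mult_eq_iff)

lemma KG_expand:
  assumes "f \<in> KG"
  shows "f = (\<Sum>x\<in>carrier G. sc (f x) (dl x))"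
proof (rule KG_eqI)
  fix y assume y: "y \<in> carrier G"
  have "(\<Sum>x\<in>carrier G. sc (f x) (dl x)) y = (\<Sum>x\<in>carrier G. if x = y then f x else 0)"
    unfolding sum_fun_apply by (rule sum.cong) (auto simp: dl_apply)
  then show "f y = (\<Sum>x\<in>carrier G. sc (f x) (dl x)) y" using y fin by simp
qed (use assms in auto)

lemma conv_expand:
  assumes "f \<in> KG" "g \<in> KG"
  shows "f \<star> g = (\<Sum>x\<in>carrier G. \<Sum>y\<in>carrier G. sc (f x * g y) (dl (x \<otimes> y)))"
proof -
  have "f \<star> g = (\<Sum>x\<in>carrier G. sc (f x) (dl x)) \<star> (\<Sum>y\<in>carrier G. sc (g y) (dl y))"
    using KG_expand[OF assms(1)] KG_expand[OF assms(2)] by simp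
  also have "\<dots> = (\<Sum>x\<in>carrier G. \<Sum>y\<in>carrier G. sc (f x) (dl x) \<star> sc (g y) (dl y))"
    by (subst conv_sum_left) (simp_all add: conv_sum_right)
  also have "\<dots> = (\<Sum>x\<in>carrier G. \<Sum>y\<in>carrier G. sc (f x * g y) (dl (x \<otimes> y)))"
    by (intro sum.cong refl) (simp add: conv_sc_left conv_sc_right conv_dl_dl mult.commute)
  finally show ?thesis .
qed

lemma conv_expand_left:
  assumes "f \<in> KG"
  shows "f \<star> g = (\<Sum>x\<in>carrier G. sc (f x) (dl x \<star> g))"
proof -
  have "f \<star> g = (\<Sum>x\<in>carrier G. sc (f x) (dl x)) \<star> g" using KG_expand[OF assms] by simp
  also have "\<dots> = (\<Sum>x\<in>carrier G. sc (f x) (dl x) \<star> g)" by (simp add: conv_sum_left)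
  finally show ?thesis by (simp add: conv_sc_left)
qed

lemma conv_expand_right:
  assumes "f \<in> KG" "g \<in> KG"
  shows "f \<star> g = (\<Sum>x\<in>carrier G. sc (g x) (f \<star> dl x))"
proof -
  have "f \<star> g = f \<star> (\<Sum>x\<in>carrier G. sc (g x) (dl x))" using KG_expand[OF assms(2)] by simp
  also have "\<dots> = (\<Sum>x\<in>carrier G. f \<star> sc (g x) (dl x))" by (simp add: conv_sum_right assms)
  finally show ?thesis by (simp add: conv_sc_right assms)
qed

lemma conv_assoc_dl:
  assumes "x \<in> carrier G" "y \<in> carrier G" "g \<in> KG"
  shows "(dl x \<star> dl y) \<star> g = dl x \<star> (dl y \<star> g)"
  by (rule KG_eqI) (use assms in \<open>auto simp: conv_dl_dl conv_dl_left inv_mult_group m_assoc\<close>)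

lemma conv_assoc:
  assumes "f \<in> KG" "g \<in> KG" "h \<in> KG"
  shows "(f \<star> g) \<star> h = f \<star> (g \<star> h)"
proof -
  have "(dl x \<star> g) \<star> h = dl x \<star> (g \<star> h)" if x: "x \<in> carrier G" for x
  proof -
    have "(dl x \<star> g) \<star> h = (\<Sum>y\<in>carrier G. sc (g y) (dl x \<star> dl y)) \<star> h"
      using x assms by (subst conv_expand_right[of "dl x" g]) auto
    also have "\<dots> = (\<Sum>y\<in>carrier G. sc (g y) (dl x \<star> (dl y \<star> h)))"
      using x assms by (simp add: conv_sum_left conv_sc_left conv_assoc_dl)
    also have "\<dots> = dl x \<star> (\<Sum>y\<in>carrier G. sc (g y) (dl y \<star> h))"
      using x assms by (simp add: conv_sum_right conv_sc_right)
    also have "\<dots> = dl x \<star> (g \<star> h)" by (subst (2) conv_expand_left) (use assms in auto)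
    finally show ?thesis .
  qed
  then show ?thesis using assms
    by (subst (2) conv_expand_left, simp, subst conv_expand_left[of f g], simp)
       (simp add: conv_sum_left conv_sc_left)
qed

lemma conv_one_left [simp]: "f \<in> KG \<Longrightarrow> dl \<one> \<star> f = f"
  by (rule KG_eqI) (auto simp: conv_dl_left)

lemma conv_one_right [simp]: "f \<in> KG \<Longrightarrow> f \<star> dl \<one> = f"
proof (rule KG_eqI)
  fix y assume f: "f \<in> KG" and y: "y \<in> carrier G"
  have "(f \<star> dl \<one>) y = (\<Sum>z\<in>carrier G. if z = y then f z else 0)"
    unfolding conv_eq[OF f y] using y by (intro sum.cong) (auto simp: dl_apply inv_mult_eq_iff)
  then show "(f \<star> dl \<one>) y = f y" using y fin by simp
qed auto

lemma aug_add: "f \<in> KG \<Longrightarrow> g \<in> KG \<Longrightarrow> aug (f + g) = aug f + aug g"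
  by (simp add: aug_eq sum.distrib)
lemma aug_minus: "f \<in> KG \<Longrightarrow> g \<in> KG \<Longrightarrow> aug (f - g) = aug f - aug g"
  by (simp add: aug_eq sum_subtractf)
lemma aug_sc: "f \<in> KG \<Longrightarrow> aug (sc c f) = c * aug f"
  by (simp add: aug_eq sum_distrib_left)
lemma aug_zero [simp]: "aug (0 :: 'a \<Rightarrow> 'k::field) = 0"
  by (simp add: aug_eq)
lemma aug_sum: "(\<And>i. i \<in> I \<Longrightarrow> F i \<in> KG) \<Longrightarrow> aug (\<Sum>i\<in>I. F i) = (\<Sum>i\<in>I. aug (F i))"
  by (induction I rule: infinite_finite_induct) (auto simp: aug_add)
lemma aug_dl [simp]: "aug (dl x) = 1"
proof -
  have "{y. dl x y \<noteq> 0} = {x}" by (auto simp: dl_apply)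
  then show ?thesis by (simp add: aug_def dl_apply)
qed
lemma aug_conv:
  assumes "f \<in> KG" "g \<in> KG"
  shows "aug (f \<star> g) = aug f * aug g"
  using assms by (simp add: conv_expand aug_sum aug_sc aug_eq[of f] aug_eq[of g] sum_product)

lemma kpow_closed [simp, intro]: "kpow G f n \<in> KG"
  by (cases n) auto

lemma aug_kpow: "f \<in> KG \<Longrightarrow> aug (kpow G f n) = aug f ^ n"
  by (induction n) (auto simp: aug_conv)

lemma kpow_add: "f \<in> KG \<Longrightarrow> kpow G f (m + n) = kpow G f m \<star> kpow G f n"
  by (induction m) (auto simp: conv_assoc)

lemma kpow_1 [simp]: "f \<in> KG \<Longrightarrow> kpow G f (Suc 0) = f"
  by simp

lemma kpow_mult: "f \<in> KG \<Longrightarrow> kpow G f (m * n) = kpow G (kpow G f m) n"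
  by (induction n) (auto simp: kpow_add)

lemma kpow_dl: "x \<in> carrier G \<Longrightarrow> kpow G (dl x) n = dl (x [^] n)"
proof (induction n)
  case (Suc n)
  have "x [^] Suc n = x \<otimes> x [^] n" using Suc.prems by (rule nat_pow_Suc2)
  then show ?case using Suc by (simp add: conv_dl_dl del: nat_pow_Suc)
qed simp

lemma kpow_sc: "f \<in> KG \<Longrightarrow> kpow G (sc c f) n = sc (c ^ n) (kpow G f n)"
  by (induction n) (auto simp: conv_sc_left conv_sc_right)

lemma kpow_zero: "n > 0 \<Longrightarrow> kpow G 0 n = 0"
  by (cases n) auto

lemma kpow_commute:
  assumes "f \<in> KG" "g \<in> KG" "f \<star> g = g \<star> f"
  shows "kpow G f n \<star> g = g \<star> kpow G f n"
proof (induction n)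
  case (Suc n)
  have "kpow G f (Suc n) \<star> g = f \<star> (kpow G f n \<star> g)" using assms by (simp add: conv_assoc)
  also have "\<dots> = f \<star> (g \<star> kpow G f n)" using Suc by simp
  also have "\<dots> = f \<star> g \<star> kpow G f n" using assms(1,2) by (subst conv_assoc) auto
  also have "\<dots> = g \<star> f \<star> kpow G f n" using assms by simp
  also have "\<dots> = g \<star> kpow G f (Suc n)" using assms(1,2) by (simp add: conv_assoc)
  finally show ?case .
qed (use assms in auto)

lemma kpow_binomial:
  assumes "f \<in> KG" "g \<in> KG" "f \<star> g = g \<star> f"
  shows "kpow G (f + g) n = (\<Sum>k\<le>n. sc (of_nat (n choose k)) (kpow G f k \<star> kpow G g (n - k)))"
proof (induction n)
  case (Suc n)
  let ?T = "\<lambda>k l. kpow G f k \<star> kpow G g l"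
  have g: "g \<star> ?T k l = ?T k (Suc l)" for k l
  proof -
    have "g \<star> ?T k l = (g \<star> kpow G f k) \<star> kpow G g l" using assms by (simp add: conv_assoc)
    also have "\<dots> = (kpow G f k \<star> g) \<star> kpow G g l" using kpow_commute[OF assms] by simp
    also have "\<dots> = ?T k (Suc l)" using assms by (simp add: conv_assoc)
    finally show ?thesis .
  qed
  have f: "f \<star> ?T k l = ?T (Suc k) l" for k l
    using assms by (simp add: conv_assoc)
  have "kpow G (f + g) (Suc n) = f \<star> kpow G (f + g) n + g \<star> kpow G (f + g) n"
    using assms by (simp add: conv_add_left)
  also have "\<dots> = (\<Sum>k\<le>n. sc (of_nat (n choose k)) (?T (Suc k) (n - k)))
      + (\<Sum>k\<le>n. sc (of_nat (n choose k)) (?T k (Suc n - k)))"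
    unfolding Suc conv_sum_right[OF assms(1)] conv_sum_right[OF assms(2)]
      conv_sc_right[OF assms(1)] conv_sc_right[OF assms(2)] f g
    by (intro arg_cong2[where f = "(+)"] sum.cong refl) (auto simp: Suc_diff_le simp del: kpow.simps)
  also have "(\<Sum>k\<le>n. sc (of_nat (n choose k)) (?T (Suc k) (n - k)))
      = (\<Sum>k\<le>Suc n. sc (of_nat (if k = 0 then 0 else n choose (k - 1))) (?T k (Suc n - k)))"
    by (subst sum.atMost_Suc_shift) (simp del: kpow.simps)
  also have "(\<Sum>k\<le>n. sc (of_nat (n choose k)) (?T k (Suc n - k)))
      = (\<Sum>k\<le>Suc n. sc (of_nat (n choose k)) (?T k (Suc n - k)))"
    by (simp add: binomial_eq_0 del: kpow.simps)
  also have "(\<Sum>k\<le>Suc n. sc (of_nat (if k = 0 then 0 else n choose (k - 1))) (?T k (Suc n - k)))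
      + (\<Sum>k\<le>Suc n. sc (of_nat (n choose k)) (?T k (Suc n - k)))
      = (\<Sum>k\<le>Suc n. sc (of_nat (Suc n choose k)) (?T k (Suc n - k)))"
    unfolding sum.distrib[symmetric]
  proof (intro sum.cong refl)
    fix k
    show "sc (of_nat (if k = 0 then 0 else n choose (k - 1))) (?T k (Suc n - k))
      + sc (of_nat (n choose k)) (?T k (Suc n - k))
      = sc (of_nat (Suc n choose k)) (?T k (Suc n - k))"
      by (cases k) (simp_all add: fun_eq_iff distrib_right del: kpow.simps)
  qed
  finally show ?case .
qed simp

text \<open>For commuting elements the binomial theorem holds, and p divides every inner binomial
  coefficient. The step from p^e to p^(e+1) applies the case of p to the p^e-th powers, which
  commute again.\<close>

lemma freshman_dream:
  fixes f g :: "'a \<Rightarrow> 'k::field"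
  assumes "Factorial_Ring.prime CHAR('k)" "f \<in> KG" "g \<in> KG" "f \<star> g = g \<star> f"
  shows "kpow G (f + g) (CHAR('k) ^ e) = kpow G f (CHAR('k) ^ e) + kpow G g (CHAR('k) ^ e)"
proof (induction e)
  case 0
  show ?case
    unfolding power_0 One_nat_def using assms(2,3) by (subst (1 2 3) kpow_1) (auto simp del: kpow.simps)
next
  case (Suc e)
  let ?p = "CHAR('k)"
  have comm: "kpow G f m \<star> kpow G g m = kpow G g m \<star> kpow G f m" for m
    using kpow_commute[OF _ _ kpow_commute[OF assms(3,2) assms(4)[symmetric], symmetric]] assms by simp
  have p: "kpow G (u + v) ?p = kpow G u ?p + kpow G v ?p"
    if "u \<in> KG" "v \<in> KG" "u \<star> v = v \<star> u" for u v :: "'a \<Rightarrow> 'k"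
  proof -
    let ?t = "\<lambda>k. sc (of_nat (?p choose k)) (kpow G u k \<star> kpow G v (?p - k))"
    have z: "?t k = 0" if "k \<in> {..?p} - {0, ?p}" for k
    proof -
      have "?p dvd (?p choose k)" using that assms(1) by (intro dvd_choose_prime) auto
      then have "(of_nat (?p choose k) :: 'k) = 0" by (simp add: of_nat_eq_0_iff_char_dvd)
      then show ?thesis by simp
    qed
    have "?p > 0" using assms(1) by (rule prime_gt_0_nat)
    have "kpow G (u + v) ?p = (\<Sum>k\<in>{0, ?p}. ?t k)"
      unfolding kpow_binomial[OF that] by (rule sum.mono_neutral_right) (use z in auto)
    then show ?thesis using \<open>?p > 0\<close> by (simp add: add.commute)
  qed
  have "kpow G (f + g) (?p ^ Suc e) = kpow G (kpow G (f + g) (?p ^ e)) ?p"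
    unfolding power_Suc2 by (rule kpow_mult) (use assms in auto)
  also have "\<dots> = kpow G (kpow G f (?p ^ e)) ?p + kpow G (kpow G g (?p ^ e)) ?p"
    unfolding Suc by (rule p) (use comm in auto)
  also have "\<dots> = kpow G f (?p ^ Suc e) + kpow G g (?p ^ Suc e)"
    unfolding power_Suc2 kpow_mult[OF assms(2)] kpow_mult[OF assms(3)] ..
  finally show ?case .
qed

end

declare plus_fun_apply [simp del] zero_fun_apply [simp del] minus_apply [simp del] uminus_apply [simp del] sc_apply [simp del]
lemmas pw = plus_fun_apply zero_fun_apply minus_apply uminus_apply sc_apply

section \<open>Coset sums and relative augmentation ideals\<close>

lemma sum_fun_plus: "sum (f + g) A = sum f A + (sum g A :: 'k::field)"
  by (simp add: plus_fun_def sum.distrib)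
lemma sum_fun_minus: "sum (f - g) A = sum f A - (sum g A :: 'k::field)"
  by (simp add: fun_diff_def sum_subtractf)
lemma sum_fun_sc: "sum (sc c f) A = c * sum f A"
  by (simp add: sc_def sum_distrib_left)

lemma (in subgroup) sum_rcos_mult:
  assumes "group G" "x \<in> carrier G" "g \<in> carrier G"
  shows "(\<Sum>y\<in>H #> x. f (y \<otimes> g)) = (\<Sum>y\<in>H #> (x \<otimes> g). f y)"
proof -
  interpret group G by fact
  have sub: "H #> x \<subseteq> carrier G" using assms(2) subset r_coset_subset_G by blast
  have "(\<lambda>y. y \<otimes> g) ` (H #> x) = (H #> x) #> g"
    by (auto simp: r_coset_def)
  also have "\<dots> = H #> (x \<otimes> g)"
    using assms subset by (simp add: coset_mult_assoc)
  finally have "(\<lambda>y. y \<otimes> g) ` (H #> x) = H #> (x \<otimes> g)" .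
  moreover have "inj_on (\<lambda>y. y \<otimes> g) (H #> x)"
    using sub assms(3) by (auto simp: inj_on_def subset_iff)
  ultimately show ?thesis using sum.reindex[of "\<lambda>y. y \<otimes> g" "H #> x" f] by simp
qed

context fgroup
begin

text \<open>The kernel of the linear map from kG to the space spanned by the right cosets of N.
  Coset sums make membership a system of linear equations; \<open>RI_eq_rel_aug_ideal\<close>
  connects it with the inductive definition.\<close>

definition RI :: "'a set \<Rightarrow> ('a \<Rightarrow> 'k::field) set" where
  "RI N = {f \<in> KG. \<forall>x\<in>carrier G. (\<Sum>y\<in>N #> x. f y) = 0}"

lemma RI_KG: "f \<in> RI N \<Longrightarrow> f \<in> KG" by (simp add: RI_def)
lemma RI_zero [simp]: "0 \<in> RI N" by (simp add: RI_def zero_fun_def[symmetric]) (simp add: zero_fun_def)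
lemma RI_add: "f \<in> RI N \<Longrightarrow> g \<in> RI N \<Longrightarrow> f + g \<in> RI N" by (simp add: RI_def sum_fun_plus)
lemma RI_sc: "f \<in> RI N \<Longrightarrow> sc c f \<in> RI N" by (simp add: RI_def sum_fun_sc)
lemma RI_sum: "(\<And>i. i \<in> I \<Longrightarrow> F i \<in> RI N) \<Longrightarrow> (\<Sum>i\<in>I. F i) \<in> RI N"
  by (induction I rule: infinite_finite_induct) (auto simp: RI_add)

lemma finite_rcos: "finite (N #> x)" if "N \<subseteq> carrier G" "x \<in> carrier G"
  using that finite_subset[OF r_coset_subset_G fin] by auto

lemma sum_dl: "finite A \<Longrightarrow> (\<Sum>y\<in>A. dl x y) = (if x \<in> A then 1 else 0)"
  by (simp add: dl_apply)

lemma mem_rcos_iff: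
  assumes "subgroup N G" "x \<in> carrier G" "y \<in> carrier G"
  shows "y \<in> N #> x \<longleftrightarrow> N #> y = N #> x"
  using assms by (metis rcos_self repr_independence)

lemma RI_diff:
  assumes N: "subgroup N G" and "x \<in> carrier G" "y \<in> carrier G" "N #> x = N #> y"
  shows "dl x - dl y \<in> RI N"
proof -
  have "x \<in> N #> z \<longleftrightarrow> y \<in> N #> z" if "z \<in> carrier G" for z
    using assms that by (simp add: mem_rcos_iff)
  then show ?thesis
    using assms subgroup.subset[OF N] by (auto simp: RI_def sum_fun_minus sum_dl finite_rcos)
qed

text \<open>Recovers N from its ideal. Every conclusion about elements of H that is drawn from an
  ideal of kH passes through this equivalence.\<close>

lemma RI_dl_iff:
  assumes N: "subgroup N G" and w: "w \<in> carrier G"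
  shows "dl w - dl \<one> \<in> (RI N :: ('a \<Rightarrow> 'k::field) set) \<longleftrightarrow> w \<in> N"
proof
  assume "dl w - dl \<one> \<in> (RI N :: ('a \<Rightarrow> 'k::field) set)"
  then have "(\<Sum>y\<in>N #> \<one>. (dl w - dl \<one> :: 'a \<Rightarrow> 'k) y) = 0" by (simp add: RI_def)
  then show "w \<in> N" using subgroup.subset[OF N] subgroup.one_closed[OF N] finite_subset[OF _ fin]
    by (auto simp: fun_diff_def sum_subtractf sum_dl split: if_splits)
next
  assume "w \<in> N"
  then have "N #> w = N #> \<one>" using w N by (metis coset_join2 one_closed subgroup.one_closed)
  then show "dl w - dl \<one> \<in> RI N" using assms by (intro RI_diff) auto
qed

lemma conv_dl_right:
  assumes "f \<in> KG" "g \<in> carrier G" "y \<in> carrier G"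
  shows "(f \<star> dl g) y = f (y \<otimes> inv g)"
proof -
  have "inv z \<otimes> y = g \<longleftrightarrow> z = y \<otimes> inv g" if "z \<in> carrier G" for z
    using that assms by (metis inv_solve_left inv_solve_right)
  then have "(f \<star> dl g) y = (\<Sum>z\<in>carrier G. if z = y \<otimes> inv g then f z else 0)"
    unfolding conv_eq[OF assms(1,3)] by (intro sum.cong) (auto simp: dl_apply)
  then show ?thesis using assms fin by simp
qed

lemma RI_right:
  assumes N: "subgroup N G" and f: "f \<in> RI N" and g: "g \<in> KG"
  shows "f \<star> g \<in> RI N"
proof -
  have "f \<star> dl x \<in> RI N" if x: "x \<in> carrier G" for x
  proof -
    have "(\<Sum>y\<in>N #> z. (f \<star> dl x) y) = 0" if z: "z \<in> carrier G" for z
    proof -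
      have "N #> z \<subseteq> carrier G" using z subgroup.subset[OF N] r_coset_subset_G by blast
      then have "(\<Sum>y\<in>N #> z. (f \<star> dl x) y) = (\<Sum>y\<in>N #> z. f (y \<otimes> inv x))"
        using x f by (intro sum.cong) (auto simp: conv_dl_right RI_KG)
      also have "\<dots> = (\<Sum>y\<in>N #> (z \<otimes> inv x). f y)"
        using subgroup.sum_rcos_mult[OF N is_group z, of "inv x" f] x by simp
      also have "\<dots> = 0" using f x z by (simp add: RI_def)
      finally show ?thesis .
    qed
    then show ?thesis by (simp add: RI_def)
  qed
  then show ?thesis
    unfolding conv_expand_right[OF RI_KG[OF f] g] by (intro RI_sum RI_sc) auto
qed

text \<open>Left translation permutes the right cosets of a normal subgroup: x^-1 N z = N x^-1
  z.\<close>

lemma RI_left: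
  assumes N: "N \<lhd> G" and f: "f \<in> RI N" and g: "g \<in> KG"
  shows "g \<star> f \<in> RI N"
proof -
  have sub: "subgroup N G" using N by (rule normal_imp_subgroup)
  have "dl x \<star> f \<in> RI N" if x: "x \<in> carrier G" for x
  proof -
    have "(\<Sum>y\<in>N #> z. (dl x \<star> f) y) = 0" if z: "z \<in> carrier G" for z
    proof -
      have c: "N #> z \<subseteq> carrier G" using z subgroup.subset[OF sub] r_coset_subset_G by blast
      have "(\<lambda>y. inv x \<otimes> y) ` (N #> z) = inv x <# (N #> z)"
        by (auto simp: l_coset_def)
      also have "\<dots> = (inv x <# N) #> z"
        using x z subgroup.subset[OF sub] by (simp add: rcos_assoc_lcos[symmetric] lcos_m_assoc coset_assoc)
      also have "\<dots> = (N #> inv x) #> z"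
        using N x by (simp add: normal.coset_eq)
      also have "\<dots> = N #> (inv x \<otimes> z)"
        using x z subgroup.subset[OF sub] by (simp add: coset_mult_assoc)
      finally have im: "(\<lambda>y. inv x \<otimes> y) ` (N #> z) = N #> (inv x \<otimes> z)" .
      have "inj_on (\<lambda>y. inv x \<otimes> y) (N #> z)"
        using c x by (auto simp: inj_on_def subset_iff)
      then have "(\<Sum>y\<in>N #> (inv x \<otimes> z). f y) = (\<Sum>y\<in>N #> z. f (inv x \<otimes> y))"
        unfolding im[symmetric] by (simp add: sum.reindex)
      also have "\<dots> = (\<Sum>y\<in>N #> z. (dl x \<star> f) y)"
        using x c by (intro sum.cong) (auto simp: conv_dl_left)
      finally show ?thesis using f x z by (simp add: RI_def)
    qed
    then show ?thesis by (simp add: RI_def)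
  qed
  then show ?thesis
    unfolding conv_expand_left[OF g] by (intro RI_sum RI_sc) auto
qed

text \<open>Right ideals. Closure under scalars comes from multiplying by a scalar multiple of the
  unit, see \<open>rideal_sc\<close>.\<close>

definition rideal :: "('a \<Rightarrow> 'k::field) set \<Rightarrow> bool" where
  "rideal W \<longleftrightarrow> W \<subseteq> KG \<and> 0 \<in> W \<and> (\<forall>f\<in>W. \<forall>g\<in>W. f + g \<in> W) \<and> (\<forall>f\<in>W. \<forall>g\<in>KG. f \<star> g \<in> W)"

lemma rideal_RI: "subgroup N G \<Longrightarrow> rideal (RI N)"
  by (auto simp: rideal_def RI_add RI_right RI_KG)

lemma rideal_sc: "rideal W \<Longrightarrow> f \<in> W \<Longrightarrow> sc c f \<in> W"
proof -
  assume *: "rideal W" "f \<in> W"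
  then have f: "f \<in> KG" by (auto simp: rideal_def)
  have "sc c f = f \<star> sc c (dl \<one>)" using f by (simp add: conv_sc_right)
  then show ?thesis using * by (auto simp: rideal_def)
qed

lemma rideal_sum:
  assumes "rideal W" "\<And>i. i \<in> I \<Longrightarrow> F i \<in> W"
  shows "(\<Sum>i\<in>I. F i) \<in> W"
  using assms(2) by (induction I rule: infinite_finite_induct) (use assms(1) in \<open>auto simp: rideal_def\<close>)

text \<open>By ab - 1 = (a - 1)b + (b - 1) and a^-1 - 1 = -(a - 1)a^-1, the elements g with g - 1 in
  W are closed under products and inverses, so generators suffice.\<close>

lemma rideal_generate:
  fixes W :: "('a \<Rightarrow> 'c::field) set"
  assumes W: "rideal W" and S: "S \<subseteq> carrier G" and "\<And>s. s \<in> S \<Longrightarrow> dl s - dl \<one> \<in> W"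
    and "n \<in> generate G S"
  shows "dl n - dl \<one> \<in> W"
proof -
  have m: "dl (a \<otimes> b) - dl \<one> \<in> W" if "dl a - dl \<one> \<in> W" "dl b - dl \<one> \<in> W" "a \<in> carrier G" "b \<in> carrier G" for a b
  proof -
    have eq: "(dl (a \<otimes> b) - dl \<one> :: 'a \<Rightarrow> 'c) = (dl a - dl \<one>) \<star> dl b + (dl b - dl \<one>)"
      using that by (simp add: conv_minus_left conv_dl_dl)
    have "(dl a - dl \<one>) \<star> dl b \<in> W" using W that by (auto simp: rideal_def)
    then show ?thesis unfolding eq using W that(2) unfolding rideal_def by blast
  qed
  have i: "dl (inv a) - dl \<one> \<in> W" if "dl a - dl \<one> \<in> W" "a \<in> carrier G" for a
  proof -
    have "(dl (inv a) - dl \<one> :: 'a \<Rightarrow> 'c) = (dl a - dl \<one>) \<star> sc (-1) (dl (inv a))"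
      using that by (simp add: conv_minus_left conv_sc_right conv_dl_dl) (simp add: fun_eq_iff pw)
    moreover have "(dl a - dl \<one>) \<star> sc (-1) (dl (inv a)) \<in> W" using W that by (auto simp: rideal_def)
    ultimately show ?thesis by (simp only:)
  qed
  from assms(4) show ?thesis
  proof induction
    case one then show ?case using W by (simp add: rideal_def)
  next
    case (incl h) then show ?case using assms by blast
  next
    case (inv h) then show ?case using assms i S by blast
  next
    case (eng h1 h2)
    then show ?case using m generate_in_carrier[OF S] by blast
  qed
qed

lemma sum_rcosets:
  fixes h :: "'a \<Rightarrow> 'c::comm_monoid_add"
  assumes N: "subgroup N G"
  shows "(\<Sum>x\<in>carrier G. h x) = (\<Sum>Y\<in>rcosets N. \<Sum>x\<in>Y. h x)"
proof -
  have "(\<Sum>Y\<in>rcosets N. \<Sum>x\<in>{x \<in> carrier G. N #> x = Y}. h x) = (\<Sum>x\<in>carrier G. h x)"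
  proof (rule sum.group[OF fin])
    show "finite (rcosets N)" using fin by (simp add: RCOSETS_def)
  qed (auto simp: RCOSETS_def)
  moreover have "{x \<in> carrier G. N #> x = Y} = Y" if "Y \<in> rcosets N" for Y
  proof -
    obtain z where z: "z \<in> carrier G" "Y = N #> z" using \<open>Y \<in> rcosets N\<close> by (auto simp: RCOSETS_def)
    then have "Y \<subseteq> carrier G" using subgroup.subset[OF N] r_coset_subset_G by blast
    then show ?thesis using z N by (auto simp: mem_rcos_iff)
  qed
  ultimately show ?thesis by (simp cong: sum.cong)
qed

text \<open>\<open>RI N\<close> is the least right ideal containing all n - 1. Subtract from every x
  the chosen representative m x of its coset: the difference x - m x = (m^-1 - 1) m x lies in W, and
  the coefficients left at a representative add up to a coset sum, which is 0.\<close>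

lemma RI_subset:
  fixes W :: "('a \<Rightarrow> 'c::field) set"
  assumes N: "subgroup N G" and W: "rideal W" and n: "\<And>n. n \<in> N \<Longrightarrow> dl n - dl \<one> \<in> W"
  shows "RI N \<subseteq> W"
proof
  fix f :: "'a \<Rightarrow> 'c" assume f: "f \<in> RI N"
  define r where "r Y = (SOME y. y \<in> Y)" for Y :: "'a set"
  have r: "r (N #> x) \<in> N #> x" if "x \<in> carrier G" for x
    unfolding r_def by (rule someI[of _ x]) (use that N rcos_self in auto)
  have "f = (\<Sum>x\<in>carrier G. sc (f x) (dl x - dl (r (N #> x)))) + (\<Sum>x\<in>carrier G. sc (f x) (dl (r (N #> x))))"
    using KG_expand[OF RI_KG[OF f]] by (simp add: sum.distrib[symmetric] sc_add[symmetric])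
  also have "(\<Sum>x\<in>carrier G. sc (f x) (dl (r (N #> x))))
      = (\<Sum>Y\<in>rcosets N. \<Sum>x\<in>Y. sc (f x) (dl (r (N #> x))))"
    by (rule sum_rcosets[OF N])
  also have "\<dots> = 0"
  proof (rule sum.neutral, rule ballI)
    fix Y assume "Y \<in> rcosets N"
    then obtain z where z: "z \<in> carrier G" "Y = N #> z" by (auto simp: RCOSETS_def)
    then have "Y \<subseteq> carrier G" using subgroup.subset[OF N] r_coset_subset_G by blast
    then have "(\<Sum>x\<in>Y. sc (f x) (dl (r (N #> x)))) = (\<Sum>x\<in>Y. sc (f x) (dl (r Y)))"
      using z N mem_rcos_iff[OF N z(1)] by (intro sum.cong) (auto simp: subset_iff)
    also have "\<dots> = sc (\<Sum>x\<in>Y. f x) (dl (r Y))"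
      by (rule ext) (simp add: pw sum_fun_apply sum_distrib_right)
    also have "\<dots> = 0" using f z by (simp add: RI_def)
    finally show "(\<Sum>x\<in>Y. sc (f x) (dl (r (N #> x)))) = 0" .
  qed
  also have "(\<Sum>x\<in>carrier G. sc (f x) (dl x - dl (r (N #> x)))) + 0 \<in> W"
  proof -
    have "dl x - dl (r (N #> x)) \<in> W" if x: "x \<in> carrier G" for x
    proof -
      obtain m where m: "m \<in> N" "r (N #> x) = m \<otimes> x" using r[OF x] by (auto simp: r_coset_def)
      have c: "inv m \<in> N" "m \<in> carrier G"
        using subgroup.m_inv_closed[OF N m(1)] subgroup.mem_carrier[OF N m(1)] by auto
      have eq: "(dl x - dl (r (N #> x)) :: 'a \<Rightarrow> 'c) = (dl (inv m) - dl \<one>) \<star> dl (m \<otimes> x)"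
        using m c x by (simp add: conv_minus_left conv_dl_dl m_assoc[symmetric])
      show ?thesis unfolding eq using n[OF c(1)] W c x by (auto simp: rideal_def)
    qed
    then show ?thesis using W by (auto intro!: rideal_sum rideal_sc)
  qed
  finally show "f \<in> W" .
qed

lemma RI_mono: "subgroup N G \<Longrightarrow> subgroup M G \<Longrightarrow> N \<subseteq> M \<Longrightarrow> RI N \<subseteq> RI M"
proof (rule RI_subset)
  assume *: "subgroup N G" "subgroup M G" "N \<subseteq> M"
  show "rideal (RI M)" by (rule rideal_RI[OF *(2)])
  fix n assume "n \<in> N"
  then have n: "n \<in> M" "n \<in> carrier G" using * subgroup.subset[OF *(1)] by auto
  then show "dl n - dl \<one> \<in> RI M" using RI_dl_iff[OF *(2) n(2)] by simp
qed

lemma RI_trivial: "f \<in> RI {\<one>} \<Longrightarrow> f = 0"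
proof (rule KG_eqI)
  assume f: "f \<in> RI {\<one>}"
  then show "f \<in> KG" by (rule RI_KG)
  fix x assume x: "x \<in> carrier G"
  have "{\<one>} #> x = {x}" using x by (simp add: r_coset_def)
  then show "f x = 0 x" using f x by (auto simp: RI_def pw dest!: bspec[where x = x])
qed auto

lemma aug_zero_iff: "f \<in> KG \<Longrightarrow> aug f = 0 \<longleftrightarrow> f \<in> RI (carrier G)"
proof -
  assume f: "f \<in> KG"
  have "carrier G #> x = carrier G" if "x \<in> carrier G" for x
    using that by (simp add: coset_join2 subgroup_self)
  then show ?thesis using f one_closed by (auto simp: RI_def aug_eq simp del: one_closed)
qed

text \<open>An element supported on N has its augmentation as sum over N and 0 as sum over every
  other coset, so the generators satisfy the coset equations. The converse is the minimality in
  \<open>RI_subset\<close>.\<close>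

lemma RI_eq_rel_aug_ideal:
  assumes N: "subgroup N G"
  shows "rel_aug_ideal G N = (RI N :: ('a \<Rightarrow> 'k::field) set)"
proof
  have a: "(a::'a \<Rightarrow> 'k) \<in> RI N" if "a \<in> aug_ideal_in G N" for a
  proof -
    have a: "a \<in> KG" "{x. a x \<noteq> 0} \<subseteq> N" "aug a = 0"
      using that by (auto simp: aug_ideal_in_def carrier_group_alg)
    have "(\<Sum>y\<in>N #> x. a y) = 0" if x: "x \<in> carrier G" for x
    proof (cases "x \<in> N")
      case True
      then have "N #> x = N" using N by (simp add: coset_join2 x)
      moreover have "sum a N = aug a" using a(2) finite_subset[OF subgroup.subset[OF N] fin]
        unfolding aug_def by (intro sum.mono_neutral_right) auto
      ultimately show ?thesis using a by simp
    next
      case False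
      have "a y = 0" if "y \<in> N #> x" for y
      proof (rule ccontr)
        assume "a y \<noteq> 0"
        then have "y \<in> N" using a by auto
        moreover obtain n where "n \<in> N" "y = n \<otimes> x" using \<open>y \<in> N #> x\<close> by (auto simp: r_coset_def)
        ultimately have "x = inv n \<otimes> y" using N x by (metis inv_solve_left subgroup.mem_carrier)
        then show False using False \<open>n \<in> N\<close> \<open>y \<in> N\<close> N by (metis subgroup.m_closed subgroup.m_inv_closed)
      qed
      then show ?thesis by simp
    qed
    then show ?thesis using a by (simp add: RI_def)
  qed
  show "rel_aug_ideal G N \<subseteq> (RI N :: ('a \<Rightarrow> 'k) set)"
  proof
    fix f :: "'a \<Rightarrow> 'k" assume "f \<in> rel_aug_ideal G N"
    then show "f \<in> RI N"
    proof induction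
      case zero then show ?case using RI_zero by (simp add: zero_fun_def)
    next
      case (prod a b)
      then show ?case using RI_right[OF N a[OF prod(1)]] by (simp add: carrier_group_alg) (simp add: group_alg_def)
    next
      case (add u v)
      then have "u + v \<in> RI N" by (simp add: RI_add)
      then show ?case by (simp add: group_alg_def plus_fun_def)
    qed
  qed
  have cv: "a \<otimes>\<^bsub>(group_alg G :: ('a \<Rightarrow> 'k) ring)\<^esub> b = a \<star> b" for a b :: "'a \<Rightarrow> 'k" by (simp add: group_alg_def)
  have dl: "dl n - dl \<one> \<in> (aug_ideal_in G N :: ('a \<Rightarrow> 'k) set)" if n: "n \<in> N" for n
  proof -
    have "n \<in> carrier G" "\<one> \<in> N" using n subgroup.mem_carrier[OF N] subgroup.one_closed[OF N] by auto
    then have "{x. (dl n - dl \<one> :: 'a \<Rightarrow> 'k) x \<noteq> 0} \<subseteq> N"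
      using n by (auto simp: pw dl_apply split: if_splits)
    then show ?thesis using \<open>n \<in> carrier G\<close> by (simp add: aug_ideal_in_def carrier_group_alg aug_minus)
  qed
  let ?W = "rel_aug_ideal G N :: ('a \<Rightarrow> 'k) set"
  have sub: "?W \<subseteq> KG" using \<open>?W \<subseteq> RI N\<close> RI_KG by blast
  have "rideal ?W"
    unfolding rideal_def
  proof (intro conjI ballI)
    show "0 \<in> ?W" using rel_aug_ideal.zero[of G N] by (simp add: zero_fun_def)
    show add: "f + g \<in> ?W" if "f \<in> ?W" "g \<in> ?W" for f g
      using rel_aug_ideal.add[OF that] by (simp add: group_alg_def plus_fun_def)
    show "f \<star> g \<in> ?W" if f: "f \<in> ?W" and g: "g \<in> KG" for f g
      using f
    proof induction
      case zero
      have "(\<lambda>x. 0) \<star> g = 0" using conv_zero_left[of g] by (simp add: zero_fun_def)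
      then show ?case using \<open>0 \<in> ?W\<close> by simp
    next
      case (prod a b)
      have "a \<in> KG" "b \<in> KG" using prod by (auto simp: aug_ideal_in_def carrier_group_alg)
      then have "a \<otimes>\<^bsub>(group_alg G :: ('a \<Rightarrow> 'k) ring)\<^esub> b \<star> g = a \<otimes>\<^bsub>(group_alg G :: ('a \<Rightarrow> 'k) ring)\<^esub> (b \<star> g)"
        using g by (simp add: cv conv_assoc)
      then show ?case using rel_aug_ideal.prod[OF prod(1), of "b \<star> g"] by (simp add: carrier_group_alg)
    next
      case (add u v)
      have "(u \<oplus>\<^bsub>(group_alg G :: ('a \<Rightarrow> 'k) ring)\<^esub> v) = u + v" by (simp add: group_alg_def plus_fun_def)
      then show ?case using add sub \<open>\<And>f g. f \<in> ?W \<Longrightarrow> g \<in> ?W \<Longrightarrow> f + g \<in> ?W\<close>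
        by (simp add: conv_add_left subset_iff)
    qed
  qed (use sub in auto)
  moreover have "dl n - dl \<one> \<in> ?W" if "n \<in> N" for n
    using rel_aug_ideal.prod[OF dl[OF that], of "dl \<one>"] dl[OF that]
    by (simp add: carrier_group_alg cv aug_ideal_in_def)
  ultimately show "RI N \<subseteq> ?W" by (intro RI_subset[OF N])
qed

section \<open>Projection to the group algebra of a quotient; the Frobenius map\<close>

definition push :: "'a set \<Rightarrow> ('a \<Rightarrow> 'k::field) \<Rightarrow> 'a set \<Rightarrow> 'k" where
  "push N f = (\<Sum>x\<in>carrier G. sc (f x) (dl (N #> x)))"

lemma push_apply:
  assumes "subgroup N G" "z \<in> carrier G"
  shows "push N f (N #> z) = (\<Sum>y\<in>N #> z. f y)"
proof -
  have "push N f (N #> z) = (\<Sum>x\<in>carrier G. if x \<in> N #> z then f x else 0)"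
    unfolding push_def sum_fun_apply using assms by (intro sum.cong) (auto simp: pw dl_apply mem_rcos_iff)
  also have "\<dots> = (\<Sum>x\<in>carrier G \<inter> (N #> z). f x)" using fin by (simp add: sum.inter_restrict)
  also have "carrier G \<inter> (N #> z) = N #> z"
    using r_coset_subset_G[OF subgroup.subset[OF assms(1)] assms(2)] by auto
  finally show ?thesis .
qed

lemma fgroup_Mod: "N \<lhd> G \<Longrightarrow> fgroup (G Mod N)"
  by (intro fgroup.intro fgroup_axioms.intro normal.factorgroup_is_group) (auto simp: carrier_FactGroup fin)

lemma push_closed: "N \<lhd> G \<Longrightarrow> push N f \<in> fgroup.KG (G Mod N)"
  unfolding push_def
  by (intro fgroup.KG_sum[OF fgroup_Mod] fgroup.KG_sc[OF fgroup_Mod] fgroup.KG_dl[OF fgroup_Mod])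
     (auto simp: carrier_FactGroup)

text \<open>\<open>push N\<close> is the algebra map from kG to k[G/N], and its coefficient at a
  coset is the coset sum, so its kernel is \<open>RI N\<close>.\<close>

lemma RI_iff_push:
  assumes N: "N \<lhd> G" and f: "f \<in> KG"
  shows "f \<in> RI N \<longleftrightarrow> push N f = 0"
proof
  assume "f \<in> RI N"
  then show "push N f = 0"
    using normal_imp_subgroup[OF N]
    by (intro fgroup.KG_eqI[OF fgroup_Mod[OF N]] push_closed[OF N] fgroup.KG_zero[OF fgroup_Mod[OF N]])
       (auto simp: carrier_FactGroup push_apply RI_def pw)
next
  assume "push N f = 0"
  then show "f \<in> RI N" using f push_apply[OF normal_imp_subgroup[OF N], of _ f] by (simp add: RI_def pw)
qed

lemma push_dl: "x \<in> carrier G \<Longrightarrow> push N (dl x) = dl (N #> x)"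
  unfolding push_def by (rule ext) (simp add: pw sum_fun_apply dl_apply fin if_distrib[of "\<lambda>c. c * _"] cong: if_cong)

lemma push_add: "push N (f + g) = push N f + push N g"
  unfolding push_def by (rule ext) (simp add: pw sum_fun_apply sum.distrib distrib_right)

lemma push_sc: "push N (sc c f) = sc c (push N f)"
  unfolding push_def by (simp add: sc_sum) (simp add: pw)

lemma push_sum: "push N (\<Sum>i\<in>I. F i) = (\<Sum>i\<in>I. push N (F i))"
proof (induction I rule: infinite_finite_induct)
  case (insert x A) then show ?case by (simp only: sum.insert push_add not_False_eq_True)
qed (auto simp: push_def pw sum_fun_apply fun_eq_iff)

lemma push_conv:
  assumes N: "N \<lhd> G" and "f \<in> KG" "g \<in> KG"
  shows "push N (f \<star> g) = conv (G Mod N) (push N f) (push N g)"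
proof -
  interpret Q: fgroup "G Mod N" by (rule fgroup_Mod[OF N])
  have QK: "dl (N #> x) \<in> Q.KG" if "x \<in> carrier G" for x
    using that by (intro Q.KG_dl) (auto simp: carrier_FactGroup)
  have d: "conv (G Mod N) (dl (N #> x)) (dl (N #> y)) = dl (N #> (x \<otimes> y))" if "x \<in> carrier G" "y \<in> carrier G" for x y
    using that N by (subst Q.conv_dl_dl) (auto simp: carrier_FactGroup normal.rcos_sum)
  have "push N (f \<star> g) = (\<Sum>x\<in>carrier G. \<Sum>y\<in>carrier G. sc (f x * g y) (dl (N #> (x \<otimes> y))))"
    unfolding conv_expand[OF assms(2,3)] push_sum push_sc by (intro sum.cong refl) (simp add: push_dl)
  also have "\<dots> = (\<Sum>x\<in>carrier G. \<Sum>y\<in>carrier G. conv (G Mod N) (sc (f x) (dl (N #> x))) (sc (g y) (dl (N #> y))))"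
    by (intro sum.cong refl) (simp add: Q.conv_sc_left Q.conv_sc_right QK d mult.commute)
  also have "\<dots> = conv (G Mod N) (push N f) (push N g)"
    unfolding push_def by (subst Q.conv_sum_left) (auto simp: QK Q.conv_sum_right)
  finally show ?thesis .
qed

lemma push_kpow:
  assumes N: "N \<lhd> G" and "f \<in> KG"
  shows "push N (kpow G f n) = kpow (G Mod N) (push N f) n"
proof (induction n)
  case 0
  then show ?case using subgroup.subset[OF normal_imp_subgroup[OF N]] by (simp add: push_dl)
next
  case (Suc n)
  then show ?case using assms by (simp add: push_conv)
qed

lemma conv_comm:
  assumes "comm_group G" "f \<in> KG" "g \<in> KG"
  shows "f \<star> g = g \<star> f"
proof -
  interpret comm_group G by fact
  have "f \<star> g = (\<Sum>x\<in>carrier G. \<Sum>y\<in>carrier G. sc (f x * g y) (dl (x \<otimes> y)))"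
    by (rule conv_expand) fact+
  also have "\<dots> = (\<Sum>y\<in>carrier G. \<Sum>x\<in>carrier G. sc (g y * f x) (dl (y \<otimes> x)))"
    by (subst sum.swap) (auto intro!: sum.cong simp: m_comm mult.commute)
  also have "\<dots> = g \<star> f" by (rule conv_expand[symmetric]) fact+
  finally show ?thesis .
qed

lemma frobenius_comm:
  fixes a :: "'i \<Rightarrow> 'k::field"
  assumes "comm_group G" "Factorial_Ring.prime CHAR('k)" "finite I" "\<And>i. i \<in> I \<Longrightarrow> u i \<in> carrier G"
  shows "kpow G (\<Sum>i\<in>I. sc (a i) (dl (u i))) (CHAR('k) ^ e)
    = (\<Sum>i\<in>I. sc (a i ^ (CHAR('k) ^ e)) (dl (u i [^] (CHAR('k) ^ e))))"
  using assms(3,4)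
proof (induction I)
  case empty
  have "CHAR('k) ^ e > 0" using assms(2) by (simp add: prime_gt_0_nat)
  then show ?case unfolding sum.empty by (rule kpow_zero)
next
  case (insert x F)
  then have K: "(\<Sum>i\<in>F. sc (a i) (dl (u i))) \<in> KG" "sc (a x) (dl (u x)) \<in> KG" by auto
  have "kpow G (sc (a x) (dl (u x)) + (\<Sum>i\<in>F. sc (a i) (dl (u i)))) (CHAR('k) ^ e)
     = kpow G (sc (a x) (dl (u x))) (CHAR('k) ^ e) + kpow G (\<Sum>i\<in>F. sc (a i) (dl (u i))) (CHAR('k) ^ e)"
    using freshman_dream[OF assms(2) K(2,1) conv_comm[OF assms(1) K(2,1)]] .
  then show ?case using insert by (simp add: kpow_sc kpow_dl)
qed

end

lemma sum_power_char:
  fixes a :: "'i \<Rightarrow> 'k::field"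
  assumes "Factorial_Ring.prime CHAR('k)"
  shows "(\<Sum>i\<in>I. a i) ^ (CHAR('k) ^ e) = (\<Sum>i\<in>I. a i ^ (CHAR('k) ^ e))"
proof -
  show ?thesis by (rule freshmans_dream_sum'[OF assms refl])
qed

context fgroup
begin

text \<open>Computed in the commutative algebra k[G/N], where the q-th power of the sum of f(x) Nx
  is the sum of f(x)^q N x^q. The coefficient at Nz gathers all x with N x^q = Nz, and the Frobenius
  of k is pulled out of that sum.\<close>

lemma frobenius:
  fixes f :: "'a \<Rightarrow> 'k::field"
  assumes N: "N \<lhd> G" and "comm_group (G Mod N)" and p: "Factorial_Ring.prime CHAR('k)" and f: "f \<in> KG" and z: "z \<in> carrier G"
  shows "(\<Sum>y\<in>N #> z. kpow G f (CHAR('k) ^ e) y)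
    = (\<Sum>x\<in>{x \<in> carrier G. N #> (x [^] (CHAR('k) ^ e)) = N #> z}. f x) ^ (CHAR('k) ^ e)"
proof -
  interpret Q: fgroup "G Mod N" by (rule fgroup_Mod[OF N])
  have sub: "subgroup N G" by (rule normal_imp_subgroup[OF N])
  let ?q = "CHAR('k) ^ e"
  have "(\<Sum>y\<in>N #> z. kpow G f ?q y) = push N (kpow G f ?q) (N #> z)"
    by (rule push_apply[OF sub z, symmetric])
  also have "\<dots> = kpow (G Mod N) (push N f) ?q (N #> z)" by (simp add: push_kpow[OF N f])
  also have "kpow (G Mod N) (push N f) ?q = (\<Sum>x\<in>carrier G. sc (f x ^ ?q) (dl ((N #> x) [^]\<^bsub>G Mod N\<^esub> ?q)))"
    unfolding push_def by (rule Q.frobenius_comm[OF assms(2) p fin]) (auto simp: carrier_FactGroup)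
  also have "\<dots> (N #> z) = (\<Sum>x\<in>carrier G. if N #> (x [^] ?q) = N #> z then f x ^ ?q else 0)"
    unfolding sum_fun_apply
  proof (rule sum.cong[OF refl])
    fix x assume x: "x \<in> carrier G"
    have "(N #> x) [^]\<^bsub>G Mod N\<^esub> ?q = N #> (x [^] ?q)" by (rule normal.FactGroup_pow[OF N x])
    show "sc (f x ^ ?q) (dl ((N #> x) [^]\<^bsub>G Mod N\<^esub> ?q)) (N #> z)
      = (if N #> (x [^] ?q) = N #> z then f x ^ ?q else 0)"
      unfolding \<open>(N #> x) [^]\<^bsub>G Mod N\<^esub> ?q = N #> (x [^] ?q)\<close> sc_apply dl_apply eq_commute[of "N #> z" "N #> (x [^] ?q)"]
      by (rule trans[OF if_distrib[of "\<lambda>t. f x ^ ?q * t"]]) (simp only: mult_1_right mult_zero_right)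
  qed
  also have "\<dots> = (\<Sum>x\<in>{x \<in> carrier G. N #> (x [^] ?q) = N #> z}. f x ^ ?q)"
    using fin by (simp add: sum.inter_filter)
  also have "\<dots> = (\<Sum>x\<in>{x \<in> carrier G. N #> (x [^] ?q) = N #> z}. f x) ^ ?q"
    by (rule sum_power_char[OF p, symmetric])
  finally show ?thesis .
qed

end

section \<open>Groups with cyclic derived subgroup\<close>

lemma geom_sum_mult_index:
  fixes r :: "'c::comm_semiring_1"
  shows "(\<Sum>i<a * b. r ^ i) = (\<Sum>i<a. r ^ i) * (\<Sum>j<b. (r ^ a) ^ j)"
proof -
  have "(\<Sum>i<m + n. r ^ i) = (\<Sum>i<m. r ^ i) + r ^ m * (\<Sum>i<n. r ^ i)" for m n
    by (induction n) (simp_all add: algebra_simps power_add)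
  note split = this
  show ?thesis
  proof (induction b)
    case (Suc b)
    have "(\<Sum>i<a * Suc b. r ^ i) = (\<Sum>i<a * b + a. r ^ i)" by (simp add: add.commute)
    also have "\<dots> = (\<Sum>i<a * b. r ^ i) + r ^ (a * b) * (\<Sum>i<a. r ^ i)" by (rule split)
    finally show ?case by (simp add: Suc algebra_simps power_mult)
  qed simp
qed

text \<open>With r = 1 + pk one has r^i = 1 + ipk modulo p^2, so the sum is p + pk(0 + 1 + ... +
  (p-1)) there. For odd p the inner sum p(p-1)/2 is a multiple of p, which leaves p modulo
  p^2.\<close>

lemma geom_sum_prime:
  fixes r :: nat
  assumes "Factorial_Ring.prime p" "odd p" "[r = 1] (mod p)"
  shows "\<exists>u. (\<Sum>i<p. r ^ i) = p * u \<and> [u = 1] (mod p)"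
proof -
  have "[int r = 1] (mod int p)" using assms(3) by (metis cong_int_iff of_nat_1)
  then obtain k where k: "int r = 1 + int p * k" by (metis cong_iff_lin mult.commute cong_sym)
  define q where "q = int p"
  have "[(1 + q * k) ^ i = 1 + int i * (q * k)] (mod q\<^sup>2)" for i
  proof (induction i)
    case (Suc i)
    have "[(1 + q * k) ^ Suc i = (1 + q * k) * (1 + int i * (q * k))] (mod q\<^sup>2)"
      using Suc by (simp add: cong_mult)
    also have "(1 + q * k) * (1 + int i * (q * k)) = 1 + int (Suc i) * (q * k) + q\<^sup>2 * (int i * k * k)"
      by (simp add: algebra_simps power2_eq_square)
    also have "[\<dots> = 1 + int (Suc i) * (q * k)] (mod q\<^sup>2)" by (simp add: cong_def)
    finally show ?case .
  qed simp
  then have "[(\<Sum>i<p. int r ^ i) = (\<Sum>i<p. 1 + int i * (q * k))] (mod q\<^sup>2)"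
    unfolding k q_def[symmetric] by (intro cong_sum) auto
  also have "(\<Sum>i<p. 1 + int i * (q * k)) = q + (\<Sum>i<p. int i) * (q * k)"
    by (simp add: sum.distrib sum_distrib_right q_def)
  also have "(\<Sum>i<p. int i) = q * ((q - 1) div 2)"
  proof -
    have "2 * (\<Sum>i<m. int i) = int m * (int m - 1)" for m
      by (induction m) (simp_all add: algebra_simps)
    then have "2 * (\<Sum>i<p. int i) = q * (q - 1)" by (simp add: q_def)
    also have "\<dots> = 2 * (q * ((q - 1) div 2))"
      using assms(2) by (simp add: q_def)
    finally show ?thesis by simp
  qed
  also have "q + q * ((q - 1) div 2) * (q * k) = q + q\<^sup>2 * ((q - 1) div 2 * k)"
    by (simp add: power2_eq_square)
  also have "[\<dots> = q] (mod q\<^sup>2)" by (simp add: cong_def)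
  finally have "[(\<Sum>i<p. int r ^ i) = q] (mod q\<^sup>2)" .
  then have "[(\<Sum>i<p. r ^ i) = p] (mod p\<^sup>2)"
    unfolding q_def by (metis (mono_tags, lifting) cong_int_iff of_nat_power of_nat_sum sum.cong)
  then obtain w where w: "int (\<Sum>i<p. r ^ i) = int p + int p ^ 2 * w"
    by (metis cong_int_iff cong_iff_lin cong_sym of_nat_power mult.commute)
  then have e: "int (\<Sum>i<p. r ^ i) = int p * (1 + int p * w)" by (simp add: algebra_simps power2_eq_square)
  have "p > 0" using assms by (simp add: prime_gt_0_nat)
  have "0 \<le> int p * (1 + int p * w)" unfolding e[symmetric] by (rule of_nat_0_le_iff)
  then have "0 \<le> 1 + int p * w" using \<open>p > 0\<close> by (simp add: zero_le_mult_iff)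
  then obtain u where u: "int u = 1 + int p * w" by (metis nonneg_int_cases)
  have "(\<Sum>i<p. r ^ i) = p * u" using e u by (metis of_nat_eq_iff of_nat_mult)
  moreover have "[int u = 1] (mod int p)" unfolding u by (simp add: cong_def)
  then have "[u = 1] (mod p)" by (metis cong_int_iff of_nat_1)
  ultimately show ?thesis by blast
qed

text \<open>Grouping the indices by blocks of length p^l splits off the factor for p with base
  r^(p^l), which is again 1 modulo p.\<close>

lemma geom_sum_prime_power:
  fixes r :: nat
  assumes "Factorial_Ring.prime p" "odd p" "[r = 1] (mod p)"
  shows "\<exists>u. (\<Sum>i<p ^ l. r ^ i) = p ^ l * u \<and> [u = 1] (mod p)"
proof (induction l)
  case (Suc l)
  then obtain u where u: "(\<Sum>i<p ^ l. r ^ i) = p ^ l * u" "[u = 1] (mod p)" by blast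
  have "[r ^ p ^ l = 1 ^ p ^ l] (mod p)" using assms(3) by (rule cong_pow)
  then have "[r ^ p ^ l = 1] (mod p)" by simp
  then obtain v where v: "(\<Sum>i<p. (r ^ p ^ l) ^ i) = p * v" "[v = 1] (mod p)"
    using geom_sum_prime assms by blast
  have "(\<Sum>i<p ^ Suc l. r ^ i) = p ^ Suc l * (u * v)"
    using geom_sum_mult_index[of r "p ^ l" p] u v by (simp add: mult_ac)
  moreover have "[u * v = 1 * 1] (mod p)" using u v by (intro cong_mult)
  ultimately show ?case by auto
qed auto

lemma geom_sum_cong_1:
  fixes r :: nat
  assumes "[r = 1] (mod p)"
  shows "[(\<Sum>i<m. r ^ i) = m] (mod p)"
proof -
  have "[(\<Sum>i<m. r ^ i) = (\<Sum>i<m. 1)] (mod p)"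
    by (intro cong_sum) (metis assms cong_pow power_one)
  then show ?thesis by simp
qed

lemma geom_sum_telescope: "int r ^ m = 1 + (int r - 1) * int (\<Sum>i<m. r ^ i)"
proof (induction m)
  case (Suc m)
  define S where "S = int (\<Sum>i<m. r ^ i)"
  have "int r ^ Suc m = int r ^ m + (int r - 1) * int r ^ m" by (simp add: algebra_simps)
  also have "int r ^ m + (int r - 1) * int r ^ m = 1 + (int r - 1) * S + (int r - 1) * int r ^ m"
    using Suc by (simp add: S_def)
  also have "\<dots> = 1 + (int r - 1) * (S + int r ^ m)" by (simp only: distrib_left add.assoc)
  also have "S + int r ^ m = int (\<Sum>i<Suc m. r ^ i)" by (simp add: S_def)
  finally show ?case .
qed simp

text \<open>Modulo an odd prime power, the powers of \<open>r \<equiv> 1 (mod p)\<close> exhaust the residues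
  \<open>1 + k (r - 1)\<close>; the solution is lifted one \<open>p\<close>-adic digit at a time.\<close>
lemma powers_exhaust:
  fixes r :: nat and x :: int
  assumes "Factorial_Ring.prime p" "odd p" "[r = 1] (mod p)"
    and "[x = 1 + k * (int r - 1)] (mod int p ^ n)"
  shows "\<exists>i. [x = int r ^ i] (mod int p ^ n)"
proof -
  have "\<exists>i w. [x = int r ^ i + (int r - 1) * int p ^ m * w] (mod int p ^ n)" for m
  proof (induction m)
    case 0
    show ?case using assms(4) by (intro exI[of _ 0] exI[of _ k]) (simp add: mult.commute)
  next
    case (Suc m)
    then obtain i w where iw: "[x = int r ^ i + (int r - 1) * int p ^ m * w] (mod int p ^ n)" by blast
    obtain u where u: "(\<Sum>i<p ^ m. r ^ i) = p ^ m * u" "[u = 1] (mod p)"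
      using geom_sum_prime_power[OF assms(1-3)] by blast
    have p0: "int p > 0" using assms(1) by (simp add: prime_gt_0_nat)
    \<comment> \<open>\<open>j\<close> is the next digit of the exponent. Adding p^m j to i
      multiplies by 1 + (r - 1) p^m u v, and r^i u v = j = w modulo p, so the remaining error gains
      a factor p.\<close>
    define j where "j = nat (w mod int p)"
    have j: "int j = w mod int p" unfolding j_def using p0 by simp
    define v where "v = (\<Sum>i<j. (r ^ p ^ m) ^ i)"
    have "[r ^ p ^ m = 1 ^ p ^ m] (mod p)" using assms(3) by (rule cong_pow)
    then have v: "[v = j] (mod p)" unfolding v_def by (intro geom_sum_cong_1) simp
    have pw: "int r ^ (p ^ m * j) = 1 + (int r - 1) * (int p ^ m * int u * int v)"
      using geom_sum_telescope[of r "p ^ m * j"] geom_sum_mult_index[of r "p ^ m" j] u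
      by (simp add: v_def)
    have "[r ^ i * u * v = 1 ^ i * 1 * j] (mod p)" using u v assms(3) by (intro cong_mult cong_pow)
    then have "[int (r ^ i * u * v) = int j] (mod int p)" by (simp only: cong_int_iff power_one mult_1)
    also have "[int j = w] (mod int p)" unfolding j by simp
    finally obtain w' where w': "w = int (r ^ i * u * v) + w' * int p"
      by (metis cong_iff_lin mult.commute)
    have "int r ^ (i + p ^ m * j) = int r ^ i + (int r - 1) * int p ^ m * int (r ^ i * u * v)"
      unfolding power_add pw by (simp add: algebra_simps)
    then have "int r ^ i + (int r - 1) * int p ^ m * w
      = int r ^ (i + p ^ m * j) + (int r - 1) * int p ^ Suc m * w'"
      by (simp add: w' algebra_simps)
    then show ?case using iw by metis
  qed
  from this[of n] obtain i w where "[x = int r ^ i + (int r - 1) * int p ^ n * w] (mod int p ^ n)" by blast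
  moreover have "[int r ^ i + (int r - 1) * int p ^ n * w = int r ^ i + 0] (mod int p ^ n)"
    by (intro cong_add cong_refl) (simp add: cong_def)
  ultimately show ?thesis by (auto intro: cong_trans)
qed

section \<open>Commutators and centralizers\<close>

context group
begin

lemma mult_inv_cancel [simp]:
  "x \<in> carrier G \<Longrightarrow> y \<in> carrier G \<Longrightarrow> x \<otimes> (inv x \<otimes> y) = y"
  "x \<in> carrier G \<Longrightarrow> y \<in> carrier G \<Longrightarrow> inv x \<otimes> (x \<otimes> y) = y"
  by (simp_all flip: m_assoc)

text \<open>The convention of \<open>derived_set\<close> and of \<open>comm_subgroup\<close>, so
  that both are generated by values of \<open>cm\<close>.\<close>

definition cm :: "'a \<Rightarrow> 'a \<Rightarrow> 'a" where
  "cm x y = x \<otimes> y \<otimes> inv x \<otimes> inv y"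

lemma cm_closed [simp, intro]: "x \<in> carrier G \<Longrightarrow> y \<in> carrier G \<Longrightarrow> cm x y \<in> carrier G"
  by (simp add: cm_def)

lemma cm_swap: "x \<in> carrier G \<Longrightarrow> y \<in> carrier G \<Longrightarrow> x \<otimes> y = cm x y \<otimes> (y \<otimes> x)"
  by (simp add: cm_def m_assoc)

lemma cm_conj: "x \<in> carrier G \<Longrightarrow> y \<in> carrier G \<Longrightarrow> x \<otimes> y \<otimes> inv x = cm x y \<otimes> y"
  by (simp add: cm_def m_assoc)

lemma cm_inv: "x \<in> carrier G \<Longrightarrow> y \<in> carrier G \<Longrightarrow> inv (cm x y) = cm y x"
  by (simp add: cm_def m_assoc inv_mult_group)

lemma cm_eq_one_iff: "x \<in> carrier G \<Longrightarrow> y \<in> carrier G \<Longrightarrow> cm x y = \<one> \<longleftrightarrow> x \<otimes> y = y \<otimes> x"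
  by (metis cm_swap cm_closed l_one m_closed r_cancel_one')

lemma cm_derived: "x \<in> carrier G \<Longrightarrow> y \<in> carrier G \<Longrightarrow> cm x y \<in> derived G (carrier G)"
  unfolding derived_def cm_def by (rule generate.incl) auto

lemma centralizer_subgroup:
  assumes "S \<subseteq> carrier G"
  shows "subgroup (centralizer G S) G"
proof (rule subgroupI)
  fix a assume a: "a \<in> centralizer G S"
  have "inv a \<otimes> s = s \<otimes> inv a" if "s \<in> S" for s
  proof -
    have ac: "a \<in> carrier G" "s \<in> carrier G" "a \<otimes> s = s \<otimes> a"
      using a that assms by (auto simp: centralizer_def)
    have "inv a \<otimes> s = inv a \<otimes> (s \<otimes> a) \<otimes> inv a" using ac(1,2) by (simp add: m_assoc)
    also have "\<dots> = s \<otimes> inv a" using ac(1,2) by (simp add: ac(3)[symmetric] m_assoc)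
    finally show ?thesis .
  qed
  then show "inv a \<in> centralizer G S" using a by (auto simp: centralizer_def)
next
  fix a b assume ab: "a \<in> centralizer G S" "b \<in> centralizer G S"
  have "a \<otimes> b \<otimes> s = s \<otimes> (a \<otimes> b)" if "s \<in> S" for s
  proof -
    have ac: "a \<in> carrier G" "b \<in> carrier G" "s \<in> carrier G" "a \<otimes> s = s \<otimes> a" "b \<otimes> s = s \<otimes> b"
      using ab that assms by (auto simp: centralizer_def)
    have "a \<otimes> b \<otimes> s = a \<otimes> s \<otimes> b" using ac(1-3) by (simp add: m_assoc ac(5))
    then show ?thesis using ac(1-3) by (simp add: m_assoc ac(4))
  qed
  then show "a \<otimes> b \<in> centralizer G S" using ab by (auto simp: centralizer_def)
qed (use assms in \<open>auto simp: centralizer_def intro!: exI[of _ \<one>]\<close>)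

lemma centralizer_comm:
  assumes "g \<in> centralizer G S" "s \<in> S" shows "g \<otimes> s = s \<otimes> g"
  using assms by (auto simp: centralizer_def)

lemma conj_pow:
  "x \<in> carrier G \<Longrightarrow> y \<in> carrier G \<Longrightarrow> (x \<otimes> y \<otimes> inv x) [^] (m::nat) = x \<otimes> y [^] m \<otimes> inv x"
  by (induction m) (simp_all add: m_assoc)

end

text \<open>The exponents \<open>n\<close> and \<open>N\<close> are parameters, so that two groups
  can later be assumed to share them.\<close>

locale pgroup_cyclic_derived = fgroup G for G :: "('a, 'b) monoid_scheme" (structure) +
  fixes p :: nat and c :: 'a and n N :: nat
  assumes prime_p: "Factorial_Ring.prime p" and odd_p: "odd p"
    and order_G: "card (carrier G) = p ^ N"
    and c_closed [simp, intro]: "c \<in> carrier G"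
    and derived_c: "derived G (carrier G) = generate G {c}"
    and ord_c: "ord c = p ^ n"
begin

definition D where "D = derived G (carrier G)"
definition C where "C = centralizer G D"
definition Z where "Z = centralizer G (carrier G)"

lemma p_gt_0: "p > 0" using prime_p by (rule prime_gt_0_nat)
lemma p_gt_1: "p > 1" using prime_p by (rule prime_gt_1_nat)

lemma D_sub: "subgroup D G" unfolding D_def by (simp add: derived_is_subgroup)
lemma D_normal: "D \<lhd> G" unfolding D_def by (rule derived_self_is_normal)
lemma D_carrier [simp]: "d \<in> D \<Longrightarrow> d \<in> carrier G" using D_sub by (rule subgroup.mem_carrier)
lemma cm_D: "x \<in> carrier G \<Longrightarrow> y \<in> carrier G \<Longrightarrow> cm x y \<in> D"
  unfolding D_def by (rule cm_derived)

lemma D_eq: "D = {c [^] i |i::nat. True}"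
proof -
  have "ord c \<noteq> 0" using ord_c p_gt_0 by simp
  then show ?thesis using generate_pow_nat[OF c_closed] by (auto simp: D_def derived_c)
qed

lemma c_D: "c \<in> D" unfolding D_def derived_c by (rule generate.incl) simp

lemma c_pow_one: "c [^] (i::nat) = \<one> \<longleftrightarrow> p ^ n dvd i"
  by (simp add: pow_eq_id ord_c)

lemma card_D: "card D = p ^ n"
  using generate_pow_card[OF c_closed] ord_c by (simp add: D_def derived_c)

lemma D_comm: "d \<in> D \<Longrightarrow> e \<in> D \<Longrightarrow> d \<otimes> e = e \<otimes> d"
  by (auto simp: D_eq nat_pow_mult add.commute)

lemma D_le_C: "D \<subseteq> C"
  unfolding C_def centralizer_def using D_comm by auto

lemma C_sub: "subgroup C G" unfolding C_def by (rule centralizer_subgroup) auto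
lemma C_carrier [simp]: "a \<in> C \<Longrightarrow> a \<in> carrier G" using C_sub by (rule subgroup.mem_carrier)
lemma C_D_comm: "a \<in> C \<Longrightarrow> d \<in> D \<Longrightarrow> a \<otimes> d = d \<otimes> a"
  unfolding C_def by (rule centralizer_comm)

lemma Z_sub: "subgroup Z G" unfolding Z_def by (rule centralizer_subgroup) auto
lemma Z_carrier [simp]: "a \<in> Z \<Longrightarrow> a \<in> carrier G" using Z_sub by (rule subgroup.mem_carrier)
lemma Z_comm: "a \<in> Z \<Longrightarrow> g \<in> carrier G \<Longrightarrow> a \<otimes> g = g \<otimes> a"
  unfolding Z_def by (rule centralizer_comm)
lemma Z_le_C: "Z \<subseteq> C"
  unfolding Z_def C_def centralizer_def by auto

lemma conj_D: "h \<in> carrier G \<Longrightarrow> d \<in> D \<Longrightarrow> h \<otimes> d \<otimes> inv h \<in> D"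
  using normal.inv_op_closed2[OF D_normal] by blast

text \<open>Conjugation by h is a power map d -> d^r on the cyclic group D. As h^(p^N) = 1, the
  number r^(p^N) is 1 modulo p^n, and Fermat's little theorem gives r = r^(p^N) = 1 modulo p when n
  > 0.\<close>

lemma action_exists:
  assumes h: "h \<in> carrier G"
  shows "\<exists>r::nat. r \<ge> 1 \<and> [r = 1] (mod p) \<and> (\<forall>d\<in>D. h \<otimes> d \<otimes> inv h = d [^] r)"
proof (cases "n = 0")
  case True
  then have "c = \<one>" using ord_c by (metis c_closed ord_eq_1 power_0)
  then have "D = {\<one>}" by (auto simp: D_eq)
  then show ?thesis using h by (intro exI[of _ 1]) simp
next
  case False
  obtain r :: nat where r: "h \<otimes> c \<otimes> inv h = c [^] r" using conj_D[OF h c_D] by (auto simp: D_eq)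
  have cr: "c [^] (r + p ^ n) = c [^] r" using ord_c by (simp add: nat_pow_mult[symmetric] c_pow_one)
  have it: "h [^] m \<otimes> c \<otimes> inv (h [^] m) = c [^] (r ^ m)" for m :: nat
  proof (induction m)
    case (Suc m)
    have "h [^] Suc m \<otimes> c \<otimes> inv (h [^] Suc m) = h [^] m \<otimes> (h \<otimes> c \<otimes> inv h) \<otimes> inv (h [^] m)"
      using h by (simp add: inv_mult_group m_assoc)
    also have "\<dots> = (h [^] m \<otimes> c \<otimes> inv (h [^] m)) [^] r" using h by (simp add: r conj_pow)
    also have "\<dots> = c [^] (r ^ Suc m)" by (simp add: Suc nat_pow_pow mult.commute)
    finally show ?case .
  qed simp
  have "h [^] (p ^ N) = \<one>" using h pow_order_eq_1[OF h] order_G by (simp add: Coset.order_def)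
  then have "c [^] (r ^ p ^ N) = c [^] (1::nat)" using it[of "p ^ N"] by simp
  then have "[int (r ^ p ^ N) = int 1] (mod int (p ^ n))"
    using int_pow_eq[OF c_closed, of "int (r ^ p ^ N)" "int 1"] unfolding int_pow_int ord_c
    by (simp add: cong_iff_dvd_diff dvd_diff_commute)
  then have "[r ^ p ^ N = 1] (mod p ^ n)" by (simp only: cong_int_iff)
  then have 1: "[r ^ p ^ N = 1] (mod p)"
    by (rule cong_dvd_modulus_nat) (use False in auto)
  have "[r ^ p ^ k = r] (mod p)" for k
  proof (induction k)
    case (Suc k)
    \<comment> \<open>Fermat's little theorem, by induction on x and the binomial theorem.\<close>
    have "[x ^ p = x] (mod p)" for x
    proof (induction x)
        case 0 then show ?case using p_gt_0 by (simp add: power_0_left)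
      next
        case (Suc x)
        have z: "[(p choose k) * x ^ k = 0] (mod p)" if "k \<in> {..p} - {0, p}" for k
        proof -
          have "p dvd (p choose k)" using that prime_p by (intro dvd_choose_prime) auto
          then show ?thesis by (simp add: cong_def mod_eq_0_iff_dvd)
        qed
        have "(x + 1) ^ p = (\<Sum>k\<le>p. (p choose k) * x ^ k)"
          using binomial_ring[of x 1 p] by simp
        also have "\<dots> = (\<Sum>k\<in>{0, p}. (p choose k) * x ^ k) + (\<Sum>k\<in>{..p} - {0, p}. (p choose k) * x ^ k)"
          by (subst sum.subset_diff[of "{0,p}" "{..p}"]) auto
        also have "[\<dots> = (\<Sum>k\<in>{0, p}. (p choose k) * x ^ k) + (\<Sum>k\<in>{..p} - {0, p}. 0)] (mod p)"
          by (intro cong_add cong_sum z) auto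
        also have "(\<Sum>k\<in>{0, p}. (p choose k) * x ^ k) + (\<Sum>k\<in>{..p} - {0, p}. 0) = 1 + x ^ p"
          using p_gt_0 by simp
        also have "[1 + x ^ p = 1 + x] (mod p)" using Suc by (intro cong_add) auto
        finally show ?case by simp
    qed
    then have "[(r ^ p ^ k) ^ p = r ^ p ^ k] (mod p)" .
    then have "[r ^ p ^ Suc k = r ^ p ^ k] (mod p)" unfolding power_Suc2 power_mult .
    then show ?case using Suc by (rule cong_trans)
  qed simp
  then have "[r = 1] (mod p)" using 1 cong_trans cong_sym by blast
  \<comment> \<open>Adding p^n leaves the action and the residue modulo p unchanged and makes the
    exponent at least 1.\<close>
  moreover have "h \<otimes> d \<otimes> inv h = d [^] (r + p ^ n)" if "d \<in> D" for d
  proof -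
    obtain i :: nat where i: "d = c [^] i" using \<open>d \<in> D\<close> by (auto simp: D_eq)
    have "h \<otimes> d \<otimes> inv h = (c [^] r) [^] i" using h conj_pow[OF h c_closed, of i] by (simp add: i r)
    also have "\<dots> = (c [^] (r + p ^ n)) [^] i" by (simp only: cr)
    also have "\<dots> = d [^] (r + p ^ n)" by (simp add: i nat_pow_pow mult.commute)
    finally show ?thesis .
  qed
  moreover have "[p ^ n = 0] (mod p)" using False by (simp add: cong_0_iff)
  then have "[r + p ^ n = 1 + 0] (mod p)" by (intro cong_add \<open>[r = 1] (mod p)\<close>)
  then have "[r + p ^ n = 1] (mod p)" by simp
  moreover have "r + p ^ n \<ge> 1" using p_gt_0 by (simp add: Suc_leI)
  ultimately show ?thesis by blast
qed

text \<open>On D only the residue modulo \<open>p ^ n\<close> matters; a representative of at least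
  1 is fixed so that \<open>act h - 1\<close> is a genuine difference of natural numbers.\<close>

definition act :: "'a \<Rightarrow> nat" where
  "act h = (SOME r. r \<ge> 1 \<and> [r = 1] (mod p) \<and> (\<forall>d\<in>D. h \<otimes> d \<otimes> inv h = d [^] r))"

lemma
  assumes "h \<in> carrier G"
  shows act_ge: "act h \<ge> 1" and act_cong: "[act h = 1] (mod p)"
    and act: "d \<in> D \<Longrightarrow> h \<otimes> d \<otimes> inv h = d [^] act h"
  using someI_ex[OF action_exists[OF assms]] unfolding act_def by blast+

end

context group
begin

lemma subgroup_pow_closed: "subgroup H G \<Longrightarrow> x \<in> H \<Longrightarrow> x [^] (m::nat) \<in> H"
  by (induction m) (auto simp: subgroup.one_closed subgroup.m_closed)

lemma cm_conj_hom:
  "h \<in> carrier G \<Longrightarrow> x \<in> carrier G \<Longrightarrow> y \<in> carrier G \<Longrightarrow>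
    h \<otimes> cm x y \<otimes> inv h = cm (h \<otimes> x \<otimes> inv h) (h \<otimes> y \<otimes> inv h)"
  by (simp add: cm_def m_assoc inv_mult_group)

lemma cm_left_mult:
  "x \<in> carrier G \<Longrightarrow> y \<in> carrier G \<Longrightarrow> z \<in> carrier G \<Longrightarrow>
    cm (x \<otimes> y) z = x \<otimes> cm y z \<otimes> inv x \<otimes> cm x z"
  by (simp add: cm_def m_assoc inv_mult_group)

lemma cm_right_mult:
  "x \<in> carrier G \<Longrightarrow> y \<in> carrier G \<Longrightarrow> z \<in> carrier G \<Longrightarrow>
    cm x (y \<otimes> z) = cm x y \<otimes> (y \<otimes> cm x z \<otimes> inv y)"
  by (simp add: cm_def m_assoc inv_mult_group)

lemma conj_commute:
  "x \<in> carrier G \<Longrightarrow> y \<in> carrier G \<Longrightarrow> x \<otimes> y = y \<otimes> x \<Longrightarrow> x \<otimes> y \<otimes> inv x = y"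
  by (simp add: m_assoc)

end

context pgroup_cyclic_derived
begin

lemma ZI: "g \<in> carrier G \<Longrightarrow> (\<And>h. h \<in> carrier G \<Longrightarrow> g \<otimes> h = h \<otimes> g) \<Longrightarrow> g \<in> Z"
  unfolding Z_def centralizer_def by blast
lemma CI: "g \<in> carrier G \<Longrightarrow> (\<And>d. d \<in> D \<Longrightarrow> g \<otimes> d = d \<otimes> g) \<Longrightarrow> g \<in> C"
  unfolding C_def centralizer_def by blast
lemma D_mult: "d \<in> D \<Longrightarrow> e \<in> D \<Longrightarrow> d \<otimes> e \<in> D" using D_sub by (rule subgroup.m_closed)
lemma D_inv: "d \<in> D \<Longrightarrow> inv d \<in> D" using D_sub by (rule subgroup.m_inv_closed)
lemma D_one: "\<one> \<in> D" using D_sub by (rule subgroup.one_closed)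
lemma D_pow: "d \<in> D \<Longrightarrow> d [^] (m::nat) \<in> D" by (induction m) (auto simp: D_mult D_one)
lemma C_mult: "d \<in> C \<Longrightarrow> e \<in> C \<Longrightarrow> d \<otimes> e \<in> C" using C_sub by (rule subgroup.m_closed)
lemma C_inv: "d \<in> C \<Longrightarrow> inv d \<in> C" using C_sub by (rule subgroup.m_inv_closed)
lemma C_one: "\<one> \<in> C" using C_sub by (rule subgroup.one_closed)
lemma C_pow: "d \<in> C \<Longrightarrow> d [^] (m::nat) \<in> C" by (induction m) (auto simp: C_mult C_one)
lemma Z_mult: "d \<in> Z \<Longrightarrow> e \<in> Z \<Longrightarrow> d \<otimes> e \<in> Z" using Z_sub by (rule subgroup.m_closed)
lemma Z_inv: "d \<in> Z \<Longrightarrow> inv d \<in> Z" using Z_sub by (rule subgroup.m_inv_closed)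
lemma Z_one: "\<one> \<in> Z" using Z_sub by (rule subgroup.one_closed)
lemma Z_pow: "d \<in> Z \<Longrightarrow> d [^] (m::nat) \<in> Z" by (induction m) (auto simp: Z_mult Z_one)
lemma D_C: "d \<in> D \<Longrightarrow> d \<in> C" using D_le_C by auto
lemma Z_C: "d \<in> Z \<Longrightarrow> d \<in> C" using Z_le_C by auto
lemma c_pow_D [simp]: "c [^] (i::nat) \<in> D" by (auto simp: D_eq)
lemma D_pow_pn: "d \<in> D \<Longrightarrow> d [^] (p ^ n) = \<one>"
  by (auto simp: D_eq nat_pow_pow c_pow_one)

lemma c_pow_eq: "c [^] (i::nat) = c [^] (j::nat) \<longleftrightarrow> [i = j] (mod p ^ n)"
proof -
  have "c [^] i = c [^] j \<longleftrightarrow> [int i = int j] (mod int (p ^ n))"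
    using int_pow_eq[OF c_closed, of "int i" "int j"] unfolding int_pow_int ord_c
    by (simp add: cong_iff_dvd_diff dvd_diff_commute)
  then show ?thesis by (simp only: cong_int_iff)
qed

lemma D_pow_cong: "d \<in> D \<Longrightarrow> [i = j] (mod p ^ n) \<Longrightarrow> d [^] (i::nat) = d [^] (j::nat)"
  by (auto simp: D_eq nat_pow_pow c_pow_eq intro!: cong_mult)

lemma C_normal: "C \<lhd> G"
proof (rule normal_invI[OF C_sub])
  fix x h assume "x \<in> carrier G" "h \<in> C"
  then show "x \<otimes> h \<otimes> inv x \<in> C"
    using cm_D[of x h] by (simp add: cm_conj C_mult D_C)
qed

lemma Z_normal: "Z \<lhd> G"
proof (rule normal_invI[OF Z_sub])
  fix x h assume "x \<in> carrier G" "h \<in> Z"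
  then show "x \<otimes> h \<otimes> inv x \<in> Z" using Z_comm[of h x] by (simp add: conj_commute)
qed

lemma cm_D_C: "d \<in> D \<Longrightarrow> a \<in> C \<Longrightarrow> cm d a = \<one>" "d \<in> D \<Longrightarrow> a \<in> C \<Longrightarrow> cm a d = \<one>"
  using C_D_comm[of a d] by (simp_all add: cm_eq_one_iff)

lemma conj_C_D: "a \<in> C \<Longrightarrow> d \<in> D \<Longrightarrow> a \<otimes> d \<otimes> inv a = d"
  using conj_commute[OF C_carrier D_carrier C_D_comm] .

lemma cm_Z: "z \<in> Z \<Longrightarrow> g \<in> carrier G \<Longrightarrow> cm z g = \<one>" "z \<in> Z \<Longrightarrow> g \<in> carrier G \<Longrightarrow> cm g z = \<one>"
  using Z_comm[of z g] by (simp_all add: cm_eq_one_iff)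

lemma cm_absorb:
  assumes "a \<in> C" "b \<in> C" "d \<in> D" "e \<in> D"
  shows "cm (d \<otimes> a) (e \<otimes> b) = cm a b"
proof -
  have "cm (d \<otimes> a) (e \<otimes> b) = d \<otimes> cm a (e \<otimes> b) \<otimes> inv d \<otimes> cm d (e \<otimes> b)"
    using assms by (intro cm_left_mult) auto
  also have "\<dots> = cm a (e \<otimes> b)"
    using assms by (simp add: cm_D_C C_mult D_C conj_C_D cm_D)
  also have "\<dots> = cm a e \<otimes> (e \<otimes> cm a b \<otimes> inv e)"
    using assms by (intro cm_right_mult) auto
  also have "\<dots> = cm a b"
    using assms by (simp add: cm_D_C D_C conj_C_D cm_D)
  finally show ?thesis .
qed

text \<open>Conjugation changes a and b only by factors from D, and \<open>cm_absorb\<close> removes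
  these. Hence the commutators of C are central and C has class at most two.\<close>

lemma cm_C_Z:
  assumes "a \<in> C" "b \<in> C"
  shows "cm a b \<in> Z"
proof -
  have "cm a b \<otimes> h = h \<otimes> cm a b" if h: "h \<in> carrier G" for h
  proof -
    have "h \<otimes> cm a b \<otimes> inv h = cm (h \<otimes> a \<otimes> inv h) (h \<otimes> b \<otimes> inv h)"
      using h assms by (intro cm_conj_hom) auto
    also have "\<dots> = cm (cm h a \<otimes> a) (cm h b \<otimes> b)" using h assms by (simp add: cm_conj)
    also have "\<dots> = cm a b" using h assms by (intro cm_absorb cm_D) auto
    finally show ?thesis using inv_solve_right'[of "cm a b" "h \<otimes> cm a b" h] h assms by simp
  qed
  then show ?thesis using assms by (intro ZI) auto
qed

lemma cm_mult_left_C: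
  assumes "a \<in> C" "b \<in> C" "e \<in> C"
  shows "cm (a \<otimes> b) e = cm a e \<otimes> cm b e"
  using assms by (simp add: cm_left_mult conj_C_D cm_D D_comm)

lemma cm_mult_right_C:
  assumes "h \<in> carrier G" "a \<in> C" "b \<in> C"
  shows "cm h (a \<otimes> b) = cm h a \<otimes> cm h b"
  using assms by (simp add: cm_right_mult conj_C_D cm_D)

lemma cm_pow_right:
  assumes "h \<in> carrier G" "a \<in> C"
  shows "cm h (a [^] (m::nat)) = cm h a [^] m"
proof (induction m)
  case 0
  then show ?case using assms by (simp add: cm_eq_one_iff)
next
  case (Suc m)
  then show ?case using assms by (simp add: cm_mult_right_C C_pow)
qed

lemma act_pow:
  assumes h: "h \<in> carrier G" and d: "d \<in> D"
  shows "h [^] (m::nat) \<otimes> d \<otimes> inv (h [^] m) = d [^] (act h ^ m)"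
proof (induction m)
  case (Suc m)
  have "h [^] Suc m \<otimes> d \<otimes> inv (h [^] Suc m) = h [^] m \<otimes> (h \<otimes> d \<otimes> inv h) \<otimes> inv (h [^] m)"
    using h d by (simp add: inv_mult_group m_assoc)
  also have "h \<otimes> d \<otimes> inv h = d [^] act h" by (rule act[OF h d])
  also have "h [^] m \<otimes> d [^] act h \<otimes> inv (h [^] m) = (h [^] m \<otimes> d \<otimes> inv (h [^] m)) [^] act h"
    using h d by (intro conj_pow[symmetric]) auto
  also have "\<dots> = d [^] (act h ^ Suc m)" using d by (simp add: Suc nat_pow_pow mult.commute)
  finally show ?case .
qed (use d in simp)

text \<open>The source of the geometric sums: the factor split off from h^(m+1) is [h, a] conjugated
  by h^m, that is [h, a]^(r^m) with r = \<open>act h\<close>.\<close>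

lemma cm_pow_left:
  assumes "h \<in> carrier G" "a \<in> C"
  shows "cm (h [^] (m::nat)) a = cm h a [^] (\<Sum>i<m. act h ^ i)"
proof (induction m)
  case 0
  then show ?case using assms by (simp add: cm_eq_one_iff)
next
  case (Suc m)
  have "cm (h [^] Suc m) a = h [^] m \<otimes> cm h a \<otimes> inv (h [^] m) \<otimes> cm (h [^] m) a"
    using assms by (simp add: cm_left_mult)
  also have "\<dots> = cm h a [^] (act h ^ m) \<otimes> cm h a [^] (\<Sum>i<m. act h ^ i)"
    using assms by (simp add: act_pow cm_D Suc)
  also have "\<dots> = cm h a [^] (\<Sum>i<Suc m. act h ^ i)"
    using assms by (simp add: nat_pow_mult add.commute)
  finally show ?case .
qed

section \<open>The quotient by the centralizer, and the derived subgroup of the centralizer\<close>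

lemma D_unit_root:
  assumes "coprime m p"
  shows "\<exists>w. \<forall>d\<in>D. d [^] (m * w) = d"
proof -
  have "coprime m (p ^ n)" using assms by simp
  then obtain w where "[m * w = 1] (mod p ^ n)" using cong_solve_coprime_nat[of m "p ^ n"] by auto
  then show ?thesis using D_pow_cong[of _ "m * w" 1] by auto
qed

lemma cong_1_coprime: "[u = 1] (mod p) \<Longrightarrow> coprime (u::nat) p"
  by (metis cong_imp_coprime cong_sym coprime_1_left)

text \<open>G/C embeds into the units congruent to 1 modulo p of the integers modulo p^n. Take b
  with \<open>act b - 1\<close> least divisible by p. Then every \<open>act g - 1\<close> is a
  multiple of \<open>act b - 1\<close> modulo p^n, and \<open>powers_exhaust\<close> makes
  \<open>act g\<close> a power of \<open>act b\<close>, so g and b^i act alike on D.\<close>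

lemma cyclic_quotient:
  shows "\<exists>b\<in>carrier G. \<forall>g\<in>carrier G. \<exists>i::nat. \<exists>a\<in>C. g = b [^] i \<otimes> a"
proof -
  let ?x = "\<lambda>h. int (act h) - 1"
  let ?m = "\<lambda>h. nat (gcd (?x h) (int p ^ n))"
  obtain b where b: "b \<in> carrier G" and min: "\<And>g. g \<in> carrier G \<Longrightarrow> ?m b \<le> ?m g"
    using ex_has_least_nat[of "\<lambda>h. h \<in> carrier G" \<one> ?m] by auto
  have pw: "\<exists>i\<le>n. ?m h = p ^ i" for h
  proof -
    have "int (?m h) dvd int (p ^ n)" by simp
    then have "?m h dvd p ^ n" by (simp only: int_dvd_int_iff)
    then show ?thesis using divides_primepow_nat[OF prime_p] by blast
  qed
  have "\<exists>i::nat. \<exists>a\<in>C. g = b [^] i \<otimes> a" if g: "g \<in> carrier G" for g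
  proof -
    have "?m b dvd ?m g"
    proof -
      obtain i j where "?m b = p ^ i" "?m g = p ^ j" using pw by metis
      then show ?thesis using min[OF g] p_gt_1 by (simp add: le_imp_power_dvd)
    qed
    then have "int (?m b) dvd int (?m g)" by (simp only: int_dvd_int_iff)
    then have "gcd (?x b) (int p ^ n) dvd ?x g" by (simp add: dvd_trans)
    then obtain l where l: "?x g = gcd (?x b) (int p ^ n) * l" by blast
    obtain y where "[?x b * y = gcd (?x b) (int p ^ n)] (mod int p ^ n)"
      using cong_solve_int by blast
    then have "[?x b * y * l = ?x g] (mod int p ^ n)" unfolding l by (rule cong_mult) simp
    then have "[1 + ?x g = 1 + ?x b * y * l] (mod int p ^ n)" by (intro cong_add) (auto simp: cong_sym)
    then have "[int (act g) = 1 + (y * l) * ?x b] (mod int p ^ n)" by (simp add: algebra_simps)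
    then obtain i where "[int (act g) = int (act b) ^ i] (mod int p ^ n)"
      using powers_exhaust[OF prime_p odd_p act_cong[OF b]] by blast
    then have "[act g = act b ^ i] (mod p ^ n)"
      unfolding of_nat_power[symmetric] cong_int_iff .
    then have eq: "g \<otimes> d \<otimes> inv g = b [^] i \<otimes> d \<otimes> inv (b [^] i)" if "d \<in> D" for d
      using act_pow[OF b that, of i] act[OF g that] D_pow_cong[OF that \<open>[act g = act b ^ i] (mod p ^ n)\<close>] by simp
    have "inv (b [^] i) \<otimes> g \<otimes> d = d \<otimes> (inv (b [^] i) \<otimes> g)" if d: "d \<in> D" for d
    proof -
      have "inv (b [^] i) \<otimes> g \<otimes> d = inv (b [^] i) \<otimes> (g \<otimes> d \<otimes> inv g) \<otimes> g"
        using b g d by (simp add: m_assoc)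
      also have "\<dots> = d \<otimes> (inv (b [^] i) \<otimes> g)" unfolding eq[OF d] using b g d by (simp add: m_assoc)
      finally show ?thesis .
    qed
    then have "inv (b [^] i) \<otimes> g \<in> C" using b g by (intro CI) auto
    moreover have "g = b [^] i \<otimes> (inv (b [^] i) \<otimes> g)" using b g by simp
    ultimately show ?thesis by blast
  qed
  then show ?thesis using b by blast
qed

text \<open>A single commutator [h, a] with a in C generates G'. Otherwise all such commutators lie
  in E, generated by c^p and stable under conjugation. Since every element is b^i a with a in C and
  the powers of b commute, the product formulas would put every commutator into E, but c is not in
  E.\<close>

lemma derived_generator:
  shows "\<exists>h\<in>carrier G. \<exists>a\<in>C. \<exists>k. coprime k p \<and> cm h a = c [^] (k::nat)"
proof (cases "n = 0")
  case True
  then have "c = \<one>" using ord_c by (metis c_closed ord_eq_1 power_0)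
  then show ?thesis by (intro bexI[of _ \<one>] exI[of _ 1]) (auto simp: C_one cm_def)
next
  case False
  show ?thesis
  proof (rule ccontr)
    assume neg: "\<not> ?thesis"
    define E where "E = generate G {c [^] p}"
    have E_sub: "subgroup E G" unfolding E_def by (rule generate_is_subgroup) auto
    have E_pow: "c [^] (p * i) \<in> E" for i :: nat
      using subgroup_pow_closed[OF E_sub generate.incl[of "c [^] p" "{c [^] p}" G, folded E_def], of i]
      by (simp add: nat_pow_pow)
    have E_eq: "\<exists>i::nat. x = c [^] (p * i)" if "x \<in> E" for x
    proof -
      have "ord (c [^] p) \<noteq> 0" using fin by (metis c_closed nat_pow_closed ord_ge_1 not_one_le_zero)
      then obtain i :: nat where "x = (c [^] p) [^] i"
        using \<open>x \<in> E\<close> generate_pow_nat[of "c [^] p"] unfolding E_def by auto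
      then show ?thesis by (auto simp: nat_pow_pow)
    qed
    have E1: "cm h a \<in> E" if "h \<in> carrier G" "a \<in> C" for h a
    proof -
      obtain k :: nat where k: "cm h a = c [^] k"
        using cm_D[OF \<open>h \<in> carrier G\<close> C_carrier[OF \<open>a \<in> C\<close>]] by (auto simp: D_eq)
      then have "\<not> coprime k p" using neg that by blast
      then have "p dvd k" using prime_p by (metis coprime_commute prime_imp_coprime)
      then show ?thesis using E_pow by (auto simp: k)
    qed
    have E2: "cm a h \<in> E" if "h \<in> carrier G" "a \<in> C" for h a
      using cm_inv[of h a] E1[of h a] subgroup.m_inv_closed[OF E_sub, of "cm h a"] that by simp
    have E_conj: "h \<otimes> x \<otimes> inv h \<in> E" if hx: "h \<in> carrier G" "x \<in> E" for h x
    proof -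
      obtain i :: nat where i: "x = c [^] (p * i)" using E_eq[OF hx(2)] by blast
      have "h \<otimes> x \<otimes> inv h = x [^] act h" using hx(1) by (intro act) (auto simp: i)
      then show ?thesis using E_pow[of "i * act h"] by (simp add: i nat_pow_pow mult.assoc)
    qed
    obtain b where b: "b \<in> carrier G" and gen: "\<forall>g\<in>carrier G. \<exists>i::nat. \<exists>a\<in>C. g = b [^] i \<otimes> a"
      using cyclic_quotient by blast
    have "cm x y \<in> E" if xy: "x \<in> carrier G" "y \<in> carrier G" for x y
    proof -
      obtain i :: nat and a where a: "a \<in> C" "x = b [^] i \<otimes> a" using gen xy by blast
      obtain j :: nat and a' where a': "a' \<in> C" "y = b [^] j \<otimes> a'" using gen xy by blast
      have 1: "cm (b [^] i) (b [^] j) = \<one>"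
        using b by (simp add: cm_eq_one_iff nat_pow_mult add.commute)
      have "cm (b [^] i) y = cm (b [^] i) (b [^] j) \<otimes> (b [^] j \<otimes> cm (b [^] i) a' \<otimes> inv (b [^] j))"
        unfolding a'(2) using b a' by (intro cm_right_mult) auto
      then have 2: "cm (b [^] i) y \<in> E" using b a' E_conj[of "b [^] j" "cm (b [^] i) a'"] E1[of "b [^] i" a']
        by (simp add: 1)
      have "cm x y = b [^] i \<otimes> cm a y \<otimes> inv (b [^] i) \<otimes> cm (b [^] i) y"
        unfolding a(2) using b a xy by (intro cm_left_mult) auto
      then show ?thesis using 2 E_conj[of "b [^] i" "cm a y"] E2[of y a] b a xy subgroup.m_closed[OF E_sub] by simp
    qed
    then have "D \<subseteq> E" unfolding D_def derived_def cm_def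
      by (intro generate_subgroup_incl[OF _ E_sub]) auto
    then obtain i where "c [^] (1::nat) = c [^] (p * i)" using E_eq c_D by fastforce
    then have "[1 = p * i] (mod p ^ n)" by (simp only: c_pow_eq)
    then have "[1 = p * i] (mod p)" by (rule cong_dvd_modulus_nat) (use False in auto)
    then have "p dvd 1" using cong_dvd_iff[of 1 "p * i" p] by simp
    then show False using p_gt_1 by simp
  qed
qed

definition M where "M = Z \<inter> D"

lemma M_sub: "subgroup M G" unfolding M_def using Z_sub D_sub by (rule subgroups_Inter_pair)

lemma derived_C_le_M: "derived G C \<subseteq> M"
  unfolding derived_def
proof (rule generate_subgroup_incl[OF _ M_sub])
  have "cm a b \<in> M" if "a \<in> C" "b \<in> C" for a b using cm_C_Z[OF that] cm_D[of a b] that by (auto simp: M_def)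
  then show "derived_set G C \<subseteq> M" by (auto simp: cm_def)
qed

text \<open>With [h, a] generating D and t least such that h^(p^t) lies in C, the element
  [h^(p^t), a] is c^(p^t) up to a unit exponent and is a commutator of C. Conversely, if c^i is
  central, then h fixes it, so p^n divides i(r - 1); minimality of t forces p^t to divide i.\<close>

lemma M_structure: "\<exists>t\<le>n. derived G C = M \<and> M = generate G {c [^] (p ^ t)}"
proof -
  obtain h a k where h: "h \<in> carrier G" "a \<in> C" "coprime k p" "cm h a = c [^] (k::nat)"
    using derived_generator by blast
  let ?r = "act h"
  have S: "\<exists>u. (\<Sum>i<p ^ l. ?r ^ i) = p ^ l * u \<and> [u = 1] (mod p)" for l
    by (rule geom_sum_prime_power[OF prime_p odd_p act_cong[OF h(1)]])
  \<comment> \<open>Centralizing D means r^(p^l) = 1 modulo p^n, and r^(p^l) - 1 = (r - 1) p^l u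
    with u prime to p.\<close>
  have pw: "h [^] (p ^ l) \<in> C \<longleftrightarrow> p ^ n dvd (?r - 1) * p ^ l" for l
  proof -
    obtain u where u: "(\<Sum>i<p ^ l. ?r ^ i) = p ^ l * u" "[u = 1] (mod p)" using S by blast
    have "h [^] (p ^ l) \<in> C \<longleftrightarrow> (\<forall>d\<in>D. h [^] (p ^ l) \<otimes> d \<otimes> inv (h [^] (p ^ l)) = d)"
    proof
      assume "h [^] (p ^ l) \<in> C"
      then show "\<forall>d\<in>D. h [^] (p ^ l) \<otimes> d \<otimes> inv (h [^] (p ^ l)) = d" using conj_C_D by blast
    next
      assume *: "\<forall>d\<in>D. h [^] (p ^ l) \<otimes> d \<otimes> inv (h [^] (p ^ l)) = d"
      have "h [^] (p ^ l) \<otimes> d = d \<otimes> h [^] (p ^ l)" if "d \<in> D" for d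
      proof -
        have "h [^] (p ^ l) \<otimes> d = h [^] (p ^ l) \<otimes> d \<otimes> inv (h [^] (p ^ l)) \<otimes> h [^] (p ^ l)"
          using h that by (simp add: m_assoc)
        then show ?thesis using * that by simp
      qed
      then show "h [^] (p ^ l) \<in> C" using h by (intro CI) auto
    qed
    also have "\<dots> \<longleftrightarrow> (\<forall>d\<in>D. d [^] (?r ^ p ^ l) = d)" using h by (simp add: act_pow)
    also have "\<dots> \<longleftrightarrow> [?r ^ p ^ l = 1] (mod p ^ n)"
    proof
      assume "\<forall>d\<in>D. d [^] (?r ^ p ^ l) = d"
      then have "c [^] (?r ^ p ^ l) = c [^] (1::nat)" using c_D by simp
      then show "[?r ^ p ^ l = 1] (mod p ^ n)" by (simp only: c_pow_eq)
    next
      assume "[?r ^ p ^ l = 1] (mod p ^ n)"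
      then show "\<forall>d\<in>D. d [^] (?r ^ p ^ l) = d" using D_pow_cong[of _ "?r ^ p ^ l" 1] by simp
    qed
    also have "\<dots> \<longleftrightarrow> [int ?r ^ p ^ l = 1] (mod int (p ^ n))"
      by (metis cong_int_iff of_nat_1 of_nat_power)
    also have "\<dots> \<longleftrightarrow> int (p ^ n) dvd (int ?r - 1) * int (p ^ l * u)"
      unfolding geom_sum_telescope u(1) by (simp add: cong_iff_dvd_diff)
    also have "(int ?r - 1) * int (p ^ l * u) = int ((?r - 1) * p ^ l * u)"
      using act_ge[OF h(1)] by (simp add: of_nat_diff)
    also have "int (p ^ n) dvd \<dots> \<longleftrightarrow> p ^ n dvd (?r - 1) * p ^ l * u" by (rule int_dvd_int_iff)
    also have "\<dots> \<longleftrightarrow> p ^ n dvd (?r - 1) * p ^ l"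
      using cong_1_coprime[OF u(2)] by (metis coprime_commute coprime_dvd_mult_left_iff coprime_power_left_iff)
    finally show ?thesis .
  qed
  define t where "t = (LEAST t. h [^] (p ^ t) \<in> C)"
  have "h [^] (p ^ n) \<in> C" unfolding pw by simp
  then have t: "h [^] (p ^ t) \<in> C" "t \<le> n" and tmin: "l < t \<Longrightarrow> h [^] (p ^ l) \<notin> C" for l
    unfolding t_def by (auto intro: LeastI Least_le dest: not_less_Least)
  let ?E = "generate G {c [^] (p ^ t)}"
  have "c [^] (p ^ t) \<in> derived G C"
  proof -
    obtain u where u: "(\<Sum>i<p ^ t. ?r ^ i) = p ^ t * u" "[u = 1] (mod p)" using S by blast
    have "coprime (k * u) p" using h(3) cong_1_coprime[OF u(2)] by simp
    then obtain w where w: "\<forall>d\<in>D. d [^] (k * u * w) = d" using D_unit_root by blast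
    have sub: "subgroup (derived G C) G" by (rule derived_is_subgroup) auto
    have "cm (h [^] (p ^ t)) a \<in> derived G C"
      unfolding derived_def cm_def using t h by (intro generate.incl) auto
    then have "cm (h [^] (p ^ t)) a [^] w \<in> derived G C" by (rule subgroup_pow_closed[OF sub])
    also have "cm (h [^] (p ^ t)) a [^] w = (c [^] (p ^ t)) [^] (k * u * w)"
      using h by (simp add: cm_pow_left u nat_pow_pow mult_ac)
    also have "\<dots> = c [^] (p ^ t)" using w by simp
    finally show ?thesis .
  qed
  then have "?E \<subseteq> derived G C"
    by (intro generate_subgroup_incl derived_is_subgroup) auto
  moreover have "M \<subseteq> ?E"
  proof
    fix m assume "m \<in> M"
    then have m: "m \<in> Z" "m \<in> D" by (auto simp: M_def)
    obtain i :: nat where i: "m = c [^] i" using m by (auto simp: D_eq)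
    have "m [^] ?r = h \<otimes> m \<otimes> inv h" using act[OF h(1) m(2)] by simp
    also have "\<dots> = m" using m h Z_comm[of m h] by (simp add: conj_commute)
    finally have "c [^] (i * ?r) = c [^] i" by (simp add: i nat_pow_pow)
    then have "[i * ?r = i * 1] (mod p ^ n)" by (simp only: c_pow_eq mult_1_right)
    then have dv: "p ^ n dvd i * (?r - 1)"
      using act_ge[OF h(1)] by (simp add: cong_altdef_nat right_diff_distrib')
    have "p ^ t dvd i"
    proof (cases "i = 0 \<or> t = 0")
      case False
      obtain l i' where l: "i = p ^ l * i'" "\<not> p dvd i'"
        using False p_gt_1 by (metis multiplicity_decompose' prime_p not_prime_unit bot_nat_0.not_eq_extremum)
      have "t \<le> l"
      proof (rule ccontr)
        assume "\<not> t \<le> l"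
        then have lt: "l \<le> t - 1" "t - 1 < t" by auto
        have "coprime i' (p ^ n)" using l(2) prime_p by (metis coprime_commute coprime_power_right_iff prime_imp_coprime)
        then have "p ^ n dvd p ^ l * (?r - 1)"
          using dv unfolding l(1) by (metis coprime_commute coprime_dvd_mult_left_iff mult.assoc mult.commute)
        also have "p ^ l * (?r - 1) dvd (?r - 1) * p ^ (t - 1)"
          using lt by (simp add: mult.commute le_imp_power_dvd mult_dvd_mono)
        finally show False using tmin[OF lt(2)] pw by blast
      qed
      then show ?thesis using l by (simp add: le_imp_power_dvd dvd_mult2)
    qed auto
    then obtain j where "i = p ^ t * j" by blast
    then have "m = (c [^] (p ^ t)) [^] j" by (simp add: i nat_pow_pow)
    moreover have "c [^] (p ^ t) \<in> ?E" by (rule generate.incl) simp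
    moreover have "subgroup ?E G" by (rule generate_is_subgroup) auto
    ultimately show "m \<in> ?E" by (metis subgroup_pow_closed)
  qed
  ultimately have "derived G C = M \<and> M = ?E" using derived_C_le_M by blast
  then show ?thesis using t(2) by blast
qed

text \<open>The logarithm of the order of M to base p. All properties are chosen together; the form
  needed below is that M is the kernel of the p^s-th power map on the cyclic group D.\<close>

definition s where "s = (SOME s. s \<le> n \<and> derived G C = M \<and> card M = p ^ s \<and> (\<forall>x\<in>D. x \<in> M \<longleftrightarrow> x [^] (p ^ s) = \<one>))"

lemma s_exists: "\<exists>s. s \<le> n \<and> derived G C = M \<and> card M = p ^ s \<and> (\<forall>x\<in>D. x \<in> M \<longleftrightarrow> x [^] (p ^ s) = \<one>)"
proof -
  obtain t where t: "t \<le> n" "derived G C = M" "M = generate G {c [^] (p ^ t)}" using M_structure by blast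
  have pt: "p ^ n = p ^ t * p ^ (n - t)" using t by (simp flip: power_add)
  have o: "ord (c [^] (p ^ t)) = p ^ (n - t)"
    using ord_pow[OF c_closed, of "p ^ t"] p_gt_0 by (simp add: ord_c pt)
  then have "card M = p ^ (n - t)" using t generate_pow_card[of "c [^] (p ^ t)"] by simp
  moreover have "x \<in> M \<longleftrightarrow> x [^] (p ^ (n - t)) = \<one>" if "x \<in> D" for x
  proof
    assume "x \<in> M"
    have "ord (c [^] (p ^ t)) \<noteq> 0" using o p_gt_0 by simp
    then obtain j :: nat where "x = (c [^] (p ^ t)) [^] j"
      using generate_pow_nat[of "c [^] (p ^ t)"] \<open>x \<in> M\<close> t by auto
    then show "x [^] (p ^ (n - t)) = \<one>" by (simp add: nat_pow_pow c_pow_one pt)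
  next
    assume x: "x [^] (p ^ (n - t)) = \<one>"
    obtain i :: nat where i: "x = c [^] i" using \<open>x \<in> D\<close> by (auto simp: D_eq)
    have "p ^ t * p ^ (n - t) dvd i * p ^ (n - t)" using x by (simp add: i nat_pow_pow c_pow_one pt)
    then have "p ^ t dvd i" using p_gt_0 by (metis dvd_times_right_cancel_iff power_not_zero not_gr_zero)
    then obtain j where "i = p ^ t * j" by blast
    then have "x = (c [^] (p ^ t)) [^] j" by (simp add: i nat_pow_pow)
    moreover have "c [^] (p ^ t) \<in> M" unfolding t by (rule generate.incl) simp
    ultimately show "x \<in> M" using M_sub by (metis subgroup_pow_closed)
  qed
  ultimately show ?thesis using t by (intro exI[of _ "n - t"]) auto
qed

lemma s_le: "s \<le> n" and derived_C: "derived G C = M" and card_M: "card M = p ^ s"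
  and M_iff: "x \<in> D \<Longrightarrow> x \<in> M \<longleftrightarrow> x [^] (p ^ s) = \<one>"
  using someI_ex[OF s_exists] unfolding s_def by blast+

definition ZD where "ZD = Z <#> D"

lemma ZD_normal: "ZD \<lhd> G"
proof (rule normal_invI)
  show "subgroup ZD G" unfolding ZD_def using mult_norm_subgroup[OF Z_normal D_sub] .
  fix x h assume x: "x \<in> carrier G" and "h \<in> ZD"
  then obtain z d where zd: "z \<in> Z" "d \<in> D" "h = z \<otimes> d" by (auto simp: ZD_def set_mult_def)
  have "x \<otimes> h \<otimes> inv x = (x \<otimes> z \<otimes> inv x) \<otimes> (x \<otimes> d \<otimes> inv x)"
    using x zd by (simp add: m_assoc)
  also have "\<dots> = z \<otimes> (x \<otimes> d \<otimes> inv x)" using x zd Z_comm[of z x] by (simp add: conj_commute)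
  finally show "x \<otimes> h \<otimes> inv x \<in> ZD" using conj_D[OF x zd(2)] zd unfolding ZD_def set_mult_def by blast
qed

text \<open>Look for j such that z = g^(p^s) c^j is central. Because G consists of the elements b^i
  a, it suffices that z commutes with C and with b. Commutators with C vanish, since [a, g] lies in
  M and is killed by p^s. With x = \<open>act b - 1\<close> and [b, g] = c^k, commuting with b means
  k p^s + j x = 0 modulo p^n.\<close>

lemma C_imp_pow_ZD:
  assumes g: "g \<in> C"
  shows "g [^] (p ^ s) \<in> ZD"
proof -
  obtain b where b: "b \<in> carrier G" and gen: "\<forall>g\<in>carrier G. \<exists>i::nat. \<exists>a\<in>C. g = b [^] i \<otimes> a"
    using cyclic_quotient by blast
  have central: "z \<in> Z" if z: "z \<in> C" "cm b z = \<one>" "\<And>a. a \<in> C \<Longrightarrow> cm a z = \<one>" for z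
  proof -
    have "z \<otimes> h = h \<otimes> z" if "h \<in> carrier G" for h
    proof -
      obtain i :: nat and a where a: "a \<in> C" "h = b [^] i \<otimes> a" using gen \<open>h \<in> carrier G\<close> by blast
      have "b \<otimes> z = z \<otimes> b" "a \<otimes> z = z \<otimes> a" using z a b cm_eq_one_iff[of b z] cm_eq_one_iff[of a z] by auto
      then have "b [^] i \<otimes> z = z \<otimes> b [^] i" using b z by (intro group_commutes_pow) auto
      then show ?thesis using a b z \<open>a \<otimes> z = z \<otimes> a\<close>
        by (metis C_carrier m_assoc nat_pow_closed)
    qed
    then show ?thesis using z(1) by (intro ZI) auto
  qed
  define x where "x = act b - 1"
  have r: "act b = 1 + x" using act_ge[OF b] by (simp add: x_def)
  have cmb: "cm b d = d [^] x" if "d \<in> D" for d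
  proof -
    have "cm b d \<otimes> d = d [^] x \<otimes> d" using cm_conj[of b d] act[OF b that] b that by (simp add: r)
    then show ?thesis using b that by simp
  qed
  obtain e where e: "e \<le> n" "gcd x (p ^ n) = p ^ e"
    using divides_primepow_nat[OF prime_p, of "gcd x (p ^ n)" n] by auto
  \<comment> \<open>This makes the congruence solvable: c^(p^(n-e)) commutes with b, so it lies in M
    and is killed by p^s, hence e is at most s and gcd(x, p^n) = p^e divides p^s.\<close>
  have "c [^] (p ^ (n - e)) \<in> M"
  proof -
    have "p ^ e dvd x" using e by (metis gcd_dvd1)
    then have "p ^ (n - e) * p ^ e dvd p ^ (n - e) * x" by (intro mult_dvd_mono) auto
    then have "p ^ n dvd p ^ (n - e) * x" using e by (simp flip: power_add)
    then have "cm b (c [^] (p ^ (n - e))) = \<one>" by (simp add: cmb nat_pow_pow c_pow_one)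
    then have "c [^] (p ^ (n - e)) \<in> Z" by (intro central) (auto simp: D_C cm_D_C)
    then show ?thesis by (simp add: M_def)
  qed
  then have "p ^ n dvd p ^ (n - e) * p ^ s" by (simp add: M_iff nat_pow_pow c_pow_one)
  then have "n \<le> n - e + s" using p_gt_1 by (simp add: power_add[symmetric] power_dvd_imp_le)
  then have "p ^ e dvd p ^ s" using e by (intro le_imp_power_dvd) linarith
  then obtain l where l: "p ^ s = p ^ e * l" by blast
  obtain k :: nat where k: "cm b g = c [^] k" using cm_D[of b g] b g by (auto simp: D_eq)
  obtain y where "[int x * y = gcd (int x) (int (p ^ n))] (mod int (p ^ n))" using cong_solve_int by blast
  then have y: "[int x * y = int (p ^ e)] (mod int (p ^ n))" by (simp only: gcd_int_int_eq e(2))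
  \<comment> \<open>The solution -y l k, where x y = p^e modulo p^n and p^s = p^e l, reduced to a
    natural number.\<close>
  define j where "j = nat ((- (y * int l * int k)) mod int (p ^ n))"
  have "int j = (- (y * int l * int k)) mod int (p ^ n)" unfolding j_def using p_gt_0 by simp
  then have "[int j = - (y * int l * int k)] (mod int (p ^ n))" by (simp add: cong_def)
  then have "[int j * int x = - (y * int l * int k) * int x] (mod int (p ^ n))" by (intro cong_mult) auto
  also have "- (y * int l * int k) * int x = (int x * y) * (- (int l * int k))" by simp
  also have "[\<dots> = int (p ^ e) * (- (int l * int k))] (mod int (p ^ n))" using y by (intro cong_mult) auto
  also have "int (p ^ e) * (- (int l * int k)) = - int (k * p ^ s)" by (simp add: l)
  finally have "int (p ^ n) dvd int (k * p ^ s + j * x)"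
    by (simp add: cong_iff_dvd_diff add.commute)
  then have dv: "p ^ n dvd k * p ^ s + j * x" by (simp only: int_dvd_int_iff)
  define z where "z = g [^] (p ^ s) \<otimes> c [^] j"
  have "z \<in> Z"
  proof (rule central)
    show "z \<in> C" using g by (simp add: z_def C_mult C_pow D_C)
    have "cm b z = c [^] (k * p ^ s + j * x)"
      using b g by (simp add: z_def cm_mult_right_C C_pow D_C cm_pow_right k cmb nat_pow_pow nat_pow_mult)
    then show "cm b z = \<one>" using dv by (simp add: c_pow_one)
    fix a assume a: "a \<in> C"
    have "cm a g \<in> M" using cm_C_Z[OF a g] cm_D[of a g] a g by (auto simp: M_def)
    then have "cm a g [^] (p ^ s) = \<one>" using M_iff[of "cm a g"] cm_D[of a g] a g by simp
    then show "cm a z = \<one>" using a g by (simp add: z_def cm_mult_right_C C_pow D_C cm_pow_right cm_D_C)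
  qed
  moreover have "g [^] (p ^ s) = z \<otimes> inv (c [^] j)" using g by (simp add: z_def m_assoc)
  ultimately show ?thesis using D_inv[OF c_pow_D, of j] unfolding ZD_def set_mult_def by blast
qed

text \<open>For a in C the commutator of g^(p^s) = zd with a is trivial, and it equals [g, a]^(p^s
  u) with u prime to p. So [g, a] is killed by p^s, lies in M and is central.\<close>

lemma pow_ZD_imp_C:
  assumes g: "g \<in> carrier G" "g [^] (p ^ s) \<in> ZD"
  shows "g \<in> C"
proof -
  obtain z d where zd: "z \<in> Z" "d \<in> D" "g [^] (p ^ s) = z \<otimes> d" using g by (auto simp: ZD_def set_mult_def)
  obtain u where u: "(\<Sum>i<p ^ s. act g ^ i) = p ^ s * u" "[u = 1] (mod p)"
    using geom_sum_prime_power[OF prime_p odd_p act_cong[OF g(1)]] by blast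
  obtain w where w: "\<forall>d\<in>D. d [^] (u * w) = d" using D_unit_root[OF cong_1_coprime[OF u(2)]] by blast
  have zC: "cm g a \<in> Z" if a: "a \<in> C" for a
  proof -
    have "cm (z \<otimes> d) a = \<one>" using zd a by (simp add: cm_left_mult cm_D_C cm_Z)
    then have "cm g a [^] (p ^ s * u) = \<one>" using cm_pow_left[OF g(1) a, of "p ^ s"] zd u by simp
    then have "(cm g a [^] (p ^ s * u)) [^] w = \<one>" by simp
    then have "(cm g a [^] (p ^ s)) [^] (u * w) = \<one>" using g a by (simp add: nat_pow_pow mult.assoc)
    then have "cm g a [^] (p ^ s) = \<one>" using w D_pow[OF cm_D, of g a "p ^ s"] g a by simp
    then show ?thesis using M_iff[of "cm g a"] cm_D[of g a] g a by (simp add: M_def)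
  qed
  obtain h a k where h: "h \<in> carrier G" "a \<in> C" "coprime k p" "cm h a = c [^] (k::nat)"
    using derived_generator by blast
  \<comment> \<open>Conjugation by g changes h by a factor from D and a by a central factor, so it
    fixes the generator [h, a] of D.\<close>
  have "g \<otimes> cm h a \<otimes> inv g = cm (g \<otimes> h \<otimes> inv g) (g \<otimes> a \<otimes> inv g)"
    using g h by (intro cm_conj_hom) auto
  also have "\<dots> = cm (cm g h \<otimes> h) (cm g a \<otimes> a)" using g h by (simp add: cm_conj)
  also have "\<dots> = cm (cm g h \<otimes> h) a"
    using g h zC[OF h(2)] by (simp add: cm_right_mult cm_Z conj_commute Z_comm)
  also have "\<dots> = cm h a"
    using g h cm_D[of g h] cm_D[of h a] by (simp add: cm_left_mult cm_D_C conj_C_D D_C)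
  finally have 1: "g \<otimes> cm h a \<otimes> inv g = cm h a" .
  obtain w' where w': "\<forall>d\<in>D. d [^] (k * w') = d" using D_unit_root[OF h(3)] by blast
  have c: "cm h a [^] w' = c" using w' c_D by (simp add: h nat_pow_pow)
  have gc: "g \<otimes> c \<otimes> inv g = c"
    using conj_pow[of g "cm h a" w'] g h(1,2) 1 by (simp add: c)
  have "g \<otimes> d = d \<otimes> g" if d: "d \<in> D" for d
  proof -
    obtain i :: nat where i: "d = c [^] i" using d by (auto simp: D_eq)
    have "g \<otimes> d \<otimes> inv g = d" using conj_pow[of g c i] g gc by (simp add: i)
    then show ?thesis using inv_solve_right'[of d "g \<otimes> d" g] g d by simp
  qed
  then show ?thesis using g by (intro CI) auto
qed

lemma C_iff: "g \<in> carrier G \<Longrightarrow> g \<in> C \<longleftrightarrow> g [^] (p ^ s) \<in> ZD"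
  using C_imp_pow_ZD pow_ZD_imp_C by blast

section \<open>Powers in the centralizer\<close>

lemma pow_mult_C:
  assumes "a \<in> C" "b \<in> C"
  shows "(a \<otimes> b) [^] (m::nat) = a [^] m \<otimes> b [^] m \<otimes> cm b a [^] (\<Sum>i<m. i)"
proof (induction m)
  case (Suc m)
  let ?T = "cm b a [^] (\<Sum>i<m. i)"
  have z: "cm b a \<in> Z" using assms by (intro cm_C_Z)
  have zp: "cm b a [^] (i::nat) \<in> Z" for i using Z_pow[OF z] .
  have "cm (b [^] m) a = inv (cm a (b [^] m))" using assms by (intro cm_inv[symmetric]) auto
  also have "\<dots> = inv (cm a b [^] m)" using cm_pow_right[of a b m] assms by simp
  also have "\<dots> = cm b a [^] m" using assms by (simp add: cm_inv flip: nat_pow_inv)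
  finally have "cm (b [^] m) a = cm b a [^] m" .
  then have sw: "b [^] m \<otimes> a = cm b a [^] m \<otimes> (a \<otimes> b [^] m)" using cm_swap[of "b [^] m" a] assms by simp
  have "(a \<otimes> b) [^] Suc m = a [^] m \<otimes> b [^] m \<otimes> (?T \<otimes> (a \<otimes> b))" using Suc assms by (simp add: m_assoc)
  also have "?T \<otimes> (a \<otimes> b) = a \<otimes> b \<otimes> ?T" using Z_comm[OF zp] assms by simp
  also have "a [^] m \<otimes> b [^] m \<otimes> (a \<otimes> b \<otimes> ?T) = a [^] m \<otimes> (b [^] m \<otimes> a) \<otimes> (b \<otimes> ?T)"
    using assms by (simp add: m_assoc)
  also have "\<dots> = a [^] m \<otimes> (a \<otimes> b [^] m \<otimes> cm b a [^] m) \<otimes> (b \<otimes> ?T)"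
    unfolding sw using Z_comm[OF zp[of m], of "a \<otimes> b [^] m"] assms by simp
  also have "\<dots> = a [^] m \<otimes> a \<otimes> b [^] m \<otimes> (cm b a [^] m \<otimes> b) \<otimes> ?T"
    using assms by (simp add: m_assoc)
  also have "cm b a [^] m \<otimes> b = b \<otimes> cm b a [^] m" using Z_comm[OF zp] assms by simp
  also have "a [^] m \<otimes> a \<otimes> b [^] m \<otimes> (b \<otimes> cm b a [^] m) \<otimes> ?T = a [^] Suc m \<otimes> b [^] Suc m \<otimes> (cm b a [^] m \<otimes> ?T)"
    using assms by (simp add: m_assoc)
  also have "cm b a [^] m \<otimes> ?T = cm b a [^] (\<Sum>i<Suc m. i)"
    using assms by (simp add: nat_pow_mult add.commute)
  finally show ?case .
qed simp

definition P where "P j = (\<lambda>g. g [^] (p ^ j)) ` C"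

text \<open>For odd m = p^j the correction [b, a]^(m(m-1)/2) in (ab)^m is itself the m-th power of a
  central element, so a^m b^m is the m-th power of ab times the central element
  [b, a]^(-(m-1)/2).\<close>

lemma P_sub: "subgroup (P j) G"
proof (rule subgroupI)
  show "P j \<subseteq> carrier G" by (auto simp: P_def)
  show "P j \<noteq> {}" using C_one by (auto simp: P_def)
next
  fix x assume "x \<in> P j"
  then obtain g where g: "g \<in> C" "x = g [^] (p ^ j)" by (auto simp: P_def)
  then have "inv x = inv g [^] (p ^ j)" by (simp add: nat_pow_inv)
  then show "inv x \<in> P j" using C_inv[OF g(1)] by (auto simp: P_def)
next
  fix x y assume "x \<in> P j" "y \<in> P j"
  then obtain a b where ab: "a \<in> C" "x = a [^] (p ^ j)" "b \<in> C" "y = b [^] (p ^ j)" by (auto simp: P_def)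
  let ?m = "p ^ j"
  have "(\<Sum>i<?m. i) = ((?m - 1) div 2) * ?m"
  proof -
    have "2 * (\<Sum>i<k. i) = k * (k - 1)" for k :: nat
    proof (induction k)
      case (Suc k) then show ?case by (cases k) (simp_all add: algebra_simps)
    qed simp
    moreover have "even (?m - 1)" using odd_p by simp
    ultimately have "2 * (\<Sum>i<?m. i) = 2 * (((?m - 1) div 2) * ?m)" by (simp add: mult.commute)
    then show ?thesis by simp
  qed
  define y' where "y' = inv (cm b a) [^] ((?m - 1) div 2)"
  have z: "cm b a \<in> Z" using ab by (intro cm_C_Z)
  have y': "y' \<in> Z" unfolding y'_def by (intro Z_pow Z_inv z)
  have "(a \<otimes> b \<otimes> y') [^] ?m = (a \<otimes> b) [^] ?m \<otimes> y' [^] ?m"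
    using ab y' Z_comm[OF y', of "a \<otimes> b"] by (intro pow_mult_distrib) auto
  also have "(a \<otimes> b) [^] ?m = a [^] ?m \<otimes> b [^] ?m \<otimes> cm b a [^] (((?m - 1) div 2) * ?m)"
    using pow_mult_C[OF ab(1,3), of ?m] \<open>(\<Sum>i<?m. i) = _\<close> by simp
  also have "y' [^] ?m = inv (cm b a [^] (((?m - 1) div 2) * ?m))"
    using ab by (simp add: y'_def nat_pow_pow nat_pow_inv)
  finally have "(a \<otimes> b \<otimes> y') [^] ?m = x \<otimes> y" using ab by (simp add: m_assoc)
  moreover have "a \<otimes> b \<otimes> y' \<in> C" using ab y' by (simp add: C_mult Z_C)
  ultimately show "x \<otimes> y \<in> P j" by (metis P_def image_eqI)
qed

lemma P_normal: "P j \<lhd> G"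
proof (rule normal_invI[OF P_sub])
  fix x h assume x: "x \<in> carrier G" and "h \<in> P j"
  then obtain g where g: "g \<in> C" "h = g [^] (p ^ j)" by (auto simp: P_def)
  have "x \<otimes> h \<otimes> inv x = (x \<otimes> g \<otimes> inv x) [^] (p ^ j)" using x g by (simp add: conj_pow)
  moreover have "x \<otimes> g \<otimes> inv x \<in> C" using normal.inv_op_closed2[OF C_normal x g(1)] .
  ultimately show "x \<otimes> h \<otimes> inv x \<in> P j" by (auto simp: P_def)
qed

end

section \<open>Relative augmentation ideals and central elements\<close>

context fgroup
begin

lemma RI_commutator:
  assumes N: "N \<lhd> G" and Q: "comm_group (G Mod N)" and f: "f \<in> KG" and g: "g \<in> KG"
  shows "f \<star> g - g \<star> f \<in> RI N"
proof -
  interpret Q: fgroup "G Mod N" by (rule fgroup_Mod[OF N])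
  have "push N (f \<star> g) = push N (g \<star> f)"
    unfolding push_conv[OF N f g] push_conv[OF N g f]
    by (rule Q.conv_comm[OF Q push_closed[OF N] push_closed[OF N]])
  then have "push N (f \<star> g + sc (-1) (g \<star> f)) = 0"
    unfolding push_add push_sc by (simp add: fun_eq_iff pw)
  moreover have "f \<star> g + sc (-1) (g \<star> f) = f \<star> g - g \<star> f" by (simp add: fun_eq_iff pw)
  ultimately show ?thesis by (simp add: RI_iff_push[OF N])
qed

text \<open>Since [x, y] - 1 = (xy - yx) x^-1 y^-1, any right ideal with all additive commutators
  contains \<open>RI\<close> of the derived subgroup. With \<open>RI_commutator\<close> this
  describes the ideal in ring-theoretic terms.\<close>

lemma RI_derived_subset:
  fixes W :: "('a \<Rightarrow> 'c::field) set"
  assumes W: "rideal W" and comm: "\<And>f g. f \<in> KG \<Longrightarrow> g \<in> KG \<Longrightarrow> f \<star> g - g \<star> f \<in> W"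
  shows "RI (derived G (carrier G)) \<subseteq> W"
proof (rule RI_subset[OF _ W])
  show "subgroup (derived G (carrier G)) G" by (rule derived_is_subgroup) simp
  fix d assume "d \<in> derived G (carrier G)"
  then show "(dl d - dl \<one> :: 'a \<Rightarrow> 'c) \<in> W"
    unfolding derived_def
  proof (rule rideal_generate[OF W derived_set_in_carrier[OF order_refl], rotated])
    fix e assume "e \<in> derived_set G (carrier G)"
    then obtain x y where xy: "x \<in> carrier G" "y \<in> carrier G" "e = x \<otimes> y \<otimes> inv x \<otimes> inv y" by auto
    have eq: "(dl e - dl \<one> :: 'a \<Rightarrow> 'c) = (dl x \<star> dl y - dl y \<star> dl x) \<star> dl (inv x \<otimes> inv y)"
      using xy by (simp add: conv_minus_left conv_dl_dl m_assoc)
    show "(dl e - dl \<one> :: 'a \<Rightarrow> 'c) \<in> W"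
      unfolding eq using W comm[of "dl x" "dl y"] xy by (auto simp: rideal_def)
  qed
qed

lemma kpow_diff_one:
  fixes g :: 'a
  assumes "Factorial_Ring.prime CHAR('k::field)" "g \<in> carrier G"
  shows "kpow G (dl g - dl \<one> :: 'a \<Rightarrow> 'k) (CHAR('k) ^ e) = dl (g [^] (CHAR('k) ^ e)) - dl \<one>"
proof -
  let ?f = "dl g - dl \<one> :: 'a \<Rightarrow> 'k"
  have "kpow G (?f + dl \<one>) (CHAR('k) ^ e) = kpow G ?f (CHAR('k) ^ e) + kpow G (dl \<one>) (CHAR('k) ^ e)"
    using assms by (intro freshman_dream) auto
  moreover have "?f + dl \<one> = dl g" by simp
  ultimately show ?thesis using assms by (simp add: kpow_dl)
qed

text \<open>As G/N is abelian, g -> N g^q is a homomorphism; the subgroup is its kernel and the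
  fibres are the cosets of the kernel.\<close>

lemma power_preimage_subgroup:
  assumes N: "N \<lhd> G" and Q: "comm_group (G Mod N)"
  shows "subgroup {g \<in> carrier G. g [^] (q::nat) \<in> N} G"
    and "x \<in> carrier G \<Longrightarrow> y \<in> carrier G \<Longrightarrow>
      N #> (x [^] q) = N #> (y [^] q) \<longleftrightarrow> {g \<in> carrier G. g [^] q \<in> N} #> x = {g \<in> carrier G. g [^] q \<in> N} #> y"
proof -
  interpret Q: comm_group "G Mod N" by fact
  have sub: "subgroup N G" by (rule normal_imp_subgroup[OF N])
  let ?h = "\<lambda>g. N #> (g [^] q)"
  have h: "?h g = (N #> g) [^]\<^bsub>G Mod N\<^esub> q" if "g \<in> carrier G" for g
    by (rule normal.FactGroup_pow[OF N that, symmetric])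
  have hom: "?h (x \<otimes> y) = ?h x \<otimes>\<^bsub>G Mod N\<^esub> ?h y" if "x \<in> carrier G" "y \<in> carrier G" for x y
  proof -
    have "N #> (x \<otimes> y) = (N #> x) \<otimes>\<^bsub>G Mod N\<^esub> (N #> y)" using normal.rcos_sum[OF N that] by simp
    then show ?thesis using that by (simp add: h Q.nat_pow_distrib carrier_FactGroup del: mult_FactGroup)
  qed
  have hc: "?h g \<in> carrier (G Mod N)" if "g \<in> carrier G" for g using that by (auto simp: carrier_FactGroup)
  interpret gh: group_hom G "G Mod N" ?h
    by (intro group_hom.intro group_hom_axioms.intro homI is_group Q.is_group hc hom)
  have ker: "kernel G (G Mod N) ?h = {g \<in> carrier G. g [^] q \<in> N}"
  proof -
    have "N #> (g [^] q) = N \<longleftrightarrow> g [^] q \<in> N" if "g \<in> carrier G" for g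
      using coset_join1[OF _ _ sub, of "g [^] q"] coset_join2[OF _ sub, of "g [^] q"] that by blast
    then show ?thesis unfolding kernel_def one_FactGroup by blast
  qed
  show K: "subgroup {g \<in> carrier G. g [^] q \<in> N} G"
    unfolding ker[symmetric] by (rule gh.subgroup_kernel)
  assume xy: "x \<in> carrier G" "y \<in> carrier G"
  have "?h x = ?h y \<longleftrightarrow> ?h (x \<otimes> inv y) = \<one>\<^bsub>G Mod N\<^esub>"
    using xy hc[OF xy(1)] hc[OF xy(2)] Q.inv_solve_right'[of "\<one>\<^bsub>G Mod N\<^esub>" "?h x" "?h y"]
    by (simp add: hom gh.hom_inv del: one_FactGroup mult_FactGroup)
  also have "\<dots> \<longleftrightarrow> x \<otimes> inv y \<in> {g \<in> carrier G. g [^] q \<in> N}"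
    unfolding ker[symmetric] kernel_def using xy by simp
  also have "\<dots> \<longleftrightarrow> x \<in> {g \<in> carrier G. g [^] q \<in> N} #> y"
    using subgroup.rcos_module[OF K is_group xy(2,1)] by simp
  also have "\<dots> \<longleftrightarrow> {g \<in> carrier G. g [^] q \<in> N} #> x = {g \<in> carrier G. g [^] q \<in> N} #> y"
    by (rule mem_rcos_iff[OF K xy(2,1)])
  finally show "?h x = ?h y \<longleftrightarrow> {g \<in> carrier G. g [^] q \<in> N} #> x = {g \<in> carrier G. g [^] q \<in> N} #> y" .
qed

text \<open>By \<open>frobenius\<close> the sum of f^q over Nz is the q-th power of the sum of f
  over all x with N x^q = Nz. That set is empty or a coset of the preimage subgroup, and every coset
  of it occurs.\<close>

lemma RI_frobenius:
  fixes f :: "'a \<Rightarrow> 'k::field"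
  assumes N: "N \<lhd> G" and Q: "comm_group (G Mod N)" and p: "Factorial_Ring.prime CHAR('k)" and f: "f \<in> KG"
  shows "kpow G f (CHAR('k) ^ e) \<in> RI N \<longleftrightarrow> f \<in> RI {g \<in> carrier G. g [^] (CHAR('k) ^ e) \<in> N}"
proof -
  let ?q = "CHAR('k) ^ e" and ?K = "{g \<in> carrier G. g [^] (CHAR('k) ^ e) \<in> N}"
  have K: "subgroup ?K G" by (rule power_preimage_subgroup[OF N Q])
  have set_eq: "{x \<in> carrier G. N #> (x [^] ?q) = N #> (y [^] ?q)} = ?K #> y" if y: "y \<in> carrier G" for y
  proof -
    have "x \<in> ?K #> y \<longleftrightarrow> N #> (x [^] ?q) = N #> (y [^] ?q)" if "x \<in> carrier G" for x
      unfolding power_preimage_subgroup(2)[OF N Q that y] by (rule mem_rcos_iff[OF K y that])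
    moreover have "?K #> y \<subseteq> carrier G" by (rule r_coset_subset_G[OF subgroup.subset[OF K] y])
    ultimately show ?thesis by auto
  qed
  have sum_eq: "(\<Sum>v\<in>N #> z. kpow G f ?q v) = (\<Sum>x\<in>{x \<in> carrier G. N #> (x [^] ?q) = N #> z}. f x) ^ ?q"
    if "z \<in> carrier G" for z by (rule frobenius[OF N Q p f that])
  have q0: "?q > 0" using p by (simp add: prime_gt_0_nat)
  show ?thesis
  proof
    assume l: "kpow G f ?q \<in> RI N"
    have "(\<Sum>x\<in>?K #> y. f x) = 0" if y: "y \<in> carrier G" for y
      using sum_eq[of "y [^] ?q"] l y by (simp add: set_eq RI_def)
    then show "f \<in> RI ?K" using f by (simp add: RI_def)
  next
    assume r: "f \<in> RI ?K"
    have "(\<Sum>v\<in>N #> z. kpow G f ?q v) = 0" if z: "z \<in> carrier G" for z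
    proof (cases "\<exists>y\<in>carrier G. N #> (y [^] ?q) = N #> z")
      case True
      then obtain y where y: "y \<in> carrier G" "N #> (y [^] ?q) = N #> z" by blast
      then have "(\<Sum>v\<in>N #> z. kpow G f ?q v) = (\<Sum>x\<in>?K #> y. f x) ^ ?q"
        using sum_eq[OF z] set_eq[OF y(1)] by simp
      then show ?thesis using r y q0 by (simp add: RI_def)
    next
      case False
      then have "{x \<in> carrier G. N #> (x [^] ?q) = N #> z} = {}" by blast
      then show ?thesis unfolding sum_eq[OF z] using q0 by (simp only: sum.empty zero_power)
    qed
    then show "kpow G f ?q \<in> RI N" by (simp add: RI_def)
  qed
qed

lemma Mod_comm_group:
  assumes N: "N \<lhd> G" and D: "derived G (carrier G) \<subseteq> N"
  shows "comm_group (G Mod N)"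
proof -
  interpret Q: group "G Mod N" by (rule normal.factorgroup_is_group[OF N])
  show ?thesis
  proof (rule Q.group_comm_groupI)
    fix x y assume "x \<in> carrier (G Mod N)" "y \<in> carrier (G Mod N)"
    then obtain a b where ab: "a \<in> carrier G" "b \<in> carrier G" "x = N #> a" "y = N #> b"
      by (auto simp: carrier_FactGroup)
    have sub: "subgroup N G" by (rule normal_imp_subgroup[OF N])
    have "cm a b \<in> N" using cm_derived[OF ab(1,2)] D by auto
    then have "a \<otimes> b \<in> N #> (b \<otimes> a)" using cm_swap[OF ab(1,2)] by (auto simp: r_coset_def)
    then have "N #> (a \<otimes> b) = N #> (b \<otimes> a)" using ab by (simp add: mem_rcos_iff[OF sub])
    then show "x \<otimes>\<^bsub>G Mod N\<^esub> y = y \<otimes>\<^bsub>G Mod N\<^esub> x"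
      using ab by (simp add: normal.rcos_sum[OF N])
  qed
qed

end

section \<open>The principal ideal of G' and nilpotency\<close>

context pgroup_cyclic_derived
begin

lemma Mod_comm: "L \<lhd> G \<Longrightarrow> D \<subseteq> L \<Longrightarrow> comm_group (G Mod L)"
  using Mod_comm_group unfolding D_def by blast

lemma D_eq_generate: "D = generate G {c}"
  by (simp add: D_def derived_c)

lemma RI_D_principal:
  fixes f :: "'a \<Rightarrow> 'k::field"
  assumes "f \<in> RI D"
  shows "\<exists>h\<in>KG. f = (dl c - dl \<one>) \<star> h"
proof -
  define x where "x = (dl c - dl \<one> :: 'a \<Rightarrow> 'k::field)"
  define W where "W = {f. \<exists>h\<in>KG. f = x \<star> h}"
  have xK: "x \<in> KG" by (simp add: x_def)
  have W: "rideal W"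
    unfolding rideal_def
  proof (intro conjI ballI)
    show "W \<subseteq> KG" by (auto simp: W_def)
    have "0 = x \<star> 0" using xK by simp
    then show "0 \<in> W" unfolding W_def using KG_zero by blast
  next
    fix f g :: "'a \<Rightarrow> 'k" assume "f \<in> W" "g \<in> W"
    then obtain f' g' where "f' \<in> KG" "f = x \<star> f'" "g' \<in> KG" "g = x \<star> g'" by (auto simp: W_def)
    then have "f + g = x \<star> (f' + g')" "f' + g' \<in> KG" using xK by (simp_all add: conv_add_right)
    then show "f + g \<in> W" unfolding W_def by blast
  next
    fix f g :: "'a \<Rightarrow> 'k" assume "f \<in> W" and g: "g \<in> KG"
    then obtain f' where f': "f' \<in> KG" "f = x \<star> f'" by (auto simp: W_def)
    then have "f \<star> g = x \<star> (f' \<star> g)" using xK g by (simp add: conv_assoc)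
    then show "f \<star> g \<in> W" unfolding W_def using conv_closed by blast
  qed
  have "x = x \<star> dl \<one>" using xK by simp
  then have "x \<in> W" unfolding W_def using KG_dl[OF one_closed] by blast
  have "RI D \<subseteq> W"
  proof (rule RI_subset[OF D_sub W])
    fix d assume "d \<in> D"
    then show "(dl d - dl \<one> :: 'a \<Rightarrow> 'k) \<in> W"
      unfolding D_eq_generate
      by (rule rideal_generate[OF W, rotated 2]) (use \<open>x \<in> W\<close> in \<open>auto simp: x_def\<close>)
  qed
  then show ?thesis using assms unfolding W_def x_def by blast
qed

lemma xc_RI: "dl c - dl \<one> \<in> RI D"
  using RI_dl_iff[OF D_sub c_closed] c_D by simp

text \<open>Write x = c - 1. As \<open>RI D\<close> is a two-sided ideal and equals x kG, every f x
  has the form x f'. All factors x in (x f)^m can therefore be moved to the left.\<close>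

lemma RI_D_kpow:
  fixes y :: "'a \<Rightarrow> 'k::field"
  assumes "y \<in> RI D"
  shows "\<exists>h\<in>KG. kpow G y m = kpow G (dl c - dl \<one>) m \<star> h"
proof -
  let ?x = "dl c - dl \<one> :: 'a \<Rightarrow> 'k::field"
  have 1: "\<exists>f'\<in>KG. f \<star> kpow G ?x m = kpow G ?x m \<star> f'" if "f \<in> KG" for f :: "'a \<Rightarrow> 'k" and m
    using that
  proof (induction m arbitrary: f)
    case 0 then show ?case by (intro bexI[of _ f]) auto
  next
    case (Suc m)
    obtain f1 where f1: "f1 \<in> KG" "f \<star> ?x = ?x \<star> f1"
      using RI_D_principal[OF RI_left[OF D_normal xc_RI Suc.prems]] by blast
    obtain f2 where f2: "f2 \<in> KG" "f1 \<star> kpow G ?x m = kpow G ?x m \<star> f2" using Suc.IH[OF f1(1)] by blast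
    have "f \<star> kpow G ?x (Suc m) = ?x \<star> (f1 \<star> kpow G ?x m)"
      using Suc.prems f1 by (simp add: conv_assoc[symmetric])
    also have "\<dots> = kpow G ?x (Suc m) \<star> f2" using f2 by (simp add: conv_assoc)
    finally show ?case using f2 by blast
  qed
  obtain f where f: "f \<in> KG" "y = ?x \<star> f" using RI_D_principal[OF assms] by blast
  show ?thesis
  proof (induction m)
    case 0 then show ?case by (intro bexI[of _ "dl \<one>"]) auto
  next
    case (Suc m)
    then obtain h where h: "h \<in> KG" "kpow G y m = kpow G ?x m \<star> h" by blast
    obtain f' where f': "f' \<in> KG" "f \<star> kpow G ?x m = kpow G ?x m \<star> f'" using 1[OF f(1)] by blast
    have "kpow G y (Suc m) = ?x \<star> ((f \<star> kpow G ?x m) \<star> h)"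
      using f h by (simp add: conv_assoc)
    also have "\<dots> = kpow G ?x (Suc m) \<star> (f' \<star> h)"
      unfolding f'(2) using f' h by (simp add: conv_assoc)
    finally show ?case using f' h by blast
  qed
qed

text \<open>All p^N-th powers in G are trivial, so Frobenius modulo D puts f^(p^N) into
  \<open>RI D\<close>. Its p^n-th power is a multiple of (c - 1)^(p^n) = c^(p^n) - 1 = 0.\<close>

lemma aug_zero_nilpotent:
  fixes f :: "'a \<Rightarrow> 'k::field"
  assumes char: "CHAR('k) = p" and f: "f \<in> KG" "aug f = 0"
  shows "\<exists>m. kpow G f m = 0"
proof -
  have pr: "Factorial_Ring.prime CHAR('k)" using char prime_p by simp
  have one: "g [^] (p ^ N) = \<one>" if "g \<in> carrier G" for g
    using pow_order_eq_1[OF that] order_G by (simp add: Coset.order_def)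
  have "{g \<in> carrier G. g [^] (CHAR('k) ^ N) \<in> D} = carrier G"
    using one D_one by (auto simp: char)
  then have y: "kpow G f (p ^ N) \<in> RI D"
    using RI_frobenius[OF D_normal Mod_comm[OF D_normal order_refl] pr f(1), of N] f
    by (simp add: char aug_zero_iff)
  obtain h where h: "h \<in> KG" "kpow G (kpow G f (p ^ N)) (p ^ n) = kpow G (dl c - dl \<one>) (p ^ n) \<star> h"
    using RI_D_kpow[OF y] by blast
  have "c [^] (p ^ n) = \<one>" by (simp add: c_pow_one)
  then have "kpow G (dl c - dl \<one> :: 'a \<Rightarrow> 'k) (p ^ n) = 0"
    using kpow_diff_one[OF pr c_closed, of n] by (simp add: char)
  then have "kpow G f (p ^ N * p ^ n) = 0" using h f by (simp add: kpow_mult)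
  then show ?thesis by blast
qed

section \<open>Class functions and central elements of the group algebra\<close>

lemma sum_class_function:
  fixes f :: "'a \<Rightarrow> 'k::field"
  assumes char: "CHAR('k) = p"
    and f: "\<And>h x. h \<in> carrier G \<Longrightarrow> x \<in> carrier G \<Longrightarrow> f (h \<otimes> x \<otimes> inv h) = f x"
    and A: "A \<subseteq> carrier G" "\<And>h x. h \<in> carrier G \<Longrightarrow> x \<in> A \<Longrightarrow> h \<otimes> x \<otimes> inv h \<in> A"
  shows "sum f A = sum f (A \<inter> Z)"
proof -
  define \<phi> where "\<phi> = (\<lambda>g. \<lambda>h\<in>carrier G. g \<otimes> h \<otimes> inv g)"
  interpret act: group_action G "carrier G" \<phi>
    unfolding \<phi>_def by (rule action_by_conjugation)
  let ?o = "\<lambda>x. orbit G \<phi> x"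
  have orb: "?o x = {h \<otimes> x \<otimes> inv h |h. h \<in> carrier G}" if "x \<in> carrier G" for x
    using that by (auto simp: orbit_def \<phi>_def)
  let ?B = "A - Z"
  have "finite A" using A(1) fin finite_subset by blast
  have oB: "?o x \<subseteq> ?B" if x: "x \<in> ?B" for x
  proof
    fix y assume "y \<in> ?o x"
    have xc: "x \<in> carrier G" using x A(1) by auto
    obtain h where h: "h \<in> carrier G" "y = h \<otimes> x \<otimes> inv h" using \<open>y \<in> ?o x\<close> orb[OF xc] by auto
    have "y \<notin> Z"
    proof
      assume y: "y \<in> Z"
      have "inv h \<otimes> y \<otimes> h = y" using Z_comm[OF y, of h] h(1) y by (simp add: m_assoc)
      moreover have "inv h \<otimes> y \<otimes> h = x" using h xc by (simp add: m_assoc)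
      ultimately show False using x y by simp
    qed
    then show "y \<in> ?B" using A(2)[of h x] h x by auto
  qed
  have same: "y \<in> ?o x \<longleftrightarrow> ?o y = ?o x" if "x \<in> carrier G" "y \<in> carrier G" for x y
  proof
    assume "y \<in> ?o x"
    show "?o y = ?o x"
    proof (rule act.disjoint_union[of "?o y" "?o x", THEN disjE])
      show "?o y \<in> orbits G (carrier G) \<phi>" "?o x \<in> orbits G (carrier G) \<phi>"
        using that by (auto simp: orbits_def)
      assume "?o y \<inter> ?o x = {}"
      then show "?o y = ?o x" using \<open>y \<in> ?o x\<close> act.orbit_refl[OF that(2)] by blast
    qed
  next
    assume "?o y = ?o x"
    then show "y \<in> ?o x" using act.orbit_refl[OF that(2)] by simp
  qed
  have zero: "sum f (?o x) = 0" if x: "x \<in> ?B" for x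
  proof -
    have xc: "x \<in> carrier G" using x A(1) by auto
    have fo: "finite (?o x)" using orb[OF xc] fin by simp
    have "f y = f x" if "y \<in> ?o x" for y using that orb[OF xc] f xc by auto
    then have s: "sum f (?o x) = of_nat (card (?o x)) * f x" by simp
    \<comment> \<open>Class lengths divide the order of G, hence are powers of p; a class of length
      1 would be central. So the length of a noncentral class vanishes in k.\<close>
    have "card (?o x) dvd p ^ N"
      using act.orbit_stabilizer_theorem[OF xc] order_G by (metis dvd_triv_left Coset.order_def)
    then obtain i where i: "card (?o x) = p ^ i" using divides_primepow_nat[OF prime_p] by blast
    have "card (?o x) \<noteq> 1"
    proof
      assume "card (?o x) = 1"
      then have "?o x = {x}" using act.orbit_refl[OF xc] by (metis card_1_singletonE singletonD)
      then have "h \<otimes> x \<otimes> inv h = x" if "h \<in> carrier G" for h using orb[OF xc] that by auto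
      then have "h \<otimes> x = x \<otimes> h" if "h \<in> carrier G" for h
        using inv_solve_right'[of x "h \<otimes> x" h] that xc by auto
      then have "x \<in> Z" using xc by (intro ZI) auto
      then show False using x by simp
    qed
    then have "p dvd card (?o x)" using i by (cases i) auto
    then have "(of_nat (card (?o x)) :: 'k) = 0" by (simp add: of_nat_eq_0_iff_char_dvd char)
    then show ?thesis using s by simp
  qed
  have "sum f ?B = (\<Sum>U\<in>?o ` ?B. sum f {x \<in> ?B. ?o x = U})"
    using \<open>finite A\<close> by (intro sum.group[symmetric]) auto
  also have "\<dots> = 0"
  proof (rule sum.neutral, rule ballI)
    fix U assume "U \<in> ?o ` ?B"
    then obtain x where x: "x \<in> ?B" "U = ?o x" by blast
    have "{y \<in> ?B. ?o y = U} = ?o x"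
      using same oB[OF x(1)] A(1) x by auto
    then show "sum f {x \<in> ?B. ?o x = U} = 0" using zero[OF x(1)] by simp
  qed
  finally have "sum f ?B = 0" .
  moreover have "sum f A = sum f (A \<inter> Z) + sum f ?B"
    using \<open>finite A\<close> by (rule sum.Int_Diff)
  ultimately show ?thesis by simp
qed

lemma central_class_function:
  assumes f: "f \<in> KG" and cen: "\<And>g. g \<in> KG \<Longrightarrow> f \<star> g = g \<star> f"
    and h: "h \<in> carrier G" and x: "x \<in> carrier G"
  shows "f (h \<otimes> x \<otimes> inv h) = f x"
proof -
  have "(f \<star> dl h) (h \<otimes> x) = (dl h \<star> f) (h \<otimes> x)" using cen[of "dl h"] h by simp
  then show ?thesis using f h x by (simp add: conv_dl_right conv_dl_left)
qed

lemma ZD_sub: "subgroup ZD G" by (rule normal_imp_subgroup[OF ZD_normal])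
lemma ZD_D: "D \<subseteq> ZD" unfolding ZD_def set_mult_def using Z_one by force
lemma ZD_Z: "Z \<subseteq> ZD" unfolding ZD_def set_mult_def using D_one by force

lemma conj_rcos:
  assumes L: "subgroup L G" "D \<subseteq> L" and y: "y \<in> carrier G" and h: "h \<in> carrier G" and x: "x \<in> L #> y"
  shows "h \<otimes> x \<otimes> inv h \<in> L #> y"
proof -
  obtain m where m: "m \<in> L" "x = m \<otimes> y" using x by (auto simp: r_coset_def)
  have xc: "x \<in> carrier G" and mc: "m \<in> carrier G" using m y subgroup.mem_carrier[OF L(1)] by auto
  have "h \<otimes> x \<otimes> inv h = (cm h x \<otimes> m) \<otimes> y"
    using cm_conj[OF h xc] h xc mc y by (simp add: m(2) m_assoc)
  moreover have "cm h x \<otimes> m \<in> L" using cm_D[OF h xc] L m subgroup.m_closed[OF L(1)] by auto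
  ultimately show ?thesis by (auto simp: r_coset_def)
qed

text \<open>Cosets of ZD are stable under conjugation because ZD contains D, so only their central
  elements count. The coset ZD itself contains all of Z, over which f sums to its augmentation 0;
  the other cosets contain no central element.\<close>

lemma central_RI_ZD:
  fixes f :: "'a \<Rightarrow> 'k::field"
  assumes char: "CHAR('k) = p" and f: "f \<in> KG" "aug f = 0" and cen: "\<And>g. g \<in> KG \<Longrightarrow> f \<star> g = g \<star> f"
  shows "f \<in> RI ZD"
proof -
  have cf: "f (h \<otimes> x \<otimes> inv h) = f x" if "h \<in> carrier G" "x \<in> carrier G" for h x
    using central_class_function[OF f(1) _ that] cen by blast
  have Z0: "sum f Z = 0"
  proof -
    have "sum f (carrier G) = sum f (carrier G \<inter> Z)"
      by (rule sum_class_function[OF char cf]) auto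
    moreover have "carrier G \<inter> Z = Z" by auto
    ultimately show ?thesis using f by (simp add: aug_eq)
  qed
  have "sum f (ZD #> y) = 0" if y: "y \<in> carrier G" for y
  proof -
    have "sum f (ZD #> y) = sum f ((ZD #> y) \<inter> Z)"
      by (rule sum_class_function[OF char cf])
         (use conj_rcos[OF ZD_sub ZD_D y] r_coset_subset_G[OF subgroup.subset[OF ZD_sub] y] in auto)
    also have "\<dots> = 0"
    proof (cases "y \<in> ZD")
      case True
      then have "(ZD #> y) \<inter> Z = Z" using ZD_Z coset_join2[OF y ZD_sub] by auto
      then show ?thesis using Z0 by simp
    next
      case False
      have "z \<notin> ZD #> y" if "z \<in> Z" for z
      proof
        assume "z \<in> ZD #> y"
        then have "ZD #> z = ZD #> y" using mem_rcos_iff[OF ZD_sub y] that by auto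
        moreover have "ZD #> z = ZD" using that ZD_Z by (intro coset_join2 ZD_sub) auto
        ultimately show False using False rcos_self[OF y ZD_sub] by simp
      qed
      then have "(ZD #> y) \<inter> Z = {}" by auto
      then show ?thesis by simp
    qed
    finally show ?thesis .
  qed
  then show ?thesis using f by (simp add: RI_def)
qed

lemma D_last_power:
  assumes "e \<in> D" "e \<noteq> \<one>"
  shows "\<exists>l. e [^] (p ^ l) \<noteq> \<one> \<and> e [^] (p ^ Suc l) = \<one>"
proof -
  define j where "j = (LEAST j. e [^] (p ^ j) = \<one>)"
  have j: "e [^] (p ^ j) = \<one>" unfolding j_def by (rule LeastI[of _ n]) (rule D_pow_pn[OF assms(1)])
  have min: "i < j \<Longrightarrow> e [^] (p ^ i) \<noteq> \<one>" for i unfolding j_def by (rule not_less_Least)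
  have "j \<noteq> 0"
  proof
    assume "j = 0"
    then show False using j assms by simp
  qed
  then obtain l where "j = Suc l" using not0_implies_Suc by blast
  then show ?thesis using j min[of l] by auto
qed

text \<open>\<open>act h\<close> is 1 modulo p, so conjugation fixes every d in D with d^p =
  1.\<close>

lemma D_order_p_M:
  assumes "x \<in> D" "x [^] p = \<one>"
  shows "x \<in> M"
proof -
  have "x \<otimes> h = h \<otimes> x" if h: "h \<in> carrier G" for h
  proof -
    obtain i where i: "act h = 1 + p * i"
      using act_cong[OF h] act_ge[OF h] by (metis cong_altdef_nat cong_sym dvdE le_add_diff_inverse)
    have "h \<otimes> x \<otimes> inv h = (x [^] p) [^] i \<otimes> x"
      using act[OF h assms(1)] assms(1) by (simp add: i nat_pow_pow)
    also have "\<dots> = x" using assms by simp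
    finally show ?thesis using inv_solve_right'[of x "h \<otimes> x" h] h assms by simp
  qed
  then show ?thesis using assms by (auto simp: M_def intro!: ZI)
qed

text \<open>Every noncentral y is conjugate to m y for some m in M other than 1. Start from a
  nontrivial commutator of y and push it down to order p by a power: of h if y is in C, of c if not.
  Elements of D of order p lie in M.\<close>

lemma noncentral_commutator_M:
  assumes y: "y \<in> carrier G" "y \<notin> Z"
  shows "\<exists>h\<in>carrier G. cm h y \<in> M \<and> cm h y \<noteq> \<one>"
proof (cases "y \<in> C")
  case True
  have "\<exists>h\<in>carrier G. cm h y \<noteq> \<one>"
  proof (rule ccontr)
    assume "\<not> ?thesis"
    then have "y \<otimes> h = h \<otimes> y" if "h \<in> carrier G" for h using that y cm_eq_one_iff[of h y] by auto
    then show False using y by (auto intro: ZI)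
  qed
  then obtain h where h: "h \<in> carrier G" "cm h y \<noteq> \<one>" by blast
  let ?e = "cm h y"
  have e: "?e \<in> D" using h y by (intro cm_D)
  obtain l where l: "?e [^] (p ^ l) \<noteq> \<one>" "?e [^] (p ^ Suc l) = \<one>" using D_last_power[OF e h(2)] by blast
  obtain u where u: "(\<Sum>i<p ^ l. act h ^ i) = p ^ l * u" "[u = 1] (mod p)"
    using geom_sum_prime_power[OF prime_p odd_p act_cong[OF h(1)]] by blast
  obtain w where w: "\<forall>d\<in>D. d [^] (u * w) = d" using D_unit_root[OF cong_1_coprime[OF u(2)]] by blast
  have c: "cm (h [^] (p ^ l)) y = (?e [^] (p ^ l)) [^] u"
    using cm_pow_left[OF h(1) True, of "p ^ l"] u h y by (simp add: nat_pow_pow)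
  have "(?e [^] (p ^ l)) [^] u \<noteq> \<one>"
  proof
    assume "(?e [^] (p ^ l)) [^] u = \<one>"
    then have "((?e [^] (p ^ l)) [^] u) [^] w = \<one>" by simp
    then have "(?e [^] (p ^ l)) [^] (u * w) = \<one>" unfolding mult.assoc[symmetric] using h y by (simp add: nat_pow_pow mult.assoc)
    then show False using w D_pow[OF e] l by simp
  qed
  moreover have "(?e [^] (p ^ l)) [^] u \<in> M"
  proof (rule D_order_p_M)
    have "((?e [^] (p ^ l)) [^] u) [^] p = (?e [^] (p ^ Suc l)) [^] u"
      using h y by (simp add: nat_pow_pow mult_ac)
    then show "((?e [^] (p ^ l)) [^] u) [^] p = \<one>" using l by simp
  qed (simp add: D_pow e)
  ultimately show ?thesis using h by (intro bexI[of _ "h [^] (p ^ l)"]) (auto simp: c)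
next
  case False
  let ?e = "cm y c"
  have e: "?e \<in> D" using y by (intro cm_D) auto
  have "?e \<noteq> \<one>"
  proof
    assume "?e = \<one>"
    then have "y \<otimes> c = c \<otimes> y" using y cm_eq_one_iff[of y c] by simp
    then have "y \<otimes> c [^] i = c [^] i \<otimes> y" for i :: nat
      using group_commutes_pow[of c y i] y by simp
    then show False using False y by (auto simp: D_eq intro!: CI)
  qed
  then obtain l where l: "?e [^] (p ^ l) \<noteq> \<one>" "?e [^] (p ^ Suc l) = \<one>" using D_last_power[OF e] by blast
  have c: "cm y (c [^] (p ^ l)) = ?e [^] (p ^ l)" using y by (intro cm_pow_right) (auto simp: D_C c_D)
  have "?e [^] (p ^ l) \<in> M"
    using l y by (intro D_order_p_M D_pow e) (simp add: nat_pow_pow mult.commute)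
  then have "inv (cm y (c [^] (p ^ l))) \<in> M" "inv (cm y (c [^] (p ^ l))) \<noteq> \<one>"
    using l y subgroup.m_inv_closed[OF M_sub] by (auto simp: c)
  then show ?thesis using y by (intro bexI[of _ "c [^] (p ^ l)"]) (auto simp: cm_inv)
qed

text \<open>For central y the central part of the coset D y is exactly M y, so the sum over M y
  equals the one over D y. For other y choose m = [h, y] in M. Conjugating v y by h gives m v y for
  v in M, so f is constant along the cosets of the group generated by m, and their size is 0 in
  k.\<close>

lemma central_RI_M:
  fixes f :: "'a \<Rightarrow> 'k::field"
  assumes char: "CHAR('k) = p" and f: "f \<in> RI D" and cen: "\<And>g. g \<in> KG \<Longrightarrow> f \<star> g = g \<star> f"
  shows "f \<in> RI M"
proof -
  have cf: "f (h \<otimes> x \<otimes> inv h) = f x" if "h \<in> carrier G" "x \<in> carrier G" for h x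
    using central_class_function[OF RI_KG[OF f] _ that] cen by blast
  have MZ: "M \<subseteq> Z" and MD: "M \<subseteq> D" by (auto simp: M_def)
  have "sum f (M #> y) = 0" if y: "y \<in> carrier G" for y
  proof (cases "y \<in> Z")
    case True
    have "sum f (D #> y) = sum f ((D #> y) \<inter> Z)"
      by (rule sum_class_function[OF char cf])
         (use conj_rcos[OF D_sub order_refl y] r_coset_subset_G[OF subgroup.subset[OF D_sub] y] in auto)
    moreover have "(D #> y) \<inter> Z = M #> y"
    proof -
      have "d \<otimes> y \<in> Z \<longleftrightarrow> d \<in> Z" if "d \<in> D" for d
      proof
        assume "d \<otimes> y \<in> Z"
        then have "d \<otimes> y \<otimes> inv y \<in> Z" using Z_mult Z_inv[OF True] by blast
        then show "d \<in> Z" using that y by (simp add: m_assoc)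
      qed (use True Z_mult in auto)
      then show ?thesis by (auto simp: r_coset_def M_def)
    qed
    ultimately show ?thesis using f y by (simp add: RI_def)
  next
    case False
    obtain h where h: "h \<in> carrier G" "cm h y \<in> M" "cm h y \<noteq> \<one>" using noncentral_commutator_M[OF y False] by blast
    let ?m = "cm h y"
    let ?K = "generate G {?m}"
    have mc: "?m \<in> carrier G" using h y by simp
    have K: "subgroup ?K G" using mc by (intro generate_is_subgroup) auto
    have KM: "?K \<subseteq> M" using h by (intro generate_subgroup_incl M_sub) auto
    have inv: "f (?m \<otimes> (v \<otimes> y)) = f (v \<otimes> y)" if v: "v \<in> M" for v
    proof -
      have vc: "v \<in> carrier G" "v \<in> Z" using v MZ by auto
      have "h \<otimes> (v \<otimes> y) \<otimes> inv h = (h \<otimes> v) \<otimes> y \<otimes> inv h"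
        using vc(1) h(1) y by (simp add: m_assoc)
      also have "h \<otimes> v = v \<otimes> h" using Z_comm[OF vc(2) h(1)] by simp
      also have "v \<otimes> h \<otimes> y \<otimes> inv h = v \<otimes> (h \<otimes> y \<otimes> inv h)"
        using vc(1) h(1) y by (simp add: m_assoc)
      also have "\<dots> = v \<otimes> (?m \<otimes> y)" using cm_conj[OF h(1) y] by simp
      also have "\<dots> = (v \<otimes> ?m) \<otimes> y" using vc(1) mc y by (simp add: m_assoc)
      also have "v \<otimes> ?m = ?m \<otimes> v" by (rule Z_comm[OF vc(2) mc])
      also have "?m \<otimes> v \<otimes> y = ?m \<otimes> (v \<otimes> y)" using vc(1) mc y by (simp add: m_assoc)
      finally show ?thesis using cf[OF h(1), of "v \<otimes> y"] vc y by simp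
    qed
    have invK: "f (k \<otimes> (v \<otimes> y)) = f (v \<otimes> y)" if k: "k \<in> ?K" and v: "v \<in> M" for k v
    proof -
      have "ord ?m \<noteq> 0" using fin mc by (metis ord_ge_1 not_one_le_zero)
      then obtain i :: nat where i: "k = ?m [^] i" using k generate_pow_nat[OF mc] by auto
      show ?thesis unfolding i
      proof (induction i)
        case 0 then show ?case using v y MZ by auto
      next
        case (Suc i)
        have vM: "?m [^] i \<otimes> v \<in> M" using v h subgroup_pow_closed[OF M_sub h(2)] subgroup.m_closed[OF M_sub] by blast
        have vc: "v \<in> carrier G" using v MZ by auto
        have "?m [^] Suc i \<otimes> (v \<otimes> y) = ?m \<otimes> (?m [^] i \<otimes> v \<otimes> y)"
          using mc vc y nat_pow_Suc2[OF mc, of i] by (simp add: m_assoc del: nat_pow_Suc)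
        then show ?case using inv[OF vM] Suc mc vc y by (simp add: m_assoc del: nat_pow_Suc)
      qed
    qed
    have cardK: "(of_nat (card ?K) :: 'k) = 0"
    proof -
      have "card ?K dvd p ^ N" using generate_pow_card[OF mc] ord_dvd_group_order[OF mc] order_G
        by (simp add: Coset.order_def)
      then obtain i where i: "card ?K = p ^ i" using divides_primepow_nat[OF prime_p] by blast
      have "card ?K \<noteq> 1" using generate_pow_card[OF mc] ord_eq_1[OF mc] h by simp
      then have "p dvd card ?K" using i by (cases i) auto
      then show ?thesis by (simp add: of_nat_eq_0_iff_char_dvd char)
    qed
    define g where "g v = (if v \<in> M then f (v \<otimes> y) else 0)" for v
    have "sum f (M #> y) = (\<Sum>v\<in>M. f (v \<otimes> y))"
    proof -
      have "M #> y = (\<lambda>v. v \<otimes> y) ` M" by (auto simp: r_coset_def)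
      moreover have "inj_on (\<lambda>v. v \<otimes> y) M" using y MD by (intro inj_onI) (auto simp: subset_iff)
      ultimately show ?thesis by (simp add: sum.reindex)
    qed
    also have "\<dots> = (\<Sum>v\<in>carrier G. g v)"
      unfolding g_def using MD by (intro sum.mono_neutral_cong_left[OF fin]) auto
    also have "\<dots> = (\<Sum>Y\<in>rcosets ?K. \<Sum>v\<in>Y. g v)" by (rule sum_rcosets[OF K])
    also have "\<dots> = 0"
    proof (rule sum.neutral, rule ballI)
      fix Y assume "Y \<in> rcosets ?K"
      then obtain w where w: "w \<in> carrier G" "Y = ?K #> w" by (auto simp: RCOSETS_def)
      have "g v = g w" if v: "v \<in> Y" for v
      proof -
        obtain k where k: "k \<in> ?K" "v = k \<otimes> w" using v w by (auto simp: r_coset_def)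
        have kM: "k \<in> M" and kc: "k \<in> carrier G" using k KM MD by auto
        have "v \<in> M \<longleftrightarrow> w \<in> M"
        proof
          assume "v \<in> M"
          then have "inv k \<otimes> v \<in> M" using subgroup.m_closed[OF M_sub] subgroup.m_inv_closed[OF M_sub kM] by blast
          then show "w \<in> M" using k kc w by simp
        qed (use k kM subgroup.m_closed[OF M_sub] in auto)
        then show ?thesis using invK[OF k(1), of w] k kc w y by (simp add: g_def m_assoc)
      qed
      then have "(\<Sum>v\<in>Y. g v) = of_nat (card Y) * g w" by simp
      also have "card Y = card ?K" using w subgroup.subset[OF K]
        by (metis card_rcosets_equal rcosetsI)
      finally show "(\<Sum>v\<in>Y. g v) = 0" using cardK by simp
    qed
    finally show ?thesis .
  qed
  then show ?thesis using RI_KG[OF f] by (simp add: RI_def)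
qed

lemma RI_C_iff:
  fixes f :: "'a \<Rightarrow> 'k::field"
  assumes char: "CHAR('k) = p" and f: "f \<in> KG"
  shows "f \<in> RI C \<longleftrightarrow> kpow G f (p ^ s) \<in> RI ZD"
proof -
  have "{g \<in> carrier G. g [^] (CHAR('k) ^ s) \<in> ZD} = C" unfolding char using C_iff C_carrier by blast
  then show ?thesis
    using RI_frobenius[OF ZD_normal Mod_comm[OF ZD_normal ZD_D] _ f, of s] prime_p by (simp add: char)
qed

definition PD where "PD j = P j <#> D"

lemma PD_normal: "PD j \<lhd> G"
proof (rule normal_invI)
  show "subgroup (PD j) G" unfolding PD_def using mult_norm_subgroup[OF P_normal D_sub] .
  fix x h assume x: "x \<in> carrier G" and "h \<in> PD j"
  then obtain z d where zd: "z \<in> P j" "d \<in> D" "h = z \<otimes> d" by (auto simp: PD_def set_mult_def)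
  have zc: "z \<in> carrier G" using zd subgroup.mem_carrier[OF P_sub] by blast
  have "x \<otimes> h \<otimes> inv x = (x \<otimes> z \<otimes> inv x) \<otimes> (x \<otimes> d \<otimes> inv x)"
    using x zc zd by (simp add: m_assoc)
  then show "x \<otimes> h \<otimes> inv x \<in> PD j"
    using conj_D[OF x zd(2)] normal.inv_op_closed2[OF P_normal x zd(1)] unfolding PD_def set_mult_def by blast
qed

lemma PD_sub: "subgroup (PD j) G" by (rule normal_imp_subgroup[OF PD_normal])
lemma PD_D: "D \<subseteq> PD j"
proof
  fix d assume d: "d \<in> D"
  then have "\<one> \<otimes> d \<in> PD j" unfolding PD_def set_mult_def using subgroup.one_closed[OF P_sub] by blast
  then show "d \<in> PD j" using d by simp
qed
lemma PD_P: "P j \<subseteq> PD j"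
proof
  fix z assume z: "z \<in> P j"
  then have "z \<otimes> \<one> \<in> PD j" unfolding PD_def set_mult_def using D_one by blast
  then show "z \<in> PD j" using z subgroup.mem_carrier[OF P_sub] by simp
qed

text \<open>C is contained in the preimage of \<open>PD j\<close> under the p^j-th power map;
  monotonicity of \<open>RI\<close> and \<open>RI_frobenius\<close> do the rest.\<close>

lemma RI_C_power:
  fixes f :: "'a \<Rightarrow> 'k::field"
  assumes char: "CHAR('k) = p" and f: "f \<in> RI C"
  shows "kpow G f (p ^ j) \<in> RI (PD j)"
proof -
  let ?K = "{g \<in> carrier G. g [^] (CHAR('k) ^ j) \<in> PD j}"
  have Q: "comm_group (G Mod PD j)" by (rule Mod_comm[OF PD_normal PD_D])
  have "C \<subseteq> ?K" using PD_P by (auto simp: char P_def)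
  then have "f \<in> RI ?K" using f RI_mono[OF C_sub power_preimage_subgroup(1)[OF PD_normal Q]] by blast
  then show ?thesis
    using RI_frobenius[OF PD_normal Q _ RI_KG[OF f], of j] prime_p by (simp add: char)
qed

end

section \<open>Isomorphisms of group algebras\<close>

lemma independent_dl:
  "\<not> module.dependent sc (dl ` S :: ('b \<Rightarrow> 'k::field) set)"
proof
  interpret vs: vector_space "sc :: 'k \<Rightarrow> ('b \<Rightarrow> 'k) \<Rightarrow> 'b \<Rightarrow> 'k" by (rule vector_space_sc)
  assume "vs.dependent (dl ` S :: ('b \<Rightarrow> 'k) set)"
  then have "\<exists>t u. finite t \<and> t \<subseteq> (dl ` S :: ('b \<Rightarrow> 'k) set) \<and> (\<Sum>v\<in>t. sc (u v) v) = 0 \<and> (\<exists>v\<in>t. u v \<noteq> 0)"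
    unfolding vs.dependent_explicit .
  then obtain t u v where t: "finite t" "t \<subseteq> (dl ` S :: ('b \<Rightarrow> 'k) set)" "(\<Sum>v\<in>t. sc (u v) v) = 0" "v \<in> t" "u v \<noteq> 0"
    by (elim exE conjE bexE) (rule that)
  obtain x where x: "v = dl x" using t by auto
  have "(\<Sum>w\<in>t. sc (u w) w) x = (\<Sum>w\<in>t. if w = v then u w else 0)"
    unfolding sum_fun_apply
  proof (rule sum.cong[OF refl])
    fix w assume "w \<in> t"
    then obtain z where z: "w = dl z" using t by auto
    show "sc (u w) w x = (if w = v then u w else 0)"
    proof (cases "z = x")
      case True then show ?thesis by (simp add: z x pw dl_apply)
    next
      case False
      then have "w z \<noteq> v z" by (simp add: z x dl_apply)
      then have "w \<noteq> v" by auto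
      then show ?thesis using False by (simp add: z pw dl_apply)
    qed
  qed
  also have "\<dots> = u v" using t by simp
  finally show False using t by (simp add: pw)
qed

lemma inj_dl: "inj (dl :: 'b \<Rightarrow> 'b \<Rightarrow> 'k::field)"
proof (rule injI)
  fix x y assume "(dl x :: 'b \<Rightarrow> 'k) = dl y"
  then have "(dl x :: 'b \<Rightarrow> 'k) x = dl y x" by simp
  then show "x = y" by (simp add: dl_apply split: if_splits)
qed

text \<open>Point masses are linearly independent. Finiteness is part of the conclusion because this
  is also how H is shown to be finite.\<close>

lemma card_le_of_span:
  fixes S :: "'b set" and T :: "('b \<Rightarrow> 'k::field) set"
  assumes "finite T" "\<And>x. x \<in> S \<Longrightarrow> dl x \<in> module.span sc T"
  shows "finite S \<and> card S \<le> card T"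
proof -
  interpret vs: vector_space "sc :: 'k \<Rightarrow> ('b \<Rightarrow> 'k) \<Rightarrow> 'b \<Rightarrow> 'k" by (rule vector_space_sc)
  have "finite (dl ` S :: ('b \<Rightarrow> 'k) set) \<and> card (dl ` S :: ('b \<Rightarrow> 'k) set) \<le> card T"
    using assms independent_dl[of S] by (intro vs.independent_span_bound) auto
  then show ?thesis using inj_on_subset[OF inj_dl] by (metis card_image finite_imageD subset_UNIV)
qed

text \<open>A k-algebra isomorphism between finite group algebras, restated with plain function
  operations on \<open>KG\<close>. Compatibility with the augmentation is derived in
  \<open>aug_preserved\<close>.\<close>

locale kiso = G: fgroup G + H: fgroup H
  for G :: "('a, 'c) monoid_scheme" and H :: "('b, 'd) monoid_scheme" +
  fixes \<phi> :: "('a \<Rightarrow> 'k::field) \<Rightarrow> ('b \<Rightarrow> 'k)"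
  assumes bij: "bij_betw \<phi> G.KG H.KG"
    and add: "f \<in> G.KG \<Longrightarrow> g \<in> G.KG \<Longrightarrow> \<phi> (f + g) = \<phi> f + \<phi> g"
    and mult: "f \<in> G.KG \<Longrightarrow> g \<in> G.KG \<Longrightarrow> \<phi> (conv G f g) = conv H (\<phi> f) (\<phi> g)"
    and one: "\<phi> (dl \<one>\<^bsub>G\<^esub>) = dl \<one>\<^bsub>H\<^esub>"
    and scal: "f \<in> G.KG \<Longrightarrow> \<phi> (sc a f) = sc a (\<phi> f)"
begin

lemma closed [simp, intro]: "f \<in> G.KG \<Longrightarrow> \<phi> f \<in> H.KG"
  using bij by (auto simp: bij_betw_def)

lemma surj: "g \<in> H.KG \<Longrightarrow> \<exists>f\<in>G.KG. g = \<phi> f"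
  using bij by (auto simp: bij_betw_def)

lemma inject: "f \<in> G.KG \<Longrightarrow> g \<in> G.KG \<Longrightarrow> \<phi> f = \<phi> g \<Longrightarrow> f = g"
  using bij by (auto simp: bij_betw_def inj_on_def)

lemma zero: "\<phi> 0 = 0"
  using scal[OF G.KG_zero, of 0] by simp

lemma minus: "f \<in> G.KG \<Longrightarrow> g \<in> G.KG \<Longrightarrow> \<phi> (f - g) = \<phi> f - \<phi> g"
proof -
  assume "f \<in> G.KG" "g \<in> G.KG"
  then have "\<phi> ((f - g) + g) = \<phi> (f - g) + \<phi> g" by (intro add) auto
  then show ?thesis by (simp add: diff_eq_eq[symmetric])
qed

lemma sum: "(\<And>i. i \<in> I \<Longrightarrow> F i \<in> G.KG) \<Longrightarrow> \<phi> (\<Sum>i\<in>I. F i) = (\<Sum>i\<in>I. \<phi> (F i))"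
proof (induction I rule: infinite_finite_induct)
  case (insert x J)
  then have "F x \<in> G.KG" "(\<Sum>i\<in>J. F i) \<in> G.KG" by auto
  then show ?case using insert by (simp add: add)
qed (auto simp: zero)

lemma kpow: "f \<in> G.KG \<Longrightarrow> \<phi> (kpow G f m) = kpow H (\<phi> f) m"
  by (induction m) (auto simp: one mult)

lemma inv_kiso: "kiso H G (inv_into G.KG \<phi>)"
proof -
  have b: "bij_betw (inv_into G.KG \<phi>) H.KG G.KG" using bij by (rule bij_betw_inv_into)
  have e: "inv_into G.KG \<phi> (\<phi> f) = f" if "f \<in> G.KG" for f
    using bij that by (auto simp: bij_betw_def)
  show ?thesis
  proof (intro kiso.intro kiso_axioms.intro)
    show "fgroup H" "fgroup G" by unfold_locales
    fix f g :: "'b \<Rightarrow> 'k" and a :: 'k assume "f \<in> H.KG"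
    then obtain f' where f': "f' \<in> G.KG" "f = \<phi> f'" using surj by blast
    show "inv_into G.KG \<phi> (sc a f) = sc a (inv_into G.KG \<phi> f)"
      using f' e[of "sc a f'"] by (simp add: e scal)
    assume "g \<in> H.KG"
    then obtain g' where g': "g' \<in> G.KG" "g = \<phi> g'" using surj by blast
    show "inv_into G.KG \<phi> (f + g) = inv_into G.KG \<phi> f + inv_into G.KG \<phi> g"
      using f' g' e[OF G.KG_add[OF f'(1) g'(1)]] by (simp add: e add)
    show "inv_into G.KG \<phi> (conv H f g) = conv G (inv_into G.KG \<phi> f) (inv_into G.KG \<phi> g)"
      using f' g' e[OF G.conv_closed[of f' g']] by (simp add: e mult)
  next
    show "inv_into G.KG \<phi> (dl \<one>\<^bsub>H\<^esub>) = dl \<one>\<^bsub>G\<^esub>" using e[of "dl \<one>\<^bsub>G\<^esub>"] by (simp add: one)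
  qed (rule b)
qed

lemma rideal_preimage:
  assumes "H.rideal W"
  shows "G.rideal {f \<in> G.KG. \<phi> f \<in> W}"
  using assms by (auto simp: H.rideal_def G.rideal_def zero add mult)

lemma image_RI_subset:
  assumes N: "subgroup N G" and W: "H.rideal W" and "\<And>n. n \<in> N \<Longrightarrow> \<phi> (dl n - dl \<one>\<^bsub>G\<^esub>) \<in> W"
  shows "\<phi> ` G.RI N \<subseteq> W"
proof -
  have "G.RI N \<subseteq> {f \<in> G.KG. \<phi> f \<in> W}"
    by (rule G.RI_subset[OF N rideal_preimage[OF W]])
       (use assms(3) subgroup.mem_carrier[OF N] in auto)
  then show ?thesis by auto
qed

lemma image_RI_derived: "\<phi> ` G.RI (derived G (carrier G)) \<subseteq> H.RI (derived H (carrier H))"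
proof -
  have "G.RI (derived G (carrier G)) \<subseteq> {f \<in> G.KG. \<phi> f \<in> H.RI (derived H (carrier H))}"
  proof (rule G.RI_derived_subset[OF rideal_preimage])
    show "H.rideal (H.RI (derived H (carrier H)) :: ('b \<Rightarrow> 'k) set)"
      by (intro H.rideal_RI H.derived_is_subgroup) simp
    fix f g :: "'a \<Rightarrow> 'k" assume "f \<in> G.KG" "g \<in> G.KG"
    then show "conv G f g - conv G g f \<in> {f \<in> G.KG. \<phi> f \<in> H.RI (derived H (carrier H))}"
      using H.RI_commutator[OF H.derived_self_is_normal H.derived_quot_is_comm_group, of "\<phi> f" "\<phi> g"]
      by (simp add: minus mult)
  qed
  then show ?thesis by auto
qed

text \<open>The map from kG through kH onto k[H/M] is surjective and takes one value on each coset
  of N, so k[H/M] is spanned by as many vectors as N has cosets.\<close>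

lemma card_rcosets_le:
  assumes N: "subgroup N G" and M: "M \<lhd> H" and sub: "\<phi> ` G.RI N \<subseteq> H.RI M"
  shows "card (rcosets\<^bsub>H\<^esub> M) \<le> card (rcosets\<^bsub>G\<^esub> N)"
proof -
  interpret vs: vector_space "sc :: 'k \<Rightarrow> ('b set \<Rightarrow> 'k) \<Rightarrow> 'b set \<Rightarrow> 'k" by (rule vector_space_sc)
  define r where "r Y = (SOME y. y \<in> Y)" for Y :: "'a set"
  have r: "r (N #>\<^bsub>G\<^esub> x) \<in> N #>\<^bsub>G\<^esub> x" if "x \<in> carrier G" for x
    unfolding r_def by (rule someI[of _ x]) (use that N G.rcos_self in auto)
  define V where "V = (\<lambda>Y. H.push M (\<phi> (dl (r Y)))) ` (rcosets\<^bsub>G\<^esub> N)"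
  have fV: "finite (rcosets\<^bsub>G\<^esub> N)" using G.fin by (simp add: RCOSETS_def)
  have g: "H.push M (\<phi> (dl g)) \<in> V" if g: "g \<in> carrier G" for g
  proof -
    have rc: "r (N #>\<^bsub>G\<^esub> g) \<in> carrier G"
      using r[OF g] G.r_coset_subset_G[OF subgroup.subset[OF N] g] by auto
    have "N #>\<^bsub>G\<^esub> g = N #>\<^bsub>G\<^esub> r (N #>\<^bsub>G\<^esub> g)"
      using G.mem_rcos_iff[OF N g rc] r[OF g] by simp
    then have "dl g - dl (r (N #>\<^bsub>G\<^esub> g)) \<in> G.RI N" by (intro G.RI_diff N g rc)
    then have "\<phi> (dl g - dl (r (N #>\<^bsub>G\<^esub> g))) \<in> H.RI M" using sub by auto
    then have z: "H.push M (\<phi> (dl g - dl (r (N #>\<^bsub>G\<^esub> g)))) = 0"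
      using H.RI_iff_push[OF M closed[OF G.KG_minus[OF G.KG_dl[OF g] G.KG_dl[OF rc]]]] by simp
    have "\<phi> (dl g) = \<phi> (dl g - dl (r (N #>\<^bsub>G\<^esub> g))) + \<phi> (dl (r (N #>\<^bsub>G\<^esub> g)))"
      using g rc by (simp add: minus)
    then have "H.push M (\<phi> (dl g)) = H.push M (\<phi> (dl (r (N #>\<^bsub>G\<^esub> g))))"
      using H.push_add[of M "\<phi> (dl g - dl (r (N #>\<^bsub>G\<^esub> g)))" "\<phi> (dl (r (N #>\<^bsub>G\<^esub> g)))"] z by simp
    moreover have "N #>\<^bsub>G\<^esub> g \<in> rcosets\<^bsub>G\<^esub> N" using g subgroup.subset[OF N] by (intro G.rcosetsI)
    ultimately show ?thesis unfolding V_def by (auto intro: image_eqI)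
  qed
  have "dl Y \<in> vs.span V" if "Y \<in> rcosets\<^bsub>H\<^esub> M" for Y
  proof -
    obtain h where h: "h \<in> carrier H" "Y = M #>\<^bsub>H\<^esub> h" using \<open>Y \<in> rcosets\<^bsub>H\<^esub> M\<close> by (auto simp: RCOSETS_def)
    obtain f where f: "f \<in> G.KG" "dl h = \<phi> f" using surj[of "dl h"] h by auto
    have "dl Y = H.push M (dl h :: 'b \<Rightarrow> 'k)" unfolding h(2) by (rule H.push_dl[OF h(1), symmetric])
    also have "\<dots> = H.push M (\<phi> f)" by (simp only: f(2))
    also have "\<phi> f = \<phi> (\<Sum>g\<in>carrier G. sc (f g) (dl g))" using G.KG_expand[OF f(1)] by simp
    also have "\<dots> = (\<Sum>g\<in>carrier G. \<phi> (sc (f g) (dl g)))" by (rule sum) auto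
    also have "\<dots> = (\<Sum>g\<in>carrier G. sc (f g) (\<phi> (dl g)))" by (rule sum.cong) (auto simp: scal)
    also have "H.push M \<dots> = (\<Sum>g\<in>carrier G. sc (f g) (H.push M (\<phi> (dl g))))"
      by (simp add: H.push_sum H.push_sc)
    finally have e: "dl Y = (\<Sum>g\<in>carrier G. sc (f g) (H.push M (\<phi> (dl g))))" .
    show ?thesis unfolding e by (intro vs.span_sum vs.span_scale vs.span_base g)
  qed
  then have "card (rcosets\<^bsub>H\<^esub> M) \<le> card V" using card_le_of_span[of V] fV by (auto simp: V_def)
  also have "\<dots> \<le> card (rcosets\<^bsub>G\<^esub> N)" unfolding V_def using fV by (rule card_image_le)
  finally show ?thesis .
qed

lemma card_carrier_le: "card (carrier H) \<le> card (carrier G)"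
proof -
  have s: "subgroup {\<one>\<^bsub>G\<^esub>} G" by (rule G.triv_subgroup)
  have "card (rcosets\<^bsub>H\<^esub> {\<one>\<^bsub>H\<^esub>}) \<le> card (rcosets\<^bsub>G\<^esub> {\<one>\<^bsub>G\<^esub>})"
    by (rule card_rcosets_le[OF s H.one_is_normal]) (auto dest: G.RI_trivial simp: zero)
  then show ?thesis
    using G.lagrange[OF s] H.lagrange[OF H.triv_subgroup] by (simp add: Coset.order_def)
qed

end

section \<open>From algebra isomorphisms to the structure of H\<close>

lemma kiso_kalg_iso:
  fixes \<phi> :: "('a \<Rightarrow> 'k::field) \<Rightarrow> ('b \<Rightarrow> 'k)"
  assumes G: "fgroup G" and H: "fgroup H" and \<phi>: "kalg_iso G H \<phi>"
  shows "kiso G H \<phi>"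
proof -
  interpret G: fgroup G by fact
  interpret H: fgroup H by fact
  have h: "\<phi> \<in> ring_hom (group_alg G) (group_alg H)" "bij_betw \<phi> G.KG H.KG"
    using \<phi> by (auto simp: kalg_iso_def ring_iso_def G.carrier_group_alg H.carrier_group_alg)
  have one: "dl \<one>\<^bsub>G\<^esub> = \<one>\<^bsub>(group_alg G :: ('a \<Rightarrow> 'k) ring)\<^esub>" "dl \<one>\<^bsub>H\<^esub> = \<one>\<^bsub>(group_alg H :: ('b \<Rightarrow> 'k) ring)\<^esub>"
    by (auto simp: group_alg_def dl_def)
  show ?thesis
  proof (intro kiso.intro kiso_axioms.intro G H h)
    fix f g :: "'a \<Rightarrow> 'k" and a :: 'k assume f: "f \<in> G.KG"
    show "\<phi> (sc a f) = sc a (\<phi> f)" using \<phi> f by (simp add: kalg_iso_def sc_def G.carrier_group_alg)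
    assume g: "g \<in> G.KG"
    show "\<phi> (f + g) = \<phi> f + \<phi> g"
      using ring_hom_add[OF h(1), of f g] f g unfolding G.carrier_group_alg
      by (simp add: group_alg_def plus_fun_def)
    show "\<phi> (conv G f g) = conv H (\<phi> f) (\<phi> g)"
      using ring_hom_mult[OF h(1), of f g] f g unfolding G.carrier_group_alg
      by (simp add: group_alg_def)
  next
    show "\<phi> (dl \<one>\<^bsub>G\<^esub>) = dl \<one>\<^bsub>H\<^esub>" unfolding one by (rule ring_hom_one[OF h(1)])
  qed
qed

text \<open>The elements of H are independent vectors in the span of the images of the finitely many
  elements of G. \<open>kiso\<close> presupposes that H is finite, so the few facts on linearity are
  derived here directly.\<close>

lemma kalg_iso_fgroup:
  fixes \<psi> :: "('a \<Rightarrow> 'k::field) \<Rightarrow> ('b \<Rightarrow> 'k)"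
  assumes G: "fgroup G" and H: "group H" and \<psi>: "kalg_iso G H \<psi>"
  shows "fgroup H"
proof -
  interpret G: fgroup G by fact
  interpret vs: vector_space "sc :: 'k \<Rightarrow> ('b \<Rightarrow> 'k) \<Rightarrow> 'b \<Rightarrow> 'k" by (rule vector_space_sc)
  have hom: "\<psi> \<in> ring_hom (group_alg G) (group_alg H)" and bij: "bij_betw \<psi> G.KG (carrier (group_alg H))"
    using \<psi> by (auto simp: kalg_iso_def ring_iso_def G.carrier_group_alg)
  have scal: "\<psi> (sc a f) = sc a (\<psi> f)" if "f \<in> G.KG" for a f
    using \<psi> that by (simp add: kalg_iso_def sc_def G.carrier_group_alg)
  have add: "\<psi> (f + g) = \<psi> f + \<psi> g" if "f \<in> G.KG" "g \<in> G.KG" for f g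
    using ring_hom_add[OF hom, of f g] that unfolding G.carrier_group_alg
    by (simp add: group_alg_def plus_fun_def)
  have zero: "\<psi> 0 = 0" using scal[OF G.KG_zero, of 0] by simp
  have sum: "\<psi> (\<Sum>i\<in>I. F i) = (\<Sum>i\<in>I. \<psi> (F i))" if "\<And>i. i \<in> I \<Longrightarrow> F i \<in> G.KG" for F and I :: "'a set"
    using that
  proof (induction I rule: infinite_finite_induct)
    case (insert x J)
    then have "F x \<in> G.KG" "(\<Sum>i\<in>J. F i) \<in> G.KG" by auto
    then show ?case using insert by (simp add: add)
  qed (auto simp: zero)
  have "dl h \<in> vs.span ((\<lambda>g. \<psi> (dl g)) ` carrier G)" if h: "h \<in> carrier H" for h
  proof -
    have "finite {x. (dl h :: 'b \<Rightarrow> 'k) x \<noteq> 0}" by (rule finite_subset[of _ "{h}"]) (auto simp: dl_apply)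
    then have "dl h \<in> carrier (group_alg H)" using h by (auto simp: group_alg_def dl_apply)
    then obtain f where f: "f \<in> G.KG" "dl h = \<psi> f" using bij by (auto simp: bij_betw_def)
    have "\<psi> f = \<psi> (\<Sum>g\<in>carrier G. sc (f g) (dl g))" using G.KG_expand[OF f(1)] by simp
    also have "\<dots> = (\<Sum>g\<in>carrier G. \<psi> (sc (f g) (dl g)))" by (rule sum) auto
    also have "\<dots> = (\<Sum>g\<in>carrier G. sc (f g) (\<psi> (dl g)))" by (rule sum.cong) (auto simp: scal)
    finally have e: "\<psi> f = (\<Sum>g\<in>carrier G. sc (f g) (\<psi> (dl g)))" .
    show ?thesis unfolding f(2) e by (intro vs.span_sum vs.span_scale vs.span_base imageI)
  qed
  then have "finite (carrier H)" using card_le_of_span G.fin by blast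
  then show ?thesis using H by (intro fgroup.intro fgroup_axioms.intro)
qed

text \<open>The one-sided stage: only G is known to have cyclic derived subgroup. Its goal is
  \<open>pgroup_cyclic_derived_H\<close>, after which G and H play symmetric roles in
  \<open>kiso_pgroups\<close>.\<close>

locale kiso_pgroup = kiso G H \<phi> + G: pgroup_cyclic_derived G p c n N
  for G :: "('a, 'c) monoid_scheme" and H :: "('b, 'd) monoid_scheme"
    and \<phi> :: "('a \<Rightarrow> 'k::field) \<Rightarrow> ('b \<Rightarrow> 'k)" and p c n N +
  assumes char: "CHAR('k) = p"
begin

lemma card_H: "card (carrier H) = p ^ N"
proof -
  interpret I: kiso H G "inv_into G.KG \<phi>" by (rule inv_kiso)
  show ?thesis using card_carrier_le I.card_carrier_le G.order_G by simp
qed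

text \<open>A \<open>p\<close>-group has only one \<open>k\<close>-algebra homomorphism \<open>kG \<rightarrow> k\<close>, because \<open>k\<close> has no nontrivial
  \<open>p\<close>-power roots of unity; so every isomorphism preserves the augmentation.\<close>
lemma aug_preserved:
  assumes f: "f \<in> G.KG"
  shows "aug (\<phi> f) = aug f"
proof -
  have 1: "aug (\<phi> (dl g)) = (1::'k)" if g: "g \<in> carrier G" for g
  proof -
    define a where "a = (aug (\<phi> (dl g)) :: 'k)"
    have "g [^]\<^bsub>G\<^esub> (p ^ N) = \<one>\<^bsub>G\<^esub>" using G.pow_order_eq_1[OF g] G.order_G by (simp add: Coset.order_def)
    then have "kpow H (\<phi> (dl g)) (p ^ N) = dl \<one>\<^bsub>H\<^esub>"
      using kpow[of "dl g" "p ^ N"] g by (simp add: G.kpow_dl one)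
    then have "a ^ (p ^ N) = 1" using H.aug_kpow[of "\<phi> (dl g)" "p ^ N"] g by (simp add: a_def)
    moreover have "((a - 1) + 1) ^ (p ^ N) = (a - 1) ^ (p ^ N) + 1 ^ (p ^ N)"
      using G.prime_p char by (intro freshmans_dream') auto
    ultimately have "(a - 1) ^ (p ^ N) = 0" by simp
    then show ?thesis by (simp add: a_def)
  qed
  have "\<phi> f = \<phi> (\<Sum>g\<in>carrier G. sc (f g) (dl g))" using G.KG_expand[OF f] by simp
  also have "\<dots> = (\<Sum>g\<in>carrier G. \<phi> (sc (f g) (dl g)))" by (rule sum) auto
  also have "\<dots> = (\<Sum>g\<in>carrier G. sc (f g) (\<phi> (dl g)))" by (rule sum.cong) (auto simp: scal)
  finally have "aug (\<phi> f) = (\<Sum>g\<in>carrier G. f g * aug (\<phi> (dl g)))"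
    by (simp add: H.aug_sum H.aug_sc)
  also have "\<dots> = aug f" using f by (simp add: 1 G.aug_eq)
  finally show ?thesis .
qed

lemma aug_zero_nilpotent_H:
  fixes u :: "'b \<Rightarrow> 'k"
  assumes "u \<in> H.KG" "aug u = 0"
  shows "\<exists>m. kpow H u m = 0"
proof -
  obtain f where f: "f \<in> G.KG" "u = \<phi> f" using surj assms by blast
  then obtain m where "kpow G f m = 0" using G.aug_zero_nilpotent[OF char f(1)] aug_preserved[OF f(1)] assms by auto
  then show ?thesis using kpow[OF f(1), of m] f by (auto simp: zero)
qed

text \<open>A Nakayama argument. The element y = \<phi>(c - 1) generates \<open>RI\<close> of H' as
  a right ideal, so v - 1 = y r for each v in H'. Either every r can be taken of augmentation 0, and
  then y = 0; or some r cannot, it is invertible up to a nilpotent term, and v alone generates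
  H'.\<close>

lemma derived_H_cyclic: "\<exists>v\<in>carrier H. derived H (carrier H) = generate H {v}"
proof -
  let ?D = "derived H (carrier H)"
  interpret I: kiso H G "inv_into G.KG \<phi>" by (rule inv_kiso)
  have inv: "\<phi> (inv_into G.KG \<phi> g) = g" "inv_into G.KG \<phi> g \<in> G.KG" if "g \<in> H.KG" for g
    using that bij by (auto simp: bij_betw_def f_inv_into_f inv_into_into)
  have D: "subgroup ?D H" by (rule H.derived_is_subgroup) simp
  define y where "y = \<phi> (dl c - dl \<one>\<^bsub>G\<^esub>)"
  have xK: "dl c - dl \<one>\<^bsub>G\<^esub> \<in> G.KG" by auto
  have yK: "y \<in> H.KG" unfolding y_def using xK by (rule closed)
  have yD: "y \<in> H.RI ?D" unfolding y_def using image_RI_derived G.xc_RI unfolding G.D_def by blast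
  have princ: "\<exists>r\<in>H.KG. g = conv H y r" if g: "g \<in> H.RI ?D" for g
  proof -
    have "inv_into G.KG \<phi> g \<in> G.RI G.D" using I.image_RI_derived g unfolding G.D_def by blast
    then obtain r where r: "r \<in> G.KG" "inv_into G.KG \<phi> g = conv G (dl c - dl \<one>\<^bsub>G\<^esub>) r"
      using G.RI_D_principal by blast
    have "g = conv H y (\<phi> r)" using inv(1)[OF H.RI_KG[OF g]] r mult[OF xK r(1)] by (simp add: y_def)
    then show ?thesis using r by blast
  qed
  show ?thesis
  proof (cases "\<forall>v\<in>?D. \<exists>r\<in>H.KG. dl v - dl \<one>\<^bsub>H\<^esub> = conv H y r \<and> aug r = 0")
    case True
    \<comment> \<open>W is y times the augmentation ideal. It contains all v - 1, hence
      \<open>RI\<close> of H' and y itself, so y = y u = y u^m with u nilpotent.\<close>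
    define W where "W = {g. \<exists>r\<in>H.KG. g = conv H y r \<and> aug r = 0}"
    have W: "H.rideal W"
      unfolding H.rideal_def
    proof (intro conjI ballI)
      show "W \<subseteq> H.KG" by (auto simp: W_def)
      have "0 = conv H y 0" using yK by simp
      then show "0 \<in> W" unfolding W_def using H.KG_zero H.aug_zero by blast
    next
      fix f g assume "f \<in> W" "g \<in> W"
      then obtain r r' where r: "r \<in> H.KG" "f = conv H y r" "aug r = 0" "r' \<in> H.KG" "g = conv H y r'" "aug r' = 0"
        by (auto simp: W_def)
      then have "f + g = conv H y (r + r')" "r + r' \<in> H.KG" "aug (r + r') = 0"
        using yK by (simp_all add: H.conv_add_right H.aug_add)
      then show "f + g \<in> W" unfolding W_def by blast
    next
      fix f g :: "'b \<Rightarrow> 'k" assume "f \<in> W" and g: "g \<in> H.KG"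
      then obtain r where r: "r \<in> H.KG" "f = conv H y r" "aug r = 0" by (auto simp: W_def)
      then have "conv H f g = conv H y (conv H r g)" "aug (conv H r g) = 0"
        using yK g by (simp_all add: H.conv_assoc H.aug_conv)
      then show "conv H f g \<in> W" unfolding W_def using H.conv_closed by blast
    qed
    have "H.RI ?D \<subseteq> W" using True by (intro H.RI_subset[OF D W]) (auto simp: W_def)
    then obtain u where u: "u \<in> H.KG" "y = conv H y u" "aug u = 0" using yD by (auto simp: W_def)
    have "y = conv H y (kpow H u m)" for m
    proof (induction m)
      case (Suc m)
      have "conv H y (kpow H u (Suc m)) = conv H (conv H y u) (kpow H u m)"
        using yK u(1) by (simp add: H.conv_assoc)
      then show ?case using u(2) Suc by simp
    qed (use yK in simp)
    moreover obtain m where "kpow H u m = 0" using aug_zero_nilpotent_H u by blast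
    ultimately have "y = 0" using yK by (metis H.conv_zero_right)
    have "v = \<one>\<^bsub>H\<^esub>" if v: "v \<in> ?D" for v
    proof -
      have "v \<in> carrier H" using v subgroup.mem_carrier[OF D] by blast
      then have "dl v - dl \<one>\<^bsub>H\<^esub> \<in> H.RI ?D" using v H.RI_dl_iff[OF D] by blast
      then obtain r where "r \<in> H.KG" "dl v - dl \<one>\<^bsub>H\<^esub> = conv H y r" using princ by blast
      then have "(dl v :: 'b \<Rightarrow> 'k) = dl \<one>\<^bsub>H\<^esub>" using \<open>y = 0\<close> by simp
      then show ?thesis using inj_dl by (metis injD)
    qed
    then have "?D = {\<one>\<^bsub>H\<^esub>}" using subgroup.one_closed[OF D] by blast
    then show ?thesis using H.generate_one by (intro bexI[of _ "\<one>\<^bsub>H\<^esub>"]) auto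
  next
    case False
    then obtain v where v: "v \<in> ?D" "\<And>r. r \<in> H.KG \<Longrightarrow> dl v - dl \<one>\<^bsub>H\<^esub> = conv H y r \<Longrightarrow> aug r \<noteq> 0"
      by blast
    have vc: "v \<in> carrier H" using v subgroup.mem_carrier[OF D] by blast
    let ?V = "generate H {v}"
    have V: "subgroup ?V H" using vc by (intro H.generate_is_subgroup) auto
    define e where "e = (dl v - dl \<one>\<^bsub>H\<^esub> :: 'b \<Rightarrow> 'k)"
    have eV: "e \<in> H.RI ?V" unfolding e_def using H.RI_dl_iff[OF V vc] generate.incl[of v "{v}" H] by blast
    have "e \<in> H.RI ?D" unfolding e_def using H.RI_dl_iff[OF D vc] v by blast
    then obtain r where r: "r \<in> H.KG" "e = conv H y r" using princ by blast
    have a: "aug r \<noteq> 0" using v(2)[OF r(1)] r(2) by (simp add: e_def)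
    \<comment> \<open>Chosen to have augmentation 0, hence nilpotent. Here y = y u + e' with e' in
      the ideal of the subgroup generated by v; iterating until u^m = 0 puts y into that
      ideal.\<close>
    define u where "u = dl \<one>\<^bsub>H\<^esub> - sc (inverse (aug r)) r"
    have uK: "u \<in> H.KG" using r by (auto simp: u_def)
    have "aug u = 0" using r a by (simp add: u_def H.aug_minus H.aug_sc)
    then obtain m where m: "kpow H u m = 0" using aug_zero_nilpotent_H uK by blast
    define e' where "e' = sc (inverse (aug r)) e"
    have e'V: "e' \<in> H.RI ?V" unfolding e'_def using eV by (rule H.RI_sc)
    have "conv H y u = y - e'"
      using yK r by (simp add: u_def e'_def H.conv_minus_right H.conv_sc_right)
    then have y: "y = conv H y u + e'" by simp
    have "\<exists>w\<in>H.RI ?V. y = conv H y (kpow H u i) + w" for i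
    proof (induction i)
      case 0 then show ?case using yK by (intro bexI[of _ 0]) auto
    next
      case (Suc i)
      then obtain w where w: "w \<in> H.RI ?V" "y = conv H y (kpow H u i) + w" by blast
      have "conv H y (kpow H u i) = conv H (conv H y u + e') (kpow H u i)" using y by simp
      also have "\<dots> = conv H y (kpow H u (Suc i)) + conv H e' (kpow H u i)"
        using yK uK H.RI_KG[OF e'V] by (simp add: H.conv_add_left H.conv_assoc)
      finally have "y = conv H y (kpow H u (Suc i)) + (conv H e' (kpow H u i) + w)"
        using w(2) by (simp add: add.assoc)
      moreover have "conv H e' (kpow H u i) + w \<in> H.RI ?V"
        by (intro H.RI_add w(1) H.RI_right[OF V e'V] H.kpow_closed)
      ultimately show ?case by blast
    qed
    from this[of m] have yV: "y \<in> H.RI ?V" using m yK by auto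
    have "?D \<subseteq> ?V"
    proof
      fix w assume w: "w \<in> ?D"
      have wc: "w \<in> carrier H" using w subgroup.mem_carrier[OF D] by blast
      have "dl w - dl \<one>\<^bsub>H\<^esub> \<in> H.RI ?D" using H.RI_dl_iff[OF D wc] w by blast
      then obtain r where "r \<in> H.KG" "dl w - dl \<one>\<^bsub>H\<^esub> = conv H y r" using princ by blast
      then have "(dl w - dl \<one>\<^bsub>H\<^esub> :: 'b \<Rightarrow> 'k) \<in> H.RI ?V" using H.RI_right[OF V yV] by simp
      then show "w \<in> ?V" using H.RI_dl_iff[OF V wc] by blast
    qed
    moreover have "?V \<subseteq> ?D" using v by (intro H.generate_subgroup_incl D) auto
    ultimately show ?thesis using vc by blast
  qed
qed

text \<open>The two inclusions give equal indices, and G and H have the same order.\<close>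

lemma card_rcosets_eq:
  assumes N: "N' \<lhd> G" and M: "M' \<lhd> H" and sub: "\<phi> ` G.RI N' \<subseteq> H.RI M'"
    and sub': "inv_into G.KG \<phi> ` H.RI M' \<subseteq> G.RI N'"
  shows "card N' = card M'"
proof -
  interpret I: kiso H G "inv_into G.KG \<phi>" by (rule inv_kiso)
  have sN: "subgroup N' G" and sM: "subgroup M' H" using N M by (auto intro: normal_imp_subgroup)
  have "card (rcosets\<^bsub>H\<^esub> M') = card (rcosets\<^bsub>G\<^esub> N')"
    using card_rcosets_le[OF sN M sub] I.card_rcosets_le[OF sM N sub'] by simp
  moreover have "card (rcosets\<^bsub>G\<^esub> N') * card N' = card (rcosets\<^bsub>H\<^esub> M') * card M'"
    using G.lagrange[OF sN] H.lagrange[OF sM] card_H G.order_G by (simp add: Coset.order_def)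
  moreover have "card (rcosets\<^bsub>G\<^esub> N') \<noteq> 0"
    using G.lagrange[OF sN] G.order_G G.p_gt_0 by (metis mult_0 Coset.order_def power_eq_0_iff not_gr_zero)
  ultimately show ?thesis by simp
qed

lemma card_derived: "card (derived H (carrier H)) = p ^ n"
proof -
  interpret I: kiso H G "inv_into G.KG \<phi>" by (rule inv_kiso)
  have "card (derived G (carrier G)) = card (derived H (carrier H))"
    by (rule card_rcosets_eq[OF G.derived_self_is_normal H.derived_self_is_normal image_RI_derived I.image_RI_derived])
  then show ?thesis using G.card_D by (simp add: G.D_def)
qed

lemma pgroup_cyclic_derived_H: "\<exists>v. pgroup_cyclic_derived H p v n N"
proof -
  obtain v where v: "v \<in> carrier H" "derived H (carrier H) = generate H {v}" using derived_H_cyclic by blast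
  have "group.ord H v = p ^ n" using H.generate_pow_card[OF v(1)] card_derived v by simp
  then have "pgroup_cyclic_derived H p v n N"
    using v card_H G.prime_p G.odd_p by unfold_locales auto
  then show ?thesis by blast
qed

end

section \<open>Characters of finite abelian groups\<close>

text \<open>Homomorphisms from B to the integers modulo m, represented by integer-valued functions
  of which only the residues matter.\<close>

definition charmod :: "('a, 'b) monoid_scheme \<Rightarrow> nat \<Rightarrow> 'a set \<Rightarrow> ('a \<Rightarrow> int) \<Rightarrow> bool" where
  "charmod L m B \<chi> \<longleftrightarrow> (\<forall>x\<in>B. \<forall>y\<in>B. [\<chi> (x \<otimes>\<^bsub>L\<^esub> y) = \<chi> x + \<chi> y] (mod int m))"

context comm_group
begin

lemma charmod_one:
  assumes "charmod G m B \<chi>" "subgroup B G"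
  shows "[\<chi> \<one> = 0] (mod int m)"
proof -
  have "[\<chi> (\<one> \<otimes> \<one>) = \<chi> \<one> + \<chi> \<one>] (mod int m)"
    using assms subgroup.one_closed unfolding charmod_def by blast
  then have "[\<chi> \<one> + 0 = \<chi> \<one> + \<chi> \<one>] (mod int m)" by simp
  then have "[0 = \<chi> \<one>] (mod int m)" by (simp only: cong_add_lcancel)
  then show ?thesis by (rule cong_sym)
qed

lemma charmod_pow:
  assumes \<chi>: "charmod G m B \<chi>" and B: "subgroup B G" and x: "x \<in> B"
  shows "[\<chi> (x [^] (k::nat)) = int k * \<chi> x] (mod int m)"
proof (induction k)
  case 0 then show ?case using charmod_one[OF \<chi> B] by simp
next
  case (Suc k)
  have "[\<chi> (x [^] k \<otimes> x) = \<chi> (x [^] k) + \<chi> x] (mod int m)"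
    using \<chi> x subgroup_int_pow_closed[OF B x, of "int k"] unfolding charmod_def int_pow_int by blast
  also have "[\<chi> (x [^] k) + \<chi> x = int k * \<chi> x + \<chi> x] (mod int m)" by (intro cong_add Suc cong_refl)
  finally show ?case by (simp add: algebra_simps)
qed

lemma subgroup_adjoin:
  assumes B: "subgroup B G" and g: "g \<in> carrier G"
  shows "subgroup {b \<otimes> g [^] k |b k::int. b \<in> B} G"
proof (rule subgroupI)
  have Bc: "b \<in> carrier G" if "b \<in> B" for b using that B by (rule subgroup.mem_carrier[rotated])
  show "{b \<otimes> g [^] k |b k::int. b \<in> B} \<subseteq> carrier G" using Bc g by auto
  show "{b \<otimes> g [^] k |b k::int. b \<in> B} \<noteq> {}" using subgroup.one_closed[OF B] by blast
  fix x assume "x \<in> {b \<otimes> g [^] k |b k::int. b \<in> B}"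
  then obtain b k where x: "b \<in> B" "x = b \<otimes> g [^] (k::int)" by blast
  have "inv x = inv b \<otimes> g [^] (- k)" using x Bc g by (simp add: inv_mult int_pow_neg)
  then show "inv x \<in> {b \<otimes> g [^] k |b k::int. b \<in> B}" using subgroup.m_inv_closed[OF B x(1)] by blast
  fix y assume "y \<in> {b \<otimes> g [^] k |b k::int. b \<in> B}"
  then obtain b' k' where y: "b' \<in> B" "y = b' \<otimes> g [^] (k'::int)" by blast
  have "x \<otimes> y = (b \<otimes> b') \<otimes> g [^] (k + k')" using x y Bc g by (simp add: int_pow_mult m_ac)
  then show "x \<otimes> y \<in> {b \<otimes> g [^] k |b k::int. b \<in> B}" using subgroup.m_closed[OF B x(1) y(1)] by blast
qed

lemma order_mod_subgroup:
  assumes B: "subgroup B G" and g: "g \<in> carrier G" and fin: "finite (carrier G)"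
  shows "\<exists>d>0. \<forall>k::int. g [^] k \<in> B \<longleftrightarrow> int d dvd k"
proof -
  define d where "d = (LEAST d::nat. d > 0 \<and> g [^] d \<in> B)"
  have "ord g > 0 \<and> g [^] ord g \<in> B" using ord_ge_1[OF fin g] g subgroup.one_closed[OF B] by simp
  then have d: "d > 0" "g [^] d \<in> B" and min: "\<And>k. 0 < k \<Longrightarrow> g [^] k \<in> B \<Longrightarrow> d \<le> k"
    unfolding d_def by (auto intro: LeastI2 Least_le)
  have "g [^] k \<in> B \<longleftrightarrow> int d dvd k" for k :: int
  proof
    assume k: "g [^] k \<in> B"
    define r where "r = nat (k mod int d)"
    have r: "int r = k mod int d" using d by (simp add: r_def)
    have "g [^] r = g [^] k \<otimes> inv ((g [^] d) [^] (k div int d))"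
    proof -
      have "int r = k - int d * (k div int d)" using r by (simp add: minus_mult_div_eq_mod)
      then have "g [^] int r = g [^] k \<otimes> inv (g [^] (int d * (k div int d)))"
        using g by (simp add: int_pow_diff)
      then show ?thesis using g by (simp add: int_pow_pow int_pow_int flip: int_pow_int)
    qed
    then have "g [^] r \<in> B"
      using k subgroup_int_pow_closed[OF B d(2)] subgroup.m_closed[OF B] subgroup.m_inv_closed[OF B] by simp
    moreover have "r < d" using r d by (metis of_nat_0_less_iff of_nat_less_iff pos_mod_bound)
    ultimately have "r = 0" using min by (metis not_le not_gr_zero)
    then show "int d dvd k" using r by (simp add: dvd_eq_mod_eq_0)
  next
    assume "int d dvd k"
    then obtain q where "k = int d * q" by blast
    then have "g [^] k = (g [^] d) [^] q" using g by (simp add: int_pow_pow flip: int_pow_int)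
    then show "g [^] k \<in> B" using subgroup_int_pow_closed[OF B d(2)] by simp
  qed
  then show ?thesis using d by blast
qed

text \<open>Two expressions b g^k of the same element have exponents differing by a multiple of the
  order d of g modulo B. Hence the only obstruction to prescribing the value y at g is that d y
  agrees with the value at g^d.\<close>

lemma charmod_extend_step:
  assumes B: "subgroup B G" and g: "g \<in> carrier G" and \<chi>: "charmod G m B \<chi>"
    and d: "d > 0" "\<And>k::int. g [^] k \<in> B \<longleftrightarrow> int d dvd k"
    and y: "[int d * y = \<chi> (g [^] d)] (mod int m)"
  shows "\<exists>\<chi>'. charmod G m {b \<otimes> g [^] k |b k::int. b \<in> B} \<chi>' \<and> (\<forall>b\<in>B. [\<chi>' b = \<chi> b] (mod int m)) \<and> [\<chi>' g = y] (mod int m)"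
proof -
  have Bc: "b \<in> carrier G" if "b \<in> B" for b using that B by (rule subgroup.mem_carrier[rotated])
  have gd: "g [^] d \<in> B" using d(2)[of "int d"] by (simp add: int_pow_int)
  have add: "[\<chi> (a \<otimes> b) = \<chi> a + \<chi> b] (mod int m)" if "a \<in> B" "b \<in> B" for a b
    using \<chi> that unfolding charmod_def by blast
  have nn: "[\<chi> (g [^] (int d * int q)) = int d * int q * y] (mod int m)" for q :: nat
  proof -
    have "[\<chi> ((g [^] d) [^] q) = int q * \<chi> (g [^] d)] (mod int m)" by (rule charmod_pow[OF \<chi> B gd])
    also have "[int q * \<chi> (g [^] d) = int q * (int d * y)] (mod int m)" by (intro cong_mult cong_refl cong_sym[OF y])
    also have "(g [^] d) [^] q = g [^] (int d * int q)"
      unfolding int_pow_int[symmetric] by (rule int_pow_pow[OF g])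
    finally show ?thesis by (simp add: mult_ac)
  qed
  have pw: "[\<chi> (g [^] (k::int)) = k * y] (mod int m)" if kB: "g [^] k \<in> B" for k
  proof -
    obtain q where q: "k = int d * q" using d(2) kB by blast
    show ?thesis
    proof (cases q rule: int_cases2)
      case (nonneg i) then show ?thesis using nn[of i] q by simp
    next
      case (nonpos i)
      have k': "g [^] (int d * int i) \<in> B" using d(2) by simp
      have "g [^] k \<otimes> g [^] (int d * int i) = \<one>" using g q nonpos by (simp flip: int_pow_mult)
      then have "[\<chi> \<one> = \<chi> (g [^] k) + \<chi> (g [^] (int d * int i))] (mod int m)"
        using add[OF kB k'] by simp
      then have "[\<chi> (g [^] k) + \<chi> (g [^] (int d * int i)) = 0] (mod int m)"
        using charmod_one[OF \<chi> B] by (metis cong_sym cong_trans)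
      moreover have "[\<chi> (g [^] k) + \<chi> (g [^] (int d * int i)) = \<chi> (g [^] k) + int d * int i * y] (mod int m)"
        by (intro cong_add nn cong_refl)
      ultimately have "[\<chi> (g [^] k) + int d * int i * y = 0] (mod int m)" by (metis cong_sym cong_trans)
      then have "int m dvd \<chi> (g [^] k) - k * y" using q nonpos by (simp add: cong_0_iff)
      then show ?thesis by (simp add: cong_iff_dvd_diff)
    qed
  qed
  \<comment> \<open>\<open>S\<close> picks an arbitrary decomposition of x; \<open>val\<close> shows
    that the value does not depend on it modulo m.\<close>
  define S where "S x = (SOME bk. fst bk \<in> B \<and> x = fst bk \<otimes> g [^] (snd bk :: int))" for x
  define \<chi>' where "\<chi>' x = \<chi> (fst (S x)) + snd (S x) * y" for x
  have val: "[\<chi>' (b \<otimes> g [^] k) = \<chi> b + k * y] (mod int m)" if b: "b \<in> B" for b and k :: int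
  proof -
    let ?x = "b \<otimes> g [^] k"
    have "\<exists>bk. fst bk \<in> B \<and> ?x = fst bk \<otimes> g [^] (snd bk :: int)" using b by (intro exI[of _ "(b, k)"]) simp
    then have "fst (S ?x) \<in> B \<and> ?x = fst (S ?x) \<otimes> g [^] snd (S ?x)" unfolding S_def by (rule someI_ex)
    then obtain b' k' where S: "S ?x = (b', k')" "b' \<in> B" "?x = b' \<otimes> g [^] k'" by (metis prod.collapse)
    have "b = b' \<otimes> g [^] (k' - k)"
    proof -
      have "b = ?x \<otimes> inv (g [^] k)" using Bc[OF b] g by (simp add: m_assoc)
      also have "\<dots> = b' \<otimes> g [^] (k' - k)" unfolding S(3) using Bc[OF S(2)] g by (simp add: m_assoc int_pow_diff)
      finally show ?thesis .
    qed
    moreover from this have gB: "g [^] (k' - k) \<in> B"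
    proof -
      assume "b = b' \<otimes> g [^] (k' - k)"
      then have "g [^] (k' - k) = inv b' \<otimes> b" using Bc[OF S(2)] g by (simp add: m_assoc[symmetric])
      then show ?thesis using subgroup.m_closed[OF B subgroup.m_inv_closed[OF B S(2)] b] by simp
    qed
    ultimately have "[\<chi> b = \<chi> b' + \<chi> (g [^] (k' - k))] (mod int m)" using add[OF S(2)] by metis
    also have "[\<chi> b' + \<chi> (g [^] (k' - k)) = \<chi> b' + (k' - k) * y] (mod int m)" by (intro cong_add pw gB cong_refl)
    finally have "[\<chi> b + k * y = \<chi> b' + (k' - k) * y + k * y] (mod int m)" by (intro cong_add cong_refl)
    then have "[\<chi> b + k * y = \<chi>' ?x] (mod int m)" by (simp add: \<chi>'_def S(1) algebra_simps)
    then show ?thesis by (rule cong_sym)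
  qed
  have "charmod G m {b \<otimes> g [^] k |b k::int. b \<in> B} \<chi>'"
    unfolding charmod_def
  proof (intro ballI)
    fix u v assume "u \<in> {b \<otimes> g [^] k |b k::int. b \<in> B}" "v \<in> {b \<otimes> g [^] k |b k::int. b \<in> B}"
    then obtain b k b' k' where uv: "b \<in> B" "u = b \<otimes> g [^] (k::int)" "b' \<in> B" "v = b' \<otimes> g [^] (k'::int)" by blast
    have "u \<otimes> v = (b \<otimes> b') \<otimes> g [^] (k + k')" using uv Bc g by (simp add: int_pow_mult m_ac)
    then have "[\<chi>' (u \<otimes> v) = \<chi> (b \<otimes> b') + (k + k') * y] (mod int m)"
      using val[OF subgroup.m_closed[OF B uv(1,3)]] by simp
    also have "[\<chi> (b \<otimes> b') + (k + k') * y = (\<chi> b + \<chi> b') + (k + k') * y] (mod int m)"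
      by (intro cong_add add uv cong_refl)
    also have "(\<chi> b + \<chi> b') + (k + k') * y = (\<chi> b + k * y) + (\<chi> b' + k' * y)" by (simp add: algebra_simps)
    also have "[\<dots> = \<chi>' u + \<chi>' v] (mod int m)" unfolding uv by (intro cong_add cong_sym[OF val] uv)
    finally show "[\<chi>' (u \<otimes> v) = \<chi>' u + \<chi>' v] (mod int m)" .
  qed
  moreover have "[\<chi>' b = \<chi> b] (mod int m)" if "b \<in> B" for b using val[OF that, of 0] Bc[OF that] by simp
  moreover have "[\<chi>' g = y] (mod int m)"
  proof -
    have "[\<chi>' (\<one> \<otimes> g [^] (1::int)) = \<chi> \<one> + 1 * y] (mod int m)" by (rule val[OF subgroup.one_closed[OF B]])
    also have "[\<chi> \<one> + 1 * y = 0 + 1 * y] (mod int m)" by (intro cong_add charmod_one[OF \<chi> B] cong_refl)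
    finally show ?thesis using g by simp
  qed
  ultimately show ?thesis by blast
qed

text \<open>One element g at a time. If d is its order modulo B and m = d q, then q times the value
  at g^d is the value at g^m, hence 0 modulo m. So d divides the value at g^d, and the quotient is
  an admissible value at g.\<close>

lemma charmod_extend:
  assumes fin: "finite (carrier G)" and m: "m > 0"
  shows "subgroup B G \<Longrightarrow> charmod G m B \<chi> \<Longrightarrow> (\<And>g. g \<in> carrier G \<Longrightarrow> g [^] m \<in> B \<and> [\<chi> (g [^] m) = 0] (mod int m))
    \<Longrightarrow> \<exists>\<chi>'. charmod G m (carrier G) \<chi>' \<and> (\<forall>b\<in>B. [\<chi>' b = \<chi> b] (mod int m))"
proof (induction "card (carrier G - B)" arbitrary: B \<chi> rule: less_induct)
  case less
  show ?case
  proof (cases "B = carrier G")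
    case True then show ?thesis using less.prems by auto
  next
    case False
    then obtain g where g: "g \<in> carrier G" "g \<notin> B" using subgroup.subset[OF less.prems(1)] by blast
    obtain d where d: "d > 0" "\<And>k::int. g [^] k \<in> B \<longleftrightarrow> int d dvd k"
      using order_mod_subgroup[OF less.prems(1) g(1) fin] by blast
    have "int d dvd int m" using less.prems(3)[OF g(1)] d(2)[of "int m"] by (simp add: int_pow_int)
    then obtain q where q: "m = d * q" unfolding int_dvd_int_iff by blast
    have gd: "g [^] d \<in> B" using d(2)[of "int d"] by (simp add: int_pow_int)
    have "[\<chi> ((g [^] d) [^] q) = int q * \<chi> (g [^] d)] (mod int m)" by (rule charmod_pow[OF less.prems(2,1) gd])
    moreover have "(g [^] d) [^] q = g [^] m" using g by (simp add: nat_pow_pow q)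
    ultimately have "[int q * \<chi> (g [^] d) = 0] (mod int m)" using less.prems(3)[OF g(1)] by (metis cong_sym cong_trans)
    then have "int q * int d dvd int q * \<chi> (g [^] d)" by (simp add: cong_0_iff q mult.commute)
    then have "int d dvd \<chi> (g [^] d)" using m q by simp
    then obtain y where "\<chi> (g [^] d) = int d * y" by blast
    then have y: "[int d * y = \<chi> (g [^] d)] (mod int m)" by simp
    define B' where "B' = {b \<otimes> g [^] k |b k::int. b \<in> B}"
    obtain \<chi>1 where \<chi>1: "charmod G m B' \<chi>1" "\<And>b. b \<in> B \<Longrightarrow> [\<chi>1 b = \<chi> b] (mod int m)"
      using charmod_extend_step[OF less.prems(1) g(1) less.prems(2) d y] unfolding B'_def by blast
    have B': "subgroup B' G" unfolding B'_def by (rule subgroup_adjoin[OF less.prems(1) g(1)])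
    have sub: "B \<subseteq> B'"
    proof
      fix b assume b: "b \<in> B"
      then have "b = b \<otimes> g [^] (0::int)" using subgroup.mem_carrier[OF less.prems(1)] by simp
      then show "b \<in> B'" unfolding B'_def using b by blast
    qed
    have "g \<in> B'"
    proof -
      have "g = \<one> \<otimes> g [^] (1::int)" using g by simp
      then show ?thesis unfolding B'_def using subgroup.one_closed[OF less.prems(1)] by blast
    qed
    then have "card (carrier G - B') < card (carrier G - B)"
      using sub g fin by (intro psubset_card_mono) auto
    moreover have "h [^] m \<in> B' \<and> [\<chi>1 (h [^] m) = 0] (mod int m)" if "h \<in> carrier G" for h
      using less.prems(3)[OF that] \<chi>1(2)[of "h [^] m"] sub by (auto intro: cong_trans)
    ultimately obtain \<chi>' where "charmod G m (carrier G) \<chi>'" "\<forall>b\<in>B'. [\<chi>' b = \<chi>1 b] (mod int m)"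
      using less.hyps[OF _ B' \<chi>1(1)] by blast
    then show ?thesis using \<chi>1(2) sub by (metis cong_trans subsetD)
  qed
qed

lemma power_set_subgroup: "subgroup ((\<lambda>x. x [^] (m::nat)) ` carrier G) G"
proof (rule subgroupI)
  fix a assume "a \<in> (\<lambda>x. x [^] m) ` carrier G"
  then obtain x where "x \<in> carrier G" "a = x [^] m" by blast
  then show "inv a \<in> (\<lambda>x. x [^] m) ` carrier G" by (intro image_eqI[of _ _ "inv x"]) (auto simp: nat_pow_inv)
next
  fix a b assume "a \<in> (\<lambda>x. x [^] m) ` carrier G" "b \<in> (\<lambda>x. x [^] m) ` carrier G"
  then obtain x y where "x \<in> carrier G" "a = x [^] m" "y \<in> carrier G" "b = y [^] m" by blast
  then show "a \<otimes> b \<in> (\<lambda>x. x [^] m) ` carrier G"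
    by (intro image_eqI[of _ _ "x \<otimes> y"]) (auto simp: nat_pow_distrib)
qed auto

text \<open>Modulo the m-th powers z has an order d > 1 dividing m. The character that is 0 on m-th
  powers and m/d at z extends to the whole group.\<close>

lemma charmod_separates_powers:
  assumes fin: "finite (carrier G)" and m: "m > 0" and z: "z \<in> carrier G" "z \<notin> (\<lambda>x. x [^] m) ` carrier G"
  shows "\<exists>\<chi>. charmod G m (carrier G) \<chi> \<and> \<not> [\<chi> z = 0] (mod int m)"
proof -
  let ?B = "(\<lambda>x. x [^] m) ` carrier G"
  have B: "subgroup ?B G" by (rule power_set_subgroup)
  obtain d where d: "d > 0" "\<And>k::int. z [^] k \<in> ?B \<longleftrightarrow> int d dvd k"
    using order_mod_subgroup[OF B z(1) fin] by blast
  have "d \<noteq> 1" using d(2)[of 1] z by auto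
  have "z [^] int m \<in> ?B" using z by (simp add: int_pow_int)
  then have "int d dvd int m" using d(2) by blast
  then obtain q where q: "m = d * q" unfolding int_dvd_int_iff by blast
  have "[int d * int q = 0] (mod int m)" by (simp add: q cong_0_iff)
  moreover have "charmod G m ?B (\<lambda>_. 0)" by (simp add: charmod_def)
  ultimately obtain \<chi>1 where \<chi>1: "charmod G m {b \<otimes> z [^] k |b k::int. b \<in> ?B} \<chi>1"
    "\<forall>b\<in>?B. [\<chi>1 b = 0] (mod int m)" "[\<chi>1 z = int q] (mod int m)"
    using charmod_extend_step[OF B z(1) _ d, of m "\<lambda>_. 0" "int q"] by blast
  let ?B' = "{b \<otimes> z [^] k |b k::int. b \<in> ?B}"
  have sub: "?B \<subseteq> ?B'"
  proof
    fix b assume b: "b \<in> ?B"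
    then have "b = b \<otimes> z [^] (0::int)" by auto
    then show "b \<in> ?B'" using b by blast
  qed
  have "g [^] m \<in> ?B' \<and> [\<chi>1 (g [^] m) = 0] (mod int m)" if "g \<in> carrier G" for g
  proof -
    have "g [^] m \<in> ?B" using that by blast
    then show ?thesis using sub \<chi>1(2) by blast
  qed
  then obtain \<chi> where \<chi>: "charmod G m (carrier G) \<chi>" "\<forall>b\<in>?B'. [\<chi> b = \<chi>1 b] (mod int m)"
    using charmod_extend[OF fin m subgroup_adjoin[OF B z(1)] \<chi>1(1)] by blast
  have "z \<in> ?B'"
  proof -
    have "z = \<one> \<otimes> z [^] (1::int)" using z by simp
    then show ?thesis using subgroup.one_closed[OF B] by blast
  qed
  then have "[\<chi> z = int q] (mod int m)" using \<chi>(2) \<chi>1(3) by (blast intro: cong_trans)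
  moreover have "\<not> [int q = 0] (mod int m)"
  proof
    assume "[int q = 0] (mod int m)"
    then have "m dvd q" by (simp add: cong_0_iff)
    then show False using q m \<open>d \<noteq> 1\<close> d(1) by (auto dest!: dvd_imp_le)
  qed
  ultimately have "\<not> [\<chi> z = 0] (mod int m)" by (metis cong_sym cong_trans)
  then show ?thesis using \<chi>(1) by blast
qed

end

section \<open>The lower bound in Jennings' theorem\<close>

context pgroup_cyclic_derived
begin

text \<open>Baer's trick: \<open>C\<close> has class at most two and \<open>p\<close> is odd, so \<open>a \<cdot> b \<cdot> [b, a]\<^sup>1\<^sup>/\<^sup>2\<close> is an abelian group
  operation on \<open>C\<close> with the same powers.\<close>
definition half :: nat where "half = (p ^ n + 1) div 2"

definition Baer :: "'a monoid" where
  "Baer = \<lparr>carrier = C, monoid.mult = (\<lambda>a b. a \<otimes> b \<otimes> cm b a [^] half), one = \<one>\<rparr>"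

lemma two_half: "2 * half = p ^ n + 1"
  using odd_p by (simp add: half_def)

text \<open>\<open>half\<close> is the inverse of 2 modulo \<open>p ^ n\<close>, and exponents on D
  count modulo \<open>p ^ n\<close>.\<close>

lemma half_pow: "d \<in> D \<Longrightarrow> d [^] half \<otimes> d [^] half = d"
proof -
  assume d: "d \<in> D"
  have "d [^] half \<otimes> d [^] half = d [^] (2 * half)" using d by (simp add: nat_pow_mult mult_2)
  also have "\<dots> = d" unfolding two_half using d by (simp add: D_pow_pn)
  finally show ?thesis .
qed

lemma half_Z: "a \<in> C \<Longrightarrow> b \<in> C \<Longrightarrow> cm a b [^] (m::nat) \<in> Z"
  by (intro Z_pow cm_C_Z)

lemma cm_C_right_Z: "a \<in> C \<Longrightarrow> b \<in> C \<Longrightarrow> z \<in> Z \<Longrightarrow> cm a (b \<otimes> z) = cm a b"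
  by (simp add: cm_mult_right_C Z_C cm_Z)
lemma cm_C_left_Z: "a \<in> C \<Longrightarrow> b \<in> C \<Longrightarrow> z \<in> Z \<Longrightarrow> cm (a \<otimes> z) b = cm a b"
  by (simp add: cm_mult_left_C Z_C cm_Z)

lemma cm_pow_mult: "a \<in> C \<Longrightarrow> b \<in> C \<Longrightarrow> a' \<in> C \<Longrightarrow> b' \<in> C \<Longrightarrow>
    (cm a b \<otimes> cm a' b') [^] (m::nat) = cm a b [^] m \<otimes> cm a' b' [^] m"
  using D_comm[of "cm a b" "cm a' b'"] by (intro pow_mult_distrib) (auto simp: cm_D)

text \<open>Commutativity: ab [b,a]^(1/2) = [a,b] ba [a,b]^(-1/2) = ba [a,b]^(1/2). Associativity:
  commutators are central and bilinear on C, so both bracketings equal abe times the square roots of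
  [b,a], [e,a] and [e,b].\<close>

lemma Baer_comm_group: "comm_group Baer"
proof (rule comm_groupI)
  have cl: "a \<otimes> b \<otimes> cm b a [^] half \<in> C" if "a \<in> C" "b \<in> C" for a b
    using that by (simp add: C_mult Z_C half_Z)
  fix a b assume "a \<in> carrier Baer" "b \<in> carrier Baer"
  then have ab: "a \<in> C" "b \<in> C" by (auto simp: Baer_def)
  show "a \<otimes>\<^bsub>Baer\<^esub> b \<in> carrier Baer" using cl ab by (simp add: Baer_def)
  have w: "cm a b = cm a b [^] half \<otimes> cm a b [^] half" using half_pow[of "cm a b"] cm_D[of a b] ab by simp
  have i: "cm b a [^] half = inv (cm a b [^] half)" using ab cm_inv[of a b] by (simp add: nat_pow_inv[symmetric])
  have wz: "cm a b [^] half \<in> Z" by (intro half_Z ab)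
  have "a \<otimes> b \<otimes> cm b a [^] half = cm a b \<otimes> (b \<otimes> a) \<otimes> inv (cm a b [^] half)"
    unfolding i using cm_swap[of a b] ab by simp
  also have "\<dots> = cm a b [^] half \<otimes> (cm a b [^] half \<otimes> (b \<otimes> a)) \<otimes> inv (cm a b [^] half)"
    by (subst (1) w) (use ab in \<open>simp add: m_assoc\<close>)
  also have "cm a b [^] half \<otimes> (cm a b [^] half \<otimes> (b \<otimes> a)) = (cm a b [^] half \<otimes> (b \<otimes> a)) \<otimes> cm a b [^] half"
    using ab by (intro Z_comm[OF wz]) auto
  also have "(cm a b [^] half \<otimes> (b \<otimes> a)) \<otimes> cm a b [^] half \<otimes> inv (cm a b [^] half) = cm a b [^] half \<otimes> (b \<otimes> a)"
    using ab by (simp add: m_assoc)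
  also have "\<dots> = b \<otimes> a \<otimes> cm a b [^] half" using ab by (intro Z_comm[OF wz]) auto
  finally show "a \<otimes>\<^bsub>Baer\<^esub> b = b \<otimes>\<^bsub>Baer\<^esub> a" by (simp add: Baer_def)
  fix e assume "e \<in> carrier Baer"
  then have e: "e \<in> C" by (simp add: Baer_def)
  let ?z = "cm b a [^] half" and ?z1 = "cm e a [^] half" and ?z2 = "cm e b [^] half"
  have z: "?z \<in> Z" "?z1 \<in> Z" "?z2 \<in> Z" using ab e by (auto intro: half_Z)
  have zc: "?z \<in> carrier G" "?z1 \<in> carrier G" "?z2 \<in> carrier G" using z by auto
  have c1: "cm e (a \<otimes> b \<otimes> ?z) = cm e a \<otimes> cm e b"
    using ab e z by (simp add: cm_C_right_Z C_mult cm_mult_right_C)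
  have c2: "cm (b \<otimes> e \<otimes> ?z2) a = cm b a \<otimes> cm e a"
    using ab e z by (simp add: cm_C_left_Z C_mult cm_mult_left_C)
  have "a \<otimes> b \<otimes> ?z \<otimes> e \<otimes> cm e (a \<otimes> b \<otimes> ?z) [^] half = a \<otimes> b \<otimes> (?z \<otimes> e) \<otimes> (?z1 \<otimes> ?z2)"
    unfolding c1 using ab e by (simp add: cm_pow_mult m_assoc)
  also have "?z \<otimes> e = e \<otimes> ?z" using e by (intro Z_comm[OF z(1)]) auto
  also have "a \<otimes> b \<otimes> (e \<otimes> ?z) \<otimes> (?z1 \<otimes> ?z2) = a \<otimes> (b \<otimes> e) \<otimes> (?z \<otimes> ?z1 \<otimes> ?z2)"
    using ab e zc by (simp add: m_assoc)
  also have "?z \<otimes> ?z1 \<otimes> ?z2 = ?z2 \<otimes> (?z \<otimes> ?z1)" using zc by (intro Z_comm[OF z(3), symmetric]) auto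
  also have "a \<otimes> (b \<otimes> e) \<otimes> (?z2 \<otimes> (?z \<otimes> ?z1)) = a \<otimes> (b \<otimes> e \<otimes> ?z2) \<otimes> cm (b \<otimes> e \<otimes> ?z2) a [^] half"
    unfolding c2 using ab e zc by (simp add: cm_pow_mult m_assoc)
  finally show "a \<otimes>\<^bsub>Baer\<^esub> b \<otimes>\<^bsub>Baer\<^esub> e = a \<otimes>\<^bsub>Baer\<^esub> (b \<otimes>\<^bsub>Baer\<^esub> e)" by (simp add: Baer_def)
next
  show "\<one>\<^bsub>Baer\<^esub> \<in> carrier Baer" by (simp add: Baer_def C_one)
  fix a assume "a \<in> carrier Baer"
  then have a: "a \<in> C" by (simp add: Baer_def)
  show "\<one>\<^bsub>Baer\<^esub> \<otimes>\<^bsub>Baer\<^esub> a = a" using a by (simp add: Baer_def cm_def)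
  show "\<exists>b\<in>carrier Baer. b \<otimes>\<^bsub>Baer\<^esub> a = \<one>\<^bsub>Baer\<^esub>"
    using a C_inv[OF a] by (intro bexI[of _ "inv a"]) (auto simp: Baer_def cm_def)
qed

lemma Baer_pow: "a \<in> C \<Longrightarrow> a [^]\<^bsub>Baer\<^esub> (m::nat) = a [^] m"
proof (induction m)
  case (Suc m)
  have "cm a (a [^] m) = \<one>" using Suc.prems by (simp add: cm_eq_one_iff nat_pow_comm[of a 1 m, simplified])
  have "a [^]\<^bsub>Baer\<^esub> Suc m = a [^] m \<otimes>\<^bsub>Baer\<^esub> a" using Suc by simp
  also have "\<dots> = a [^] Suc m" using \<open>cm a (a [^] m) = \<one>\<close> Suc.prems by (simp add: Baer_def)
  finally show ?case .
qed (simp add: Baer_def)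

text \<open>A character of \<open>Baer\<close> is quadratic with respect to the original product of \<open>C\<close>, the commutator being the
  defect.\<close>
lemma quadratic_character:
  assumes z: "z \<in> C" "z \<notin> P j"
  shows "\<exists>\<chi> \<kappa>. (\<forall>a\<in>C. \<forall>b\<in>C. [\<chi> (a \<otimes> b) = \<chi> a + \<chi> b + \<kappa> a b] (mod int (p ^ j)))
    \<and> (\<forall>a\<in>C. \<forall>b\<in>C. \<forall>b'\<in>C. [\<kappa> a (b \<otimes> b') = \<kappa> a b + \<kappa> a b'] (mod int (p ^ j)))
    \<and> [\<chi> \<one> = 0] (mod int (p ^ j)) \<and> \<not> [\<chi> z = 0] (mod int (p ^ j))"
proof -
  interpret B: comm_group Baer by (rule Baer_comm_group)
  let ?m = "p ^ j"
  have cB: "carrier Baer = C" by (simp add: Baer_def)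
  have "(\<lambda>x. x [^]\<^bsub>Baer\<^esub> ?m) ` C = P j" unfolding P_def by (intro image_cong refl Baer_pow)
  moreover have "finite C" using finite_subset[OF subgroup.subset[OF C_sub] fin] .
  ultimately obtain \<chi> where \<chi>: "charmod Baer ?m C \<chi>" "\<not> [\<chi> z = 0] (mod int ?m)"
    using B.charmod_separates_powers[of ?m z] z p_gt_0 unfolding cB by auto
  have hom: "[\<chi> (a \<otimes> b \<otimes> cm b a [^] half) = \<chi> a + \<chi> b] (mod int ?m)" if "a \<in> C" "b \<in> C" for a b
    using \<chi>(1) that unfolding charmod_def by (simp add: Baer_def)
  have homz: "[\<chi> (a \<otimes> w) = \<chi> a + \<chi> w] (mod int ?m)" if "a \<in> C" "w \<in> Z" for a w
    using hom[of a w] that by (simp add: Z_C cm_Z)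
  \<comment> \<open>The ordinary product is the Baer product times [a,b]^(1/2). This factor is
    central, and with central factors the Baer product agrees with the ordinary one, so \<chi> is
    additive there.\<close>
  define \<kappa> where "\<kappa> a b = \<chi> (cm a b [^] half)" for a b
  have 1: "[\<chi> (a \<otimes> b) = \<chi> a + \<chi> b + \<kappa> a b] (mod int ?m)" if ab: "a \<in> C" "b \<in> C" for a b
  proof -
    let ?w = "cm a b [^] half"
    have wz: "?w \<in> Z" by (intro half_Z ab)
    have "cm b a [^] half = inv ?w" using ab cm_inv[of a b] by (simp add: nat_pow_inv[symmetric])
    then have "a \<otimes> b = (a \<otimes> b \<otimes> cm b a [^] half) \<otimes> ?w" using ab by (simp add: m_assoc)
    moreover have "a \<otimes> b \<otimes> cm b a [^] half \<in> C" using ab by (simp add: C_mult Z_C half_Z)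
    ultimately have "[\<chi> (a \<otimes> b) = \<chi> (a \<otimes> b \<otimes> cm b a [^] half) + \<chi> ?w] (mod int ?m)"
      using homz[OF _ wz] by metis
    also have "[\<chi> (a \<otimes> b \<otimes> cm b a [^] half) + \<chi> ?w = \<chi> a + \<chi> b + \<chi> ?w] (mod int ?m)"
      by (intro cong_add hom ab cong_refl)
    finally show ?thesis by (simp add: \<kappa>_def)
  qed
  have 2: "[\<kappa> a (b \<otimes> b') = \<kappa> a b + \<kappa> a b'] (mod int ?m)" if "a \<in> C" "b \<in> C" "b' \<in> C" for a b b'
  proof -
    have "cm a (b \<otimes> b') [^] half = cm a b [^] half \<otimes> cm a b' [^] half"
      using that by (simp add: cm_mult_right_C cm_pow_mult)
    then show ?thesis unfolding \<kappa>_def using homz[OF Z_C[OF half_Z] half_Z, of a b a b'] that by simp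
  qed
  have "[\<chi> \<one> = 0] (mod int ?m)"
    using B.charmod_one[of ?m C \<chi>] \<chi>(1) B.subgroup_self unfolding cB by (simp add: Baer_def)
  then show ?thesis using 1 2 \<chi>(2) by blast
qed

end

section \<open>Truncated powers of 1 + X and filtered functions\<close>

definition tpow :: "nat \<Rightarrow> int \<Rightarrow> 'k::field poly" where
  "tpow m i = [:1, 1:] ^ nat (i mod int m)"

lemma tpow_zero [simp]: "tpow m 0 = 1" by (simp add: tpow_def)

lemma tpow_cong: "[i = j] (mod int m) \<Longrightarrow> tpow m i = tpow m j"
  by (simp add: tpow_def cong_def)

abbreviation tX :: "'k::field poly" where "tX \<equiv> [:0, 1:]"

lemma tpow_frobenius:
  assumes "Factorial_Ring.prime CHAR('k::field)"
  shows "([:1, 1:] :: 'k poly) ^ (CHAR('k) ^ e) = 1 + tX ^ (CHAR('k) ^ e)"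
proof -
  have "(1 + tX :: 'k poly) ^ (CHAR('k) ^ e) = 1 ^ (CHAR('k) ^ e) + tX ^ (CHAR('k) ^ e)"
    using assms by (intro freshmans_dream') auto
  moreover have "(1 + tX :: 'k poly) = [:1, 1:]" by (simp add: one_pCons)
  ultimately show ?thesis by simp
qed

text \<open>As (1 + X)^m = 1 + X^m for m a power of the characteristic, i -> (1 + X)^i is a
  homomorphism from the integers modulo m into the units modulo X^m. With reduced exponents a
  wraparound costs a multiple of X^m.\<close>

lemma tpow_add:
  assumes "Factorial_Ring.prime CHAR('k::field)" and m: "m = CHAR('k) ^ e"
  shows "\<exists>E :: 'k poly. tpow m (i + j) = tpow m i * tpow m j + tX ^ m * E"
proof -
  have m0: "m > 0" using assms by (simp add: prime_gt_0_nat)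
  let ?t = "[:1, 1:] :: 'k poly"
  define u where "u = nat (i mod int m) + nat (j mod int m)"
  have u: "int u = i mod int m + j mod int m" using m0 by (simp add: u_def)
  have "nat ((i + j) mod int m) = u mod m"
  proof -
    have "(i + j) mod int m = int u mod int m" unfolding u by (simp add: mod_add_eq)
    then show ?thesis by (simp flip: of_nat_mod)
  qed
  then have 1: "tpow m (i + j) = ?t ^ (u mod m)" by (simp add: tpow_def)
  have 2: "tpow m i * tpow m j = ?t ^ u" by (simp add: tpow_def u_def power_add)
  have "u = u mod m \<or> u = u mod m + m"
  proof -
    have "nat (i mod int m) < m" "nat (j mod int m) < m" using m0 by (simp_all add: nat_less_iff)
    then have "u < 2 * m" by (simp add: u_def)
    then show ?thesis by (cases "u < m") (auto simp: mod_if)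
  qed
  then show ?thesis
  proof
    assume "u = u mod m"
    then show ?thesis unfolding 1 2 by (intro exI[of _ 0]) simp
  next
    assume "u = u mod m + m"
    then have "?t ^ u = ?t ^ (u mod m) * (1 + tX ^ m)"
      by (metis power_add tpow_frobenius[OF assms(1), of e] m)
    then have "?t ^ (u mod m) = ?t ^ u + tX ^ m * (- (?t ^ (u mod m)))" by (simp add: algebra_simps)
    then show ?thesis unfolding 1 2 by blast
  qed
qed

lemma tpow_minus_one: "\<exists>w :: 'k::field poly. tpow m i = 1 + tX * w"
proof -
  have "\<exists>w :: 'k poly. [:1, 1:] ^ r = 1 + tX * w" for r
  proof (induction r)
    case (Suc r)
    then obtain w :: "'k poly" where w: "[:1, 1:] ^ r = 1 + tX * w" by blast
    have t: "([:1, 1:] :: 'k poly) = 1 + tX" by (simp add: one_pCons)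
    have "([:1, 1:] :: 'k poly) ^ Suc r = 1 + tX * (w + 1 + tX * w)"
      unfolding power_Suc w unfolding t by (simp only: distrib_left distrib_right mult_1_left mult_1_right add_ac mult_ac)
    then show ?case by blast
  qed (auto intro: exI[of _ 0])
  then show ?thesis by (simp add: tpow_def)
qed

text \<open>If the residue of i is p^l u with u prime to p, then (1 + X)^i = (1 + X^(p^l))^u = 1 + u
  X^(p^l) + ..., of order p^l. From p^l < m and p >= 3 follows 3 p^l <= m, which is below the bound
  (m + 1)/2.\<close>

lemma tpow_order:
  assumes "Factorial_Ring.prime CHAR('k::field)" "odd CHAR('k)" and m: "m = CHAR('k) ^ e"
    and i: "\<not> [i = 0] (mod int m)"
  shows "\<not> tX ^ ((m + 1) div 2) dvd (tpow m i - 1 :: 'k poly)"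
proof
  let ?p = "CHAR('k)"
  assume dv: "tX ^ ((m + 1) div 2) dvd (tpow m i - 1 :: 'k poly)"
  have p: "?p > 2" using assms(1,2) by (metis One_nat_def even_numeral le_neq_implies_less prime_ge_2_nat)
  have m0: "m > 0" using m p by simp
  define a where "a = nat (i mod int m)"
  have im: "0 \<le> i mod int m" "i mod int m < int m" "i mod int m \<noteq> 0"
    using i m0 by (auto simp: cong_def)
  have a0: "a \<noteq> 0" "a < m" unfolding a_def using im by linarith+
  obtain l u where l: "a = ?p ^ l * u" "\<not> ?p dvd u"
    using a0(1) assms(1) by (metis multiplicity_decompose' not_prime_unit)
  have "u > 0" using l(2) by (cases u) auto
  then have "?p ^ l \<le> a" unfolding l(1) by simp
  then have "?p ^ l < ?p ^ e" using a0 m by simp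
  then have "l < e" using p by (simp add: power_strict_increasing_iff)
  then have "?p ^ Suc l \<le> m" unfolding m using p by (intro power_increasing) auto
  then have "?p ^ l * 3 \<le> m" using p by (metis Suc_leI mult_le_mono2 le_trans numeral_2_eq_2 numeral_3_eq_3 power_Suc2)
  moreover have "?p ^ l > 0" using p by simp
  ultimately have le: "?p ^ l + 1 \<le> (m + 1) div 2" by linarith
  define y where "y = (tX :: 'k poly) ^ (?p ^ l)"
  have "\<exists>w. (1 + y) ^ u = 1 + of_nat u * y + y * y * w" for u
  proof (induction u)
    case (Suc u)
    then obtain w where w: "(1 + y) ^ u = 1 + of_nat u * y + y * y * w" by blast
    have "(1 + y) ^ Suc u = 1 + of_nat (Suc u) * y + y * y * (of_nat u + w + y * w)"
      by (simp add: w algebra_simps)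
    then show ?case by blast
  qed (auto intro: exI[of _ 0])
  then obtain w where w: "(1 + y) ^ u = 1 + of_nat u * y + y * y * w" by blast
  have "(tpow m i :: 'k poly) = (1 + y) ^ u"
    unfolding tpow_def a_def[symmetric] l(1) power_mult tpow_frobenius[OF assms(1)] y_def ..
  then have "tX ^ (?p ^ l + 1) dvd of_nat u * y + y * y * w"
    using dv le_imp_power_dvd[OF le, of "tX :: 'k poly"] w by (auto intro: dvd_trans)
  then have "y * tX dvd y * (of_nat u + y * w)"
    by (simp add: y_def algebra_simps)
  moreover have "y \<noteq> 0" by (simp add: y_def)
  ultimately have "tX dvd of_nat u + y * w" using dvd_times_left_cancel_iff[of y tX "of_nat u + y * w"] by blast
  moreover have "tX dvd y * w" unfolding y_def using p by (intro dvd_mult2 dvd_power) auto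
  ultimately have "tX dvd (of_nat u :: 'k poly)" by (simp only: dvd_add_left_iff)
  then obtain v :: "'k poly" where "of_nat u = tX * v" by blast
  then have "poly [:of_nat u:] (0 :: 'k) = poly (tX * v) 0" by (simp only: of_nat_poly)
  then have "(of_nat u :: 'k) = 0" by simp
  then show False using l(2) by (simp add: of_nat_eq_0_iff_char_dvd)
qed

text \<open>\<open>filtered S m \<Lambda> \<chi> l F\<close> says that the function \<open>F\<close> has weight at least \<open>l\<close>, where \<open>tX\<close> has weight \<open>2\<close>
  and \<open>tpow m \<circ> \<kappa> - 1\<close> has weight \<open>1\<close> for \<open>\<kappa> \<in> \<Lambda>\<close> (characters, in the application).
  Left differences raise the weight, and weight \<open>l\<close> forces divisibility of the values by
  \<open>tX\<close> to the power \<open>l / 2\<close>, up to multiples of \<open>tX ^ m\<close>.\<close>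
inductive filtered :: "'a set \<Rightarrow> nat \<Rightarrow> ('a \<Rightarrow> int) set \<Rightarrow> ('a \<Rightarrow> int) \<Rightarrow> nat \<Rightarrow> ('a \<Rightarrow> 'k::field poly) \<Rightarrow> bool"
  for S m \<Lambda> \<chi> where
  base: "filtered S m \<Lambda> \<chi> 0 (\<lambda>g. tpow m (\<chi> g))"
| char: "\<kappa> \<in> \<Lambda> \<Longrightarrow> filtered S m \<Lambda> \<chi> l F \<Longrightarrow> filtered S m \<Lambda> \<chi> (Suc l) (\<lambda>g. (tpow m (\<kappa> g) - 1) * F g)"
| const: "filtered S m \<Lambda> \<chi> l F \<Longrightarrow> filtered S m \<Lambda> \<chi> l (\<lambda>g. r * F g)"
| X: "filtered S m \<Lambda> \<chi> l F \<Longrightarrow> filtered S m \<Lambda> \<chi> (Suc (Suc l)) (\<lambda>g. tX * F g)"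
| add: "filtered S m \<Lambda> \<chi> l F \<Longrightarrow> filtered S m \<Lambda> \<chi> l F' \<Longrightarrow> filtered S m \<Lambda> \<chi> l (\<lambda>g. F g + F' g)"
| weaken: "filtered S m \<Lambda> \<chi> (Suc l) F \<Longrightarrow> filtered S m \<Lambda> \<chi> l F"
| err: "filtered S m \<Lambda> \<chi> l (\<lambda>g. tX ^ m * E g)"
| restrict: "filtered S m \<Lambda> \<chi> l F \<Longrightarrow> (\<And>g. g \<in> S \<Longrightarrow> F g = F' g) \<Longrightarrow> filtered S m \<Lambda> \<chi> l F'"

text \<open>Each factor of weight one or two contributes an X, so weight l yields at least l/2 of
  them, rounded up. The cap m is due to the error terms.\<close>

lemma filtered_value:
  "filtered S m \<Lambda> \<chi> l F \<Longrightarrow> g \<in> S \<Longrightarrow> tX ^ min (Suc l div 2) m dvd F g"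
proof (induction rule: filtered.induct)
  case (char \<kappa> l F)
  obtain w where w: "(tpow m (\<kappa> g) :: 'b poly) = 1 + tX * w" using tpow_minus_one by blast
  have "tX ^ min (Suc (Suc l) div 2) m dvd (tX ^ Suc (min (Suc l div 2) m) :: 'b poly)"
    by (intro le_imp_power_dvd) auto
  also have "\<dots> dvd tX * F g" using char by (simp add: mult_dvd_mono del: mult_pCons_left)
  also have "\<dots> dvd (tpow m (\<kappa> g) - 1) * F g" unfolding w by (simp add: mult.assoc mult.left_commute[of w] del: mult_pCons_left)
  finally show ?case .
next
  case (X l F)
  have "tX ^ min (Suc (Suc (Suc l)) div 2) m dvd (tX ^ Suc (min (Suc l div 2) m) :: 'b poly)"
    by (intro le_imp_power_dvd) auto
  also have "\<dots> dvd tX * F g" using X by (simp add: mult_dvd_mono del: mult_pCons_left)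
  finally show ?case .
next
  case (weaken l F)
  have "tX ^ min (Suc l div 2) m dvd (tX ^ min (Suc (Suc l) div 2) m :: 'b poly)"
    by (intro le_imp_power_dvd) auto
  then show ?case using weaken by (blast intro: dvd_trans)
next
  case (err l E)
  have "tX ^ min (Suc l div 2) m dvd (tX ^ m :: 'b poly)" by (intro le_imp_power_dvd) auto
  then show ?case by (rule dvd_mult2)
qed auto

text \<open>This is why X has weight two. A difference of the quadratic \<chi> produces a factor (1
  + X)^\<kappa> - 1 with \<kappa> a character, of weight one. A further difference turns such a
  factor into a multiple of X, up to terms in which F is differenced instead, so X may cost two
  differences.\<close>

lemma filtered_difference:
  fixes F :: "'a \<Rightarrow> 'k::field poly"
  assumes G: "subgroup S G" and p: "Factorial_Ring.prime CHAR('k)" and m: "m = CHAR('k) ^ e"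
    and \<Lambda>: "\<And>\<kappa> a b. \<kappa> \<in> \<Lambda> \<Longrightarrow> a \<in> S \<Longrightarrow> b \<in> S \<Longrightarrow> [\<kappa> (a \<otimes>\<^bsub>G\<^esub> b) = \<kappa> a + \<kappa> b] (mod int m)"
    and \<chi>: "\<And>a b. a \<in> S \<Longrightarrow> b \<in> S \<Longrightarrow> [\<chi> (a \<otimes>\<^bsub>G\<^esub> b) = \<chi> a + \<chi> b + \<mu> a b] (mod int m)"
    and \<mu>: "\<And>a. a \<in> S \<Longrightarrow> \<mu> a \<in> \<Lambda>"
    and a: "a \<in> S"
  shows "filtered S m \<Lambda> \<chi> l F \<Longrightarrow> filtered S m \<Lambda> \<chi> (Suc l) (\<lambda>h. F (a \<otimes>\<^bsub>G\<^esub> h) - F h)"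
proof (induction rule: filtered.induct)
  case base
  have "\<forall>h. \<exists>E :: 'k poly. h \<in> S \<longrightarrow> tpow m (\<chi> (a \<otimes>\<^bsub>G\<^esub> h)) = tpow m (\<chi> a) * (tpow m (\<mu> a h) * tpow m (\<chi> h)) + tX ^ m * E"
  proof (intro allI)
    fix h
    show "\<exists>E :: 'k poly. h \<in> S \<longrightarrow> tpow m (\<chi> (a \<otimes>\<^bsub>G\<^esub> h)) = tpow m (\<chi> a) * (tpow m (\<mu> a h) * tpow m (\<chi> h)) + tX ^ m * E"
    proof (cases "h \<in> S")
      case True
      have "[\<chi> (a \<otimes>\<^bsub>G\<^esub> h) = \<chi> a + (\<mu> a h + \<chi> h)] (mod int m)" using \<chi>[OF a True] by (simp add: add_ac)
      then have 1: "(tpow m (\<chi> (a \<otimes>\<^bsub>G\<^esub> h)) :: 'k poly) = tpow m (\<chi> a + (\<mu> a h + \<chi> h))" by (rule tpow_cong)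
      obtain E1 :: "'k poly" where E1: "tpow m (\<chi> a + (\<mu> a h + \<chi> h)) = tpow m (\<chi> a) * tpow m (\<mu> a h + \<chi> h) + tX ^ m * E1"
        using tpow_add[OF p m] by blast
      obtain E2 :: "'k poly" where E2: "tpow m (\<mu> a h + \<chi> h) = tpow m (\<mu> a h) * tpow m (\<chi> h) + tX ^ m * E2"
        using tpow_add[OF p m] by blast
      have "tpow m (\<chi> (a \<otimes>\<^bsub>G\<^esub> h)) = tpow m (\<chi> a) * (tpow m (\<mu> a h) * tpow m (\<chi> h)) + tX ^ m * (tpow m (\<chi> a) * E2 + E1)"
        unfolding 1 E1 E2 by (simp only: distrib_left add_ac mult_ac)
      then show ?thesis by blast
    qed auto
  qed
  then obtain E :: "'a \<Rightarrow> 'k poly" where E: "\<And>h. h \<in> S \<Longrightarrow> tpow m (\<chi> (a \<otimes>\<^bsub>G\<^esub> h)) = tpow m (\<chi> a) * (tpow m (\<mu> a h) * tpow m (\<chi> h)) + tX ^ m * E h"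
    by metis
  obtain w :: "'k poly" where w: "tpow m (\<chi> a) = 1 + tX * w" using tpow_minus_one by blast
  let ?F = "\<lambda>h. tpow m (\<chi> h) :: 'k poly"
  have "filtered S m \<Lambda> \<chi> (Suc 0) (\<lambda>h. tpow m (\<chi> a) * ((tpow m (\<mu> a h) - 1) * ?F h) + (tX * (w * ?F h) + tX ^ m * E h))"
    by (intro filtered.add filtered.const filtered.char \<mu> a filtered.base filtered.err
        filtered.weaken[OF filtered.X])
  then show ?case
  proof (rule filtered.restrict)
    fix h assume h: "h \<in> S"
    have "tX * w = (tpow m (\<chi> a) - 1 :: 'k poly)" by (simp add: w)
    then have "tX * (w * ?F h) = (tpow m (\<chi> a) - 1) * ?F h" by (metis mult.assoc)
    then show "tpow m (\<chi> a) * ((tpow m (\<mu> a h) - 1) * ?F h) + (tX * (w * ?F h) + tX ^ m * E h)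
      = tpow m (\<chi> (a \<otimes>\<^bsub>G\<^esub> h)) - tpow m (\<chi> h)"
      unfolding E[OF h] by (simp add: algebra_simps del: mult_pCons_left mult_pCons_right)
  qed
next
  case (char \<kappa> l F)
  have "\<forall>h. \<exists>E :: 'k poly. h \<in> S \<longrightarrow> tpow m (\<kappa> (a \<otimes>\<^bsub>G\<^esub> h)) = tpow m (\<kappa> a) * tpow m (\<kappa> h) + tX ^ m * E"
  proof (intro allI)
    fix h
    show "\<exists>E :: 'k poly. h \<in> S \<longrightarrow> tpow m (\<kappa> (a \<otimes>\<^bsub>G\<^esub> h)) = tpow m (\<kappa> a) * tpow m (\<kappa> h) + tX ^ m * E"
    proof (cases "h \<in> S")
      case True
      have "(tpow m (\<kappa> (a \<otimes>\<^bsub>G\<^esub> h)) :: 'k poly) = tpow m (\<kappa> a + \<kappa> h)"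
        by (rule tpow_cong[OF \<Lambda>[OF char(1) a True]])
      then show ?thesis using tpow_add[OF p m] by metis
    qed auto
  qed
  then obtain E :: "'a \<Rightarrow> 'k poly" where E: "\<And>h. h \<in> S \<Longrightarrow> tpow m (\<kappa> (a \<otimes>\<^bsub>G\<^esub> h)) = tpow m (\<kappa> a) * tpow m (\<kappa> h) + tX ^ m * E h"
    by metis
  obtain w :: "'k poly" where w: "tpow m (\<kappa> a) = 1 + tX * w" using tpow_minus_one by blast
  let ?F = "\<lambda>h. F (a \<otimes>\<^bsub>G\<^esub> h)"
  \<comment> \<open>The translate of F is F plus its difference, so translation preserves the
    weight.\<close>
  have "filtered S m \<Lambda> \<chi> l (\<lambda>h. F h + (?F h - F h))"
    by (intro filtered.add char(2) filtered.weaken[OF char.IH])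
  then have tr: "filtered S m \<Lambda> \<chi> l ?F" by simp
  have "filtered S m \<Lambda> \<chi> (Suc (Suc l)) (\<lambda>h. (tpow m (\<kappa> h) - 1) * (?F h - F h)
      + (tX * (w * ((tpow m (\<kappa> h) - 1) * ?F h)) + (tX * (w * ?F h) + tX ^ m * (E h * ?F h))))"
    by (intro filtered.add filtered.char[OF char(1)] char.IH filtered.err filtered.X[OF filtered.const[OF tr]]
        filtered.weaken[OF filtered.X[OF filtered.const[OF filtered.char[OF char(1) tr]]]])
  then show ?case
  proof (rule filtered.restrict)
    fix h assume h: "h \<in> S"
    have tw: "tX * (w * f) = (tpow m (\<kappa> a) - 1) * f" for f :: "'k poly" by (simp only: w mult.assoc add_diff_cancel_left')
    show "(tpow m (\<kappa> h) - 1) * (?F h - F h)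
      + (tX * (w * ((tpow m (\<kappa> h) - 1) * ?F h)) + (tX * (w * ?F h) + tX ^ m * (E h * ?F h)))
      = (tpow m (\<kappa> (a \<otimes>\<^bsub>G\<^esub> h)) - 1) * ?F h - (tpow m (\<kappa> h) - 1) * F h"
      unfolding E[OF h] tw by (simp add: algebra_simps del: mult_pCons_left mult_pCons_right)
  qed
next
  case (const l F r)
  then show ?case using filtered.const[OF const.IH, of r] by (simp add: right_diff_distrib)
next
  case (X l F)
  then show ?case using filtered.X[OF X.IH] by (simp add: right_diff_distrib del: mult_pCons_left)
next
  case (add l F F')
  have "filtered S m \<Lambda> \<chi> (Suc l) (\<lambda>h. (F (a \<otimes>\<^bsub>G\<^esub> h) - F h) + (F' (a \<otimes>\<^bsub>G\<^esub> h) - F' h))"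
    by (intro filtered.add add.IH)
  then show ?case by (simp add: algebra_simps)
next
  case (weaken l F) then show ?case by (blast intro: filtered.weaken)
next
  case (err l E)
  have "filtered S m \<Lambda> \<chi> (Suc l) (\<lambda>h. tX ^ m * (E (a \<otimes>\<^bsub>G\<^esub> h) - E h))" by (rule filtered.err)
  then show ?case by (simp add: right_diff_distrib)
next
  case (restrict l F F')
  show ?case
    by (rule filtered.restrict[OF restrict.IH])
       (use restrict.hyps subgroup.m_closed[OF G a] in auto)
qed

section \<open>Powers of ideals and their pairing with functions on the centralizer\<close>

context fgroup
begin

text \<open>The i-th power of W as the additive span of right-nested products; the innermost factor
  is an arbitrary element of kG, so the power 0 is kG itself.\<close>

inductive ideal_power :: "('a \<Rightarrow> 'k::field) set \<Rightarrow> nat \<Rightarrow> ('a \<Rightarrow> 'k) \<Rightarrow> bool" for W where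
  all: "f \<in> KG \<Longrightarrow> ideal_power W 0 f"
| zero: "ideal_power W i 0"
| prod: "f \<in> W \<Longrightarrow> ideal_power W i g \<Longrightarrow> ideal_power W (Suc i) (f \<star> g)"
| add: "ideal_power W i f \<Longrightarrow> ideal_power W i g \<Longrightarrow> ideal_power W i (f + g)"

lemma ideal_power_KG: "ideal_power W i f \<Longrightarrow> f \<in> KG"
  by (induction rule: ideal_power.induct) auto

lemma ideal_power_right:
  assumes "W \<subseteq> KG" "h \<in> KG"
  shows "ideal_power W i f \<Longrightarrow> ideal_power W i (f \<star> h)"
proof (induction rule: ideal_power.induct)
  case (prod f i g)
  have "f \<star> g \<star> h = f \<star> (g \<star> h)" using prod assms ideal_power_KG by (intro conv_assoc) auto
  then show ?case using ideal_power.prod[OF prod(1) prod.IH] by simp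
next
  case (add i f g)
  have "(f + g) \<star> h = f \<star> h + g \<star> h" using add ideal_power_KG by (intro conv_add_left) auto
  then show ?case using ideal_power.add[OF add.IH] by simp
qed (auto intro: ideal_power.intros)

lemma ideal_power_left:
  assumes "W \<subseteq> KG" "h \<in> KG" and left: "\<And>f. f \<in> W \<Longrightarrow> h \<star> f \<in> W"
  shows "ideal_power W i f \<Longrightarrow> ideal_power W i (h \<star> f)"
proof (induction rule: ideal_power.induct)
  case (prod f i g)
  have "h \<star> (f \<star> g) = (h \<star> f) \<star> g" using prod assms ideal_power_KG by (intro conv_assoc[symmetric]) auto
  then show ?case using ideal_power.prod[OF left[OF prod(1)] prod(2)] by simp
next
  case (add i f g)
  have "h \<star> (f + g) = h \<star> f + h \<star> g" using assms(2) by (rule conv_add_right)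
  then show ?case using ideal_power.add[OF add.IH] by simp
next
  case (zero i) then show ?case using assms by (simp add: ideal_power.zero)
qed (auto intro: ideal_power.intros)

lemma ideal_power_kpow: "f \<in> W \<Longrightarrow> ideal_power W i (kpow G f i)"
  by (induction i) (auto intro: ideal_power.intros)

end

context pgroup_cyclic_derived
begin

text \<open>The linear extension of F, with coefficients outside C ignored: the filtered functions
  are controlled on C only.\<close>

definition pairing :: "('a \<Rightarrow> 'k::field poly) \<Rightarrow> ('a \<Rightarrow> 'k) \<Rightarrow> 'k poly" where
  "pairing F f = (\<Sum>g\<in>C. smult (f g) (F g))"

lemma pairing_add: "pairing F (f + g) = pairing F f + pairing F g"
  by (simp add: pairing_def pw smult_add_left sum.distrib)
lemma pairing_minus: "pairing F (f - g) = pairing F f - pairing F g"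
  by (simp add: pairing_def pw smult_diff_left sum_subtractf)
lemma pairing_zero [simp]: "pairing F 0 = 0"
  by (simp add: pairing_def pw)
lemma finite_C: "finite C" using finite_subset[OF subgroup.subset[OF C_sub] fin] .
lemma pairing_dl: "z \<in> C \<Longrightarrow> pairing F (dl z) = F z"
proof -
  assume z: "z \<in> C"
  have "pairing F (dl z) = (\<Sum>g\<in>C. if g = z then F g else 0)"
    unfolding pairing_def by (rule sum.cong) (auto simp: dl_apply)
  then show ?thesis using z finite_C by simp
qed

text \<open>Left multiplication by a - 1 is adjoint to the left difference. Each factor from
  \<open>RI C\<close> thus becomes one difference of F and raises the weight by one.\<close>

lemma pairing_shift:
  assumes a: "a \<in> C" and f: "f \<in> KG"
  shows "pairing F ((dl a - dl \<one>) \<star> f) = pairing (\<lambda>h. F (a \<otimes> h) - F h) f"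
proof -
  have "(dl a - dl \<one>) \<star> f = dl a \<star> f - f" using a f by (simp add: conv_minus_left)
  moreover have "pairing F (dl a \<star> f) = (\<Sum>h\<in>C. smult (f h) (F (a \<otimes> h)))"
  proof -
    have "bij_betw (\<lambda>h. a \<otimes> h) C C"
    proof (rule bij_betw_byWitness[where f' = "\<lambda>h. inv a \<otimes> h"])
      show "\<forall>h\<in>C. inv a \<otimes> (a \<otimes> h) = h" "\<forall>h\<in>C. a \<otimes> (inv a \<otimes> h) = h" using a by auto
      show "(\<otimes>) a ` C \<subseteq> C" "(\<otimes>) (inv a) ` C \<subseteq> C" using a C_mult C_inv[OF a] by auto
    qed
    then have "pairing F (dl a \<star> f) = (\<Sum>h\<in>C. smult ((dl a \<star> f) (a \<otimes> h)) (F (a \<otimes> h)))"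
      unfolding pairing_def by (rule sum.reindex_bij_betw[symmetric])
    also have "\<dots> = (\<Sum>h\<in>C. smult (f h) (F (a \<otimes> h)))"
      using a by (intro sum.cong refl) (simp add: conv_dl_left)
    finally show ?thesis .
  qed
  ultimately show ?thesis
    by (simp add: pairing_minus) (simp add: pairing_def smult_diff_right sum_subtractf)
qed

text \<open>The lower bound half of Jennings' theorem for \<open>C\<close> in weights \<open>p ^ j\<close>: if \<open>z \<notin> P j\<close>, some quadratic \<open>\<chi>\<close> does not
  vanish at \<open>z\<close> modulo \<open>p ^ j\<close>. Pairing with \<open>tpow \<chi>\<close> maps the power of the ideal into the multiples of \<open>tX\<close> to the
  power \<open>(p ^ j + 1) / 2\<close>, whereas \<open>tpow (\<chi> z) - 1\<close> has smaller order because \<open>p \<ge> 3\<close>.\<close>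
theorem dimension_subgroup_C:
  assumes char: "CHAR('k::field) = p" and z: "z \<in> C"
    and I: "ideal_power (RI C) (p ^ j) (dl z - dl \<one> :: 'a \<Rightarrow> 'k)"
  shows "z \<in> P j"
proof (rule ccontr)
  assume nz: "z \<notin> P j"
  let ?m = "p ^ j"
  obtain \<chi> \<mu> where \<chi>: "\<forall>a\<in>C. \<forall>b\<in>C. [\<chi> (a \<otimes> b) = \<chi> a + \<chi> b + \<mu> a b] (mod int ?m)"
    and \<mu>: "\<forall>a\<in>C. \<forall>b\<in>C. \<forall>b'\<in>C. [\<mu> a (b \<otimes> b') = \<mu> a b + \<mu> a b'] (mod int ?m)"
    and \<chi>1: "[\<chi> \<one> = 0] (mod int ?m)" and \<chi>z: "\<not> [\<chi> z = 0] (mod int ?m)"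
    using quadratic_character[OF z nz] by blast
  have pr: "Factorial_Ring.prime CHAR('k)" and m: "?m = CHAR('k) ^ j" using char prime_p by auto
  define \<Lambda> where "\<Lambda> = \<mu> ` C"
  have diff: "filtered C ?m \<Lambda> \<chi> (Suc l) (\<lambda>h. F (a \<otimes> h) - F h)"
    if "filtered C ?m \<Lambda> \<chi> l F" "a \<in> C" for l a and F :: "'a \<Rightarrow> 'k poly"
    by (rule filtered_difference[where \<mu> = \<mu>, OF C_sub pr m _ _ _ that(2,1)]) (use \<chi> \<mu> in \<open>auto simp: \<Lambda>_def\<close>)
  \<comment> \<open>Generalized over F and its weight l, since each factor of the ideal trades one
    unit of i for one unit of l.\<close>
  have main: "\<forall>f l F. ideal_power (RI C) i f \<longrightarrow> filtered C ?m \<Lambda> \<chi> l F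
      \<longrightarrow> tX ^ min (Suc (i + l) div 2) ?m dvd pairing F (f :: 'a \<Rightarrow> 'k)" for i
  proof (induction i)
    case 0
    show ?case
    proof (intro allI impI)
      fix f :: "'a \<Rightarrow> 'k" and l and F :: "'a \<Rightarrow> 'k poly"
      assume F: "filtered C ?m \<Lambda> \<chi> l F"
      have "tX ^ min (Suc l div 2) ?m dvd smult (f g) (F g)" if "g \<in> C" for g
        using filtered_value[OF F that] by (rule dvd_smult)
      then show "tX ^ min (Suc (0 + l) div 2) ?m dvd pairing F f" unfolding pairing_def by (simp add: dvd_sum)
    qed
  next
    case (Suc i)
    note IH = Suc.IH[rule_format]
    show ?case
    proof (intro allI impI)
      fix f :: "'a \<Rightarrow> 'k" and l and F :: "'a \<Rightarrow> 'k poly"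
      assume f: "ideal_power (RI C) (Suc i) f" and F: "filtered C ?m \<Lambda> \<chi> l F"
      let ?d = "tX ^ min (Suc (Suc i + l) div 2) ?m :: 'k poly"
      \<comment> \<open>A right ideal, because \<open>RI C\<close> is two-sided and so its powers
        are stable under left multiplication. By \<open>RI_subset\<close> it is enough to test the
        elements a - 1, where \<open>pairing_shift\<close> applies.\<close>
      define W where "W = {u \<in> KG. \<forall>b. ideal_power (RI C) i b \<longrightarrow> ?d dvd pairing F (u \<star> b)}"
      have "rideal W"
        unfolding rideal_def
      proof (intro conjI ballI)
        show "W \<subseteq> KG" by (auto simp: W_def)
        show "0 \<in> W" by (auto simp: W_def)
      next
        fix u v assume "u \<in> W" "v \<in> W"
        then show "u + v \<in> W" by (auto simp: W_def conv_add_left pairing_add)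
      next
        fix u v :: "'a \<Rightarrow> 'k" assume u: "u \<in> W" and v: "v \<in> KG"
        have uK: "u \<in> KG" using u by (simp add: W_def)
        have "?d dvd pairing F ((u \<star> v) \<star> b)" if b: "ideal_power (RI C) i b" for b
        proof -
          have "ideal_power (RI C) i (v \<star> b)"
            by (rule ideal_power_left[OF _ v RI_left[OF C_normal _ v] b]) (auto simp: RI_KG)
          then show ?thesis using u conv_assoc[OF uK v ideal_power_KG[OF b]] by (simp add: W_def)
        qed
        then show "u \<star> v \<in> W" by (simp add: W_def)
      qed
      moreover have "(dl a - dl \<one> :: 'a \<Rightarrow> 'k) \<in> W" if a: "a \<in> C" for a
      proof -
        have "?d dvd pairing F ((dl a - dl \<one>) \<star> b)" if b: "ideal_power (RI C) i b" for b
          using IH[OF b diff[OF F a]] pairing_shift[where F = F, OF a ideal_power_KG[OF b]] by simp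
        then show ?thesis using a by (auto simp: W_def)
      qed
      ultimately have sub: "RI C \<subseteq> W" by (intro RI_subset[OF C_sub])
      from f show "?d dvd pairing F f"
      proof (induction "Suc i" f rule: ideal_power.induct)
        case (prod f g) then show ?case using sub by (auto simp: W_def)
      next
        case (add f g) then show ?case by (simp add: pairing_add)
      qed simp
    qed
  qed
  have "tX ^ min (Suc (?m + 0) div 2) ?m dvd pairing (\<lambda>g. tpow ?m (\<chi> g)) (dl z - dl \<one> :: 'a \<Rightarrow> 'k)"
    using main I filtered.base by blast
  also have "pairing (\<lambda>g. tpow ?m (\<chi> g)) (dl z - dl \<one> :: 'a \<Rightarrow> 'k) = tpow ?m (\<chi> z) - 1"
  proof -
    have "(tpow ?m (\<chi> \<one>) :: 'k poly) = 1" using tpow_cong[OF \<chi>1] by simp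
    then show ?thesis using z by (simp add: pairing_minus pairing_dl C_one)
  qed
  also have "min (Suc (?m + 0) div 2) ?m = (?m + 1) div 2"
    using p_gt_0 by (simp add: min_def)
  finally show False
    using tpow_order[OF pr _ m \<chi>z] odd_p by (simp add: char)
qed

end

section \<open>Orders of the power subgroups\<close>

lemma (in fgroup) card_set_mult:
  assumes A: "subgroup A G" and B: "subgroup B G"
  shows "card (A <#> B) * card (A \<inter> B) = card A * card B"
proof -
  let ?f = "\<lambda>(a, b). a \<otimes> b"
  have fA: "finite A" "finite B" using subgroup.subset[OF A] subgroup.subset[OF B] fin by (auto intro: finite_subset)
  have AB: "A <#> B = ?f ` (A \<times> B)" by (auto simp: set_mult_def)
  have fib: "card {ab \<in> A \<times> B. ?f ab = x} = card (A \<inter> B)" if x: "x \<in> A <#> B" for x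
  proof -
    obtain a b where ab: "a \<in> A" "b \<in> B" "x = a \<otimes> b" using x by (auto simp: set_mult_def)
    have c: "a \<in> carrier G" "b \<in> carrier G" using ab subgroup.mem_carrier[OF A] subgroup.mem_carrier[OF B] by auto
    have "bij_betw (\<lambda>k. (a \<otimes> k, inv k \<otimes> b)) (A \<inter> B) {ab \<in> A \<times> B. ?f ab = x}"
    proof (rule bij_betw_byWitness[where f' = "\<lambda>ab. inv a \<otimes> fst ab"])
      show "\<forall>k\<in>A \<inter> B. inv a \<otimes> fst (a \<otimes> k, inv k \<otimes> b) = k"
        using c subgroup.mem_carrier[OF A] by auto
      show "(\<lambda>k. (a \<otimes> k, inv k \<otimes> b)) ` (A \<inter> B) \<subseteq> {ab \<in> A \<times> B. ?f ab = x}"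
      proof
        fix y assume "y \<in> (\<lambda>k. (a \<otimes> k, inv k \<otimes> b)) ` (A \<inter> B)"
        then obtain k where k: "k \<in> A" "k \<in> B" "y = (a \<otimes> k, inv k \<otimes> b)" by blast
        have kc: "k \<in> carrier G" using k subgroup.mem_carrier[OF A] by blast
        have "a \<otimes> k \<in> A" "inv k \<otimes> b \<in> B"
          using ab k subgroup.m_closed[OF A] subgroup.m_closed[OF B] subgroup.m_inv_closed[OF B] by auto
        then show "y \<in> {ab \<in> A \<times> B. ?f ab = x}" using c kc ab k by (simp add: m_assoc)
      qed
      have *: "inv a \<otimes> a' \<in> A \<inter> B \<and> inv (inv a \<otimes> a') \<otimes> b = b'"
        if "a' \<in> A" "b' \<in> B" "a' \<otimes> b' = x" for a' b'
      proof -
        have c': "a' \<in> carrier G" "b' \<in> carrier G" using that subgroup.mem_carrier[OF A] subgroup.mem_carrier[OF B] by auto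
        have eq: "inv a \<otimes> a' \<otimes> b' = b" using that ab c c' by (simp add: m_assoc)
        have "inv a \<otimes> a' = b \<otimes> inv b'" using eq c c' inv_solve_right[of "inv a \<otimes> a'" b b'] by simp
        moreover have "b \<otimes> inv b' \<in> B" using ab that subgroup.m_closed[OF B] subgroup.m_inv_closed[OF B] by auto
        moreover have "inv a \<otimes> a' \<in> A" using ab that subgroup.m_closed[OF A] subgroup.m_inv_closed[OF A] by auto
        moreover have "inv (inv a \<otimes> a') \<otimes> b = b'" unfolding eq[symmetric] using c c' by simp
        ultimately show ?thesis by auto
      qed
      show "(\<lambda>ab. inv a \<otimes> fst ab) ` {ab \<in> A \<times> B. ?f ab = x} \<subseteq> A \<inter> B" using * by auto
      show "\<forall>ab\<in>{ab \<in> A \<times> B. ?f ab = x}. (a \<otimes> (inv a \<otimes> fst ab), inv (inv a \<otimes> fst ab) \<otimes> b) = ab"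
        using * c subgroup.mem_carrier[OF A] by auto
    qed
    then show ?thesis by (rule bij_betw_same_card[symmetric])
  qed
  have "card A * card B = card (A \<times> B)" by (simp add: card_cartesian_product)
  also have "\<dots> = (\<Sum>x\<in>A <#> B. card {ab \<in> A \<times> B. ?f ab = x})"
    using sum.group[of "A \<times> B" "A <#> B" ?f "\<lambda>_. 1::nat"] fA by (simp add: AB)
  also have "\<dots> = card (A <#> B) * card (A \<inter> B)" using fib by simp
  finally show ?thesis by simp
qed

context pgroup_cyclic_derived
begin

definition Dp where "Dp t = generate G {c [^] (p ^ t)}"

lemma Dp_sub: "subgroup (Dp t) G" unfolding Dp_def by (rule generate_is_subgroup) auto

lemma Dp_mem: "c [^] (p ^ t) \<in> Dp t" unfolding Dp_def by (rule generate.incl) simp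

lemma Dp_card: "t \<le> n \<Longrightarrow> card (Dp t) = p ^ (n - t)"
proof -
  assume t: "t \<le> n"
  then have "p ^ n = p ^ t * p ^ (n - t)" by (simp flip: power_add)
  then have "ord (c [^] (p ^ t)) = p ^ (n - t)"
    using ord_pow[OF c_closed, of "p ^ t"] p_gt_0 by (simp add: ord_c)
  then show ?thesis unfolding Dp_def using generate_pow_card[of "c [^] (p ^ t)"] by simp
qed

text \<open>The last clause reads t off from the powers c^(p^u) that lie in S, and this is the
  information that can be compared between G and H.\<close>

lemma D_subgroup_structure:
  assumes S: "subgroup S G" "S \<subseteq> D"
  shows "\<exists>t\<le>n. S = Dp t \<and> (\<forall>u. c [^] (p ^ u) \<in> S \<longleftrightarrow> t \<le> u)"
proof -
  define t where "t = (LEAST t. c [^] (p ^ t) \<in> S)"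
  have "c [^] (p ^ n) \<in> S" using subgroup.one_closed[OF S(1)] by (simp add: c_pow_one[THEN iffD2])
  then have t: "c [^] (p ^ t) \<in> S" "t \<le> n" unfolding t_def by (auto intro: LeastI Least_le)
  have iff: "c [^] (p ^ u) \<in> S \<longleftrightarrow> t \<le> u" for u
  proof
    assume "c [^] (p ^ u) \<in> S" then show "t \<le> u" unfolding t_def by (rule Least_le)
  next
    assume "t \<le> u"
    then have "p ^ u = p ^ t * p ^ (u - t)" by (simp flip: power_add)
    then have "c [^] (p ^ u) = (c [^] (p ^ t)) [^] (p ^ (u - t))" by (simp add: nat_pow_pow)
    then show "c [^] (p ^ u) \<in> S" using subgroup_pow_closed[OF S(1) t(1)] by simp
  qed
  have "S \<subseteq> Dp t"
  proof
    fix x assume x: "x \<in> S"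
    then obtain i :: nat where i: "x = c [^] i" using S(2) by (auto simp: D_eq)
    show "x \<in> Dp t"
    proof (cases "i = 0")
      case True then show ?thesis using i subgroup.one_closed[OF Dp_sub] by simp
    next
      case False
      then obtain l i' where l: "i = p ^ l * i'" "\<not> p dvd i'"
        using prime_p by (metis multiplicity_decompose' not_prime_unit)
      have "coprime i' p" using l(2) prime_p by (metis coprime_commute prime_imp_coprime)
      then obtain w where w: "\<forall>d\<in>D. d [^] (i' * w) = d" using D_unit_root by blast
      have "x [^] w = (c [^] (p ^ l)) [^] (i' * w)" by (simp add: i l(1) nat_pow_pow mult.assoc)
      also have "\<dots> = c [^] (p ^ l)" using w by simp
      finally have "c [^] (p ^ l) \<in> S" using subgroup_pow_closed[OF S(1) x] by metis
      then have "t \<le> l" using iff by blast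
      then have "i = p ^ t * (p ^ (l - t) * i')" using l by (simp flip: power_add mult.assoc)
      then have "x = (c [^] (p ^ t)) [^] (p ^ (l - t) * i')" unfolding i by (simp add: nat_pow_pow)
      then show ?thesis using subgroup_pow_closed[OF Dp_sub Dp_mem] by simp
    qed
  qed
  moreover have "Dp t \<subseteq> S" unfolding Dp_def using t S by (intro generate_subgroup_incl) auto
  ultimately show ?thesis using t iff by blast
qed

lemma D_subgroup_chain:
  assumes "subgroup S G" "S \<subseteq> D" "subgroup T G" "T \<subseteq> D" "card S \<le> card T"
  shows "S \<subseteq> T"
proof -
  obtain t where t: "t \<le> n" "S = Dp t" "\<forall>u. c [^] (p ^ u) \<in> S \<longleftrightarrow> t \<le> u" using D_subgroup_structure[OF assms(1,2)] by blast
  obtain r where r: "r \<le> n" "T = Dp r" "\<forall>u. c [^] (p ^ u) \<in> T \<longleftrightarrow> r \<le> u" using D_subgroup_structure[OF assms(3,4)] by blast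
  have "p ^ (n - t) \<le> p ^ (n - r)" using assms(5) t r Dp_card by simp
  then have "n - t \<le> n - r" by (rule power_le_imp_le_exp[OF p_gt_1])
  then have "r \<le> t" using t r by simp
  then show ?thesis using r assms(3) unfolding t(2) Dp_def by (intro generate_subgroup_incl) auto
qed

lemma D_subgroup_card_Int:
  assumes "subgroup S G" "S \<subseteq> D" "subgroup T G" "T \<subseteq> D"
  shows "card (S \<inter> T) = min (card S) (card T)"
proof (cases "card S \<le> card T")
  case True
  then show ?thesis using D_subgroup_chain[OF assms] by (simp add: Int_absorb2 min_def)
next
  case False
  then show ?thesis using D_subgroup_chain[OF assms(3,4,1,2)] by (simp add: Int_absorb1 min_def)
qed

section \<open>Transfer of ideals and subgroup orders between G and H\<close>

lemma dl_Z_central: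
  assumes "z \<in> Z" "f \<in> KG"
  shows "(dl z - dl \<one>) \<star> f = f \<star> (dl z - dl \<one>)"
proof -
  have zi: "inv z \<in> Z" using assms by (simp add: Z_inv)
  have "dl z \<star> f = f \<star> dl z"
  proof (rule KG_eqI)
    fix x assume x: "x \<in> carrier G"
    show "(dl z \<star> f) x = (f \<star> dl z) x"
      using assms x Z_comm[OF zi x] by (simp add: conv_dl_left conv_dl_right)
  qed auto
  then show ?thesis using assms by (simp add: conv_minus_left conv_minus_right)
qed

end

text \<open>Symmetric in G and H, with common \<open>n\<close> and \<open>N\<close>: by
  \<open>inv_kiso_pgroups\<close> the inverse is again an instance, so every inclusion or inequality
  proved here comes with its reverse.\<close>

locale kiso_pgroups = kiso G H \<phi> + G: pgroup_cyclic_derived G p c n N + H: pgroup_cyclic_derived H p c' n N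
  for G :: "('a, 'c) monoid_scheme" and H :: "('b, 'd) monoid_scheme"
    and \<phi> :: "('a \<Rightarrow> 'k::field) \<Rightarrow> ('b \<Rightarrow> 'k)" and p c c' n N +
  assumes char: "CHAR('k) = p"
begin

sublocale kiso_pgroup G H \<phi> p c n N
  by unfold_locales (rule char)

lemma inv_kiso_pgroups: "kiso_pgroups H G (inv_into G.KG \<phi>) p c' c n N"
proof -
  interpret I: kiso H G "inv_into G.KG \<phi>" by (rule inv_kiso)
  show ?thesis by unfold_locales (rule char)
qed

lemma prime_char: "Factorial_Ring.prime CHAR('k)" using char G.prime_p by simp

lemma eq_inv: "g \<in> H.KG \<Longrightarrow> \<phi> (inv_into G.KG \<phi> g) = g" "g \<in> H.KG \<Longrightarrow> inv_into G.KG \<phi> g \<in> G.KG"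
  using bij by (auto simp: bij_betw_def f_inv_into_f inv_into_into)

lemma image_RI_D: "f \<in> G.RI G.D \<Longrightarrow> \<phi> f \<in> H.RI H.D"
  using image_RI_derived unfolding G.D_def H.D_def by blast

lemma phi_D: "d \<in> G.D \<Longrightarrow> \<phi> (dl d - dl \<one>\<^bsub>G\<^esub>) \<in> H.RI H.D"
  by (rule image_RI_D[OF iffD2[OF G.RI_dl_iff[OF G.D_sub G.D_carrier]]])

lemma phi_mult_dl:
  assumes W: "H.rideal W" and "x \<in> carrier G" "y \<in> carrier G"
    and "\<phi> (dl x - dl \<one>\<^bsub>G\<^esub>) \<in> W" "\<phi> (dl y - dl \<one>\<^bsub>G\<^esub>) \<in> W"
  shows "\<phi> (dl (x \<otimes>\<^bsub>G\<^esub> y) - dl \<one>\<^bsub>G\<^esub>) \<in> W"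
proof -
  have e: "dl (x \<otimes>\<^bsub>G\<^esub> y) - dl \<one>\<^bsub>G\<^esub> = conv G (dl x - dl \<one>\<^bsub>G\<^esub>) (dl y) + (dl y - dl \<one>\<^bsub>G\<^esub> :: 'a \<Rightarrow> 'k)"
    using assms by (simp add: G.conv_minus_left G.conv_dl_dl)
  have "\<phi> (dl (x \<otimes>\<^bsub>G\<^esub> y) - dl \<one>\<^bsub>G\<^esub>) = conv H (\<phi> (dl x - dl \<one>\<^bsub>G\<^esub>)) (\<phi> (dl y)) + \<phi> (dl y - dl \<one>\<^bsub>G\<^esub>)"
    unfolding e using assms by (simp add: add mult)
  then show ?thesis using W assms unfolding H.rideal_def by (metis G.KG_dl closed)
qed

lemma image_RI_ZD: "\<phi> ` G.RI G.ZD \<subseteq> H.RI H.ZD"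
proof (rule image_RI_subset[OF G.ZD_sub H.rideal_RI[OF H.ZD_sub]])
  fix m assume "m \<in> G.ZD"
  then obtain z d where zd: "z \<in> G.Z" "d \<in> G.D" "m = z \<otimes>\<^bsub>G\<^esub> d" by (auto simp: G.ZD_def set_mult_def)
  have zK: "dl z - dl \<one>\<^bsub>G\<^esub> \<in> G.KG" using zd by auto
  have "\<phi> (dl z - dl \<one>\<^bsub>G\<^esub>) \<in> H.RI H.ZD"
  proof (rule H.central_RI_ZD[OF char])
    show "aug (\<phi> (dl z - dl \<one>\<^bsub>G\<^esub>)) = 0" using aug_preserved[OF zK] zd by (simp add: G.aug_minus)
    fix g :: "'b \<Rightarrow> 'k" assume "g \<in> H.KG"
    then obtain f where f: "f \<in> G.KG" "g = \<phi> f" using surj by blast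
    show "conv H (\<phi> (dl z - dl \<one>\<^bsub>G\<^esub>)) g = conv H g (\<phi> (dl z - dl \<one>\<^bsub>G\<^esub>))"
      unfolding f using G.dl_Z_central[OF zd(1) f(1)] mult[OF zK f(1)] mult[OF f(1) zK] by simp
  qed (use zK in auto)
  moreover have "\<phi> (dl d - dl \<one>\<^bsub>G\<^esub>) \<in> H.RI H.ZD"
    using phi_D[OF zd(2)] H.RI_mono[OF H.D_sub H.ZD_sub H.ZD_D] by blast
  ultimately show "\<phi> (dl m - dl \<one>\<^bsub>G\<^esub>) \<in> H.RI H.ZD"
    unfolding zd(3) using zd by (intro phi_mult_dl H.rideal_RI[OF H.ZD_sub]) auto
qed

lemma kpow_xc: "kpow G (dl c - dl \<one>\<^bsub>G\<^esub> :: 'a \<Rightarrow> 'k) (p ^ e) = dl (c [^]\<^bsub>G\<^esub> (p ^ e)) - dl \<one>\<^bsub>G\<^esub>"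
  using G.kpow_diff_one[OF prime_char G.c_closed, of e] by (simp add: char)

lemma kpow_xc': "kpow H (dl c' - dl \<one>\<^bsub>H\<^esub> :: 'b \<Rightarrow> 'k) (p ^ e) = dl (c' [^]\<^bsub>H\<^esub> (p ^ e)) - dl \<one>\<^bsub>H\<^esub>"
  using H.kpow_diff_one[OF prime_char H.c_closed, of e] by (simp add: char)

text \<open>\<phi>(c - 1) lies in (c' - 1)kH, so by \<open>RI_D_kpow\<close> its p^t-th power, the
  image of c^(p^t) - 1, is a multiple of (c' - 1)^(p^t) = c'^(p^t) - 1.\<close>

lemma image_RI_Dp: "\<phi> ` G.RI (G.Dp t) \<subseteq> H.RI (H.Dp t)"
proof (rule image_RI_subset[OF G.Dp_sub H.rideal_RI[OF H.Dp_sub]])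
  have xK: "dl c - dl \<one>\<^bsub>G\<^esub> \<in> G.KG" by auto
  obtain h where h: "h \<in> H.KG" "kpow H (\<phi> (dl c - dl \<one>\<^bsub>G\<^esub>)) (p ^ t) = conv H (kpow H (dl c' - dl \<one>\<^bsub>H\<^esub>) (p ^ t)) h"
    using H.RI_D_kpow[OF image_RI_D[OF G.xc_RI]] by blast
  have cp: "c' [^]\<^bsub>H\<^esub> (p ^ t) \<in> carrier H" by simp
  have "dl (c' [^]\<^bsub>H\<^esub> (p ^ t)) - dl \<one>\<^bsub>H\<^esub> \<in> (H.RI (H.Dp t) :: ('b \<Rightarrow> 'k) set)"
    by (rule iffD2[OF H.RI_dl_iff[OF H.Dp_sub cp] H.Dp_mem])
  then have "\<phi> (dl (c [^]\<^bsub>G\<^esub> (p ^ t)) - dl \<one>\<^bsub>G\<^esub>) \<in> H.RI (H.Dp t)"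
    unfolding kpow_xc[symmetric] kpow[OF xK] h(2) kpow_xc' using h(1) by (intro H.RI_right[OF H.Dp_sub])
  then have x: "dl (c [^]\<^bsub>G\<^esub> (p ^ t)) - dl \<one>\<^bsub>G\<^esub> \<in> {f \<in> G.KG. \<phi> f \<in> H.RI (H.Dp t)}" by auto
  fix m assume "m \<in> G.Dp t"
  then have "dl m - dl \<one>\<^bsub>G\<^esub> \<in> {f \<in> G.KG. \<phi> f \<in> H.RI (H.Dp t)}"
    unfolding G.Dp_def
    by (rule G.rideal_generate[OF rideal_preimage[OF H.rideal_RI[OF H.Dp_sub]], rotated 2]) (use x in auto)
  then show "\<phi> (dl m - dl \<one>\<^bsub>G\<^esub>) \<in> H.RI (H.Dp t)" by blast
qed

text \<open>For w in \<open>H.M\<close> the preimage of w - 1 is central and lies in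
  \<open>RI D\<close>, hence in \<open>RI M\<close> by \<open>central_RI_M\<close>. Here M is some
  \<open>Dp t\<close>, so mapping back by \<open>image_RI_Dp\<close> puts w into the subgroup of H'
  of the same order as \<open>G.M\<close>.\<close>

lemma s_le: "H.s \<le> G.s"
proof -
  interpret I: kiso_pgroups H G "inv_into G.KG \<phi>" p c' c n N by (rule inv_kiso_pgroups)
  obtain t where t: "t \<le> n" "G.M = G.Dp t" using G.M_structure unfolding G.Dp_def by blast
  have "H.M \<subseteq> H.Dp t"
  proof
    fix w assume w: "w \<in> H.M"
    then have wZ: "w \<in> H.Z" and wD: "w \<in> H.D" by (auto simp: H.M_def)
    have wc: "w \<in> carrier H" using wZ by simp
    let ?y = "dl w - dl \<one>\<^bsub>H\<^esub> :: 'b \<Rightarrow> 'k"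
    let ?f = "inv_into G.KG \<phi> ?y"
    have yK: "?y \<in> H.KG" using wc by auto
    have "?f \<in> G.RI G.D" by (rule I.phi_D[OF wD])
    moreover have "conv G ?f g = conv G g ?f" if g: "g \<in> G.KG" for g
    proof -
      have "conv H ?y (\<phi> g) = conv H (\<phi> g) ?y" using g by (intro H.dl_Z_central wZ) auto
      then have "\<phi> (conv G ?f g) = \<phi> (conv G g ?f)" using eq_inv[OF yK] g by (simp add: mult)
      then show ?thesis using inject by blast
    qed
    ultimately have "?f \<in> G.RI G.M" by (intro G.central_RI_M[OF char])
    then have "\<phi> ?f \<in> H.RI (H.Dp t)" using image_RI_Dp unfolding t by blast
    then have "?y \<in> H.RI (H.Dp t)" by (simp only: eq_inv(1)[OF yK])
    then show "w \<in> H.Dp t" by (rule iffD1[OF H.RI_dl_iff[OF H.Dp_sub wc]])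
  qed
  then have "card H.M \<le> card (H.Dp t)"
    using finite_subset[OF subgroup.subset[OF H.Dp_sub] H.fin] by (intro card_mono)
  also have "\<dots> = card G.M" using t G.Dp_card H.Dp_card by simp
  finally have "p ^ H.s \<le> p ^ G.s" by (simp add: G.card_M H.card_M)
  then show ?thesis by (rule power_le_imp_le_exp[OF G.p_gt_1])
qed

lemma s_eq: "G.s = H.s"
proof -
  interpret I: kiso_pgroups H G "inv_into G.KG \<phi>" p c' c n N by (rule inv_kiso_pgroups)
  show ?thesis using s_le I.s_le by simp
qed

lemma image_RI_C: "\<phi> ` G.RI G.C \<subseteq> H.RI H.C"
proof
  fix g assume "g \<in> \<phi> ` G.RI G.C"
  then obtain f where f: "f \<in> G.RI G.C" "g = \<phi> f" by blast
  have fK: "f \<in> G.KG" by (rule G.RI_KG[OF f(1)])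
  have "kpow G f (p ^ G.s) \<in> G.RI G.ZD" using G.RI_C_iff[OF char fK] f by simp
  then have "kpow H (\<phi> f) (p ^ H.s) \<in> H.RI H.ZD" using image_RI_ZD kpow[OF fK] s_eq by force
  then show "g \<in> H.RI H.C" unfolding f(2) using H.RI_C_iff[OF char closed[OF fK]] by simp
qed

lemma image_RI_C_eq: "\<phi> ` G.RI G.C = H.RI H.C"
proof -
  interpret I: kiso_pgroups H G "inv_into G.KG \<phi>" p c' c n N by (rule inv_kiso_pgroups)
  have "g \<in> \<phi> ` G.RI G.C" if g: "g \<in> H.RI H.C" for g
    using I.image_RI_C g eq_inv[OF H.RI_KG[OF g]] by (metis image_eqI image_subset_iff)
  then show ?thesis using image_RI_C by blast
qed

lemma phi_C: "g \<in> G.C \<Longrightarrow> \<phi> (dl g - dl \<one>\<^bsub>G\<^esub>) \<in> H.RI H.C"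
proof -
  assume g: "g \<in> G.C"
  have "dl g - dl \<one>\<^bsub>G\<^esub> \<in> (G.RI G.C :: ('a \<Rightarrow> 'k) set)"
    by (rule iffD2[OF G.RI_dl_iff[OF G.C_sub G.C_carrier[OF g]] g])
  then show ?thesis using image_RI_C by blast
qed

lemma phi_pow:
  assumes "g \<in> carrier G"
  shows "\<phi> (dl (g [^]\<^bsub>G\<^esub> (p ^ j)) - dl \<one>\<^bsub>G\<^esub>) = kpow H (\<phi> (dl g - dl \<one>\<^bsub>G\<^esub>)) (p ^ j)"
proof -
  have "dl (g [^]\<^bsub>G\<^esub> (p ^ j)) - dl \<one>\<^bsub>G\<^esub> = kpow G (dl g - dl \<one>\<^bsub>G\<^esub> :: 'a \<Rightarrow> 'k) (p ^ j)"
    using G.kpow_diff_one[OF prime_char assms, of j] by (simp add: char)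
  then show ?thesis using assms by (simp add: kpow)
qed

lemma image_RI_PD: "\<phi> ` G.RI (G.PD j) \<subseteq> H.RI (H.PD j)"
proof (rule image_RI_subset[OF G.PD_sub H.rideal_RI[OF H.PD_sub]])
  fix m assume "m \<in> G.PD j"
  then obtain g d where gd: "g \<in> G.C" "d \<in> G.D" "m = g [^]\<^bsub>G\<^esub> (p ^ j) \<otimes>\<^bsub>G\<^esub> d"
    by (auto simp: G.PD_def G.P_def set_mult_def)
  have "\<phi> (dl (g [^]\<^bsub>G\<^esub> (p ^ j)) - dl \<one>\<^bsub>G\<^esub>) \<in> H.RI (H.PD j)"
    using H.RI_C_power[OF char phi_C[OF gd(1)]] phi_pow[of g j] gd by simp
  moreover have "\<phi> (dl d - dl \<one>\<^bsub>G\<^esub>) \<in> H.RI (H.PD j)"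
    using phi_D[OF gd(2)] H.RI_mono[OF H.D_sub H.PD_sub H.PD_D] by blast
  ultimately show "\<phi> (dl m - dl \<one>\<^bsub>G\<^esub>) \<in> H.RI (H.PD j)"
    unfolding gd(3) using gd by (intro phi_mult_dl H.rideal_RI[OF H.PD_sub]) auto
qed

lemma card_PD: "card (G.PD j) = card (H.PD j)"
proof -
  interpret I: kiso_pgroups H G "inv_into G.KG \<phi>" p c' c n N by (rule inv_kiso_pgroups)
  show ?thesis by (rule card_rcosets_eq[OF G.PD_normal H.PD_normal image_RI_PD I.image_RI_PD])
qed

text \<open>If c^(p^u) = g^(p^j), the image of c^(p^u) - 1 is \<phi>(g - 1)^(p^j), in the p^j-th
  power of \<open>RI C\<close>. The preimage of c' - 1 is a multiple of c - 1, so c'^(p^u) - 1 is a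
  right multiple of that image, lies in the same power, and \<open>dimension_subgroup_C\<close>
  applies.\<close>

lemma power_in_P:
  assumes "c [^]\<^bsub>G\<^esub> (p ^ u) \<in> G.P j"
  shows "c' [^]\<^bsub>H\<^esub> (p ^ u) \<in> H.P j"
proof -
  interpret I: kiso_pgroups H G "inv_into G.KG \<phi>" p c' c n N by (rule inv_kiso_pgroups)
  obtain g where g: "g \<in> G.C" "c [^]\<^bsub>G\<^esub> (p ^ u) = g [^]\<^bsub>G\<^esub> (p ^ j)" using assms by (auto simp: G.P_def)
  have xK: "dl c - dl \<one>\<^bsub>G\<^esub> \<in> G.KG" by auto
  have ip: "H.ideal_power (H.RI H.C) (p ^ j) (\<phi> (dl (c [^]\<^bsub>G\<^esub> (p ^ u)) - dl \<one>\<^bsub>G\<^esub>))"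
    unfolding g(2) using phi_pow[of g j] H.ideal_power_kpow[OF phi_C[OF g(1)]] g by simp
  let ?y = "dl c' - dl \<one>\<^bsub>H\<^esub> :: 'b \<Rightarrow> 'k"
  let ?w = "inv_into G.KG \<phi> ?y"
  have yK: "?y \<in> H.KG" by auto
  have wD: "?w \<in> G.RI G.D" by (rule I.phi_D[OF H.c_D])
  obtain h where h: "h \<in> G.KG" "kpow G ?w (p ^ u) = conv G (kpow G (dl c - dl \<one>\<^bsub>G\<^esub>) (p ^ u)) h"
    using G.RI_D_kpow[OF wD] by blast
  have "dl (c' [^]\<^bsub>H\<^esub> (p ^ u)) - dl \<one>\<^bsub>H\<^esub> = kpow H (\<phi> ?w) (p ^ u)"
    using eq_inv[OF yK] kpow_xc'[of u] by simp
  also have "\<dots> = \<phi> (kpow G ?w (p ^ u))" using kpow[OF eq_inv(2)[OF yK]] by simp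
  also have "\<dots> = conv H (\<phi> (dl (c [^]\<^bsub>G\<^esub> (p ^ u)) - dl \<one>\<^bsub>G\<^esub>)) (\<phi> h)"
    unfolding h(2) kpow_xc using h(1) by (simp add: mult)
  finally have "H.ideal_power (H.RI H.C) (p ^ j) (dl (c' [^]\<^bsub>H\<^esub> (p ^ u)) - dl \<one>\<^bsub>H\<^esub> :: 'b \<Rightarrow> 'k)"
    using H.ideal_power_right[OF _ closed[OF h(1)] ip] H.RI_KG by auto
  then show ?thesis by (intro H.dimension_subgroup_C[OF char]) (auto simp: H.D_C)
qed

lemma card_P_Int_D: "card (G.P j \<inter> G.D) = card (H.P j \<inter> H.D)"
proof -
  interpret I: kiso_pgroups H G "inv_into G.KG \<phi>" p c' c n N by (rule inv_kiso_pgroups)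
  obtain t where t: "t \<le> n" "G.P j \<inter> G.D = G.Dp t" "\<forall>u. c [^]\<^bsub>G\<^esub> (p ^ u) \<in> G.P j \<inter> G.D \<longleftrightarrow> t \<le> u"
    using G.D_subgroup_structure[OF G.subgroups_Inter_pair[OF G.P_sub G.D_sub]] by blast
  obtain r where r: "r \<le> n" "H.P j \<inter> H.D = H.Dp r" "\<forall>u. c' [^]\<^bsub>H\<^esub> (p ^ u) \<in> H.P j \<inter> H.D \<longleftrightarrow> r \<le> u"
    using H.D_subgroup_structure[OF H.subgroups_Inter_pair[OF H.P_sub H.D_sub]] by blast
  have "t \<le> u \<longleftrightarrow> r \<le> u" for u
    using t(3) r(3) power_in_P[of u j] I.power_in_P[of u j] G.c_pow_D H.c_pow_D by blast
  then have "t = r" by (metis le_antisym order_refl)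
  then show ?thesis using t r G.Dp_card H.Dp_card by simp
qed

lemma card_P: "card (G.P j) = card (H.P j)"
proof -
  have "card (G.PD j) * card (G.P j \<inter> G.D) = card (G.P j) * card G.D"
    unfolding G.PD_def by (rule G.card_set_mult[OF G.P_sub G.D_sub])
  moreover have "card (H.PD j) * card (H.P j \<inter> H.D) = card (H.P j) * card H.D"
    unfolding H.PD_def by (rule H.card_set_mult[OF H.P_sub H.D_sub])
  ultimately show ?thesis using card_PD card_P_Int_D G.card_D H.card_D G.p_gt_0 by simp
qed

end

section \<open>Finite abelian groups and the sizes of their power subgroups\<close>

lemma card_eq_1_mem:
  assumes "x \<in> S" shows "card S = 1 \<longleftrightarrow> S = {x}"
proof
  assume "card S = 1"
  then obtain z where "S = {z}" by (rule card_1_singletonE)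
  then show "S = {x}" using assms by simp
qed simp

context comm_group
begin

lemma subgroup_comm_group: "subgroup H G \<Longrightarrow> comm_group (G\<lparr>carrier := H\<rparr>)"
proof -
  assume H: "subgroup H G"
  have "group (G\<lparr>carrier := H\<rparr>)" by (rule subgroup_imp_group[OF H])
  then show ?thesis
    by (rule group.group_comm_groupI) (use subgroup.mem_carrier[OF H] m_comm in auto)
qed

text \<open>A cyclic subgroup of order equal to the exponent m is a direct factor: its isomorphism
  with the integers modulo m extends to the whole group, and the kernel is a complement. The value 1
  at a is admissible because m times 1 is 0 modulo m.\<close>

lemma charmod_retraction:
  assumes fin: "finite (carrier G)" and a: "a \<in> carrier G" and m: "ord a = m"
    and exp: "\<And>x. x \<in> carrier G \<Longrightarrow> x [^] m = \<one>"
  shows "\<exists>\<chi>. charmod G m (carrier G) \<chi> \<and> [\<chi> a = 1] (mod int m)"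
proof -
  have m0: "m > 0" using ord_ge_1[OF fin a] m by simp
  have B: "subgroup {\<one>} G" by (rule triv_subgroup)
  have d: "a [^] k \<in> {\<one>} \<longleftrightarrow> int m dvd k" for k :: int using int_pow_eq_id[OF a] m by simp
  have y: "[int m * 1 = (\<lambda>_. 0) (a [^] m)] (mod int m)" by (simp add: cong_0_iff)
  have "charmod G m {\<one>} (\<lambda>_. 0)" by (simp add: charmod_def)
  then obtain \<chi>1 where \<chi>1: "charmod G m {b \<otimes> a [^] k |b k::int. b \<in> {\<one>}} \<chi>1"
    "\<forall>b\<in>{\<one>}. [\<chi>1 b = 0] (mod int m)" "[\<chi>1 a = 1] (mod int m)"
    using charmod_extend_step[OF B a _ m0 d y] by blast
  let ?B' = "{b \<otimes> a [^] k |b k::int. b \<in> {\<one>}}"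
  have one: "\<one> \<in> ?B'"
  proof -
    have "\<one> = \<one> \<otimes> a [^] (0::int)" by simp
    then show ?thesis by blast
  qed
  have "g [^] m \<in> ?B' \<and> [\<chi>1 (g [^] m) = 0] (mod int m)" if "g \<in> carrier G" for g
    using one \<chi>1(2) exp[OF that] by simp
  then obtain \<chi> where \<chi>: "charmod G m (carrier G) \<chi>" "\<forall>b\<in>?B'. [\<chi> b = \<chi>1 b] (mod int m)"
    using charmod_extend[OF fin m0 subgroup_adjoin[OF B a] \<chi>1(1)] by blast
  have "a \<in> ?B'"
  proof -
    have "a = \<one> \<otimes> a [^] (1::int)" using a by simp
    then show ?thesis by blast
  qed
  then have "[\<chi> a = 1] (mod int m)" using \<chi>(2) \<chi>1(3) by (blast intro: cong_trans)
  then show ?thesis using \<chi>(1) by blast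
qed

lemma charmod_kernel:
  assumes \<chi>: "charmod G m (carrier G) \<chi>"
  shows "subgroup {x \<in> carrier G. [\<chi> x = 0] (mod int m)} G"
proof (rule subgroupI)
  have add: "[\<chi> (x \<otimes> y) = \<chi> x + \<chi> y] (mod int m)" if "x \<in> carrier G" "y \<in> carrier G" for x y
    using \<chi> that unfolding charmod_def by blast
  have one: "[\<chi> \<one> = 0] (mod int m)" by (rule charmod_one[OF \<chi> subgroup_self])
  show "{x \<in> carrier G. [\<chi> x = 0] (mod int m)} \<noteq> {}" using one by blast
  fix x assume x: "x \<in> {x \<in> carrier G. [\<chi> x = 0] (mod int m)}"
  have "[\<chi> (x \<otimes> inv x) = \<chi> x + \<chi> (inv x)] (mod int m)" using add[of x "inv x"] x by simp
  also have "[\<chi> x + \<chi> (inv x) = 0 + \<chi> (inv x)] (mod int m)" using x by (intro cong_add) auto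
  finally have "[\<chi> (inv x) = \<chi> (x \<otimes> inv x)] (mod int m)" by (simp add: cong_sym)
  then have "[\<chi> (inv x) = 0] (mod int m)" using one x by (auto intro: cong_trans)
  then show "inv x \<in> {x \<in> carrier G. [\<chi> x = 0] (mod int m)}" using x by simp
  fix y assume y: "y \<in> {x \<in> carrier G. [\<chi> x = 0] (mod int m)}"
  have "[\<chi> (x \<otimes> y) = \<chi> x + \<chi> y] (mod int m)" using add x y by simp
  also have "[\<chi> x + \<chi> y = 0 + 0] (mod int m)" using x y by (intro cong_add) auto
  finally show "x \<otimes> y \<in> {x \<in> carrier G. [\<chi> x = 0] (mod int m)}" using x y by simp
qed auto

lemma charmod_int_pow:
  assumes fin: "finite (carrier G)" and \<chi>: "charmod G m (carrier G) \<chi>" and a: "a \<in> carrier G" "[\<chi> a = 1] (mod int m)"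
  shows "[\<chi> (a [^] (k::int)) = k] (mod int m)"
proof -
  have nn: "[\<chi> (a [^] (i::nat)) = int i] (mod int m)" for i
  proof -
    have "[\<chi> (a [^] i) = int i * \<chi> a] (mod int m)" by (rule charmod_pow[OF \<chi> subgroup_self a(1)])
    also have "[int i * \<chi> a = int i * 1] (mod int m)" by (intro cong_mult a(2) cong_refl)
    finally show ?thesis by simp
  qed
  show ?thesis
  proof (cases k rule: int_cases2)
    case (nonneg i) then show ?thesis using nn by (simp add: int_pow_int)
  next
    case (nonpos i)
    have "[\<chi> (a [^] k \<otimes> a [^] i) = \<chi> (a [^] k) + \<chi> (a [^] i)] (mod int m)"
      using \<chi> a unfolding charmod_def by blast
    also have "a [^] k \<otimes> a [^] i = \<one>" using a nonpos by (simp add: int_pow_neg_int)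
    finally have 1: "[\<chi> \<one> = \<chi> (a [^] k) + \<chi> (a [^] i)] (mod int m)" .
    have "[0 = \<chi> \<one>] (mod int m)" by (rule cong_sym[OF charmod_one[OF \<chi> subgroup_self]])
    also note 1
    also have "[\<chi> (a [^] k) + \<chi> (a [^] i) = \<chi> (a [^] k) + int i] (mod int m)" by (intro cong_add nn cong_refl)
    finally have "[\<chi> (a [^] k) + int i = 0] (mod int m)" by (rule cong_sym)
    then show ?thesis using nonpos by (simp add: cong_iff_dvd_diff)
  qed
qed

end

lemma (in group) image_pow_carrier_update:
  "(\<lambda>x. x [^]\<^bsub>G\<lparr>carrier := H\<rparr>\<^esub> (q::nat)) ` carrier (G\<lparr>carrier := H\<rparr>) = (\<lambda>x. x [^] q) ` H"
  by (simp add: nat_pow_consistent[symmetric])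

text \<open>The group is the direct product of the kernel of \<chi> and the cyclic group of a; q-th
  powers are formed in each factor separately.\<close>

lemma (in comm_group) card_power_image_split:
  assumes fin: "finite (carrier G)" and \<chi>: "charmod G m (carrier G) \<chi>" and a: "a \<in> carrier G" "ord a = m" "[\<chi> a = 1] (mod int m)"
  shows "card ((\<lambda>x. x [^] (q::nat)) ` carrier G)
    = card ((\<lambda>x. x [^] q) ` {x \<in> carrier G. [\<chi> x = 0] (mod int m)}) * ord (a [^] q)"
proof -
  interpret fgroup G by unfold_locales (rule fin)
  let ?A1 = "{x \<in> carrier G. [\<chi> x = 0] (mod int m)}"
  let ?I = "(\<lambda>x. x [^] q) ` ?A1" and ?J = "generate G {a [^] q}"
  have A1: "subgroup ?A1 G" by (rule charmod_kernel[OF \<chi>])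
  interpret K: comm_group "G\<lparr>carrier := ?A1\<rparr>" by (rule subgroup_comm_group[OF A1])
  have "subgroup ((\<lambda>x. x [^]\<^bsub>G\<lparr>carrier := ?A1\<rparr>\<^esub> q) ` carrier (G\<lparr>carrier := ?A1\<rparr>)) (G\<lparr>carrier := ?A1\<rparr>)"
    by (rule K.power_set_subgroup)
  then have I: "subgroup ?I G" unfolding image_pow_carrier_update by (rule incl_subgroup[OF A1])
  have J: "subgroup ?J G" using a by (intro generate_is_subgroup) auto
  have Jint: "?J = {(a [^] q) [^] (k::int) |k. k \<in> UNIV}" using a by (intro generate_pow) auto
  have "?I <#> ?J = (\<lambda>x. x [^] q) ` carrier G"
  proof
    show "?I <#> ?J \<subseteq> (\<lambda>x. x [^] q) ` carrier G"
    proof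
      fix z assume "z \<in> ?I <#> ?J"
      then obtain x k where xk: "x \<in> ?A1" "z = x [^] q \<otimes> (a [^] q) [^] (k::int)"
        unfolding Jint by (auto simp: set_mult_def)
      have "(a [^] q) [^] k = (a [^] k) [^] q"
        using a by (simp add: int_pow_pow mult.commute flip: int_pow_int)
      then have "z = (x \<otimes> a [^] k) [^] q" using xk a by (simp add: nat_pow_distrib)
      then show "z \<in> (\<lambda>x. x [^] q) ` carrier G" using xk a by auto
    qed
    show "(\<lambda>x. x [^] q) ` carrier G \<subseteq> ?I <#> ?J"
    proof
      fix z assume "z \<in> (\<lambda>x. x [^] q) ` carrier G"
      then obtain x where x: "x \<in> carrier G" "z = x [^] q" by blast
      let ?x1 = "x \<otimes> a [^] (- \<chi> x)"
      have "[\<chi> ?x1 = \<chi> x + \<chi> (a [^] (- \<chi> x))] (mod int m)" using \<chi> x a unfolding charmod_def by simp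
      also have "[\<chi> x + \<chi> (a [^] (- \<chi> x)) = \<chi> x + (- \<chi> x)] (mod int m)"
        by (intro cong_add charmod_int_pow[OF fin \<chi> a(1,3)] cong_refl)
      finally have x1: "?x1 \<in> ?A1" using x a by simp
      have "x = ?x1 \<otimes> a [^] \<chi> x" using x a by (simp add: m_assoc int_pow_neg)
      then have "z = ?x1 [^] q \<otimes> (a [^] \<chi> x) [^] q"
        unfolding x(2) using x a by (metis int_pow_closed m_closed nat_pow_distrib)
      moreover have "(a [^] \<chi> x) [^] q = (a [^] q) [^] \<chi> x"
        using a by (simp add: int_pow_pow mult.commute flip: int_pow_int)
      ultimately show "z \<in> ?I <#> ?J" using x1 unfolding Jint set_mult_def by blast
    qed
  qed
  moreover have "?I \<inter> ?J = {\<one>}"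
  proof -
    have "z = \<one>" if "z \<in> ?I" "z \<in> ?J" for z
    proof -
      have "z \<in> ?A1" using that(1) subgroup_pow_closed[OF A1] by blast
      obtain k :: int where "z = (a [^] q) [^] k" using \<open>z \<in> ?J\<close> unfolding Jint by blast
      then have z: "z = a [^] (int q * k)" using a by (simp add: int_pow_pow flip: int_pow_int)
      have "[int q * k = \<chi> z] (mod int m)" unfolding z by (rule cong_sym[OF charmod_int_pow[OF fin \<chi> a(1,3)]])
      also have "[\<chi> z = 0] (mod int m)" using \<open>z \<in> ?A1\<close> by blast
      finally have "int m dvd int q * k" by (simp add: cong_0_iff)
      then show ?thesis unfolding z using int_pow_eq_id[OF a(1)] a(2) by blast
    qed
    then show ?thesis using subgroup.one_closed[OF I] subgroup.one_closed[OF J] by blast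
  qed
  ultimately have "card ((\<lambda>x. x [^] q) ` carrier G) = card ?I * card ?J"
    using card_set_mult[OF I J] by simp
  then show ?thesis using generate_pow_card[of "a [^] q"] a by simp
qed

text \<open>A finite abelian \<open>p\<close>-group is determined by the sizes of its subgroups of \<open>p\<^sup>j\<close>-th powers:
  split off a cyclic subgroup of maximal order and induct.\<close>
theorem abelian_pgroup_iso:
  fixes A :: "('a, 'c) monoid_scheme" and B :: "('b, 'd) monoid_scheme" and p :: nat
  assumes p: "Factorial_Ring.prime p"
  shows "comm_group A \<Longrightarrow> comm_group B \<Longrightarrow> finite (carrier A) \<Longrightarrow> finite (carrier B) \<Longrightarrow>
    (\<And>j. card ((\<lambda>x. x [^]\<^bsub>A\<^esub> (p ^ j)) ` carrier A) = card ((\<lambda>x. x [^]\<^bsub>B\<^esub> (p ^ j)) ` carrier B)) \<Longrightarrow>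
    (\<exists>j. card ((\<lambda>x. x [^]\<^bsub>A\<^esub> (p ^ j)) ` carrier A) = 1) \<Longrightarrow> A \<cong> B"
proof (induction "card (carrier A)" arbitrary: A B rule: less_induct)
  case less
  interpret A: comm_group A by (rule less.prems)
  interpret B: comm_group B by (rule less.prems)
  note finA = less.prems(3) and finB = less.prems(4) and eq = less.prems(5)
  let ?IA = "\<lambda>j. (\<lambda>x. x [^]\<^bsub>A\<^esub> (p ^ j)) ` carrier A"
  let ?IB = "\<lambda>j. (\<lambda>x. x [^]\<^bsub>B\<^esub> (p ^ j)) ` carrier B"
  have trivA: "card (?IA j) = 1 \<longleftrightarrow> (\<forall>x\<in>carrier A. x [^]\<^bsub>A\<^esub> (p ^ j) = \<one>\<^bsub>A\<^esub>)" for j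
  proof -
    have o: "\<one>\<^bsub>A\<^esub> \<in> ?IA j" by (rule image_eqI[of _ _ "\<one>\<^bsub>A\<^esub>"]) auto
    have "card (?IA j) = 1 \<longleftrightarrow> ?IA j = {\<one>\<^bsub>A\<^esub>}" by (rule card_eq_1_mem[OF o])
    also have "\<dots> \<longleftrightarrow> (\<forall>x\<in>carrier A. x [^]\<^bsub>A\<^esub> (p ^ j) = \<one>\<^bsub>A\<^esub>)" using o by blast
    finally show ?thesis .
  qed
  have trivB: "card (?IB j) = 1 \<longleftrightarrow> (\<forall>x\<in>carrier B. x [^]\<^bsub>B\<^esub> (p ^ j) = \<one>\<^bsub>B\<^esub>)" for j
  proof -
    have o: "\<one>\<^bsub>B\<^esub> \<in> ?IB j" by (rule image_eqI[of _ _ "\<one>\<^bsub>B\<^esub>"]) auto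
    have "card (?IB j) = 1 \<longleftrightarrow> ?IB j = {\<one>\<^bsub>B\<^esub>}" by (rule card_eq_1_mem[OF o])
    also have "\<dots> \<longleftrightarrow> (\<forall>x\<in>carrier B. x [^]\<^bsub>B\<^esub> (p ^ j) = \<one>\<^bsub>B\<^esub>)" using o by blast
    finally show ?thesis .
  qed
  define e where "e = (LEAST j. card (?IA j) = 1)"
  have e: "card (?IA e) = 1" unfolding e_def using less.prems(6) by (rule LeastI_ex)
  have emin: "j < e \<Longrightarrow> card (?IA j) \<noteq> 1" for j unfolding e_def by (rule not_less_Least)
  \<comment> \<open>The case j = 0, where the power map is the identity.\<close>
  have cardAB: "card (carrier A) = card (carrier B)" using eq[of 0] by (simp cong: image_cong)
  show ?case
  proof (cases e)
    case 0
    have "card (carrier A) = 1" using e 0 by (simp cong: image_cong)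
    then have "carrier A = {\<one>\<^bsub>A\<^esub>}" "carrier B = {\<one>\<^bsub>B\<^esub>}"
      using cardAB card_eq_1_mem[OF A.one_closed] card_eq_1_mem[OF B.one_closed] by simp_all
    then have "(\<lambda>_. \<one>\<^bsub>B\<^esub>) \<in> iso A B" by (auto simp: iso_def hom_def bij_betw_def)
    then show ?thesis by (rule is_isoI)
  next
    case (Suc e')
    define m where "m = p ^ e"
    have expA: "x [^]\<^bsub>A\<^esub> m = \<one>\<^bsub>A\<^esub>" if "x \<in> carrier A" for x using e trivA that by (simp add: m_def)
    have expB: "x [^]\<^bsub>B\<^esub> m = \<one>\<^bsub>B\<^esub>" if "x \<in> carrier B" for x using e eq trivB that by (simp add: m_def)
    have m1: "m > 1" unfolding m_def Suc by (rule one_less_power[OF prime_gt_1_nat[OF p]]) simp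
    \<comment> \<open>An element that p^(e-1) does not kill has order exactly p^e, the exponent of
      the group.\<close>
    have ordA: "\<exists>a\<in>carrier A. A.ord a = m"
    proof -
      have "card (?IA e') \<noteq> 1" using emin Suc by simp
      then obtain a where a: "a \<in> carrier A" "a [^]\<^bsub>A\<^esub> (p ^ e') \<noteq> \<one>\<^bsub>A\<^esub>" using trivA by blast
      have "A.ord a dvd p ^ e" "\<not> A.ord a dvd p ^ e'"
        using expA[OF a(1)] a A.pow_eq_id[OF a(1)] by (auto simp: m_def)
      moreover from this obtain i where "i \<le> e" "A.ord a = p ^ i" using divides_primepow_nat[OF p] by blast
      ultimately have "\<not> i \<le> e'" using le_imp_power_dvd by metis
      then show ?thesis using \<open>i \<le> e\<close> \<open>A.ord a = p ^ i\<close> a Suc by (intro bexI[of _ a]) (auto simp: m_def le_Suc_eq)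
    qed
    have ordB: "\<exists>b\<in>carrier B. B.ord b = m"
    proof -
      have "card (?IB e') \<noteq> 1" using emin Suc eq by simp
      then obtain a where a: "a \<in> carrier B" "a [^]\<^bsub>B\<^esub> (p ^ e') \<noteq> \<one>\<^bsub>B\<^esub>" using trivB by blast
      have "B.ord a dvd p ^ e" "\<not> B.ord a dvd p ^ e'"
        using expB[OF a(1)] a B.pow_eq_id[OF a(1)] by (auto simp: m_def)
      moreover from this obtain i where "i \<le> e" "B.ord a = p ^ i" using divides_primepow_nat[OF p] by blast
      ultimately have "\<not> i \<le> e'" using le_imp_power_dvd by metis
      then show ?thesis using \<open>i \<le> e\<close> \<open>B.ord a = p ^ i\<close> a Suc by (intro bexI[of _ a]) (auto simp: m_def le_Suc_eq)
    qed
    obtain a where a: "a \<in> carrier A" "A.ord a = m" using ordA by blast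
    obtain b where b: "b \<in> carrier B" "B.ord b = m" using ordB by blast
    obtain \<chi> where \<chi>: "charmod A m (carrier A) \<chi>" "[\<chi> a = 1] (mod int m)"
      using A.charmod_retraction[OF finA a expA] by blast
    obtain \<psi> where \<psi>: "charmod B m (carrier B) \<psi>" "[\<psi> b = 1] (mod int m)"
      using B.charmod_retraction[OF finB b expB] by blast
    define A1 where "A1 = {x \<in> carrier A. [\<chi> x = 0] (mod int m)}"
    define B1 where "B1 = {x \<in> carrier B. [\<psi> x = 0] (mod int m)}"
    have A1: "subgroup A1 A" unfolding A1_def by (rule A.charmod_kernel[OF \<chi>(1)])
    have B1: "subgroup B1 B" unfolding B1_def by (rule B.charmod_kernel[OF \<psi>(1)])
    have A1c: "x \<in> carrier A" if "x \<in> A1" for x using that by (simp add: A1_def)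
    have B1c: "x \<in> carrier B" if "x \<in> B1" for x using that by (simp add: B1_def)
    \<comment> \<open>Equal orders, so that the cyclic contributions cancel in
      \<open>card_power_image_split\<close> and the complements satisfy the induction
      hypothesis.\<close>
    have ordab: "A.ord (a [^]\<^bsub>A\<^esub> q) = B.ord (b [^]\<^bsub>B\<^esub> q)" for q :: nat
    proof -
      have "A.ord (a [^]\<^bsub>A\<^esub> q) dvd k \<longleftrightarrow> B.ord (b [^]\<^bsub>B\<^esub> q) dvd k" for k
        using A.pow_eq_id[of "a [^]\<^bsub>A\<^esub> q" k] B.pow_eq_id[of "b [^]\<^bsub>B\<^esub> q" k]
          A.pow_eq_id[OF a(1), of "q * k"] B.pow_eq_id[OF b(1), of "q * k"] a b
        by (simp add: A.nat_pow_pow B.nat_pow_pow)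
      then show ?thesis by (meson dvd_antisym dvd_refl)
    qed
    have ord0: "A.ord (a [^]\<^bsub>A\<^esub> q) > 0" for q :: nat using A.ord_ge_1[OF finA, of "a [^]\<^bsub>A\<^esub> q"] a by simp
    have eq1: "card ((\<lambda>x. x [^]\<^bsub>A\<^esub> (p ^ j)) ` A1) = card ((\<lambda>x. x [^]\<^bsub>B\<^esub> (p ^ j)) ` B1)" for j
      using eq[of j] A.card_power_image_split[OF finA \<chi>(1) a \<chi>(2), of "p ^ j"]
        B.card_power_image_split[OF finB \<psi>(1) b \<psi>(2), of "p ^ j"] ordab[of "p ^ j"] ord0[of "p ^ j"]
      unfolding A1_def B1_def by simp
    have "A\<lparr>carrier := A1\<rparr> \<cong> B\<lparr>carrier := B1\<rparr>"
    proof (rule less.hyps)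
      have "a \<notin> A1"
      proof
        assume "a \<in> A1"
        then have "[\<chi> a = 0] (mod int m)" by (simp add: A1_def)
        then have "[1 = 0] (mod int m)" using \<chi>(2) by (metis cong_sym cong_trans)
        then show False using m1 by (simp add: cong_def)
      qed
      then have "A1 \<subset> carrier A" using a A1c by blast
      then show "card (carrier (A\<lparr>carrier := A1\<rparr>)) < card (carrier A)" using finA by (simp add: psubset_card_mono)
      show "comm_group (A\<lparr>carrier := A1\<rparr>)" by (rule A.subgroup_comm_group[OF A1])
      show "comm_group (B\<lparr>carrier := B1\<rparr>)" by (rule B.subgroup_comm_group[OF B1])
      show "finite (carrier (A\<lparr>carrier := A1\<rparr>))" "finite (carrier (B\<lparr>carrier := B1\<rparr>))"
        using finA finB by (simp_all add: A1_def B1_def)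
      fix j
      show "card ((\<lambda>x. x [^]\<^bsub>A\<lparr>carrier := A1\<rparr>\<^esub> (p ^ j)) ` carrier (A\<lparr>carrier := A1\<rparr>))
        = card ((\<lambda>x. x [^]\<^bsub>B\<lparr>carrier := B1\<rparr>\<^esub> (p ^ j)) ` carrier (B\<lparr>carrier := B1\<rparr>))"
        unfolding A.image_pow_carrier_update B.image_pow_carrier_update by (rule eq1)
    next
      have "(\<lambda>x. x [^]\<^bsub>A\<^esub> (p ^ e)) ` A1 = {\<one>\<^bsub>A\<^esub>}"
        using expA A1c subgroup.one_closed[OF A1] by (force simp: m_def)
      then show "\<exists>j. card ((\<lambda>x. x [^]\<^bsub>A\<lparr>carrier := A1\<rparr>\<^esub> (p ^ j)) ` carrier (A\<lparr>carrier := A1\<rparr>)) = 1"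
        unfolding A.image_pow_carrier_update by (intro exI[of _ e]) simp
    qed
    then obtain f where f: "f \<in> iso (A\<lparr>carrier := A1\<rparr>) (B\<lparr>carrier := B1\<rparr>)" unfolding is_iso_def by blast
    have fB1: "f x \<in> B1" if "x \<in> A1" for x using f that by (auto simp: iso_def hom_def)
    have fhom: "f (x \<otimes>\<^bsub>A\<^esub> y) = f x \<otimes>\<^bsub>B\<^esub> f y" if "x \<in> A1" "y \<in> A1" for x y
      using f that by (auto simp: iso_def hom_def)
    have finj: "inj_on f A1" using f by (auto simp: iso_def bij_betw_def)
    have f1: "f \<one>\<^bsub>A\<^esub> = \<one>\<^bsub>B\<^esub>"
    proof -
      have o: "\<one>\<^bsub>A\<^esub> \<in> A1" by (rule subgroup.one_closed[OF A1])
      have "f \<one>\<^bsub>A\<^esub> \<otimes>\<^bsub>B\<^esub> f \<one>\<^bsub>A\<^esub> = f \<one>\<^bsub>A\<^esub>" using fhom[OF o o] by simp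
      then show ?thesis using B1c[OF fB1[OF o]] by simp
    qed
    have \<chi>add: "[\<chi> (x \<otimes>\<^bsub>A\<^esub> y) = \<chi> x + \<chi> y] (mod int m)" if "x \<in> carrier A" "y \<in> carrier A" for x y
      using \<chi>(1) that unfolding charmod_def by blast
    \<comment> \<open>The projection onto the complement \<open>A1\<close> along the cyclic factor
      generated by a.\<close>
    define r where "r x = x \<otimes>\<^bsub>A\<^esub> a [^]\<^bsub>A\<^esub> (- \<chi> x)" for x
    have rA1: "r x \<in> A1" if x: "x \<in> carrier A" for x
    proof -
      have "[\<chi> (r x) = \<chi> x + \<chi> (a [^]\<^bsub>A\<^esub> (- \<chi> x))] (mod int m)" unfolding r_def using x a by (intro \<chi>add) auto
      also have "[\<chi> x + \<chi> (a [^]\<^bsub>A\<^esub> (- \<chi> x)) = \<chi> x + (- \<chi> x)] (mod int m)"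
        by (intro cong_add A.charmod_int_pow[OF finA \<chi>(1) a(1) \<chi>(2)] cong_refl)
      finally show ?thesis using x a by (simp add: A1_def r_def)
    qed
    have powA: "a [^]\<^bsub>A\<^esub> i = a [^]\<^bsub>A\<^esub> j" if "[i = j] (mod int m)" for i j :: int
    proof -
      have "int (A.ord a) dvd j - i" using that a by (simp add: cong_iff_dvd_diff dvd_diff_commute)
      then show ?thesis using A.int_pow_eq[OF a(1)] by blast
    qed
    have powB: "b [^]\<^bsub>B\<^esub> i = b [^]\<^bsub>B\<^esub> j" if "[i = j] (mod int m)" for i j :: int
    proof -
      have "int (B.ord b) dvd j - i" using that b by (simp add: cong_iff_dvd_diff dvd_diff_commute)
      then show ?thesis using B.int_pow_eq[OF b(1)] by blast
    qed
    \<comment> \<open>Glues f on the complements with the isomorphism a -> b on the cyclic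
      factors.\<close>
    define F where "F x = f (r x) \<otimes>\<^bsub>B\<^esub> b [^]\<^bsub>B\<^esub> \<chi> x" for x
    have Fc: "F x \<in> carrier B" if "x \<in> carrier A" for x
      unfolding F_def using B1c[OF fB1[OF rA1[OF that]]] b by simp
    have Fhom: "F (x \<otimes>\<^bsub>A\<^esub> y) = F x \<otimes>\<^bsub>B\<^esub> F y" if xy: "x \<in> carrier A" "y \<in> carrier A" for x y
    proof -
      have "[- \<chi> (x \<otimes>\<^bsub>A\<^esub> y) = - \<chi> x + - \<chi> y] (mod int m)"
        using \<chi>add[OF xy] by (simp add: cong_iff_dvd_diff dvd_diff_commute algebra_simps)
      then have "a [^]\<^bsub>A\<^esub> (- \<chi> (x \<otimes>\<^bsub>A\<^esub> y)) = a [^]\<^bsub>A\<^esub> (- \<chi> x) \<otimes>\<^bsub>A\<^esub> a [^]\<^bsub>A\<^esub> (- \<chi> y)"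
        using powA A.int_pow_mult[OF a(1), of "- \<chi> x" "- \<chi> y"] by metis
      then have "r (x \<otimes>\<^bsub>A\<^esub> y) = r x \<otimes>\<^bsub>A\<^esub> r y" unfolding r_def using xy a by (simp add: A.m_ac)
      moreover have "b [^]\<^bsub>B\<^esub> \<chi> (x \<otimes>\<^bsub>A\<^esub> y) = b [^]\<^bsub>B\<^esub> \<chi> x \<otimes>\<^bsub>B\<^esub> b [^]\<^bsub>B\<^esub> \<chi> y"
        using powB[OF \<chi>add[OF xy]] b by (simp add: B.int_pow_mult)
      ultimately show ?thesis
        unfolding F_def using fhom[OF rA1[OF xy(1)] rA1[OF xy(2)]] B1c[OF fB1[OF rA1[OF xy(1)]]]
          B1c[OF fB1[OF rA1[OF xy(2)]]] b by (simp add: B.m_ac)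
    qed
    interpret FH: group_hom A B F
      by (intro group_hom.intro group_hom_axioms.intro homI A.is_group B.is_group Fc Fhom)
    have Fker: "x = \<one>\<^bsub>A\<^esub>" if x: "x \<in> carrier A" "F x = \<one>\<^bsub>B\<^esub>" for x
    proof -
      let ?y = "f (r x)"
      have y: "?y \<in> B1" by (rule fB1[OF rA1[OF x(1)]])
      have "?y = inv\<^bsub>B\<^esub> (b [^]\<^bsub>B\<^esub> \<chi> x)" using x(2) B1c[OF y] b unfolding F_def by (intro B.inv_equality[symmetric]) auto
      then have yb: "?y = b [^]\<^bsub>B\<^esub> (- \<chi> x)" using b by (simp add: B.int_pow_neg)
      \<comment> \<open>f(r x) lies both in the kernel of \<psi> and in the group generated by b,
        hence is trivial.\<close>
      have "[- \<chi> x = \<psi> ?y] (mod int m)"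
        unfolding yb by (rule cong_sym[OF B.charmod_int_pow[OF finB \<psi>(1) b(1) \<psi>(2)]])
      also have "[\<psi> ?y = 0] (mod int m)" using y by (simp add: B1_def)
      finally have z: "[- \<chi> x = 0] (mod int m)" .
      then have "?y = \<one>\<^bsub>B\<^esub>" unfolding yb using powB by fastforce
      then have "r x = \<one>\<^bsub>A\<^esub>" using finj f1 rA1[OF x(1)] subgroup.one_closed[OF A1] by (metis inj_onD)
      moreover have "a [^]\<^bsub>A\<^esub> (- \<chi> x) = \<one>\<^bsub>A\<^esub>" using powA[OF z] by simp
      ultimately show ?thesis using x a by (simp add: r_def)
    qed
    have inj: "inj_on F (carrier A)" using Fker FH.inj_on_one_iff by blast
    have "F ` carrier A = carrier B"
      using finB Fc card_image[OF inj] cardAB by (intro card_subset_eq) auto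
    then have "F \<in> iso A B" using inj Fc Fhom by (auto simp: iso_def hom_def bij_betw_def)
    then show ?thesis by (rule is_isoI)
  qed
qed

section \<open>The Jennings series of the centralizer\<close>

text \<open>The count behind the second isomorphism theorem: the fibres of x -> L x on S are cosets
  of the intersection of S and L.\<close>

lemma (in fgroup) card_rcos_image:
  assumes S: "subgroup S G" and L: "subgroup L G"
  shows "card ((\<lambda>x. L #> x) ` S) * card (S \<inter> L) = card S"
proof -
  let ?f = "\<lambda>x. L #> x"
  have fS: "finite S" using subgroup.subset[OF S] fin finite_subset by blast
  have SL: "subgroup (S \<inter> L) G" using S L by (rule subgroups_Inter_pair)
  have Sc: "x \<in> carrier G" if "x \<in> S" for x using that subgroup.mem_carrier[OF S] by blast
  have fib: "card {y \<in> S. ?f y = Y} = card (S \<inter> L)" if "Y \<in> ?f ` S" for Y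
  proof -
    obtain x where x: "x \<in> S" "Y = ?f x" using \<open>Y \<in> ?f ` S\<close> by blast
    have "{y \<in> S. ?f y = Y} = (S \<inter> L) #> x"
    proof
      show "(S \<inter> L) #> x \<subseteq> {y \<in> S. ?f y = Y}"
      proof
        fix y assume "y \<in> (S \<inter> L) #> x"
        then obtain k where k: "k \<in> S" "k \<in> L" "y = k \<otimes> x" by (auto simp: r_coset_def)
        have "y \<in> S" using k x subgroup.m_closed[OF S] by simp
        moreover have "y \<in> L #> x" using k by (auto simp: r_coset_def)
        ultimately show "y \<in> {y \<in> S. ?f y = Y}" using mem_rcos_iff[OF L Sc[OF x(1)] Sc] x by simp
      qed
      show "{y \<in> S. ?f y = Y} \<subseteq> (S \<inter> L) #> x"
      proof
        fix y assume "y \<in> {y \<in> S. ?f y = Y}"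
        then have y: "y \<in> S" "y \<in> L #> x" using mem_rcos_iff[OF L Sc[OF x(1)] Sc, of y] x by auto
        then obtain k where k: "k \<in> L" "y = k \<otimes> x" by (auto simp: r_coset_def)
        have "k = y \<otimes> inv x" using k Sc[OF x(1)] subgroup.mem_carrier[OF L k(1)] by (simp add: m_assoc)
        then have "k \<in> S" using y x subgroup.m_closed[OF S] subgroup.m_inv_closed[OF S] by simp
        then show "y \<in> (S \<inter> L) #> x" using k by (auto simp: r_coset_def)
      qed
    qed
    then show ?thesis
      using card_rcosets_equal[OF rcosetsI[OF subgroup.subset[OF SL] Sc[OF x(1)]] subgroup.subset[OF SL]] by simp
  qed
  have "card S = (\<Sum>Y\<in>?f ` S. card {y \<in> S. ?f y = Y})"
    using sum.group[of S "?f ` S" ?f "\<lambda>_. 1::nat"] fS by simp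
  then show ?thesis using fib by simp
qed

context pgroup_cyclic_derived
begin

abbreviation K where "K \<equiv> G\<lparr>carrier := C\<rparr>"

lemma CGG_eq: "CGG G = K"
  by (simp add: CGG_def C_def D_def)

lemma K_fgroup: "fgroup K"
  by (intro fgroup.intro fgroup_axioms.intro subgroup_imp_group C_sub) (simp add: finite_C)

lemma K_pow: "x [^]\<^bsub>K\<^esub> (q::nat) = x [^] q"
  by (simp add: nat_pow_consistent[symmetric])

lemma K_generate: "S \<subseteq> C \<Longrightarrow> generate K S = generate G S"
  using generate_consistent[OF _ C_sub, of S] by simp

lemma K_derived: "derived K (carrier K) = M"
  using derived_consistent[OF order_refl C_sub] derived_C by simp

lemma M_le_C: "M \<subseteq> C" using D_le_C by (auto simp: M_def)

lemma K_comm_subgroup: "A \<subseteq> C \<Longrightarrow> B \<subseteq> C \<Longrightarrow> comm_subgroup K A B = generate G (\<Union>x\<in>A. \<Union>y\<in>B. {cm x y})"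
proof -
  assume AB: "A \<subseteq> C" "B \<subseteq> C"
  have "(\<Union>x\<in>A. \<Union>y\<in>B. {x \<otimes>\<^bsub>K\<^esub> y \<otimes>\<^bsub>K\<^esub> inv\<^bsub>K\<^esub> x \<otimes>\<^bsub>K\<^esub> inv\<^bsub>K\<^esub> y}) = (\<Union>x\<in>A. \<Union>y\<in>B. {cm x y})"
    using AB m_inv_consistent[OF C_sub] by (intro SUP_cong refl) (auto simp: cm_def subset_iff)
  moreover have "(\<Union>x\<in>A. \<Union>y\<in>B. {cm x y}) \<subseteq> C"
    using AB cm_C_Z Z_C by (auto simp: subset_iff)
  ultimately show ?thesis unfolding comm_subgroup_def using K_generate by simp
qed

text \<open>M is the derived subgroup of C and is central, so the series reaches 1 at the third term
  and only i = 1, 2 contribute to the Jennings terms.\<close>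

lemma lower_central_K:
  "lower_central K (Suc 0) = C"
  "lower_central K (Suc (Suc 0)) = M"
  "lower_central K (Suc (Suc (Suc i))) = {\<one>}"
proof -
  show 1: "lower_central K (Suc 0) = C" by simp
  have "derived G C = comm_subgroup K C C"
    unfolding K_comm_subgroup[OF order_refl order_refl] derived_def cm_def by simp
  then show 2: "lower_central K (Suc (Suc 0)) = M" by (simp add: derived_C)
  have t: "comm_subgroup K A C = {\<one>}" if "A \<subseteq> Z" "A \<noteq> {}" for A
  proof -
    have "(\<Union>x\<in>A. \<Union>y\<in>C. {cm x y}) = {\<one>}" using that cm_Z C_one by (auto simp: subset_iff)
    moreover have "A \<subseteq> C" using that Z_C by auto
    ultimately show ?thesis using K_comm_subgroup[of A C] generate_one by simp
  qed
  show "lower_central K (Suc (Suc (Suc i))) = {\<one>}"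
  proof (induction i)
    case 0
    have "comm_subgroup K M C = {\<one>}"
      using subgroup.one_closed[OF M_sub] by (intro t) (auto simp: M_def)
    then show ?case using 2 by simp
  next
    case (Suc i)
    have "comm_subgroup K {\<one>} C = {\<one>}" using Z_one by (intro t) auto
    then show ?case using Suc by simp
  qed
qed

section \<open>Power subgroups of M and the Jennings terms\<close>

definition Mp where "Mp b = (\<lambda>x. x [^] (p ^ b)) ` M"

lemma Mp_eq_Dp: "\<exists>t\<le>n. t = n - s \<and> Mp b = Dp (t + b)"
proof -
  obtain t where t: "t \<le> n" "M = Dp t" using M_structure unfolding Dp_def by blast
  have "p ^ s = p ^ (n - t)" using card_M Dp_card[OF t(1)] t(2) by simp
  then have "s = n - t" using power_inject_exp[OF p_gt_1] by blast
  then have ts: "t = n - s" using t(1) by simp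
  have "Dp (t + b) \<subseteq> Mp b"
  proof
    fix x assume "x \<in> Dp (t + b)"
    moreover have "ord (c [^] (p ^ (t + b))) \<noteq> 0" using ord_ge_1[OF fin, of "c [^] (p ^ (t + b))"] by simp
    ultimately obtain k :: nat where "x = (c [^] (p ^ (t + b))) [^] k"
      using generate_pow_nat[of "c [^] (p ^ (t + b))"] unfolding Dp_def by auto
    then have "x = ((c [^] (p ^ t)) [^] k) [^] (p ^ b)" by (simp add: nat_pow_pow power_add mult_ac)
    moreover have "(c [^] (p ^ t)) [^] k \<in> M" unfolding t(2) by (intro subgroup_pow_closed Dp_sub Dp_mem)
    ultimately show "x \<in> Mp b" unfolding Mp_def by blast
  qed
  moreover have "Mp b \<subseteq> Dp (t + b)"
  proof
    fix x assume "x \<in> Mp b"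
    then obtain y where y: "y \<in> Dp t" "x = y [^] (p ^ b)" unfolding Mp_def t(2) by blast
    moreover have "ord (c [^] (p ^ t)) \<noteq> 0" using ord_ge_1[OF fin, of "c [^] (p ^ t)"] by simp
    ultimately obtain k :: nat where "y = (c [^] (p ^ t)) [^] k"
      using generate_pow_nat[of "c [^] (p ^ t)"] unfolding Dp_def by auto
    then have "x = (c [^] (p ^ (t + b))) [^] k" using y by (simp add: nat_pow_pow power_add mult_ac)
    then show "x \<in> Dp (t + b)" using subgroup_pow_closed[OF Dp_sub Dp_mem] by simp
  qed
  ultimately show ?thesis using t ts by blast
qed

lemma Mp_sub: "subgroup (Mp b) G" using Mp_eq_Dp Dp_sub by metis

lemma Mp_le: "Mp b \<subseteq> M"
  unfolding Mp_def using subgroup_pow_closed[OF M_sub] by auto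

lemma Mp_Z: "x \<in> Mp b \<Longrightarrow> x \<in> Z" using Mp_le by (auto simp: M_def)

text \<open>Truncated subtraction is meant: for b >= s the group is trivial.\<close>

lemma card_Mp: "card (Mp b) = p ^ (s - b)"
proof -
  obtain t where t: "t \<le> n" "t = n - s" "Mp b = Dp (t + b)" using Mp_eq_Dp by blast
  show ?thesis
  proof (cases "t + b \<le> n")
    case True
    then show ?thesis using Dp_card[OF True] t s_le by simp
  next
    case False
    then have "p ^ n dvd p ^ (t + b)" by (intro le_imp_power_dvd) simp
    then have "c [^] (p ^ (t + b)) = \<one>" by (simp add: c_pow_one)
    then have "Dp (t + b) = {\<one>}" by (simp add: Dp_def generate_one)
    then show ?thesis using False t s_le by simp
  qed
qed

lemma P_antimono: "i \<le> j \<Longrightarrow> P j \<subseteq> P i"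
proof
  assume ij: "i \<le> j"
  fix x assume "x \<in> P j"
  then obtain g where g: "g \<in> C" "x = g [^] (p ^ j)" by (auto simp: P_def)
  have "p ^ j = p ^ (j - i) * p ^ i" using ij by (simp flip: power_add)
  then have "x = (g [^] (p ^ (j - i))) [^] (p ^ i)" using g by (simp add: nat_pow_pow)
  then show "x \<in> P i" using C_pow[OF g(1)] by (auto simp: P_def)
qed

lemma Mp_antimono: "i \<le> j \<Longrightarrow> Mp j \<subseteq> Mp i"
proof
  assume ij: "i \<le> j"
  fix x assume "x \<in> Mp j"
  then obtain g where g: "g \<in> M" "x = g [^] (p ^ j)" by (auto simp: Mp_def)
  have gc: "g \<in> carrier G" using g M_le_C by auto
  have "p ^ j = p ^ (j - i) * p ^ i" using ij by (simp flip: power_add)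
  then have "x = (g [^] (p ^ (j - i))) [^] (p ^ i)" using g gc by (simp add: nat_pow_pow)
  then show "x \<in> Mp i" using subgroup_pow_closed[OF M_sub g(1)] by (auto simp: Mp_def)
qed

lemma P_le_C: "P j \<subseteq> C" using C_pow by (auto simp: P_def)

text \<open>The p^j-th powers of C and of M already form subgroups, so passing to the generated
  subgroup adds nothing.\<close>

lemma agemo_K:
  "agemo K p j (lower_central K (Suc 0)) = P j"
  "agemo K p j (lower_central K (Suc (Suc 0))) = Mp j"
  "agemo K p j (lower_central K (Suc (Suc (Suc i)))) = {\<one>}"
proof -
  have g: "generate K S = S" if "subgroup S G" "S \<subseteq> C" for S
    using generateI[OF that(1)] K_generate[OF that(2)] generate_incl that
    by (metis generateI order_refl subgroup_def)
  have gp: "gpow K (p ^ j) ` S = (\<lambda>x. x [^] (p ^ j)) ` S" for S by (simp add: gpow_def K_pow)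
  show "agemo K p j (lower_central K (Suc 0)) = P j"
    unfolding agemo_def lower_central_K gp P_def[symmetric] by (rule g[OF P_sub P_le_C])
  show "agemo K p j (lower_central K (Suc (Suc 0))) = Mp j"
    unfolding agemo_def lower_central_K gp Mp_def[symmetric] using Mp_le M_le_C by (intro g Mp_sub) auto
  show "agemo K p j (lower_central K (Suc (Suc (Suc i)))) = {\<one>}"
    unfolding agemo_def lower_central_K gp using g[OF triv_subgroup] C_one by simp
qed

text \<open>Together with \<open>jb\<close>, the least j with i <= l p^j for l = 1, 2, the two
  relevant lower central terms. The power subgroups decrease in j, so each term contributes only
  through this j.\<close>

definition ja where "ja i = (LEAST j. i \<le> p ^ j)"
definition jb where "jb i = (LEAST j. i \<le> 2 * p ^ j)"

lemma ja_iff: "i \<le> p ^ j \<longleftrightarrow> ja i \<le> j"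
proof
  assume "i \<le> p ^ j" then show "ja i \<le> j" unfolding ja_def by (rule Least_le)
next
  have "i \<le> p ^ i" using p_gt_1 by (simp add: less_exp less_imp_le self_le_power order_trans[OF less_imp_le[OF power_gt_expt]])
  then have "i \<le> p ^ ja i" unfolding ja_def by (rule LeastI)
  moreover assume "ja i \<le> j"
  then have "p ^ ja i \<le> p ^ j" using p_gt_0 by (intro power_increasing) auto
  ultimately show "i \<le> p ^ j" by linarith
qed

lemma jb_iff: "i \<le> 2 * p ^ j \<longleftrightarrow> jb i \<le> j"
proof
  assume "i \<le> 2 * p ^ j" then show "jb i \<le> j" unfolding jb_def by (rule Least_le)
next
  have "i \<le> 2 * p ^ ja i" using ja_iff[of i "ja i"] by simp
  then have "i \<le> 2 * p ^ jb i" unfolding jb_def by (rule LeastI)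
  moreover assume "jb i \<le> j"
  then have "p ^ jb i \<le> p ^ j" using p_gt_0 by (intro power_increasing) auto
  ultimately show "i \<le> 2 * p ^ j" by linarith
qed

definition J where "J i = P (ja i) <#> Mp (jb i)"

lemma J_sub: "subgroup (J i) G"
  unfolding J_def by (rule mult_norm_subgroup[OF P_normal Mp_sub])

lemma J_P: "P (ja i) \<subseteq> J i"
proof
  fix x assume "x \<in> P (ja i)"
  then have "x \<otimes> \<one> \<in> J i" unfolding J_def set_mult_def using subgroup.one_closed[OF Mp_sub] by blast
  then show "x \<in> J i" using \<open>x \<in> P (ja i)\<close> subgroup.mem_carrier[OF P_sub] by simp
qed

lemma J_Mp: "Mp (jb i) \<subseteq> J i"
proof
  fix x assume "x \<in> Mp (jb i)"
  then have "\<one> \<otimes> x \<in> J i" unfolding J_def set_mult_def using subgroup.one_closed[OF P_sub] by blast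
  then show "x \<in> J i" using \<open>x \<in> Mp (jb i)\<close> subgroup.mem_carrier[OF Mp_sub] by simp
qed

lemma J_le_C: "J i \<subseteq> C"
proof
  fix x assume "x \<in> J i"
  then obtain a b where "a \<in> P (ja i)" "b \<in> Mp (jb i)" "x = a \<otimes> b" by (auto simp: J_def set_mult_def)
  then show "x \<in> C" using P_le_C Mp_le M_le_C C_mult by blast
qed

lemma jennings_K: "jennings K p i = J i"
proof -
  let ?U = "\<Union>{agemo K p j (lower_central K l) |l j. 1 \<le> l \<and> i \<le> l * p ^ j}"
  have ag: "agemo K p j (lower_central K l) \<subseteq> J i" if l: "1 \<le> l" "i \<le> l * p ^ j" for l j
  proof -
    consider "l = Suc 0" | "l = Suc (Suc 0)" | k where "l = Suc (Suc (Suc k))"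
      using l(1) by (metis One_nat_def Suc_le_D not0_implies_Suc)
    then show ?thesis
    proof cases
      case 1
      then have "ja i \<le> j" using l ja_iff by simp
      then show ?thesis unfolding 1 agemo_K using P_antimono J_P by blast
    next
      case 2
      then have "jb i \<le> j" using l jb_iff[of i j] by (simp add: mult_2)
      then show ?thesis unfolding 2 agemo_K using Mp_antimono J_Mp by blast
    next
      case 3
      then show ?thesis unfolding 3 agemo_K using subgroup.one_closed[OF J_sub] by simp
    qed
  qed
  have U: "?U \<subseteq> J i" using ag by blast
  then have "generate K ?U = generate G ?U" using J_le_C by (intro K_generate) blast
  moreover have "generate G ?U \<subseteq> J i" using U by (intro generate_subgroup_incl J_sub)
  moreover have "J i \<subseteq> generate G ?U"
  proof
    have Uc: "?U \<subseteq> carrier G" using U subgroup.subset[OF J_sub] by blast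
    have P: "P (ja i) \<subseteq> ?U"
    proof -
      have "P (ja i) = agemo K p (ja i) (lower_central K (Suc 0))" by (rule agemo_K(1)[symmetric])
      moreover have "i \<le> Suc 0 * p ^ ja i" using ja_iff[of i "ja i"] by simp
      ultimately show ?thesis by (intro Union_upper CollectI exI[of _ "Suc 0"] exI[of _ "ja i"]) simp
    qed
    have M: "Mp (jb i) \<subseteq> ?U"
    proof -
      have "Mp (jb i) = agemo K p (jb i) (lower_central K (Suc (Suc 0)))" by (rule agemo_K(2)[symmetric])
      moreover have "i \<le> Suc (Suc 0) * p ^ jb i" using jb_iff[of i "jb i"] by simp
      ultimately show ?thesis by (intro Union_upper CollectI exI[of _ "Suc (Suc 0)"] exI[of _ "jb i"]) simp
    qed
    fix x assume "x \<in> J i"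
    then obtain a b where "a \<in> P (ja i)" "b \<in> Mp (jb i)" "x = a \<otimes> b" by (auto simp: J_def set_mult_def)
    then show "x \<in> generate G ?U" using generate.eng[OF generate.incl generate.incl, of a ?U b G] P M by blast
  qed
  ultimately show ?thesis unfolding jennings_def by simp
qed

text \<open>The product formula; the intersection lies in D, whose subgroups form a chain, so its
  order is the smaller of two known orders. Cleared of denominators.\<close>

lemma card_J: "card (J i) * min (card (P (ja i) \<inter> D)) (p ^ (s - jb i)) = card (P (ja i)) * p ^ (s - jb i)"
proof -
  have "P (ja i) \<inter> Mp (jb i) = (P (ja i) \<inter> D) \<inter> Mp (jb i)" using Mp_le by (auto simp: M_def)
  moreover have "card ((P (ja i) \<inter> D) \<inter> Mp (jb i)) = min (card (P (ja i) \<inter> D)) (card (Mp (jb i)))"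
    using Mp_le by (intro D_subgroup_card_Int subgroups_Inter_pair P_sub D_sub Mp_sub) (auto simp: M_def)
  ultimately show ?thesis
    using card_set_mult[OF P_sub Mp_sub, of "ja i" "jb i"] by (simp add: J_def card_Mp)
qed

text \<open>The central factors drop out, and [g^(p^a), h^(p^a)] = [g, h]^(p^(2a)) lies in
  \<open>Mp (2 * a)\<close>. As i >= 1 and i <= p^a, one has i + 1 <= 2 p^(2a), so this is inside
  the next term.\<close>

lemma J_commutator:
  assumes "1 \<le> i" "x \<in> J i" "y \<in> J i"
  shows "cm x y \<in> J (Suc i)"
proof -
  let ?a = "ja i"
  obtain g m where x: "g \<in> C" "m \<in> Mp (jb i)" "x = g [^] (p ^ ?a) \<otimes> m" using assms(2) by (auto simp: J_def P_def set_mult_def)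
  obtain h l where y: "h \<in> C" "l \<in> Mp (jb i)" "y = h [^] (p ^ ?a) \<otimes> l" using assms(3) by (auto simp: J_def P_def set_mult_def)
  have "cm x y = cm (g [^] (p ^ ?a)) (h [^] (p ^ ?a))"
    using x y Mp_Z by (simp add: cm_C_left_Z cm_C_right_Z C_pow C_mult Z_C)
  also have "\<dots> = cm (g [^] (p ^ ?a)) h [^] (p ^ ?a)" using x y by (intro cm_pow_right) auto
  also have "cm (g [^] (p ^ ?a)) h = inv (cm h (g [^] (p ^ ?a)))" using x y by (simp add: cm_inv)
  also have "cm h (g [^] (p ^ ?a)) = cm h g [^] (p ^ ?a)" using x y by (intro cm_pow_right) auto
  also have "inv (cm h g [^] (p ^ ?a)) [^] (p ^ ?a) = inv (cm h g) [^] (p ^ (?a + ?a))"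
    using x y by (simp add: nat_pow_pow power_add flip: nat_pow_inv)
  finally have eq: "cm x y = inv (cm h g) [^] (p ^ (?a + ?a))" .
  have "inv (cm h g) \<in> M" using x y cm_C_Z cm_D by (auto simp: M_def Z_inv D_inv)
  then have "cm x y \<in> Mp (?a + ?a)" unfolding eq Mp_def by blast
  moreover have "jb (Suc i) \<le> ?a + ?a"
  proof -
    have "i \<le> p ^ ?a" using ja_iff by blast
    also have "p ^ ?a \<le> p ^ (?a + ?a)" using p_gt_0 by (intro power_increasing) auto
    finally have "Suc i \<le> 2 * p ^ (?a + ?a)" using assms(1) by linarith
    then show ?thesis by (simp only: jb_iff)
  qed
  ultimately show ?thesis using Mp_antimono J_Mp by blast
qed

text \<open>The factor from M is central, so taking p-th powers raises both exponents by one. Since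
  p >= 2 and i >= 1, this at least doubles both thresholds and reaches i + 1.\<close>

lemma J_power:
  assumes "1 \<le> i" "x \<in> J i"
  shows "x [^] p \<in> J (Suc i)"
proof -
  let ?a = "ja i" and ?b = "jb i"
  have p2: "2 \<le> p" using p_gt_1 by simp
  obtain g m where x: "g \<in> C" "m \<in> M" "x = g [^] (p ^ ?a) \<otimes> m [^] (p ^ ?b)"
    using assms(2) by (auto simp: J_def P_def Mp_def set_mult_def)
  have mz: "m [^] (p ^ ?b) \<in> Z" using x by (intro Z_pow) (auto simp: M_def)
  have mc: "m \<in> carrier G" using x M_le_C by auto
  have "x [^] p = (g [^] (p ^ ?a)) [^] p \<otimes> (m [^] (p ^ ?b)) [^] p"
    unfolding x(3) using x(1) mc Z_comm[OF mz, of "g [^] (p ^ ?a)"] by (intro pow_mult_distrib) auto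
  also have "\<dots> = g [^] (p ^ Suc ?a) \<otimes> m [^] (p ^ Suc ?b)"
    using x(1) mc by (simp add: nat_pow_pow mult.commute)
  finally have eq: "x [^] p = g [^] (p ^ Suc ?a) \<otimes> m [^] (p ^ Suc ?b)" .
  have "i \<le> p ^ ?a" using ja_iff by blast
  moreover have "2 * p ^ ?a \<le> p ^ Suc ?a" using p2 by simp
  ultimately have "Suc i \<le> p ^ Suc ?a" using assms(1) by linarith
  then have "ja (Suc i) \<le> Suc ?a" by (simp only: ja_iff)
  then have 1: "g [^] (p ^ Suc ?a) \<in> J (Suc i)" using P_antimono J_P x(1) unfolding P_def by blast
  have "i \<le> 2 * p ^ ?b" using jb_iff by blast
  moreover have "2 * p ^ ?b \<le> p ^ Suc ?b" using p2 by simp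
  ultimately have "Suc i \<le> 2 * p ^ Suc ?b" using assms(1) by linarith
  then have "jb (Suc i) \<le> Suc ?b" by (simp only: jb_iff)
  then have 2: "m [^] (p ^ Suc ?b) \<in> J (Suc i)" using Mp_antimono J_Mp x(2) unfolding Mp_def by blast
  show ?thesis unfolding eq using subgroup.m_closed[OF J_sub 1 2] .
qed

lemma J_antimono: "J (Suc i) \<subseteq> J i"
proof -
  have "i \<le> p ^ ja (Suc i)" using ja_iff[of "Suc i" "ja (Suc i)"] by simp
  then have a: "ja i \<le> ja (Suc i)" by (simp only: ja_iff)
  have "i \<le> 2 * p ^ jb (Suc i)" using jb_iff[of "Suc i" "jb (Suc i)"] by simp
  then have b: "jb i \<le> jb (Suc i)" by (simp only: jb_iff)
  show ?thesis unfolding J_def using P_antimono[OF a] Mp_antimono[OF b] by (rule mono_set_mult)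
qed

end

text \<open>The commutator hypothesis serves twice: x h x^-1 = [x, h] h makes L normal in S, and the
  quotient becomes abelian.\<close>

lemma (in fgroup) quotient_power_image:
  assumes S: "subgroup S G" and L: "subgroup L G" "L \<subseteq> S" and comm: "\<And>x y. x \<in> S \<Longrightarrow> y \<in> S \<Longrightarrow> cm x y \<in> L"
  shows "comm_group (G\<lparr>carrier := S\<rparr> Mod L)"
    and "finite (carrier (G\<lparr>carrier := S\<rparr> Mod L))"
    and "(\<lambda>x. x [^]\<^bsub>G\<lparr>carrier := S\<rparr> Mod L\<^esub> (q::nat)) ` carrier (G\<lparr>carrier := S\<rparr> Mod L) = (\<lambda>x. L #> x) ` ((\<lambda>x. x [^] q) ` S)"
proof -
  let ?S = "G\<lparr>carrier := S\<rparr>"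
  have Sc: "x \<in> carrier G" if "x \<in> S" for x using that subgroup.mem_carrier[OF S] by blast
  interpret T: group ?S by (rule subgroup_imp_group[OF S])
  have finS: "finite S" using subgroup.subset[OF S] fin finite_subset by blast
  interpret F: fgroup ?S by unfold_locales (simp add: finS)
  have LS: "subgroup L ?S" by (rule subgroup_incl[OF L(1) S L(2)])
  have nor: "L \<lhd> ?S"
  proof (rule T.normal_invI[OF LS])
    fix x h assume "x \<in> carrier ?S" "h \<in> L"
    then have xh: "x \<in> S" "h \<in> L" "h \<in> S" using L by auto
    have "x \<otimes> h \<otimes> inv x = cm x h \<otimes> h" using xh Sc by (intro cm_conj) auto
    then show "x \<otimes>\<^bsub>?S\<^esub> h \<otimes>\<^bsub>?S\<^esub> inv\<^bsub>?S\<^esub> x \<in> L"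
      using xh comm[OF xh(1,3)] subgroup.m_closed[OF L(1)] m_inv_consistent[OF S xh(1)] by simp
  qed
  have "derived ?S (carrier ?S) \<subseteq> L"
  proof -
    have "derived ?S S = derived G S" by (rule derived_consistent[OF order_refl S])
    also have "\<dots> \<subseteq> L" unfolding derived_def using comm by (intro generate_subgroup_incl L) (auto simp: cm_def)
    finally show ?thesis by simp
  qed
  then show "comm_group (?S Mod L)" by (rule F.Mod_comm_group[OF nor])
  show "finite (carrier (?S Mod L))" using finS by (simp add: carrier_FactGroup)
  have "(L #>\<^bsub>?S\<^esub> x) [^]\<^bsub>?S Mod L\<^esub> q = L #> (x [^] q)" if "x \<in> S" for x
    using normal.FactGroup_pow[OF nor, of x q] that by (simp add: nat_pow_consistent[symmetric])
  then show "(\<lambda>x. x [^]\<^bsub>?S Mod L\<^esub> q) ` carrier (?S Mod L) = (\<lambda>x. L #> x) ` ((\<lambda>x. x [^] q) ` S)"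
    unfolding carrier_FactGroup by (simp add: image_image cong: image_cong)
qed

lemma (in group) cyclic_subgroup_generator:
  assumes S: "subgroup S G" and cyc: "cyclic_group (subgroup_generated G S)"
  shows "\<exists>c\<in>S. S = generate G {c}"
proof -
  interpret T: group "subgroup_generated G S" by (rule group_subgroup_generated)
  have car: "carrier (subgroup_generated G S) = S" by (rule subgroup.carrier_subgroup_generated_subgroup[OF S])
  obtain c where c: "c \<in> S" "S = range (\<lambda>i::int. c [^]\<^bsub>subgroup_generated G S\<^esub> i)"
    using cyc unfolding T.cyclic_group car by blast
  have "c \<in> carrier G" using c(1) subgroup.mem_carrier[OF S] by blast
  moreover have "c [^]\<^bsub>subgroup_generated G S\<^esub> i = c [^] i" for i :: int
    using c(1) car by (intro int_pow_subgroup_generated) simp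
  ultimately have "S = generate G {c}" using c(2) by (auto simp: generate_pow)
  then show ?thesis using c(1) by blast
qed

context pgroup_cyclic_derived
begin

lemma P_top: "P N = {\<one>}"
proof -
  have "x [^] (p ^ N) = \<one>" if "x \<in> C" for x
    using pow_order_eq_1[OF C_carrier[OF that]] order_G by (simp add: Coset.order_def)
  then show ?thesis using C_one by (auto simp: P_def)
qed

lemma P_pow: "(\<lambda>x. x [^] (p ^ j)) ` C = P j" by (auto simp: P_def)

lemma card_P_Int_M: "card (P j \<inter> M) = min (card (P j \<inter> D)) (p ^ s)"
proof -
  have "P j \<inter> M = (P j \<inter> D) \<inter> M" by (auto simp: M_def)
  moreover have "card ((P j \<inter> D) \<inter> M) = min (card (P j \<inter> D)) (card M)"
    by (intro D_subgroup_card_Int subgroups_Inter_pair P_sub D_sub M_sub) (auto simp: M_def)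
  ultimately show ?thesis by (simp add: card_M)
qed

text \<open>Expresses the exponent through the orders of the \<open>P j\<close>, which are
  invariants.\<close>

lemma exponent_K: "\<exists>e. group_exponent K = p ^ e \<and> (\<forall>j. e \<le> j \<longleftrightarrow> card (P j) = 1)"
proof -
  interpret K: fgroup K by (rule K_fgroup)
  have dvd: "group_exponent K dvd q \<longleftrightarrow> (\<lambda>x. x [^] q) ` C = {\<one>}" for q :: nat
  proof -
    have "group_exponent K dvd q \<longleftrightarrow> (\<forall>x\<in>C. group.ord K x dvd q)"
      by (simp add: group_exponent_def Lcm_dvd_iff)
    also have "\<dots> \<longleftrightarrow> (\<forall>x\<in>C. x [^] q = \<one>)"
      using K.pow_eq_id by (intro ball_cong refl) (simp add: K_pow)
    also have "\<dots> \<longleftrightarrow> (\<lambda>x. x [^] q) ` C = {\<one>}" using C_one by auto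
    finally show ?thesis .
  qed
  have "group_exponent K dvd p ^ N" unfolding dvd P_pow by (rule P_top)
  then obtain e where e: "group_exponent K = p ^ e" using divides_primepow_nat[OF prime_p] by blast
  have "e \<le> j \<longleftrightarrow> card (P j) = 1" for j
  proof -
    have "e \<le> j \<longleftrightarrow> P j = {\<one>}" using dvd[of "p ^ j"] p_gt_1 unfolding e P_pow by (simp add: dvd_power_iff_le)
    also have "\<dots> \<longleftrightarrow> card (P j) = 1" using subgroup.one_closed[OF P_sub, of j] by (metis card_1_singletonE card.empty card.insert empty_iff finite.emptyI One_nat_def singletonD)
    finally show ?thesis .
  qed
  then show ?thesis using e by blast
qed

lemma card_K_Mod_power:
  assumes L: "subgroup L G" "M \<subseteq> L" "L \<subseteq> C"
  shows "comm_group (K Mod L)" "finite (carrier (K Mod L))"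
    and "card ((\<lambda>x. x [^]\<^bsub>K Mod L\<^esub> (p ^ j)) ` carrier (K Mod L)) * card (P j \<inter> L) = card (P j)"
proof -
  have comm: "cm x y \<in> L" if "x \<in> C" "y \<in> C" for x y
    using that cm_C_Z cm_D L(2) by (auto simp: M_def)
  note q = quotient_power_image[OF C_sub L(1,3) comm]
  show "comm_group (K Mod L)" "finite (carrier (K Mod L))" using q(1,2) by blast+
  show "card ((\<lambda>x. x [^]\<^bsub>K Mod L\<^esub> (p ^ j)) ` carrier (K Mod L)) * card (P j \<inter> L) = card (P j)"
    using q(3)[of "p ^ j"] card_rcos_image[OF P_sub L(1), of j] by (simp add: P_pow)
qed

lemma card_K_Mod_top:
  assumes L: "subgroup L G" "M \<subseteq> L" "L \<subseteq> C"
  shows "card ((\<lambda>x. x [^]\<^bsub>K Mod L\<^esub> (p ^ N)) ` carrier (K Mod L)) = 1"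
proof -
  have "P N \<inter> L = {\<one>}" using subgroup.one_closed[OF L(1)] by (simp add: P_top)
  then show ?thesis using card_K_Mod_power(3)[OF L, of N] by (simp add: P_top)
qed

text \<open>The sizes required by \<open>abelian_pgroup_iso\<close>: the whole factor for exponent
  0, and 1 from exponent 1 on, as the factor is elementary abelian.\<close>

lemma J_quotient:
  assumes "1 \<le> i"
  shows "comm_group (G\<lparr>carrier := J i\<rparr> Mod J (Suc i))" "finite (carrier (G\<lparr>carrier := J i\<rparr> Mod J (Suc i)))"
    and "card ((\<lambda>x. x [^]\<^bsub>G\<lparr>carrier := J i\<rparr> Mod J (Suc i)\<^esub> (p ^ 0)) ` carrier (G\<lparr>carrier := J i\<rparr> Mod J (Suc i)))
           * card (J (Suc i)) = card (J i)"
    and "card ((\<lambda>x. x [^]\<^bsub>G\<lparr>carrier := J i\<rparr> Mod J (Suc i)\<^esub> (p ^ Suc j)) ` carrier (G\<lparr>carrier := J i\<rparr> Mod J (Suc i))) = 1"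
proof -
  note q = quotient_power_image[OF J_sub J_sub J_antimono J_commutator[OF assms]]
  show "comm_group (G\<lparr>carrier := J i\<rparr> Mod J (Suc i))" "finite (carrier (G\<lparr>carrier := J i\<rparr> Mod J (Suc i)))"
    using q(1,2) by blast+
  have "(\<lambda>x. x [^] (1::nat)) ` J i = J i" using subgroup.mem_carrier[OF J_sub] by (auto simp: image_iff)
  then show "card ((\<lambda>x. x [^]\<^bsub>G\<lparr>carrier := J i\<rparr> Mod J (Suc i)\<^esub> (p ^ 0)) ` carrier (G\<lparr>carrier := J i\<rparr> Mod J (Suc i)))
           * card (J (Suc i)) = card (J i)"
    using q(3)[of 1] card_rcos_image[OF J_sub J_sub, of "Suc i" i] J_antimono[of i] by (simp add: Int_absorb1)
  have "J (Suc i) #> (x [^] (p ^ Suc j)) = J (Suc i)" if "x \<in> J i" for x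
  proof -
    have "x [^] (p ^ Suc j) = (x [^] p) [^] (p ^ j)" using subgroup.mem_carrier[OF J_sub that] by (simp add: nat_pow_pow)
    then have "x [^] (p ^ Suc j) \<in> J (Suc i)" using subgroup_pow_closed[OF J_sub J_power[OF assms that]] by simp
    then show ?thesis using coset_join2[OF _ J_sub] subgroup.mem_carrier[OF J_sub] by blast
  qed
  then have "(\<lambda>x. J (Suc i) #> x) ` ((\<lambda>x. x [^] (p ^ Suc j)) ` J i) = {J (Suc i)}"
    using subgroup.one_closed[OF J_sub, of i] by (auto simp: image_image)
  then show "card ((\<lambda>x. x [^]\<^bsub>G\<lparr>carrier := J i\<rparr> Mod J (Suc i)\<^esub> (p ^ Suc j)) ` carrier (G\<lparr>carrier := J i\<rparr> Mod J (Suc i))) = 1"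
    using q(3)[of "p ^ Suc j"] by (simp del: power_Suc)
qed

end

lemma nat_mult_eq_cancel:
  fixes x y a b u v :: nat
  shows "x * a = u \<Longrightarrow> y * b = v \<Longrightarrow> a = b \<Longrightarrow> u = v \<Longrightarrow> a > 0 \<Longrightarrow> x = y"
  by auto

section \<open>Comparison of the factor groups of G and H\<close>

context kiso_pgroups
begin

lemma image_rel_aug_ideal:
  "\<phi> ` rel_aug_ideal G (centralizer G (derived G (carrier G))) = rel_aug_ideal H (centralizer H (derived H (carrier H)))"
  using image_RI_C_eq G.RI_eq_rel_aug_ideal[OF G.C_sub, where 'k = 'k] H.RI_eq_rel_aug_ideal[OF H.C_sub, where 'k = 'k]
  by (simp add: G.C_def H.C_def G.D_def H.D_def)

lemma card_J: "card (G.J i) = card (H.J i)"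
proof -
  have fin: "finite (G.P (G.ja i) \<inter> G.D)" by (rule finite_subset[OF _ G.fin]) (use G.D_carrier in blast)
  have "card (G.P (G.ja i) \<inter> G.D) > 0"
    using subgroup.one_closed[OF G.P_sub] subgroup.one_closed[OF G.D_sub] fin by (auto simp: card_gt_0_iff)
  then have "min (card (G.P (G.ja i) \<inter> G.D)) (p ^ (G.s - G.jb i)) \<noteq> 0" using G.p_gt_0 by simp
  moreover have "card (G.J i) * min (card (G.P (G.ja i) \<inter> G.D)) (p ^ (G.s - G.jb i))
      = card (H.J i) * min (card (G.P (G.ja i) \<inter> G.D)) (p ^ (G.s - G.jb i))"
    using G.card_J[of i] H.card_J[of i] unfolding card_P card_P_Int_D s_eq by simp
  ultimately show ?thesis by (rule iffD1[OF mult_right_cancel])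
qed

text \<open>Treats C/G' and C/C' at once: the order of the p^j-th powers in C/L is |P_j| divided by
  the order of the intersection of P_j with L.\<close>

lemma K_Mod_iso:
  assumes LG: "subgroup LG G" "G.M \<subseteq> LG" "LG \<subseteq> G.C" and LH: "subgroup LH H" "H.M \<subseteq> LH" "LH \<subseteq> H.C"
    and eq: "\<And>j. card (G.P j \<inter> LG) = card (H.P j \<inter> LH)"
  shows "G.K Mod LG \<cong> H.K Mod LH"
proof (rule abelian_pgroup_iso[OF G.prime_p])
  show "\<exists>j. card ((\<lambda>x. x [^]\<^bsub>G.K Mod LG\<^esub> (p ^ j)) ` carrier (G.K Mod LG)) = 1"
    using G.card_K_Mod_top[OF LG] by blast
  fix j
  have fin: "finite (G.P j \<inter> LG)" by (rule finite_subset[OF _ G.fin]) (use subgroup.mem_carrier[OF LG(1)] in blast)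
  have "card (G.P j \<inter> LG) > 0"
    using subgroup.one_closed[OF G.P_sub] subgroup.one_closed[OF LG(1)] fin by (auto simp: card_gt_0_iff)
  then show "card ((\<lambda>x. x [^]\<^bsub>G.K Mod LG\<^esub> (p ^ j)) ` carrier (G.K Mod LG))
      = card ((\<lambda>x. x [^]\<^bsub>H.K Mod LH\<^esub> (p ^ j)) ` carrier (H.K Mod LH))"
    by (rule nat_mult_eq_cancel[OF G.card_K_Mod_power(3)[OF LG] H.card_K_Mod_power(3)[OF LH] eq card_P])
qed (use G.card_K_Mod_power(1,2)[OF LG] H.card_K_Mod_power(1,2)[OF LH] in auto)

lemma Mod_D_iso: "G.K Mod G.D \<cong> H.K Mod H.D"
  by (intro K_Mod_iso G.D_sub H.D_sub G.D_le_C H.D_le_C card_P_Int_D) (auto simp: G.M_def H.M_def)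

lemma Mod_M_iso: "G.K Mod G.M \<cong> H.K Mod H.M"
  by (intro K_Mod_iso G.M_sub H.M_sub G.M_le_C H.M_le_C order_refl)
     (simp add: G.card_P_Int_M H.card_P_Int_M card_P_Int_D s_eq)

lemma exponent_eq: "group_exponent G.K = group_exponent H.K"
proof -
  obtain e where e: "group_exponent G.K = p ^ e" "\<And>j. e \<le> j \<longleftrightarrow> card (G.P j) = 1" using G.exponent_K by blast
  obtain f where f: "group_exponent H.K = p ^ f" "\<And>j. f \<le> j \<longleftrightarrow> card (H.P j) = 1" using H.exponent_K by blast
  have "e \<le> j \<longleftrightarrow> f \<le> j" for j by (simp add: e f card_P)
  then have "e = f" by (meson order_antisym order_refl)
  then show ?thesis by (simp add: e f)
qed

lemma J_quotient_iso:
  assumes i: "1 \<le> i"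
  shows "G\<lparr>carrier := G.J i\<rparr> Mod G.J (Suc i) \<cong> H\<lparr>carrier := H.J i\<rparr> Mod H.J (Suc i)" (is "?A \<cong> ?B")
proof (rule abelian_pgroup_iso[OF G.prime_p])
  show "\<exists>j. card ((\<lambda>x. x [^]\<^bsub>?A\<^esub> (p ^ j)) ` carrier ?A) = 1"
    by (rule exI[of _ "Suc 0"]) (rule G.J_quotient(4)[OF i])
  fix j
  show "card ((\<lambda>x. x [^]\<^bsub>?A\<^esub> (p ^ j)) ` carrier ?A) = card ((\<lambda>x. x [^]\<^bsub>?B\<^esub> (p ^ j)) ` carrier ?B)"
  proof (cases j)
    case 0
    have "card (G.J (Suc i)) > 0"
      using subgroup.one_closed[OF G.J_sub] G.fin subgroup.subset[OF G.J_sub]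
      by (subst card_gt_0_iff) (auto intro: finite_subset[of _ "carrier G"])
    then show ?thesis unfolding 0
      by (rule nat_mult_eq_cancel[OF G.J_quotient(3)[OF i] H.J_quotient(3)[OF i] card_J card_J])
  next
    case (Suc j')
    then show ?thesis using G.J_quotient(4)[OF i] H.J_quotient(4)[OF i] by simp
  qed
qed (use G.J_quotient(1,2)[OF i] H.J_quotient(1,2)[OF i] in auto)

end

theorem theorem4p2:
  fixes G :: "('a, 'c) monoid_scheme" and H :: "('b, 'd) monoid_scheme" and p :: nat
  assumes char: "CHAR('k::field) = p"
    and p_prime: "Factorial_Ring.prime p" and p_odd: "odd p"
    and G_pgroup: "p_group p G"
    and G'_cyclic: "cyclic_group (subgroup_generated G (derived G (carrier G)))"
    and H_group: "group H"
    and iso: "\<exists>\<psi> :: ('a \<Rightarrow> 'k) \<Rightarrow> ('b \<Rightarrow> 'k). kalg_iso G H \<psi>"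
  shows
    "(\<forall>\<phi> :: ('a \<Rightarrow> 'k) \<Rightarrow> ('b \<Rightarrow> 'k). kalg_iso G H \<phi> \<and> aug_preserving G \<phi> \<longrightarrow>
        \<phi> ` (rel_aug_ideal G (centralizer G (derived G (carrier G))) :: ('a \<Rightarrow> 'k) set)
          = rel_aug_ideal H (centralizer H (derived H (carrier H))))
     \<and> (\<forall>i\<ge>1.
          ((CGG G)\<lparr>carrier := jennings (CGG G) p i\<rparr> Mod jennings (CGG G) p (Suc i))
          \<cong> ((CGG H)\<lparr>carrier := jennings (CGG H) p i\<rparr> Mod jennings (CGG H) p (Suc i)))
     \<and> group_exponent (CGG G) = group_exponent (CGG H)
     \<and> (CGG G Mod derived G (carrier G)) \<cong> (CGG H Mod derived H (carrier H))
     \<and> (CGG G Mod derived (CGG G) (carrier (CGG G)))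
          \<cong> (CGG H Mod derived (CGG H) (carrier (CGG H)))"
proof -
  obtain N where N: "card (carrier G) = p ^ N" using G_pgroup by (auto simp: p_group_def)
  have fG: "fgroup G"
    using G_pgroup by (intro fgroup.intro fgroup_axioms.intro) (auto simp: p_group_def)
  interpret FG: fgroup G by (rule fG)
  have Dsub: "subgroup (derived G (carrier G)) G" by (simp add: FG.derived_is_subgroup)
  obtain c where c: "c \<in> derived G (carrier G)" "derived G (carrier G) = generate G {c}"
    using FG.cyclic_subgroup_generator[OF Dsub G'_cyclic] by blast
  have cc: "c \<in> carrier G" using c(1) subgroup.mem_carrier[OF Dsub] by blast
  have "FG.ord c dvd p ^ N" using FG.ord_dvd_group_order[OF cc] N by (simp add: Coset.order_def)
  then obtain n where n: "FG.ord c = p ^ n" using divides_primepow_nat[OF p_prime] by blast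
  interpret G: pgroup_cyclic_derived G p c n N
    using p_prime p_odd N cc c(2) n by unfold_locales
  obtain \<psi> :: "('a \<Rightarrow> 'k) \<Rightarrow> ('b \<Rightarrow> 'k)" where \<psi>: "kalg_iso G H \<psi>" using iso by blast
  have fH: "fgroup H" by (rule kalg_iso_fgroup[OF fG H_group \<psi>])
  interpret k: kiso G H \<psi> by (rule kiso_kalg_iso[OF fG fH \<psi>])
  interpret k: kiso_pgroup G H \<psi> p c n N by unfold_locales (rule char)
  obtain c' where c': "pgroup_cyclic_derived H p c' n N" using k.pgroup_cyclic_derived_H by blast
  interpret H: pgroup_cyclic_derived H p c' n N by (rule c')
  \<comment> \<open>The structure of H, obtained once from \<psi>, does not refer to the
    isomorphism, so it can be combined with an arbitrary \<phi> as part (a) demands.\<close>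
  have pair: "kiso_pgroups G H \<phi> p c c' n N" if "kalg_iso G H \<phi>" for \<phi> :: "('a \<Rightarrow> 'k) \<Rightarrow> ('b \<Rightarrow> 'k)"
  proof -
    interpret kiso G H \<phi> by (rule kiso_kalg_iso[OF fG fH that])
    show ?thesis by unfold_locales (rule char)
  qed
  interpret pgs: kiso_pgroups G H \<psi> p c c' n N by (rule pair[OF \<psi>])
  have a: "\<phi> ` (rel_aug_ideal G (centralizer G (derived G (carrier G))) :: ('a \<Rightarrow> 'k) set)
          = rel_aug_ideal H (centralizer H (derived H (carrier H)))" if "kalg_iso G H \<phi>" for \<phi>
  proof -
    interpret \<phi>: kiso_pgroups G H \<phi> p c c' n N by (rule pair[OF that])
    show ?thesis by (rule \<phi>.image_rel_aug_ideal)
  qed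
  have K: "CGG G = G.K" "CGG H = H.K" by (rule G.CGG_eq H.CGG_eq)+
  have b: "(CGG G)\<lparr>carrier := jennings (CGG G) p i\<rparr> Mod jennings (CGG G) p (Suc i)
          \<cong> (CGG H)\<lparr>carrier := jennings (CGG H) p i\<rparr> Mod jennings (CGG H) p (Suc i)" if "1 \<le> i" for i
    using pgs.J_quotient_iso[OF that] by (simp add: K G.jennings_K H.jennings_K)
  have d: "CGG G Mod derived G (carrier G) \<cong> CGG H Mod derived H (carrier H)"
    using pgs.Mod_D_iso by (simp add: K G.D_def H.D_def)
  have e: "CGG G Mod derived (CGG G) (carrier (CGG G)) \<cong> CGG H Mod derived (CGG H) (carrier (CGG H))"
    using pgs.Mod_M_iso unfolding K G.K_derived H.K_derived .
  show ?thesis using a b pgs.exponent_eq d e unfolding K by blast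
qed

end
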